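(* Let $R$ be a Noetherian local ring with infinite residue field and $I$ an $R$-ideal. Assume that $\mathcal{P}(I)$ is finite, that every element of $\mathcal{P}(I)$ is minimal in this set (with respect to inclusion), and that $\mu(I_{\mathfrak q}) = \ell(I_{\mathfrak q})$ for every ${\mathfrak q} \in \mathrm{Spec}(R) \setminus \overline{\mathcal{P}(I)}$. Then $\gamma(I) < \infty$.
   Context: A reduction of an ideal $I$ is an ideal $J \subset I$ with $I^{r+1} = JI^r$ for some integer $r \ge 0$; it is a minimal reduction if it is minimal with respect to inclusion among reductions of $I$. $\mathcal{M}(I)$ denotes the set of all minimal reductions of $I$. $\mathrm{core}(I)$ is the intersection of all reductions of $I$. Define $\mathcal{P}(I) = \bigcup_{J \in \mathcal{M}(I)} \mathrm{Ass}_R(I/J)$, and let $\overline{\mathcal{P}(I)}$ be its Zariski closure in $\mathrm{Spec}(R)$. Define $\gamma(I) = \inf\{ t \mid \mathrm{core}(I) = \bigcap_{i=1}^t J_i \text{ with } J_i \in \mathcal{M}(I)\}$, so that $\gamma(I) < \infty$ means that $\mathrm{core}(I)$ is an intersection of finitely many minimal reductions of $I$. $\mu$ denotes minimal number of generators, and for an ideal $I$ of a Noetherian local ring $(R,\mathfrak{m})$, $\ell(I) = \dim \bigoplus_{n\ge 0} I^n/\mathfrak{m}I^n$ is the analytic spread. *)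

theory Defs
  imports
    "HOL-Algebra.Ring_Divisibility"
    "HOL-Algebra.Ideal_Product"
    "HOL-Algebra.QuotRing"
    "HOL-Algebra.Module"
    "HOL-Library.Extended_Nat"
    "HOL-Analysis.Abstract_Topology"
begin

subsection \<open>Spectrum, dimension and local rings\<close>

definition Spec :: "('a, 'b) ring_scheme \<Rightarrow> 'a set set"
  where "Spec R = {\<pp>. primeideal \<pp> R}"

definition zariski :: "('a, 'b) ring_scheme \<Rightarrow> 'a set topology"
  where "zariski R = topology_generated_by {Spec R - {\<pp> \<in> Spec R. \<aa> \<subseteq> \<pp>} | \<aa>. ideal \<aa> R}"

definition krull_dim :: "('a, 'b) ring_scheme \<Rightarrow> enat"
  where "krull_dim R =
    Sup {enat n | n \<pp>. (\<forall>i\<le>n. \<pp> i \<in> Spec R) \<and> (\<forall>i<n. \<pp> i \<subset> \<pp> (Suc i))}"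

locale local_ring = cring +
  assumes unique_maximal: "\<exists>!\<mm>. maximalideal \<mm> R"

text \<open>Only meaningful for local rings.\<close>

definition max_ideal :: "('a, 'b) ring_scheme \<Rightarrow> 'a set"
  where "max_ideal R = (THE \<mm>. maximalideal \<mm> R)"


subsection \<open>Localization at a prime\<close>

text \<open>An element of the localization is a class of pairs (numerator, denominator), with the
  denominator outside \<open>\<qq>\<close>.\<close>

definition loc_rel :: "('a, 'b) ring_scheme \<Rightarrow> 'a set \<Rightarrow> (('a \<times> 'a) \<times> ('a \<times> 'a)) set"
  where "loc_rel R \<qq> =
    {((a, s), (b, t)). a \<in> carrier R \<and> b \<in> carrier R \<and> s \<in> carrier R - \<qq> \<and> t \<in> carrier R - \<qq> \<and>
      (\<exists>u \<in> carrier R - \<qq>. u \<otimes>\<^bsub>R\<^esub> (a \<otimes>\<^bsub>R\<^esub> t \<ominus>\<^bsub>R\<^esub> b \<otimes>\<^bsub>R\<^esub> s) = \<zero>\<^bsub>R\<^esub>)}"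

definition loc :: "('a, 'b) ring_scheme \<Rightarrow> 'a set \<Rightarrow> ('a \<times> 'a) set ring"
  where "loc R \<qq> =
    \<lparr>carrier = (carrier R \<times> (carrier R - \<qq>)) // loc_rel R \<qq>,
     mult = (\<lambda>X Y. \<Union>(a, s) \<in> X. \<Union>(b, t) \<in> Y. loc_rel R \<qq> `` {(a \<otimes>\<^bsub>R\<^esub> b, s \<otimes>\<^bsub>R\<^esub> t)}),
     one = loc_rel R \<qq> `` {(\<one>\<^bsub>R\<^esub>, \<one>\<^bsub>R\<^esub>)},
     zero = loc_rel R \<qq> `` {(\<zero>\<^bsub>R\<^esub>, \<one>\<^bsub>R\<^esub>)},
     add = (\<lambda>X Y. \<Union>(a, s) \<in> X. \<Union>(b, t) \<in> Y.
       loc_rel R \<qq> `` {(a \<otimes>\<^bsub>R\<^esub> t \<oplus>\<^bsub>R\<^esub> b \<otimes>\<^bsub>R\<^esub> s, s \<otimes>\<^bsub>R\<^esub> t)})\<rparr>"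

definition loc_ideal :: "('a, 'b) ring_scheme \<Rightarrow> 'a set \<Rightarrow> 'a set \<Rightarrow> ('a \<times> 'a) set set"
  where "loc_ideal R \<qq> I = {loc_rel R \<qq> `` {(a, s)} | a s. a \<in> I \<and> s \<in> carrier R - \<qq>}"


subsection \<open>Associated primes\<close>

definition Ass :: "('a, 'b) ring_scheme \<Rightarrow> ('a, 'm, 'c) module_scheme \<Rightarrow> 'a set set"
  where "Ass R M =
    {\<pp> \<in> Spec R. \<exists>x \<in> carrier M. \<pp> = {r \<in> carrier R. r \<odot>\<^bsub>M\<^esub> x = \<zero>\<^bsub>M\<^esub>}}"

text \<open>The \<open>R\<close>-module \<open>I/J\<close> for ideals \<open>J \<subseteq> I\<close>, as a submodule of \<open>R/J\<close>. The fields \<open>mult\<close> and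
  \<open>one\<close> are forced by the record type and carry no meaning for a module.\<close>

definition quot_module ::
    "('a, 'b) ring_scheme \<Rightarrow> 'a set \<Rightarrow> 'a set \<Rightarrow> ('a, 'a set) module"
  where "quot_module R I J =
    \<lparr>carrier = (\<lambda>a. J +>\<^bsub>R\<^esub> a) ` I,
     mult = rcoset_mult R J, one = J +>\<^bsub>R\<^esub> \<one>\<^bsub>R\<^esub>,
     zero = J, add = set_add R,
     smult = (\<lambda>r X. \<Union>x \<in> X. J +>\<^bsub>R\<^esub> (r \<otimes>\<^bsub>R\<^esub> x))\<rparr>"


subsection \<open>Number of generators and analytic spread\<close>

definition min_gens :: "('a, 'b) ring_scheme \<Rightarrow> 'a set \<Rightarrow> enat"
  where "min_gens R I = Inf {enat (card S) | S. finite S \<and> S \<subseteq> carrier R \<and> Idl\<^bsub>R\<^esub> S = I}"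

text \<open>Powers in the multiplicative monoid of ideals, so that \<open>I\<^sup>0 = R\<close>.\<close>

abbreviation ideal_pow :: "('a, 'b) ring_scheme \<Rightarrow> 'a set \<Rightarrow> nat \<Rightarrow> 'a set"
  where "ideal_pow R I n \<equiv> I [^]\<^bsub>ideals_set R\<^esub> n"

text \<open>The graded ring \<open>\<Oplus>\<^sub>n I\<^sup>n/\<mm>I\<^sup>n\<close>: an element is a finitely supported family of
  cosets. The product of a class in degree \<open>i\<close> with one in degree \<open>n - i\<close> is a coset of \<open>\<mm>I\<^sup>n\<close>, so
  the degree \<open>n\<close> part of a product is a sum in \<open>R/\<mm>I\<^sup>n\<close>.\<close>

definition fiber_ring ::
    "('a, 'b) ring_scheme \<Rightarrow> 'a set \<Rightarrow> 'a set \<Rightarrow> (nat \<Rightarrow> 'a set) ring"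
  where "fiber_ring R \<mm> I = (let K = (\<lambda>n. \<mm> \<cdot>\<^bsub>R\<^esub> ideal_pow R I n) in
    \<lparr>carrier = {f. (\<forall>n. f n \<in> carrier (quot_module R (ideal_pow R I n) (K n))) \<and>
                   finite {n. f n \<noteq> K n}},
     mult = (\<lambda>f g n. \<Oplus>\<^bsub>R Quot K n\<^esub> i \<in> {..n}. rcoset_mult R (K n) (f i) (g (n - i))),
     one = (\<lambda>n. if n = 0 then K 0 +>\<^bsub>R\<^esub> \<one>\<^bsub>R\<^esub> else K n),
     zero = K,
     add = (\<lambda>f g n. f n <+>\<^bsub>R\<^esub> g n)\<rparr>)"

definition analytic_spread :: "('a, 'b) ring_scheme \<Rightarrow> 'a set \<Rightarrow> enat"
  where "analytic_spread R I = krull_dim (fiber_ring R (max_ideal R) I)"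


subsection \<open>Reductions and the core\<close>

definition reduction :: "('a, 'b) ring_scheme \<Rightarrow> 'a set \<Rightarrow> 'a set \<Rightarrow> bool"
  where "reduction R I J \<longleftrightarrow>
    ideal J R \<and> J \<subseteq> I \<and> (\<exists>r. ideal_pow R I (r + 1) = J \<cdot>\<^bsub>R\<^esub> ideal_pow R I r)"

definition min_reductions :: "('a, 'b) ring_scheme \<Rightarrow> 'a set \<Rightarrow> 'a set set"
  where "min_reductions R I =
    {J. reduction R I J \<and> (\<forall>J'. reduction R I J' \<and> J' \<subseteq> J \<longrightarrow> J' = J)}"

definition core :: "('a, 'b) ring_scheme \<Rightarrow> 'a set \<Rightarrow> 'a set"
  where "core R I = \<Inter>{J. reduction R I J}"

definition reduction_primes :: "('a, 'b) ring_scheme \<Rightarrow> 'a set \<Rightarrow> 'a set set"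
  where "reduction_primes R I = (\<Union>J \<in> min_reductions R I. Ass R (quot_module R I J))"

definition core_number :: "('a, 'b) ring_scheme \<Rightarrow> 'a set \<Rightarrow> enat"
  where "core_number R I = Inf {enat t | t J. t \<ge> 1 \<and>
    (\<forall>i \<in> {1..t}. J i \<in> min_reductions R I) \<and> core R I = (\<Inter>i \<in> {1..t}. J i)}"

end

theory Submission imports Defs "HOL-Algebra.Subrings" begin

text \<open>Write \<open>K\<close> for the core of \<open>I\<close> and \<open>P\<close> for the finite antichain of primes associated to the modules \<open>I/J\<close>,
  \<open>J\<close> a minimal reduction. First, every prime \<open>Q\<close> containing \<open>K : I\<close> contains a member of \<open>P\<close>. Otherwise pick
  \<open>u \<notin> Q\<close> in all members of \<open>P\<close>. At every prime \<open>q\<close> not containing \<open>u\<close> one has \<open>\<mu>(I\<^sub>q) = \<ell>(I\<^sub>q)\<close>, so the fiber ring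
  of \<open>I\<^sub>q\<close> is a polynomial ring and \<open>I\<^sub>q\<close> has no proper reduction. Performing this argument
  for all \<open>J\<close> simultaneously, in the ring of functions from the set of minimal reductions to \<open>R\<close>, makes it
  uniform: a single power of \<open>u\<close> multiplies \<open>I\<close> into every \<open>J\<close>, hence lies in \<open>K : I \<subseteq> Q\<close>, a contradiction.

  Second, take a prime filtration of \<open>I/K\<close>. By the first part every prime of it contains a member of \<open>P\<close>.
  As the primes associated to \<open>I/U\<close> lie in the antichain \<open>P\<close> for every finite intersection \<open>U\<close> of minimal
  reductions, \<open>U\<close> cannot shrink without losing one of the finitely many steps with prime in \<open>P\<close>, so a
  finite intersection with the least number of such steps is \<open>K\<close>.\<close>

section \<open>Ideals of commutative rings, and Nakayama's lemma at a prime with denominators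
  cleared\<close>

section \<open>Ideals and a fraction-free Nakayama lemma\<close>

text \<open>There may be infinitely many minimal reductions, so the equality of \<open>I\<close> and
  \<open>J\<close> away from \<open>P\<close>, known for each \<open>J\<close> separately, gives no
  common power of \<open>u\<close>. A prime \<open>Q\<close> of the function ring collects the
  failure of uniformity in one place, but that ring need not be Noetherian. Two finiteness facts
  survive. A function with values in the contraction \<open>q\<close> lies in \<open>Q\<close>,
  because \<open>q\<close> is finitely generated. And one exponent \<open>r\<close> with
  \<open>I^(r+1) = J I^r\<close> serves all \<open>J\<close>; this is proved in a smaller ring of
  functions, finitely generated over the constants, where the chain condition holds. Now if the
  matrix writing the generators of the \<open>J\<close> in terms of generators \<open>f\<close> of
  \<open>I\<close> drops rank modulo \<open>Q\<close>, a kernel vector \<open>\<phi>\<close> is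
  substituted for \<open>f\<close> in the identity that puts \<open>f_k^(r+1)\<close> into
  \<open>J I^r\<close>: one side falls into \<open>Q\<close>, so every \<open>\<phi>_k\<close> does.
  The substitution is legitimate because homogeneous relations among the \<open>f\<close> have
  coefficients in \<open>q\<close>; this is where analytic spread enters. So the rank is full, and
  that puts an element outside \<open>Q\<close> into the conductor, which \<open>Q\<close> contains.
  No localization at \<open>Q\<close> is formed: multipliers outside \<open>Q\<close> replace
  denominators.\<close>

lemma (in cring) cring_idealI:
  assumes "\<aa> \<subseteq> carrier R" "\<zero> \<in> \<aa>"
    and "\<And>x y. \<lbrakk>x \<in> \<aa>; y \<in> \<aa>\<rbrakk> \<Longrightarrow> x \<oplus> y \<in> \<aa>"
    and "\<And>r x. \<lbrakk>r \<in> carrier R; x \<in> \<aa>\<rbrakk> \<Longrightarrow> r \<otimes> x \<in> \<aa>"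
  shows "ideal \<aa> R"
proof (rule idealI)
  show "ring R" by (rule ring_axioms)
  show "subgroup \<aa> (add_monoid R)"
  proof (rule add.subgroupI)
    fix a assume a: "a \<in> \<aa>"
    have "(\<ominus> \<one>) \<otimes> a \<in> \<aa>" by (rule assms(4)[OF _ a]) simp
    moreover have "(\<ominus> \<one>) \<otimes> a = \<ominus> a" using subsetD[OF assms(1) a] l_minus[of \<one> a] by simp
    ultimately show "\<ominus> a \<in> \<aa>" unfolding a_inv_def by simp
  next
    fix a b assume "a \<in> \<aa>" "b \<in> \<aa>"
    then show "a \<oplus> b \<in> \<aa>" by (rule assms(3))
  qed (use assms(1,2) in auto)
  fix a x assume a: "a \<in> \<aa>" and x: "x \<in> carrier R"
  show 1: "x \<otimes> a \<in> \<aa>" using assms(4)[OF x a] .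
  then show "a \<otimes> x \<in> \<aa>" using m_comm[OF x subsetD[OF assms(1) a]] by simp
qed

lemma (in ideal) add_in: "\<lbrakk>x \<in> I; y \<in> I\<rbrakk> \<Longrightarrow> x \<oplus> y \<in> I"
  by (rule additive_subgroup.a_closed[OF additive_subgroup_axioms])

lemma (in ideal) minus_in: "\<lbrakk>x \<in> I; y \<in> I\<rbrakk> \<Longrightarrow> x \<ominus> y \<in> I"
  using add_in[OF _ additive_subgroup.a_inv_closed[OF additive_subgroup_axioms]] by (simp add: a_minus_def)

lemma (in ideal) finsum_in: "(\<And>i. i \<in> A \<Longrightarrow> f i \<in> I) \<Longrightarrow> finsum R f A \<in> I"
proof (induction A rule: infinite_finite_induct)
  case (insert x A)
  then have "f \<in> A \<rightarrow> carrier R" "f x \<in> carrier R" using Icarr by auto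
  with insert show ?case by (simp add: add_in)
qed (simp_all add: additive_subgroup.zero_closed[OF additive_subgroup_axioms])

lemma (in ideal) add_in_cancel:
  assumes "x \<oplus> y \<in> I" "y \<in> I" "x \<in> carrier R" shows "x \<in> I"
proof -
  have "y \<in> carrier R" using assms Icarr by blast
  then have "x = (x \<oplus> y) \<ominus> y" using assms(3) by algebra
  then show ?thesis using minus_in assms by metis
qed

lemma (in primeideal) pow_in_D:
  assumes "x \<in> carrier R" "x [^] (n::nat) \<in> I" shows "x \<in> I"
  using assms(2)
proof (induction n)
  case 0
  then have "\<one> \<in> I" by simp
  then show ?case using one_imp_carrier I_notcarr by blast
next
  case (Suc n)
  then have "x [^] n \<otimes> x \<in> I" by simp
  then show ?case using I_prime[of "x [^] n" x] assms(1) Suc.IH by blast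
qed

lemma (in primeideal) mult_notin:
  "\<lbrakk>x \<in> carrier R - I; y \<in> carrier R - I\<rbrakk> \<Longrightarrow> x \<otimes> y \<in> carrier R - I"
  using I_prime by blast

lemma (in primeideal) one_notin: "\<one> \<in> carrier R - I"
proof -
  have "\<one> \<notin> I" using one_imp_carrier I_notcarr by blast
  then show ?thesis by simp
qed

lemma (in primeideal) pow_notin: "x \<in> carrier R - I \<Longrightarrow> x [^] (n::nat) \<in> carrier R - I"
  using pow_in_D[of x n] nat_pow_closed[of x n] by blast

lemma (in cring) colon_ideal:
  assumes "ideal N R" "e \<in> carrier R"
  shows "ideal {x \<in> carrier R. e \<otimes> x \<in> N} R"
proof -
  interpret ideal N R by fact
  show ?thesis
  proof (rule cring_idealI)
    fix r x assume "r \<in> carrier R" "x \<in> {x \<in> carrier R. e \<otimes> x \<in> N}"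
    moreover from this have "e \<otimes> (r \<otimes> x) = r \<otimes> (e \<otimes> x)" using assms(2) m_lcomm by auto
    ultimately show "r \<otimes> x \<in> {x \<in> carrier R. e \<otimes> x \<in> N}" using I_l_closed by auto
  qed (use assms(2) in \<open>auto simp: additive_subgroup.zero_closed[OF additive_subgroup_axioms] r_distr intro: add_in\<close>)
qed

text \<open>Splits off the coefficient of one generator. \<open>\<qq>\<close> is a prime in the
  Nakayama argument and the whole ring wherever an ordinary coefficient of \<open>z\<close> is
  wanted. The sums \<open>\<nu> z + w\<close> already form an ideal, which therefore catches the
  generated one.\<close>

lemma (in cring) genideal_insert_multiples:
  assumes "ideal \<qq> R" "X \<subseteq> carrier R" "z \<in> carrier R"
    and "u \<in> Idl (X \<union> {\<nu> \<otimes> z | \<nu>. \<nu> \<in> \<qq>})"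
  shows "\<exists>\<nu>\<in>\<qq>. \<exists>w\<in>Idl X. u = \<nu> \<otimes> z \<oplus> w"
proof -
  interpret q: ideal \<qq> R by fact
  interpret X: ideal "Idl X" R by (rule genideal_ideal[OF assms(2)])
  define T where "T = {\<nu> \<otimes> z \<oplus> w | \<nu> w. \<nu> \<in> \<qq> \<and> w \<in> Idl X}"
  have "ideal T R"
  proof (rule cring_idealI)
    show "T \<subseteq> carrier R" unfolding T_def using assms(3) q.Icarr X.Icarr by auto
    have "\<zero> \<otimes> z \<oplus> \<zero> \<in> T"
      unfolding T_def using q.zero_closed X.zero_closed q.additive_subgroup_axioms
        X.additive_subgroup_axioms additive_subgroup.zero_closed by blast
    then show "\<zero> \<in> T" using assms(3) by simp
  next
    fix x y assume "x \<in> T" "y \<in> T"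
    then obtain a b c d where h: "x = a \<otimes> z \<oplus> b" "y = c \<otimes> z \<oplus> d"
        "a \<in> \<qq>" "c \<in> \<qq>" "b \<in> Idl X" "d \<in> Idl X"
      unfolding T_def by auto
    then have "a \<in> carrier R" "c \<in> carrier R" "b \<in> carrier R" "d \<in> carrier R"
      using q.Icarr X.Icarr by auto
    then have "x \<oplus> y = (a \<oplus> c) \<otimes> z \<oplus> (b \<oplus> d)" using h(1,2) assms(3) by algebra
    then show "x \<oplus> y \<in> T" unfolding T_def using h q.add_in X.add_in by blast
  next
    fix r x assume r: "r \<in> carrier R" and "x \<in> T"
    then obtain a b where h: "x = a \<otimes> z \<oplus> b" "a \<in> \<qq>" "b \<in> Idl X"
      unfolding T_def by auto
    then have "a \<in> carrier R" "b \<in> carrier R"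
      using q.Icarr X.Icarr by auto
    then have "r \<otimes> x = (r \<otimes> a) \<otimes> z \<oplus> (r \<otimes> b)" using h(1) r assms(3) by algebra
    then show "r \<otimes> x \<in> T" unfolding T_def using h r q.I_l_closed X.I_l_closed by blast
  qed
  moreover have "X \<union> {\<nu> \<otimes> z | \<nu>. \<nu> \<in> \<qq>} \<subseteq> T"
  proof
    fix x assume "x \<in> X \<union> {\<nu> \<otimes> z | \<nu>. \<nu> \<in> \<qq>}"
    then consider "x \<in> X" | \<nu> where "\<nu> \<in> \<qq>" "x = \<nu> \<otimes> z" by blast
    then show "x \<in> T"
    proof cases
      case 1
      then have x: "\<zero> \<otimes> z \<oplus> x = x" "x \<in> Idl X"
        using assms(2,3) genideal_self[OF assms(2)] by auto
      have "\<zero> \<otimes> z \<oplus> x \<in> T"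
        unfolding T_def using x(2) additive_subgroup.zero_closed[OF q.additive_subgroup_axioms] by blast
      then show ?thesis using x(1) by simp
    next
      case 2
      then have "x = \<nu> \<otimes> z \<oplus> \<zero>" using assms(3) q.Icarr[of \<nu>] by simp
      then show ?thesis unfolding T_def
        using 2 additive_subgroup.zero_closed[OF X.additive_subgroup_axioms] by blast
    qed
  qed
  ultimately have "Idl (X \<union> {\<nu> \<otimes> z | \<nu>. \<nu> \<in> \<qq>}) \<subseteq> T" by (rule genideal_minimal)
  with assms(4) show ?thesis unfolding T_def by blast
qed

text \<open>Nakayama's lemma over the local ring at \<open>Q\<close>, for the finitely generated
  module \<open>(N + Idl Y)/N\<close>, with denominators cleared: \<open>e\<close> and
  \<open>h\<close> are multipliers outside \<open>Q\<close>. Instead of taking a determinant, the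
  proof solves for one generator at a time and eliminates it.\<close>

lemma (in cring) nakayama_prime:
  assumes "finite Y" "Y \<subseteq> carrier R" "ideal N R" "primeideal Q R" "e \<in> carrier R - Q"
    and "\<And>y. y \<in> Y \<Longrightarrow> e \<otimes> y \<in> Idl (N \<union> {\<nu> \<otimes> x | \<nu> x. \<nu> \<in> Q \<and> x \<in> Y})"
  shows "\<exists>h\<in>carrier R - Q. \<forall>y\<in>Y. h \<otimes> y \<in> N"
  using assms
proof (induction Y arbitrary: e rule: finite_induct)
  case empty
  then show ?case by blast
next
  case (insert z Y)
  interpret Q: primeideal Q R by fact
  interpret N: ideal N R by fact
  define X where "X = N \<union> {\<nu> \<otimes> x | \<nu> x. \<nu> \<in> Q \<and> x \<in> Y}"
  have z: "z \<in> carrier R" and Y: "Y \<subseteq> carrier R" using insert.prems by auto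
  have X: "X \<subseteq> carrier R" unfolding X_def using Y N.Icarr Q.Icarr by auto
  interpret X: ideal "Idl X" R by (rule genideal_ideal[OF X])
  have eq: "N \<union> {\<nu> \<otimes> x | \<nu> x. \<nu> \<in> Q \<and> x \<in> insert z Y} = X \<union> {\<nu> \<otimes> z | \<nu>. \<nu> \<in> Q}"
    unfolding X_def by blast
  have dec: "\<exists>\<nu>\<in>Q. \<exists>w\<in>Idl X. e \<otimes> y = \<nu> \<otimes> z \<oplus> w" if "y \<in> insert z Y" for y
    using genideal_insert_multiples[OF Q.is_ideal X z] insert.prems(5)[OF that] unfolding eq by blast
  from dec[of z] obtain \<nu> w where w: "\<nu> \<in> Q" "w \<in> Idl X" "e \<otimes> z = \<nu> \<otimes> z \<oplus> w" by auto
  have e: "e \<in> carrier R" and \<nu>: "\<nu> \<in> carrier R" and wc: "w \<in> carrier R"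
    using insert.prems(4) w Q.Icarr X.Icarr by auto
  \<comment> \<open>Collecting the multiples of \<open>z\<close> on the left gives
    \<open>e' z = w\<close>, with no \<open>z\<close> on the right. \<open>e'\<close> stays outside
    \<open>Q\<close> because \<open>\<nu>\<close> is in \<open>Q\<close> and \<open>e\<close> is
    not.\<close>
  define e' where "e' = e \<ominus> \<nu>"
  have e': "e' \<in> carrier R - Q"
  proof -
    have "e = e' \<oplus> \<nu>" unfolding e'_def using e \<nu> by algebra
    then show ?thesis using w(1) insert.prems(4) Q.add_in[of e' \<nu>] e \<nu> by (auto simp: e'_def)
  qed
  have e'z: "e' \<otimes> z = w"
  proof -
    have "e' \<otimes> z = e \<otimes> z \<ominus> \<nu> \<otimes> z" unfolding e'_def using e \<nu> z by algebra
    also have "\<dots> = w" unfolding w(3) using \<nu> wc z by algebra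
    finally show ?thesis .
  qed
  have "\<exists>h\<in>carrier R - Q. \<forall>y\<in>Y. h \<otimes> y \<in> N"
  \<comment> \<open>The extra factor \<open>e'\<close> turns the unwanted term
    \<open>\<mu> z\<close> into \<open>\<mu> w\<close>, so the remaining generators satisfy the
    hypothesis without \<open>z\<close>.\<close>
  proof (rule insert.IH[of "e' \<otimes> e"])
    show "e' \<otimes> e \<in> carrier R - Q" using e' insert.prems(4) Q.mult_notin by blast
    fix y assume y: "y \<in> Y"
    then obtain \<mu> v where v: "\<mu> \<in> Q" "v \<in> Idl X" "e \<otimes> y = \<mu> \<otimes> z \<oplus> v" using dec[of y] by auto
    have c: "\<mu> \<in> carrier R" "v \<in> carrier R" "y \<in> carrier R" "e' \<in> carrier R"
      using v Q.Icarr X.Icarr y Y e' by auto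
    have "(e' \<otimes> e) \<otimes> y = e' \<otimes> (\<mu> \<otimes> z \<oplus> v)" using c e m_assoc v(3) by auto
    also have "\<dots> = \<mu> \<otimes> (e' \<otimes> z) \<oplus> e' \<otimes> v" using c z by algebra
    finally have "(e' \<otimes> e) \<otimes> y = \<mu> \<otimes> w \<oplus> e' \<otimes> v" unfolding e'z .
    then show "(e' \<otimes> e) \<otimes> y \<in> Idl (N \<union> {\<nu> \<otimes> x | \<nu> x. \<nu> \<in> Q \<and> x \<in> Y})"
      unfolding X_def[symmetric] using v w c X.I_l_closed X.add_in by auto
  qed (use insert.prems Y in auto)
  then obtain h where h: "h \<in> carrier R - Q" "\<forall>y\<in>Y. h \<otimes> y \<in> N" by blast
  have "X \<subseteq> {x \<in> carrier R. h \<otimes> x \<in> N}"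
  proof
    fix x assume "x \<in> X"
    then consider "x \<in> N" | \<mu> y where "\<mu> \<in> Q" "y \<in> Y" "x = \<mu> \<otimes> y" unfolding X_def by blast
    then show "x \<in> {x \<in> carrier R. h \<otimes> x \<in> N}"
    proof cases
      case 1 then show ?thesis using h N.I_l_closed N.Icarr by auto
    next
      case 2
      then have "\<mu> \<in> carrier R" "y \<in> carrier R" using Q.Icarr Y by auto
      then have "h \<otimes> x = \<mu> \<otimes> (h \<otimes> y)" "x \<in> carrier R" using 2 h m_lcomm by auto
      then show ?thesis using N.I_l_closed h 2 \<open>\<mu> \<in> carrier R\<close> by auto
    qed
  qed
  then have "Idl X \<subseteq> {x \<in> carrier R. h \<otimes> x \<in> N}"
    using genideal_minimal colon_ideal[OF N.is_ideal] h(1) by blast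
  then have "h \<otimes> w \<in> N" using w(2) by blast
  moreover have "(h \<otimes> e') \<otimes> z = h \<otimes> w" using h e' z m_assoc e'z by auto
  moreover have "(h \<otimes> e') \<otimes> y \<in> N" if "y \<in> Y" for y
  proof -
    have "y \<in> carrier R" "h \<in> carrier R" "e' \<in> carrier R" using that h e' Y by auto
    then have "(h \<otimes> e') \<otimes> y = e' \<otimes> (h \<otimes> y)" by algebra
    then show ?thesis using N.I_l_closed h that e' by auto
  qed
  ultimately have "\<forall>y\<in>insert z Y. (h \<otimes> e') \<otimes> y \<in> N" by simp
  then show ?case using Q.mult_notin[OF h(1) e'] by (rule bexI)
qed

section \<open>Primes from Zorn's lemma, and Gaussian elimination modulo a prime\<close>

section \<open>Prime avoidance and fraction-free elimination\<close>

text \<open>One use of Zorn's lemma for two purposes: \<open>u = \<one>\<close> yields maximal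
  ideals, general \<open>u\<close> yields primes avoiding \<open>u\<close>. No chain condition may
  be assumed, since the second case is applied in the ring of all functions.\<close>

lemma (in cring) exists_maximal_avoiding_powers:
  assumes "ideal \<aa> R" "\<And>n::nat. u [^] n \<notin> \<aa>"
  obtains M where "ideal M R" "\<aa> \<subseteq> M" "\<And>n::nat. u [^] n \<notin> M"
    "\<And>X. \<lbrakk>ideal X R; \<And>n::nat. u [^] n \<notin> X; M \<subseteq> X\<rbrakk> \<Longrightarrow> X = M"
proof -
  define S where "S = {\<bb>. ideal \<bb> R \<and> \<aa> \<subseteq> \<bb> \<and> (\<forall>n::nat. u [^] n \<notin> \<bb>)}"
  have "\<exists>M\<in>S. \<forall>X\<in>S. M \<subseteq> X \<longrightarrow> X = M"
  proof (rule subset_Zorn_nonempty)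
    have "\<aa> \<in> S" unfolding S_def by (simp add: assms)
    then show "S \<noteq> {}" by blast
    fix C assume C: "C \<noteq> {}" "subset.chain S C"
    then have CS: "C \<subseteq> S" and ch: "\<And>x y. x \<in> C \<Longrightarrow> y \<in> C \<Longrightarrow> x \<subseteq> y \<or> y \<subseteq> x"
      unfolding subset.chain_def by auto
    have "ideal (\<Union>C) R"
    proof (rule cring_idealI)
      have "X \<subseteq> carrier R" if "X \<in> C" for X
        using that CS ideal.Icarr[of X R] unfolding S_def by fast
      then show "\<Union>C \<subseteq> carrier R" by (rule Union_least)
      obtain X where X: "X \<in> C" using C(1) by blast
      then have "ideal X R" using CS S_def by blast
      then have "\<zero> \<in> X" by (intro additive_subgroup.zero_closed ideal.axioms(1))
      then show "\<zero> \<in> \<Union>C" using X by blast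
    next
      fix x y assume "x \<in> \<Union>C" "y \<in> \<Union>C"
      then obtain X Y where "x \<in> X" "y \<in> Y" "X \<in> C" "Y \<in> C" by blast
      then obtain Z where Z: "x \<in> Z" "y \<in> Z" "Z \<in> C" using ch[of X Y] by blast
      then have "ideal Z R" using CS S_def by blast
      from ideal.add_in[OF this Z(1,2)] show "x \<oplus> y \<in> \<Union>C" using Z(3) by blast
    next
      fix r x assume "r \<in> carrier R" "x \<in> \<Union>C"
      then obtain X where X: "X \<in> C" "x \<in> X" by blast
      then have "ideal X R" using CS S_def by blast
      from ideal.I_l_closed[OF this X(2) \<open>r \<in> carrier R\<close>] show "r \<otimes> x \<in> \<Union>C" using X(1) by blast
    qed
    then show "\<Union>C \<in> S" using C(1) CS unfolding S_def by blast
  qed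
  then obtain M where M: "M \<in> S" "\<And>X. X \<in> S \<Longrightarrow> M \<subseteq> X \<Longrightarrow> X = M" by blast
  have SI: "X \<in> S \<longleftrightarrow> ideal X R \<and> \<aa> \<subseteq> X \<and> (\<forall>n::nat. u [^] n \<notin> X)" for X
    unfolding S_def by blast
  show thesis
  proof (rule that[of M])
    fix X assume "ideal X R" "\<And>n::nat. u [^] n \<notin> X" "M \<subseteq> X"
    then show "X = M" using M(1) by (intro M(2)) (auto simp: SI)
  qed (use M(1) SI in auto)
qed

lemma (in cring) exists_maximal_containing:
  assumes "ideal \<aa> R" "\<one> \<notin> \<aa>"
  obtains M where "maximalideal M R" "\<aa> \<subseteq> M"
proof -
  obtain M where M: "ideal M R" "\<aa> \<subseteq> M" "\<And>n::nat. \<one> [^] n \<notin> M"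
    "\<And>X. \<lbrakk>ideal X R; \<And>n::nat. \<one> [^] n \<notin> X; M \<subseteq> X\<rbrakk> \<Longrightarrow> X = M"
    using exists_maximal_avoiding_powers[OF assms(1), of \<one>] assms(2) by (metis nat_pow_one)
  have one: "\<one> \<notin> M" using M(3)[of 0] by simp
  have "maximalideal M R"
  proof (rule maximalidealI[OF M(1)])
    show "carrier R \<noteq> M" using one one_closed by blast
    fix X assume X: "ideal X R" "M \<subseteq> X" "X \<subseteq> carrier R"
    show "X = M \<or> X = carrier R"
    proof (cases "\<one> \<in> X")
      case True
      then show ?thesis using ideal.one_imp_carrier[OF X(1)] by blast
    next
      case False
      then have "X = M" using X by (intro M(4)) (simp_all only: nat_pow_one not_False_eq_True)
      then show ?thesis by blast
    qed
  qed
  with M(2) show thesis by (rule that[rotated])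
qed

text \<open>An ideal maximal among those avoiding the powers of \<open>u\<close> is prime: each
  element outside it generates, together with it, some power of \<open>u\<close>, and multiplying
  two such expressions would put a power of \<open>u\<close> into the ideal if the product of the
  two elements were there.\<close>

lemma (in cring) exists_prime_avoiding_powers:
  assumes "ideal \<aa> R" "u \<in> carrier R" "\<And>n::nat. u [^] n \<notin> \<aa>"
  shows "\<exists>Q. primeideal Q R \<and> \<aa> \<subseteq> Q \<and> u \<notin> Q"
proof -
  obtain M where M: "ideal M R" "\<aa> \<subseteq> M" "\<And>n::nat. u [^] n \<notin> M"
    "\<And>X. \<lbrakk>ideal X R; \<And>n::nat. u [^] n \<notin> X; M \<subseteq> X\<rbrakk> \<Longrightarrow> X = M"
    using exists_maximal_avoiding_powers[OF assms(1,3)] by blast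
  interpret M: ideal M R by fact
  have grow: "\<exists>n::nat. \<exists>r\<in>carrier R. \<exists>w\<in>M. u [^] n = r \<otimes> a \<oplus> w" if a: "a \<in> carrier R" "a \<notin> M" for a
  proof -
    let ?X = "Idl (M \<union> {\<nu> \<otimes> a | \<nu>. \<nu> \<in> carrier R})"
    have sub: "M \<union> {\<nu> \<otimes> a | \<nu>. \<nu> \<in> carrier R} \<subseteq> carrier R" using M.Icarr a by auto
    have "\<one> \<otimes> a \<in> ?X" using subsetD[OF genideal_self[OF sub], of "\<one> \<otimes> a"] one_closed by blast
    then have "a \<in> ?X" using a(1) by simp
    moreover have "M \<subseteq> ?X" using genideal_self[OF sub] by blast
    ultimately obtain n :: nat where "u [^] n \<in> ?X"
      using M(4)[OF genideal_ideal[OF sub]] a(2) by blast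
    from genideal_insert_multiples[OF oneideal _ a(1) this]
    have "\<exists>\<nu>\<in>carrier R. \<exists>w\<in>Idl M. u [^] n = \<nu> \<otimes> a \<oplus> w"
      using M.Icarr by blast
    moreover have "Idl M \<subseteq> M" using genideal_minimal[OF M.is_ideal] by blast
    ultimately show ?thesis by blast
  qed
  have "primeideal M R"
  proof (rule primeidealI[OF M.is_ideal cring_axioms])
    show "carrier R \<noteq> M" using M(3)[of 0] one_closed by auto
    fix a b assume ab: "a \<in> carrier R" "b \<in> carrier R" "a \<otimes> b \<in> M"
    show "a \<in> M \<or> b \<in> M"
    proof (rule ccontr)
      assume "\<not> ?thesis"
      then obtain n n' :: nat and r r' w w' where
        h: "r \<in> carrier R" "w \<in> M" "u [^] n = r \<otimes> a \<oplus> w" "r' \<in> carrier R" "w' \<in> M" "u [^] n' = r' \<otimes> b \<oplus> w'"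
        using grow[of a] grow[of b] ab by blast
      have c: "w \<in> carrier R" "w' \<in> carrier R" using h M.Icarr by auto
      have "u [^] (n + n') = (r \<otimes> a \<oplus> w) \<otimes> (r' \<otimes> b \<oplus> w')"
        using nat_pow_mult[OF assms(2)] h by metis
      also have "\<dots> = (r \<otimes> r') \<otimes> (a \<otimes> b) \<oplus> ((r \<otimes> a \<oplus> w) \<otimes> w' \<oplus> (r' \<otimes> b) \<otimes> w)"
        using ab c h(1,4) by algebra
      also have "\<dots> \<in> M"
        using M.I_l_closed[OF ab(3), of "r \<otimes> r'"] M.I_l_closed[OF h(5), of "r \<otimes> a \<oplus> w"]
          M.I_l_closed[OF h(2), of "r' \<otimes> b"] ab(1,2) h(1,4) c
        by (intro M.add_in) auto
      finally show False using M(3) by blast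
    qed
  qed
  moreover have "u \<notin> M" using M(3)[of 1] assms(2) by simp
  ultimately show ?thesis using M(2) by blast
qed

lemma (in cring) finsum_elimination:
  assumes "finite B" "p \<in> carrier R" "q \<in> carrier R"
    and "\<And>b. b \<in> B \<Longrightarrow> g b \<in> carrier R" "\<And>b. b \<in> B \<Longrightarrow> h b \<in> carrier R" "\<And>b. b \<in> B \<Longrightarrow> x b \<in> carrier R"
  shows "(\<Oplus>b\<in>B. (p \<otimes> g b \<ominus> q \<otimes> h b) \<otimes> x b) =
    p \<otimes> (\<Oplus>b\<in>B. g b \<otimes> x b) \<ominus> q \<otimes> (\<Oplus>b\<in>B. h b \<otimes> x b)"
  using assms
proof (induction B rule: finite_induct)
  case (insert a B)
  have c: "g a \<in> carrier R" "h a \<in> carrier R" "x a \<in> carrier R" "p \<in> carrier R" "q \<in> carrier R"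
    "(\<Oplus>b\<in>B. g b \<otimes> x b) \<in> carrier R" "(\<Oplus>b\<in>B. h b \<otimes> x b) \<in> carrier R"
    using insert.prems by (auto intro!: finsum_closed)
  have s: "(\<Oplus>b\<in>insert a B. (p \<otimes> g b \<ominus> q \<otimes> h b) \<otimes> x b) = (p \<otimes> g a \<ominus> q \<otimes> h a) \<otimes> x a \<oplus> (\<Oplus>b\<in>B. (p \<otimes> g b \<ominus> q \<otimes> h b) \<otimes> x b)"
    "(\<Oplus>b\<in>insert a B. g b \<otimes> x b) = g a \<otimes> x a \<oplus> (\<Oplus>b\<in>B. g b \<otimes> x b)"
    "(\<Oplus>b\<in>insert a B. h b \<otimes> x b) = h a \<otimes> x a \<oplus> (\<Oplus>b\<in>B. h b \<otimes> x b)"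
    by (subst finsum_insert; use insert.hyps insert.prems in auto)+
  have "(\<Oplus>b\<in>B. (p \<otimes> g b \<ominus> q \<otimes> h b) \<otimes> x b) =
    p \<otimes> (\<Oplus>b\<in>B. g b \<otimes> x b) \<ominus> q \<otimes> (\<Oplus>b\<in>B. h b \<otimes> x b)"
    using insert by auto
  moreover have "(p \<otimes> u \<ominus> q \<otimes> v) \<otimes> w \<oplus> (p \<otimes> S \<ominus> q \<otimes> T) = p \<otimes> (u \<otimes> w \<oplus> S) \<ominus> q \<otimes> (v \<otimes> w \<oplus> T)"
    if "u \<in> carrier R" "v \<in> carrier R" "w \<in> carrier R" "S \<in> carrier R" "T \<in> carrier R" for u v w S T
    using that \<open>p \<in> carrier R\<close> \<open>q \<in> carrier R\<close> by algebra
  ultimately show ?case unfolding s using c(1,2,3,6,7) by simp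
qed (simp add: a_minus_def)

text \<open>Back substitution without division. A vector \<open>x\<close> for the system with column
  \<open>b0\<close> eliminated is scaled by the pivot \<open>p\<close>, and the entry at
  \<open>b0\<close> is what the pivot row \<open>h\<close> demands. It serves both elimination
  modulo a prime and linear algebra over a residue field.\<close>

lemma (in cring) pivot_solution:
  assumes "finite B" "b0 \<in> B" "p = h b0" "q = g b0"
    and g: "\<And>b. b \<in> B \<Longrightarrow> g b \<in> carrier R" and h: "\<And>b. b \<in> B \<Longrightarrow> h b \<in> carrier R"
    and x: "\<And>b. b \<in> B - {b0} \<Longrightarrow> x b \<in> carrier R"
    and y: "\<And>b. y b = (if b = b0 then \<ominus> (\<Oplus>b\<in>B - {b0}. h b \<otimes> x b) else p \<otimes> x b)"
  shows "(\<Oplus>b\<in>B. g b \<otimes> y b) = (\<Oplus>b\<in>B - {b0}. (p \<otimes> g b \<ominus> q \<otimes> h b) \<otimes> x b)"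
proof -
  let ?B = "B - {b0}" and ?S = "\<Oplus>b\<in>B - {b0}. h b \<otimes> x b"
  have c: "p \<in> carrier R" "q \<in> carrier R" "?S \<in> carrier R"
    using assms by (auto intro!: finsum_closed)
  have y0: "y b0 = \<ominus> ?S" using y by simp
  have yc: "y b \<in> carrier R" if "b \<in> B" for b using that c x by (auto simp: y)
  have "(\<Oplus>b\<in>B. g b \<otimes> y b) = (\<Oplus>b\<in>insert b0 ?B. g b \<otimes> y b)"
    using assms(2) by (simp add: insert_absorb)
  also have "\<dots> = g b0 \<otimes> y b0 \<oplus> (\<Oplus>b\<in>?B. g b \<otimes> y b)"
    by (rule finsum_insert) (use assms(1,2) g yc in auto)
  also have "(\<Oplus>b\<in>?B. g b \<otimes> y b) = (\<Oplus>b\<in>?B. p \<otimes> (g b \<otimes> x b))"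
  proof (rule finsum_cong')
    fix b assume "b \<in> ?B"
    then show "g b \<otimes> y b = p \<otimes> (g b \<otimes> x b)" using y[of b] g x c m_lcomm by auto
  qed (use g x c in auto)
  also have "\<dots> = p \<otimes> (\<Oplus>b\<in>?B. g b \<otimes> x b)"
    by (rule finsum_rdistr[symmetric]) (use assms(1) g x c in auto)
  also have "g b0 \<otimes> y b0 = \<ominus> (q \<otimes> ?S)" using y0 assms(4) c r_minus by auto
  also have "\<ominus> (q \<otimes> ?S) \<oplus> p \<otimes> (\<Oplus>b\<in>?B. g b \<otimes> x b) = p \<otimes> (\<Oplus>b\<in>?B. g b \<otimes> x b) \<ominus> q \<otimes> ?S"
  proof -
    have "(\<Oplus>b\<in>?B. g b \<otimes> x b) \<in> carrier R" using g x by (auto intro!: finsum_closed)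
    then show ?thesis using c a_comm[of "\<ominus> (q \<otimes> ?S)"] by (simp add: a_minus_def)
  qed
  also have "\<dots> = (\<Oplus>b\<in>?B. (p \<otimes> g b \<ominus> q \<otimes> h b) \<otimes> x b)"
    by (rule finsum_elimination[symmetric]) (use assms(1) g h x c in auto)
  finally show ?thesis .
qed

text \<open>The dichotomy of linear algebra for the matrix \<open>G\<close> over the fraction field
  of \<open>R\<close> modulo \<open>I\<close>: either the columns are dependent, or the
  \<open>f b\<close> can be recovered from the rows up to a factor \<open>e\<close>, in effect a
  minor. \<open>N\<close> is unrelated to \<open>I\<close>, so the second alternative holds modulo
  \<open>N\<close> exactly.\<close>

lemma (in primeideal) kernel_vector_or_full_rank:
  assumes "finite B" "finite W"
    and G: "\<And>w b. w \<in> W \<Longrightarrow> b \<in> B \<Longrightarrow> G w b \<in> carrier R"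
    and f: "\<And>b. b \<in> B \<Longrightarrow> f b \<in> carrier R"
    and N: "ideal N R" "\<And>w. w \<in> W \<Longrightarrow> (\<Oplus>b\<in>B. G w b \<otimes> f b) \<in> N"
  shows "(\<exists>x. (\<forall>b\<in>B. x b \<in> carrier R) \<and> (\<exists>b\<in>B. x b \<notin> I) \<and> (\<forall>w\<in>W. (\<Oplus>b\<in>B. G w b \<otimes> x b) \<in> I)) \<or>
    (\<exists>e\<in>carrier R - I. \<forall>b\<in>B. e \<otimes> f b \<in> N)"
  using assms
proof (induction B arbitrary: G rule: finite_induct)
  case empty
  then show ?case using one_notin by blast
next
  case (insert b0 B)
  interpret N: ideal N R by fact
  note Gc = insert.prems(2) and fc = insert.prems(3) and GN = insert.prems(5)
  show ?case
  proof (cases "\<forall>w\<in>W. G w b0 \<in> I")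
    case True
    \<comment> \<open>A column that vanishes modulo \<open>I\<close> has the unit vector at
      \<open>b0\<close> in its kernel.\<close>
    let ?x = "\<lambda>b. if b = b0 then \<one> else \<zero>"
    have "(\<Oplus>b\<in>insert b0 B. G w b \<otimes> ?x b) \<in> I" if "w \<in> W" for w
      by (rule finsum_in)
        (use that True Gc in \<open>auto simp: additive_subgroup.zero_closed[OF additive_subgroup_axioms]\<close>)
    moreover have "?x b0 \<notin> I" using one_notin by auto
    ultimately show ?thesis by (intro disjI1 exI[of _ ?x]) auto
  next
    case False
    then obtain w where w: "w \<in> W" "G w b0 \<notin> I" by blast
    let ?p = "G w b0"
    \<comment> \<open>Cross-multiplication with the pivot row \<open>w\<close> removes the entry at
      \<open>b0\<close> from every row. The row \<open>w\<close> itself becomes zero, which is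
      harmless, so \<open>W\<close> stays the same.\<close>
    let ?G = "\<lambda>v b. ?p \<otimes> G v b \<ominus> G v b0 \<otimes> G w b"
    have B: "insert b0 B - {b0} = B" using insert.hyps by auto
    have p: "?p \<in> carrier R" using Gc w by auto
    have split: "(\<Oplus>b\<in>insert b0 B. G v b \<otimes> f b) = G v b0 \<otimes> f b0 \<oplus> (\<Oplus>b\<in>B. G v b \<otimes> f b)" if "v \<in> W" for v
      by (rule finsum_insert) (use insert.hyps Gc fc that in auto)
    have sc: "(\<Oplus>b\<in>B. G v b \<otimes> f b) \<in> carrier R" if "v \<in> W" for v
      using Gc fc that by (auto intro!: finsum_closed)
    have "(\<exists>x. (\<forall>b\<in>B. x b \<in> carrier R) \<and> (\<exists>b\<in>B. x b \<notin> I) \<and> (\<forall>v\<in>W. (\<Oplus>b\<in>B. ?G v b \<otimes> x b) \<in> I)) \<or>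
      (\<exists>e\<in>carrier R - I. \<forall>b\<in>B. e \<otimes> f b \<in> N)"
    proof (rule insert.IH)
      fix v assume v: "v \<in> W"
      have "(\<Oplus>b\<in>B. ?G v b \<otimes> f b) = ?p \<otimes> (\<Oplus>b\<in>B. G v b \<otimes> f b) \<ominus> G v b0 \<otimes> (\<Oplus>b\<in>B. G w b \<otimes> f b)"
        by (rule finsum_elimination) (use insert.hyps Gc fc v w in auto)
      also have "\<dots> = ?p \<otimes> (G v b0 \<otimes> f b0 \<oplus> (\<Oplus>b\<in>B. G v b \<otimes> f b)) \<ominus> G v b0 \<otimes> (G w b0 \<otimes> f b0 \<oplus> (\<Oplus>b\<in>B. G w b \<otimes> f b))"
      proof -
        have "G v b0 \<in> carrier R" "f b0 \<in> carrier R" using Gc fc v by auto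
        moreover have id: "p \<otimes> S \<ominus> g \<otimes> T = p \<otimes> (g \<otimes> u \<oplus> S) \<ominus> g \<otimes> (p \<otimes> u \<oplus> T)"
          if "p \<in> carrier R" "g \<in> carrier R" "u \<in> carrier R" "S \<in> carrier R" "T \<in> carrier R" for p g u S T
          using that by algebra
        ultimately show ?thesis using id[OF p _ _ sc[OF v] sc[OF w(1)]] by blast
      qed
      also have "\<dots> \<in> N"
        using GN[OF v] GN[OF w(1)] Gc[OF v] p by (intro N.minus_in N.I_l_closed) (auto simp: split v w(1))
      finally show "(\<Oplus>b\<in>B. ?G v b \<otimes> f b) \<in> N" .
    qed (use insert.prems w in auto)
    then consider (kernel) x where "\<forall>b\<in>B. x b \<in> carrier R" "\<exists>b\<in>B. x b \<notin> I" "\<forall>v\<in>W. (\<Oplus>b\<in>B. ?G v b \<otimes> x b) \<in> I"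
      | (full) e where "e \<in> carrier R - I" "\<forall>b\<in>B. e \<otimes> f b \<in> N" by blast
    then show ?thesis
    proof cases
      case kernel note x = this
      define y where "y b = (if b = b0 then \<ominus> (\<Oplus>b\<in>insert b0 B - {b0}. G w b \<otimes> x b) else ?p \<otimes> x b)" for b
      have "(\<Oplus>b\<in>insert b0 B. G v b \<otimes> y b) = (\<Oplus>b\<in>insert b0 B - {b0}. ?G v b \<otimes> x b)" if "v \<in> W" for v
        by (rule pivot_solution[where y = y]) (use insert.hyps Gc that x y_def w in auto)
      then have "(\<Oplus>b\<in>insert b0 B. G v b \<otimes> y b) \<in> I" if "v \<in> W" for v
        unfolding B using x(3) that by auto
      moreover have "y b \<in> carrier R" if "b \<in> insert b0 B" for b
        unfolding y_def B using that p x(1) Gc w by (auto intro!: a_inv_closed finsum_closed)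
      moreover obtain b where "b \<in> B" "x b \<notin> I" using x(2) by blast
      then have "y b \<notin> I" "b \<in> insert b0 B" unfolding y_def using I_prime p x(1) w(2) insert.hyps by auto
      ultimately show ?thesis by (intro disjI1 exI[of _ y]) auto
    next
      case full note e = this
      \<comment> \<open>For \<open>b\<close> in \<open>B\<close> the factor \<open>e\<close> is
        enough; solving the pivot row for \<open>f b0\<close> costs the further factor
        \<open>?p\<close>.\<close>
      have pe: "e \<otimes> ?p \<in> carrier R - I" using mult_notin e p w by auto
      have fB: "f b \<in> carrier R" if "b \<in> insert b0 B" for b using fc that by auto
      have "(e \<otimes> ?p) \<otimes> f b \<in> N" if "b \<in> insert b0 B" for b
      proof (cases "b = b0")
        case False
        have "(e \<otimes> ?p) \<otimes> f b = ?p \<otimes> (e \<otimes> f b)" using fB[OF that] e p m_lcomm m_assoc by auto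
        then show ?thesis using False that e N.I_l_closed p by auto
      next
        case True
        let ?S = "\<Oplus>b\<in>B. G w b \<otimes> f b"
        have "e \<otimes> ?S = (\<Oplus>b\<in>B. e \<otimes> (G w b \<otimes> f b))"
          by (rule finsum_rdistr) (use insert.hyps e Gc fc w in auto)
        also have "\<dots> \<in> N"
        proof (rule N.finsum_in)
          fix b assume b: "b \<in> B"
          then have "e \<otimes> (G w b \<otimes> f b) = G w b \<otimes> (e \<otimes> f b)" using e Gc fc w m_lcomm by auto
          then show "e \<otimes> (G w b \<otimes> f b) \<in> N" using b e N.I_l_closed Gc w by auto
        qed
        finally have 1: "e \<otimes> ?S \<in> N" .
        have "(e \<otimes> ?p) \<otimes> f b0 = e \<otimes> (?p \<otimes> f b0 \<oplus> ?S) \<ominus> e \<otimes> ?S"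
        proof -
          have id: "(e \<otimes> p) \<otimes> u = e \<otimes> (p \<otimes> u \<oplus> T) \<ominus> e \<otimes> T"
            if "e \<in> carrier R" "p \<in> carrier R" "u \<in> carrier R" "T \<in> carrier R" for e p u T
            using that by algebra
          show ?thesis using id[of e ?p "f b0", OF _ p _ sc[OF w(1)]] e(1) fB[of b0] by blast
        qed
        also have "\<dots> \<in> N"
          using GN[OF w(1)] e by (intro N.minus_in 1 N.I_l_closed) (auto simp: split w(1))
        finally show ?thesis using True by simp
      qed
      with pe show ?thesis by blast
    qed
  qed
qed

section \<open>Hilbert's basis theorem for rings \<open>A[t]\<close> inside a given ring\<close>

section \<open>A basis theorem without polynomials\<close>

text \<open>Phrased with sequences because it is consumed that way: by the double sequence of
  leading coefficient ideals below, and by the sequence of transporters in the proof of the uniform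
  reduction number.\<close>

definition ideal_acc :: "('a, 'b) ring_scheme \<Rightarrow> bool"
  where "ideal_acc R \<longleftrightarrow> (\<forall>f :: nat \<Rightarrow> 'a set.
    (\<forall>i. ideal (f i) R) \<longrightarrow> (\<forall>i. f i \<subseteq> f (Suc i)) \<longrightarrow> (\<exists>k. \<forall>i\<ge>k. f i = f k))"

lemma ideal_accD:
  fixes f :: "nat \<Rightarrow> 'a set"
  assumes "ideal_acc R" "\<And>i. ideal (f i) R" "\<And>i. f i \<subseteq> f (Suc i)"
  obtains k where "\<And>i. i \<ge> k \<Longrightarrow> f i = f k"
  using assms unfolding ideal_acc_def by blast

lemma (in cring) subcring_ideal_iff:
  assumes "subcring A R"
  shows "ideal \<aa> (R\<lparr>carrier := A\<rparr>) \<longleftrightarrow> \<aa> \<subseteq> A \<and> \<zero> \<in> \<aa> \<and>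
    (\<forall>x\<in>\<aa>. \<forall>y\<in>\<aa>. x \<oplus> y \<in> \<aa>) \<and> (\<forall>r\<in>A. \<forall>x\<in>\<aa>. r \<otimes> x \<in> \<aa>)"
proof -
  interpret A: cring "R\<lparr>carrier := A\<rparr>"
    using subcring_iff[OF subcringE(1)[OF assms]] assms by simp
  show ?thesis
  proof
    assume "ideal \<aa> (R\<lparr>carrier := A\<rparr>)"
    then interpret i: ideal \<aa> "R\<lparr>carrier := A\<rparr>" .
    show "\<aa> \<subseteq> A \<and> \<zero> \<in> \<aa> \<and> (\<forall>x\<in>\<aa>. \<forall>y\<in>\<aa>. x \<oplus> y \<in> \<aa>) \<and> (\<forall>r\<in>A. \<forall>x\<in>\<aa>. r \<otimes> x \<in> \<aa>)"
      using i.Icarr i.add_in i.I_l_closed additive_subgroup.zero_closed[OF i.additive_subgroup_axioms]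
      by auto
  next
    assume "\<aa> \<subseteq> A \<and> \<zero> \<in> \<aa> \<and> (\<forall>x\<in>\<aa>. \<forall>y\<in>\<aa>. x \<oplus> y \<in> \<aa>) \<and> (\<forall>r\<in>A. \<forall>x\<in>\<aa>. r \<otimes> x \<in> \<aa>)"
    then show "ideal \<aa> (R\<lparr>carrier := A\<rparr>)" by (intro A.cring_idealI) auto
  qed
qed

context cring
begin

text \<open>Values at \<open>t\<close> of the polynomials of degree less than \<open>d\<close> over
  \<open>A\<close>. Since \<open>t\<close> may satisfy relations over \<open>A\<close>, a value has
  no degree of its own, only bounds, and all arguments run on such bounds.\<close>

primrec poly_below :: "'a set \<Rightarrow> 'a \<Rightarrow> nat \<Rightarrow> 'a set" where
  "poly_below A t 0 = {\<zero>}"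
| "poly_below A t (Suc d) = {p \<oplus> a \<otimes> t [^] d | p a. p \<in> poly_below A t d \<and> a \<in> A}"

text \<open>The coefficient at \<open>t ^ d\<close> may be \<open>\<zero>\<close>, and one element
  may have several representations; admitting all of them makes this an ideal of \<open>A\<close> in
  spite of relations satisfied by \<open>t\<close>.\<close>

definition leading_coeffs :: "'a set \<Rightarrow> 'a \<Rightarrow> nat \<Rightarrow> 'a set \<Rightarrow> 'a set"
  where "leading_coeffs A t d \<aa> = {a \<in> A. \<exists>p\<in>poly_below A t d. p \<oplus> a \<otimes> t [^] d \<in> \<aa>}"

context
  fixes A t
  assumes A: "subcring A R" and t: "t \<in> carrier R"
begin

lemma A_carrier: "a \<in> A \<Longrightarrow> a \<in> carrier R"
  using subcringE(1)[OF A] by blast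

lemma poly_below_carrier: "p \<in> poly_below A t d \<Longrightarrow> p \<in> carrier R"
  by (induction d arbitrary: p) (use A_carrier t in auto)

lemma poly_below_zero: "\<zero> \<in> poly_below A t d"
proof (induction d)
  case (Suc d)
  have "\<zero> \<oplus> \<zero> \<otimes> t [^] d \<in> poly_below A t (Suc d)"
    using Suc subcringE(2)[OF A] by auto
  then show ?case using t by simp
qed simp

lemma poly_below_Suc: "p \<in> poly_below A t d \<Longrightarrow> p \<in> poly_below A t (Suc d)"
proof -
  assume p: "p \<in> poly_below A t d"
  then have "p \<oplus> \<zero> \<otimes> t [^] d \<in> poly_below A t (Suc d)"
    using subcringE(2)[OF A] by auto
  then show ?thesis using t poly_below_carrier[OF p] by simp
qed

lemma poly_below_mono: "d \<le> e \<Longrightarrow> p \<in> poly_below A t d \<Longrightarrow> p \<in> poly_below A t e"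
  by (induction e rule: dec_induct) (use poly_below_Suc in blast)+

lemma poly_below_add:
  "\<lbrakk>p \<in> poly_below A t d; q \<in> poly_below A t d\<rbrakk> \<Longrightarrow> p \<oplus> q \<in> poly_below A t d"
proof (induction d arbitrary: p q)
  case (Suc d)
  from Suc.prems obtain p' a q' b where h: "p = p' \<oplus> a \<otimes> t [^] d" "q = q' \<oplus> b \<otimes> t [^] d"
    "p' \<in> poly_below A t d" "q' \<in> poly_below A t d" "a \<in> A" "b \<in> A" by auto
  define s where "s = t [^] d"
  have c: "p' \<in> carrier R" "q' \<in> carrier R" "a \<in> carrier R" "b \<in> carrier R" "s \<in> carrier R"
    using h poly_below_carrier A_carrier t unfolding s_def by auto
  have "p \<oplus> q = (p' \<oplus> q') \<oplus> (a \<oplus> b) \<otimes> s"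
    using c unfolding h s_def[symmetric] by algebra
  moreover have "p' \<oplus> q' \<in> poly_below A t d" using Suc.IH h by blast
  moreover have "a \<oplus> b \<in> A" using subcringE(7)[OF A] h by blast
  ultimately show ?case unfolding s_def by auto
qed simp

lemma poly_below_scale: "\<lbrakk>r \<in> A; p \<in> poly_below A t d\<rbrakk> \<Longrightarrow> r \<otimes> p \<in> poly_below A t d"
proof (induction d arbitrary: p)
  case 0
  then show ?case using A_carrier by simp
next
  case (Suc d)
  from Suc.prems obtain p' a where h: "p = p' \<oplus> a \<otimes> t [^] d" "p' \<in> poly_below A t d" "a \<in> A" by auto
  define s where "s = t [^] d"
  have c: "p' \<in> carrier R" "a \<in> carrier R" "r \<in> carrier R" "s \<in> carrier R"
    using h poly_below_carrier A_carrier t Suc.prems unfolding s_def by auto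
  have "r \<otimes> p = r \<otimes> p' \<oplus> (r \<otimes> a) \<otimes> s"
    using c unfolding h s_def[symmetric] by algebra
  moreover have "r \<otimes> p' \<in> poly_below A t d" using Suc h by blast
  moreover have "r \<otimes> a \<in> A" using subcringE(6)[OF A] h Suc.prems by blast
  ultimately show ?case unfolding s_def by auto
qed

lemma poly_below_shift: "p \<in> poly_below A t d \<Longrightarrow> t \<otimes> p \<in> poly_below A t (Suc d)"
proof (induction d arbitrary: p)
  case 0
  then have "t \<otimes> p = \<zero>" using t by simp
  then show ?case using poly_below_zero[of "Suc 0"] by (simp only:)
next
  case (Suc d)
  from Suc.prems obtain p' a where h: "p = p' \<oplus> a \<otimes> t [^] d" "p' \<in> poly_below A t d" "a \<in> A" by auto
  define s where "s = t [^] d"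
  have c: "p' \<in> carrier R" "a \<in> carrier R" "s \<in> carrier R" "t [^] Suc d = s \<otimes> t"
    using h poly_below_carrier A_carrier t Suc.prems unfolding s_def by auto
  have "t \<otimes> (p' \<oplus> a \<otimes> s) = t \<otimes> p' \<oplus> a \<otimes> (s \<otimes> t)"
    using c(1,2,3) t by algebra
  then have "t \<otimes> p = t \<otimes> p' \<oplus> a \<otimes> t [^] Suc d" unfolding h c(4) s_def .
  moreover have "t \<otimes> p' \<in> poly_below A t (Suc d)" using Suc h by blast
  moreover have "poly_below A t (Suc (Suc d)) =
      {p \<oplus> a \<otimes> t [^] Suc d | p a. p \<in> poly_below A t (Suc d) \<and> a \<in> A}" by (rule poly_below.simps)
  ultimately show ?case using h(3) by blast
qed

lemma poly_below_shift_pow: "p \<in> poly_below A t d \<Longrightarrow> t [^] e \<otimes> p \<in> poly_below A t (d + e)"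
proof (induction e)
  case 0
  then show ?case using poly_below_carrier by simp
next
  case (Suc e)
  define s where "s = t [^] e"
  have c: "s \<in> carrier R" "p \<in> carrier R" "t [^] Suc e = s \<otimes> t"
    using Suc.prems poly_below_carrier t unfolding s_def by auto
  have "t \<otimes> (s \<otimes> p) = (s \<otimes> t) \<otimes> p" using c(1,2) t by algebra
  then have "t \<otimes> (s \<otimes> p) = t [^] Suc e \<otimes> p" unfolding c(3) .
  then show ?case using poly_below_shift[OF Suc.IH[OF Suc.prems]] unfolding s_def by simp
qed

lemma poly_below_mult:
  "\<lbrakk>p \<in> poly_below A t d; q \<in> poly_below A t e\<rbrakk> \<Longrightarrow> p \<otimes> q \<in> poly_below A t (d + e)"
proof (induction e arbitrary: q)
  case 0
  then have "p \<otimes> q = \<zero>" using poly_below_carrier by simp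
  then show ?case using poly_below_zero by (simp only:)
next
  case (Suc e)
  from Suc.prems obtain q' a where h: "q = q' \<oplus> a \<otimes> t [^] e" "q' \<in> poly_below A t e" "a \<in> A" by auto
  define s where "s = t [^] e"
  have c: "p \<in> carrier R" "q' \<in> carrier R" "a \<in> carrier R" "s \<in> carrier R"
    using h poly_below_carrier A_carrier t Suc.prems unfolding s_def by auto
  have "p \<otimes> (q' \<oplus> a \<otimes> s) = p \<otimes> q' \<oplus> a \<otimes> (s \<otimes> p)"
    using c by algebra
  moreover have "p \<otimes> q' \<in> poly_below A t (d + e)" using Suc h by blast
  moreover have "a \<otimes> (s \<otimes> p) \<in> poly_below A t (d + e)"
    unfolding s_def by (intro poly_below_scale poly_below_shift_pow h Suc.prems)
  ultimately show ?case
    using poly_below_add[THEN poly_below_Suc] unfolding h(1) s_def by simp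
qed

lemma coeff_mem_poly_below: "a \<in> A \<Longrightarrow> a \<in> poly_below A t (Suc 0)"
  using A_carrier[of a] by force

lemma subcring_poly_below: "subcring (\<Union>d. poly_below A t d) R"
proof (rule subcringI')
  have one: "\<one> \<in> A" using subcringE(3)[OF A] .
  have m1: "\<ominus> \<one> \<in> A" using subcringE(5)[OF A] one by blast
  show "subring (\<Union>d. poly_below A t d) R"
  proof (rule subringI)
    show "(\<Union>d. poly_below A t d) \<subseteq> carrier R" using poly_below_carrier by blast
    show "\<one> \<in> (\<Union>d. poly_below A t d)" using coeff_mem_poly_below[OF one] by blast
    fix p assume "p \<in> (\<Union>d. poly_below A t d)"
    then obtain d where d: "p \<in> poly_below A t d" by blast
    have "(\<ominus> \<one>) \<otimes> p = \<ominus> p" using poly_below_carrier[OF d] l_minus[of \<one> p] by simp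
    then show "\<ominus> p \<in> (\<Union>d. poly_below A t d)" using poly_below_scale[OF m1 d] by auto
    fix q assume "q \<in> (\<Union>d. poly_below A t d)"
    then obtain e where e: "q \<in> poly_below A t e" by blast
    show "p \<otimes> q \<in> (\<Union>d. poly_below A t d)" using poly_below_mult[OF d e] by blast
    show "p \<oplus> q \<in> (\<Union>d. poly_below A t d)"
      using poly_below_add[of p "max d e" q] poly_below_mono[OF _ d] poly_below_mono[OF _ e] by auto
  qed
qed

lemma poly_below_uminus: "p \<in> poly_below A t d \<Longrightarrow> \<ominus> p \<in> poly_below A t d"
proof -
  assume d: "p \<in> poly_below A t d"
  have "\<ominus> \<one> \<in> A" using subcringE(5)[OF A] subcringE(3)[OF A] by blast
  moreover have "(\<ominus> \<one>) \<otimes> p = \<ominus> p" using poly_below_carrier[OF d] l_minus[of \<one> p] by simp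
  ultimately show "\<ominus> p \<in> poly_below A t d" using poly_below_scale[OF _ d] by metis
qed

lemma gen_mem_poly_below: "t \<in> (\<Union>d. poly_below A t d)"
proof -
  have "t \<otimes> \<one> \<in> poly_below A t (Suc (Suc 0))"
    using poly_below_shift[OF coeff_mem_poly_below] subcringE(3)[OF A] by blast
  then show ?thesis unfolding r_one[OF t] by blast
qed

context
  fixes \<aa>
  assumes ideal: "ideal \<aa> (R\<lparr>carrier := \<Union>d. poly_below A t d\<rparr>)"
begin

lemma leading_coeffs_ideal: "ideal (leading_coeffs A t d \<aa>) (R\<lparr>carrier := A\<rparr>)"
proof -
  have I: "\<zero> \<in> \<aa>" "\<And>x y. x \<in> \<aa> \<Longrightarrow> y \<in> \<aa> \<Longrightarrow> x \<oplus> y \<in> \<aa>"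
    "\<And>r x. r \<in> (\<Union>d. poly_below A t d) \<Longrightarrow> x \<in> \<aa> \<Longrightarrow> r \<otimes> x \<in> \<aa>"
    using ideal unfolding subcring_ideal_iff[OF subcring_poly_below] by auto
  define s where "s = t [^] d"
  have s: "s \<in> carrier R" unfolding s_def using t by simp
  show ?thesis
    unfolding subcring_ideal_iff[OF A]
  proof (intro conjI ballI)
    show "leading_coeffs A t d \<aa> \<subseteq> A" unfolding leading_coeffs_def by blast
    have "\<zero> \<oplus> \<zero> \<otimes> t [^] d \<in> \<aa>" using I(1) t by simp
    then show "\<zero> \<in> leading_coeffs A t d \<aa>"
      unfolding leading_coeffs_def using poly_below_zero subcringE(2)[OF A] by blast
  next
    fix x y assume "x \<in> leading_coeffs A t d \<aa>" "y \<in> leading_coeffs A t d \<aa>"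
    then obtain p q where h: "x \<in> A" "y \<in> A" "p \<in> poly_below A t d" "q \<in> poly_below A t d"
      "p \<oplus> x \<otimes> s \<in> \<aa>" "q \<oplus> y \<otimes> s \<in> \<aa>" unfolding leading_coeffs_def s_def by auto
    have c: "p \<in> carrier R" "q \<in> carrier R" "x \<in> carrier R" "y \<in> carrier R"
      using h poly_below_carrier A_carrier by auto
    have "(p \<oplus> x \<otimes> s) \<oplus> (q \<oplus> y \<otimes> s) = (p \<oplus> q) \<oplus> (x \<oplus> y) \<otimes> s" using c s by algebra
    then have "(p \<oplus> q) \<oplus> (x \<oplus> y) \<otimes> t [^] d \<in> \<aa>" using I(2)[OF h(5,6)] unfolding s_def by simp
    then show "x \<oplus> y \<in> leading_coeffs A t d \<aa>"
      unfolding leading_coeffs_def using poly_below_add h(1-4) subcringE(7)[OF A] by blast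
  next
    fix r x assume r: "r \<in> A" and "x \<in> leading_coeffs A t d \<aa>"
    then obtain p where h: "x \<in> A" "p \<in> poly_below A t d"
      "p \<oplus> x \<otimes> s \<in> \<aa>" unfolding leading_coeffs_def s_def by auto
    have c: "p \<in> carrier R" "r \<in> carrier R" "x \<in> carrier R"
      using h r poly_below_carrier A_carrier by auto
    have "r \<otimes> (p \<oplus> x \<otimes> s) = r \<otimes> p \<oplus> (r \<otimes> x) \<otimes> s" using c s by algebra
    moreover have "r \<otimes> (p \<oplus> x \<otimes> s) \<in> \<aa>"
      by (rule I(3)[OF _ h(3)]) (use coeff_mem_poly_below[OF r] in blast)
    ultimately have "r \<otimes> p \<oplus> (r \<otimes> x) \<otimes> t [^] d \<in> \<aa>" unfolding s_def by simp
    then show "r \<otimes> x \<in> leading_coeffs A t d \<aa>"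
      unfolding leading_coeffs_def using poly_below_scale[OF r h(2)] h(1) r subcringE(6)[OF A] by blast
  qed
qed

lemma leading_coeffs_Suc: "leading_coeffs A t d \<aa> \<subseteq> leading_coeffs A t (Suc d) \<aa>"
proof
  fix x assume "x \<in> leading_coeffs A t d \<aa>"
  then obtain p where h: "x \<in> A" "p \<in> poly_below A t d" "p \<oplus> x \<otimes> t [^] d \<in> \<aa>"
    unfolding leading_coeffs_def by auto
  define s where "s = t [^] d"
  have c: "p \<in> carrier R" "x \<in> carrier R" "s \<in> carrier R" "t [^] Suc d = s \<otimes> t"
    using h poly_below_carrier A_carrier t unfolding s_def by auto
  have "t \<otimes> (p \<oplus> x \<otimes> s) = t \<otimes> p \<oplus> x \<otimes> (s \<otimes> t)" using c(1-3) t by algebra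
  moreover have "t \<otimes> (p \<oplus> x \<otimes> t [^] d) \<in> \<aa>"
    using ideal gen_mem_poly_below h(3) unfolding subcring_ideal_iff[OF subcring_poly_below] by blast
  ultimately have "t \<otimes> p \<oplus> x \<otimes> t [^] Suc d \<in> \<aa>" unfolding c(4) s_def by simp
  then show "x \<in> leading_coeffs A t (Suc d) \<aa>"
    unfolding leading_coeffs_def using h(1) poly_below_shift[OF h(2)] by blast
qed

lemma leading_coeffs_mono: "d \<le> e \<Longrightarrow> leading_coeffs A t d \<aa> \<subseteq> leading_coeffs A t e \<aa>"
  by (induction e rule: dec_induct) (use leading_coeffs_Suc in blast)+

end

text \<open>Induction on the degree bound: from an element of the larger ideal one subtracts an
  element of the smaller ideal with the same coefficient at \<open>t ^ d\<close>. The difference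
  stays in the larger ideal and has a smaller bound.\<close>

lemma eq_if_leading_coeffs_eq:
  assumes "ideal \<aa> (R\<lparr>carrier := \<Union>d. poly_below A t d\<rparr>)" "ideal \<bb> (R\<lparr>carrier := \<Union>d. poly_below A t d\<rparr>)"
    and "\<aa> \<subseteq> \<bb>" "\<And>d. leading_coeffs A t d \<bb> \<subseteq> leading_coeffs A t d \<aa>"
  shows "\<aa> = \<bb>"
proof -
  interpret B: cring "R\<lparr>carrier := \<Union>d. poly_below A t d\<rparr>"
    using subcring_iff[OF subcringE(1)[OF subcring_poly_below]] subcring_poly_below by simp
  interpret a: ideal \<aa> "R\<lparr>carrier := \<Union>d. poly_below A t d\<rparr>" by fact
  interpret b: ideal \<bb> "R\<lparr>carrier := \<Union>d. poly_below A t d\<rparr>" by fact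
  have a0: "\<zero> \<in> \<aa>" and aadd: "\<And>x y. x \<in> \<aa> \<Longrightarrow> y \<in> \<aa> \<Longrightarrow> x \<oplus> y \<in> \<aa>"
    and badd: "\<And>x y. x \<in> \<bb> \<Longrightarrow> y \<in> \<bb> \<Longrightarrow> x \<oplus> y \<in> \<bb>"
    using assms(1,2) unfolding subcring_ideal_iff[OF subcring_poly_below] by auto
  have bneg: "\<ominus> x \<in> \<bb>" if x: "x \<in> \<bb>" for x
  proof -
    have xc: "x \<in> carrier R"
      using x assms(2) subcringE(1)[OF subcring_poly_below]
      unfolding subcring_ideal_iff[OF subcring_poly_below] by blast
    have "\<ominus> \<one> \<in> (\<Union>d. poly_below A t d)"
      using subcringE(5)[OF subcring_poly_below] subcringE(3)[OF subcring_poly_below] by blast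
    then have "(\<ominus> \<one>) \<otimes> x \<in> \<bb>"
      using x assms(2) unfolding subcring_ideal_iff[OF subcring_poly_below] by blast
    then show ?thesis using xc l_minus[of \<one> x] by simp
  qed
  have "x \<in> \<aa>" if "x \<in> \<bb>" "x \<in> poly_below A t d" for x d
    using that
  proof (induction d arbitrary: x)
    case 0
    then show ?case using a0 by simp
  next
    case (Suc d)
    from Suc.prems obtain p a where h: "x = p \<oplus> a \<otimes> t [^] d" "p \<in> poly_below A t d" "a \<in> A" by auto
    then have "a \<in> leading_coeffs A t d \<bb>" using Suc.prems unfolding leading_coeffs_def by blast
    then obtain q where q: "q \<in> poly_below A t d" "q \<oplus> a \<otimes> t [^] d \<in> \<aa>"
      using assms(4) unfolding leading_coeffs_def by blast
    define s where "s = t [^] d"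
    have c: "p \<in> carrier R" "q \<in> carrier R" "a \<in> carrier R" "s \<in> carrier R"
      using h q poly_below_carrier A_carrier t unfolding s_def by auto
    have "(p \<oplus> a \<otimes> s) \<oplus> \<ominus> (q \<oplus> a \<otimes> s) = p \<oplus> \<ominus> q" using c by algebra
    moreover have "x \<oplus> \<ominus> (q \<oplus> a \<otimes> s) \<in> \<bb>"
      by (rule badd[OF Suc.prems(1) bneg]) (use q(2) assms(3) s_def in blast)
    ultimately have "p \<oplus> \<ominus> q \<in> \<bb>" unfolding h(1) s_def by simp
    moreover have "p \<oplus> \<ominus> q \<in> poly_below A t d"
      using poly_below_add poly_below_uminus h(2) q(1) by blast
    ultimately have 1: "p \<oplus> \<ominus> q \<in> \<aa>" by (rule Suc.IH)
    have "(p \<oplus> \<ominus> q) \<oplus> (q \<oplus> a \<otimes> s) = p \<oplus> a \<otimes> s" using c by algebra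
    then show ?case using aadd[OF 1 q(2)] unfolding h(1) s_def by simp
  qed
  moreover have "\<exists>d. x \<in> poly_below A t d" if "x \<in> \<bb>" for x
    using that assms(2) unfolding subcring_ideal_iff[OF subcring_poly_below] by blast
  ultimately show ?thesis using assms(3) by blast
qed

text \<open>Leading coefficient ideals increase both in the degree and in the index of the chain.
  Stabilisation of the diagonal controls all large degrees at once and leaves finitely many degrees
  to be treated one by one.\<close>

lemma ideal_acc_adjoin:
  assumes acc: "ideal_acc (R\<lparr>carrier := A\<rparr>)"
  shows "ideal_acc (R\<lparr>carrier := \<Union>d. poly_below A t d\<rparr>)"
  unfolding ideal_acc_def
proof (intro allI impI)
  fix f assume "\<forall>i :: nat. ideal (f i) (R\<lparr>carrier := \<Union>d. poly_below A t d\<rparr>)" and fS: "\<forall>i. f i \<subseteq> f (Suc i)"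
  then have f: "\<And>i. ideal (f i) (R\<lparr>carrier := \<Union>d. poly_below A t d\<rparr>)" by blast
  have fmono: "f i \<subseteq> f j" if "i \<le> j" for i j
    using that by (induction j rule: dec_induct) (use fS in blast)+
  let ?L = "\<lambda>d i. leading_coeffs A t d (f i)"
  have mono: "?L d i \<subseteq> ?L e j" if "d \<le> e" "i \<le> j" for d e i j
  proof -
    have "?L d i \<subseteq> ?L d j" unfolding leading_coeffs_def using fmono[OF that(2)] by blast
    also have "\<dots> \<subseteq> ?L e j" by (rule leading_coeffs_mono[OF f that(1)])
    finally show ?thesis .
  qed
  obtain K where K: "\<And>i. i \<ge> K \<Longrightarrow> ?L i i = ?L K K"
    using ideal_accD[OF acc, of "\<lambda>i. ?L i i"] leading_coeffs_ideal[OF f] mono by auto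
  have "\<exists>m. \<forall>i\<ge>m. ?L d i = ?L d m" for d
    using ideal_accD[OF acc, of "\<lambda>i. ?L d i"] leading_coeffs_ideal[OF f] mono[of d d] by (metis le_SucI order_refl)
  then obtain m where m: "\<And>d i. i \<ge> m d \<Longrightarrow> ?L d i = ?L d (m d)" by metis
  define N where "N = Max (insert K (m ` {..K}))"
  have NK: "K \<le> N" unfolding N_def by (rule Max_ge) auto
  have Nm: "m d \<le> N" if "d \<le> K" for d unfolding N_def by (rule Max_ge) (use that in auto)
  have "?L d i \<subseteq> ?L d N" if "i \<ge> N" for d i
  proof (cases "d \<le> K")
    case True
    then show ?thesis using m[of d i] m[of d N] Nm[OF True] that by auto
  next
    case False
    \<comment> \<open>A degree above \<open>K\<close> is squeezed: the entry lies below a diagonal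
      entry, which equals the one at \<open>K\<close>, and that one lies below the entry at degree
      \<open>d\<close> and index \<open>N\<close>.\<close>
    have "?L d i \<subseteq> ?L (max d i) (max d i)" by (rule mono) auto
    also have "\<dots> = ?L K K" using False by (intro K) auto
    also have "\<dots> \<subseteq> ?L d N" using False NK by (intro mono) auto
    finally show ?thesis .
  qed
  then show "\<exists>k. \<forall>i\<ge>k. f i = f k"
    using eq_if_leading_coeffs_eq[OF f f fmono] by metis
qed

end

lemma subcring_acc_adjoin_finite:
  assumes "finite T" "T \<subseteq> carrier R" "subcring A R" "ideal_acc (R\<lparr>carrier := A\<rparr>)"
  shows "\<exists>B. subcring B R \<and> A \<subseteq> B \<and> T \<subseteq> B \<and> ideal_acc (R\<lparr>carrier := B\<rparr>)"
  using assms
proof (induction T rule: finite_induct)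
  case empty
  then show ?case by blast
next
  case (insert t T)
  then obtain B where B: "subcring B R" "A \<subseteq> B" "T \<subseteq> B" "ideal_acc (R\<lparr>carrier := B\<rparr>)" by auto
  have t: "t \<in> carrier R" using insert.prems by auto
  let ?C = "\<Union>d. poly_below B t d"
  have "B \<subseteq> ?C" using coeff_mem_poly_below[OF B(1) t] by blast
  then show ?case
    using B subcring_poly_below[OF B(1) t] gen_mem_poly_below[OF B(1) t] ideal_acc_adjoin[OF B(1) t B(4)]
    by (intro exI[of _ ?C]) auto
qed

end

section \<open>Powers of ideals, and existence and generation of minimal reductions after Northcott
  and Rees\<close>

section \<open>Minimal reductions\<close>

context cring
begin

lemma genideal_Un_ideal_mono:
  assumes "X \<subseteq> Idl Y" "Y \<subseteq> carrier R"
  shows "Idl X \<subseteq> Idl Y"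
  using genideal_minimal[OF genideal_ideal[OF assms(2)] assms(1)] .

lemma ideal_prod_subset_iff:
  assumes "ideal N R"
  shows "J \<cdot> K \<subseteq> N \<longleftrightarrow> (\<forall>x\<in>J. \<forall>y\<in>K. x \<otimes> y \<in> N)"
proof
  assume "J \<cdot> K \<subseteq> N"
  then show "\<forall>x\<in>J. \<forall>y\<in>K. x \<otimes> y \<in> N" using ideal_prod.prod[of _ J _ K R] by blast
next
  assume h: "\<forall>x\<in>J. \<forall>y\<in>K. x \<otimes> y \<in> N"
  show "J \<cdot> K \<subseteq> N"
  proof
    fix x assume "x \<in> J \<cdot> K"
    then show "x \<in> N" using h by induction (use ideal.add_in[OF assms] in blast)+
  qed
qed

lemma ideal_prod_mono: "J \<subseteq> J' \<Longrightarrow> K \<subseteq> K' \<Longrightarrow> J \<cdot> K \<subseteq> J' \<cdot> K'"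
proof
  fix x assume h: "J \<subseteq> J'" "K \<subseteq> K'" "x \<in> J \<cdot> K"
  from h(3) show "x \<in> J' \<cdot> K'"
    by induction (use h(1,2) ideal_prod.prod[of _ J' _ K' R] ideal_prod.sum[of _ R J' K'] in blast)+
qed

lemma colon_ideal_Idl:
  assumes "ideal N R" "e \<in> carrier R" "Y \<subseteq> carrier R" "\<And>y. y \<in> Y \<Longrightarrow> e \<otimes> y \<in> N" "x \<in> Idl Y"
  shows "e \<otimes> x \<in> N"
  using genideal_minimal[OF colon_ideal[OF assms(1,2)], of Y] assms(3-5) by blast

lemma multiples_subset_genideal:
  assumes "ideal \<qq> R" "Y \<subseteq> carrier R" "X \<subseteq> carrier R"
  shows "\<qq> \<cdot> (Idl Y) \<subseteq> Idl (X \<union> {\<nu> \<otimes> x | \<nu> x. \<nu> \<in> \<qq> \<and> x \<in> Y})"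
proof -
  let ?Z = "X \<union> {\<nu> \<otimes> x | \<nu> x. \<nu> \<in> \<qq> \<and> x \<in> Y}"
  have "\<nu> \<otimes> x \<in> carrier R" if "\<nu> \<in> \<qq>" "x \<in> Y" for \<nu> x
    using ideal.Icarr[OF assms(1) that(1)] subsetD[OF assms(2) that(2)] by simp
  then have Z: "?Z \<subseteq> carrier R" using subsetD[OF assms(3)] by auto
  show ?thesis
    unfolding ideal_prod_subset_iff[OF genideal_ideal[OF Z]]
  proof (intro ballI)
    fix \<nu> x assume \<nu>: "\<nu> \<in> \<qq>" and x: "x \<in> Idl Y"
    show "\<nu> \<otimes> x \<in> Idl ?Z"
    proof (rule colon_ideal_Idl[OF genideal_ideal[OF Z] ideal.Icarr[OF assms(1) \<nu>] assms(2) _ x])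
      fix y assume "y \<in> Y"
      then show "\<nu> \<otimes> y \<in> Idl ?Z" using \<nu> genideal_self[OF Z] by blast
    qed
  qed
qed

text \<open>\<open>nakayama_prime\<close> with multiplier \<open>\<one>\<close>: over a local ring
  the resulting \<open>h\<close> is a unit and can be cancelled.\<close>

lemma nakayama_local:
  assumes "finite Y" "Y \<subseteq> carrier R" "ideal N R" "primeideal \<mm> R" "carrier R - \<mm> \<subseteq> Units R"
    and "Y \<subseteq> Idl (N \<union> \<mm> \<cdot> (Idl Y))"
  shows "Idl Y \<subseteq> N"
proof -
  interpret m: primeideal \<mm> R by fact
  interpret N: ideal N R by fact
  have Nc: "N \<subseteq> carrier R" using N.Icarr by blast
  let ?Z = "N \<union> {\<nu> \<otimes> x | \<nu> x. \<nu> \<in> \<mm> \<and> x \<in> Y}"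
  have Z: "?Z \<subseteq> carrier R" using assms(2) m.Icarr N.Icarr by auto
  have "N \<union> \<mm> \<cdot> (Idl Y) \<subseteq> Idl ?Z"
    using multiples_subset_genideal[OF m.is_ideal assms(2) Nc] genideal_self[OF Z] by blast
  then have "Y \<subseteq> Idl ?Z" using assms(6) genideal_Un_ideal_mono[OF _ Z] by blast
  then have "\<one> \<otimes> y \<in> Idl ?Z" if "y \<in> Y" for y
    using subsetD[OF assms(2) that] that by (simp only: l_one subset_iff)
  then have "\<exists>h\<in>carrier R - \<mm>. \<forall>y\<in>Y. h \<otimes> y \<in> N"
    by (rule nakayama_prime[OF assms(1-4) m.one_notin])
  then obtain h where h: "h \<in> Units R" "\<And>y. y \<in> Y \<Longrightarrow> h \<otimes> y \<in> N" using assms(5) by blast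
  have "y \<in> N" if "y \<in> Y" for y
  proof -
    have "inv h \<otimes> (h \<otimes> y) = (inv h \<otimes> h) \<otimes> y"
      using h(1) subsetD[OF assms(2) that] by (intro m_assoc[symmetric]) auto
    then have "inv h \<otimes> (h \<otimes> y) = y" using h(1) subsetD[OF assms(2) that] by simp
    then show ?thesis using N.I_l_closed[OF h(2)[OF that] Units_inv_closed[OF h(1)]] by simp
  qed
  then show ?thesis using genideal_minimal[OF N.is_ideal] by blast
qed

lemma ideal_pow_0: "ideal_pow R I 0 = carrier R"
  by (simp add: nat_pow_def ideals_set_def)

lemma ideal_pow_Suc: "ideal_pow R I (Suc n) = ideal_pow R I n \<cdot> I"
  by (simp add: nat_pow_def ideals_set_def)

lemma ideal_pow_ideal: "ideal I R \<Longrightarrow> ideal (ideal_pow R I n) R"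
  by (induction n) (simp_all only: ideal_pow_0 ideal_pow_Suc oneideal ideal_prod_is_ideal)

lemma ideal_pow_carrier: "ideal I R \<Longrightarrow> x \<in> ideal_pow R I n \<Longrightarrow> x \<in> carrier R"
  using ideal.Icarr[OF ideal_pow_ideal] .

lemma ideal_pow_one: "ideal I R \<Longrightarrow> ideal_pow R I (Suc 0) = I"
  using ideal_prod_one[of I] ideal_prod_commute[OF oneideal, of I] by (simp only: ideal_pow_Suc ideal_pow_0)

lemma ideal_pow_add:
  assumes "ideal I R"
  shows "ideal_pow R I (m + n) = ideal_pow R I m \<cdot> ideal_pow R I n"
proof (induction n)
  case 0
  then show ?case using ideal_prod_one[OF ideal_pow_ideal[OF assms]] by (simp only: ideal_pow_0 add_0_right)
next
  case (Suc n)
  then show ?case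
    using ideal_prod_assoc[OF ideal_pow_ideal[OF assms] ideal_pow_ideal[OF assms] assms]
    by (simp only: ideal_pow_Suc add_Suc_right)
qed

text \<open>Lets the exponent of a single reduction be raised beyond the index from which the
  transporters are stable.\<close>

lemma reduction_pow_mono:
  assumes "ideal I R" "ideal J R" "ideal_pow R I (Suc s) = J \<cdot> ideal_pow R I s" "s \<le> r"
  shows "ideal_pow R I (Suc r) = J \<cdot> ideal_pow R I r"
  using assms(4)
proof (induction r rule: dec_induct)
  case (step r)
  have "ideal_pow R I (Suc (Suc r)) = (J \<cdot> ideal_pow R I r) \<cdot> I"
    by (simp only: ideal_pow_Suc[of I "Suc r"] step.IH)
  also have "\<dots> = J \<cdot> ideal_pow R I (Suc r)"
    using ideal_prod_assoc[OF assms(2) ideal_pow_ideal[OF assms(1)] assms(1)]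
    by (simp only: ideal_pow_Suc)
  finally show ?case .
qed (rule assms(3))

lemma reduction_iff:
  "reduction R I J \<longleftrightarrow> ideal J R \<and> J \<subseteq> I \<and> (\<exists>r. ideal_pow R I (Suc r) = J \<cdot> ideal_pow R I r)"
  unfolding reduction_def by (simp only: Suc_eq_plus1)

lemma reduction_self: "ideal I R \<Longrightarrow> reduction R I I"
  unfolding reduction_iff
  using ideal_prod_one[of I] ideal_pow_one[of I] by (metis ideal_pow_0 subset_refl)

end

locale noetherian_local_ring = cring R + noetherian_ring R + local_ring R for R (structure)
begin

lemma maximalideal_max_ideal: "maximalideal (max_ideal R) R"
  unfolding max_ideal_def using unique_maximal by (rule theI')

lemma max_ideal_unique: "maximalideal M R \<Longrightarrow> M = max_ideal R"
  using maximalideal_max_ideal unique_maximal by blast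

sublocale max: primeideal "max_ideal R" R
  by (rule maximalideal_prime[OF maximalideal_max_ideal])

lemma notin_max_ideal_Units: "carrier R - max_ideal R \<subseteq> Units R"
proof
  fix x assume x: "x \<in> carrier R - max_ideal R"
  show "x \<in> Units R"
  proof (rule ccontr)
    assume nu: "x \<notin> Units R"
    have "\<one> \<notin> PIdl x"
    proof
      assume "\<one> \<in> PIdl x"
      then obtain y where "y \<in> carrier R" "\<one> = y \<otimes> x" unfolding cgenideal_def by blast
      then show False using nu x m_comm unfolding Units_def by auto
    qed
    then obtain M where "maximalideal M R" "PIdl x \<subseteq> M"
      using exists_maximal_containing[OF cgenideal_ideal] x by blast
    then show False using max_ideal_unique cgenideal_self[of x] x by blast
  qed
qed

text \<open>Whether \<open>L\<close> is a reduction depends only on its image in \<open>I\<close>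
  modulo \<open>\<mm> I\<close>: from \<open>I^(s+1) = K I^s\<close> follows that
  \<open>I^(s+1)\<close> is contained in \<open>L I^s + \<mm> I^(s+1)\<close>, and Nakayama's lemma
  removes the last term. This turns questions about reductions into linear algebra over the residue
  field.\<close>

lemma reduction_nakayama:
  assumes I: "ideal I R" and K: "reduction R I K" and L: "ideal L R" "L \<subseteq> K"
    and KL: "K \<subseteq> Idl (L \<union> max_ideal R \<cdot> I)"
  shows "reduction R I L"
proof -
  let ?m = "max_ideal R"
  obtain s where s: "ideal_pow R I (Suc s) = K \<cdot> ideal_pow R I s" and KI: "ideal K R" "K \<subseteq> I"
    using K unfolding reduction_iff by blast
  let ?P = "ideal_pow R I s" and ?Q = "ideal_pow R I (Suc s)"
  have P: "ideal ?P R" and Q: "ideal ?Q R" using ideal_pow_ideal[OF I] by blast+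
  obtain Y where Y: "Y \<subseteq> carrier R" "finite Y" "?Q = Idl Y" using finetely_gen[OF Q] by blast
  have N: "ideal (L \<cdot> ?P) R" using ideal_prod_is_ideal[OF L(1) P] .
  have mI: "ideal (?m \<cdot> I) R" and mQ: "ideal (?m \<cdot> ?Q) R"
    using ideal_prod_is_ideal[OF max.is_ideal] I Q by blast+
  let ?Z = "L \<cdot> ?P \<union> ?m \<cdot> ?Q" and ?X = "L \<union> ?m \<cdot> I"
  have Z: "?Z \<subseteq> carrier R" using ideal.Icarr[OF N] ideal.Icarr[OF mQ] by blast
  have X: "?X \<subseteq> carrier R" using ideal.Icarr[OF L(1)] ideal.Icarr[OF mI] by blast
  have "x \<otimes> y \<in> Idl ?Z" if x: "x \<in> K" and y: "y \<in> ?P" for x y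
  proof -
    have yc: "y \<in> carrier R" using ideal.Icarr[OF P y] .
    have "y \<otimes> x \<in> Idl ?Z"
    proof (rule colon_ideal_Idl[OF genideal_ideal[OF Z] yc X])
      show "x \<in> Idl ?X" using x KL by blast
      fix z assume z: "z \<in> ?X"
      then have zc: "z \<in> carrier R" using X by blast
      from z have "z \<otimes> y \<in> ?Z"
      proof
        assume "z \<in> L" then show ?thesis using ideal_prod.prod[of z L y ?P R] y by blast
      next
        assume "z \<in> ?m \<cdot> I"
        then have "z \<otimes> y \<in> (?m \<cdot> I) \<cdot> ?P" using y by (rule ideal_prod.prod)
        also have "(?m \<cdot> I) \<cdot> ?P = ?m \<cdot> ?Q"
          using ideal_prod_assoc[OF max.is_ideal I P] ideal_prod_commute[OF I P] by (simp only: ideal_pow_Suc)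
        finally show ?thesis by blast
      qed
      then show "y \<otimes> z \<in> Idl ?Z" using genideal_self[OF Z] m_comm[OF yc zc] by auto
    qed
    then show ?thesis using m_comm[OF yc ideal.Icarr[OF KI(1) x]] by simp
  qed
  then have "?Q \<subseteq> Idl ?Z" unfolding s using ideal_prod_subset_iff[OF genideal_ideal[OF Z]] s by simp
  then have "Y \<subseteq> Idl (L \<cdot> ?P \<union> ?m \<cdot> (Idl Y))" using genideal_self[OF Y(1)] Y(3) by auto
  from nakayama_local[OF Y(2,1) N max.primeideal_axioms notin_max_ideal_Units this]
  have "?Q \<subseteq> L \<cdot> ?P" using Y(3) by simp
  moreover have "L \<cdot> ?P \<subseteq> ?Q" unfolding s using ideal_prod_mono[OF L(2), of ?P ?P] by simp
  ultimately have "?Q = L \<cdot> ?P" by blast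
  then show ?thesis unfolding reduction_iff using L KI by blast
qed

text \<open>Gaussian elimination over the residue field, with \<open>W\<close> in the role of the zero space.\<close>

lemma ideal_echelon:
  assumes "finite Y" "Y \<subseteq> carrier R" "ideal W R" "\<And>\<mu> y. \<mu> \<in> max_ideal R \<Longrightarrow> y \<in> Y \<Longrightarrow> \<mu> \<otimes> y \<in> W"
    and "ideal K R" "K \<subseteq> Idl (Y \<union> W)"
  shows "\<exists>Z. finite Z \<and> Z \<subseteq> K \<and> card Z \<le> card Y \<and> K \<subseteq> Idl (Z \<union> W) \<and>
    (card Z = card Y \<longrightarrow> Y \<subseteq> Idl (K \<union> W))"
  using assms
proof (induction Y arbitrary: K rule: finite_induct)
  case empty
  then show ?case by (intro exI[of _ "{}"]) auto
next
  case (insert y Y)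
  interpret W: ideal W R by fact
  interpret K: ideal K R by fact
  have Wc: "W \<subseteq> carrier R" and Kc: "K \<subseteq> carrier R" using W.Icarr K.Icarr by blast+
  have y: "y \<in> carrier R" and Y: "Y \<subseteq> carrier R" using insert.prems by auto
  have YW: "Y \<union> W \<subseteq> carrier R" using Y Wc by blast
  interpret YW: ideal "Idl (Y \<union> W)" R by (rule genideal_ideal[OF YW])
  have dec: "\<exists>c\<in>carrier R. \<exists>w\<in>Idl (Y \<union> W). x = c \<otimes> y \<oplus> w" if "x \<in> K" for x
  proof (rule genideal_insert_multiples[OF oneideal YW y])
    let ?T = "(Y \<union> W) \<union> {\<nu> \<otimes> y | \<nu>. \<nu> \<in> carrier R}"
    have T: "?T \<subseteq> carrier R" using YW y by auto
    have "\<one> \<otimes> y \<in> ?T" by blast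
    then have "insert y Y \<union> W \<subseteq> ?T" using y by auto
    then have "Idl (insert y Y \<union> W) \<subseteq> Idl ?T"
      using genideal_self[OF T] by (intro genideal_Un_ideal_mono[OF _ T]) blast
    then show "x \<in> Idl ?T" using that insert.prems(5) by blast
  qed
  show ?case
  proof (cases "K \<subseteq> Idl (Y \<union> W)")
    case True
    \<comment> \<open>Here \<open>y\<close> is not a pivot. The bound \<open>card Y\<close> is
      strict for \<open>insert y Y\<close>, so the clause about equal cardinalities is
      vacuous.\<close>
    have "\<exists>Z. finite Z \<and> Z \<subseteq> K \<and> card Z \<le> card Y \<and> K \<subseteq> Idl (Z \<union> W) \<and>
      (card Z = card Y \<longrightarrow> Y \<subseteq> Idl (K \<union> W))"
      by (rule insert.IH) (use insert.prems True in auto)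
    then show ?thesis using insert.hyps by (metis card_insert_disjoint le_SucI not_less_eq_eq order_refl)
  next
    case False
    then obtain x0 where x0: "x0 \<in> K" "x0 \<notin> Idl (Y \<union> W)" by blast
    then obtain c w where cw: "c \<in> carrier R" "w \<in> Idl (Y \<union> W)" "x0 = c \<otimes> y \<oplus> w" using dec by blast
    have W_YW: "W \<subseteq> Idl (Y \<union> W)" using genideal_self[OF YW] by blast
    have "c \<notin> max_ideal R"
    proof
      assume "c \<in> max_ideal R"
      then have "c \<otimes> y \<in> Idl (Y \<union> W)" using insert.prems(3) W_YW by blast
      then show False using x0(2) YW.add_in cw by blast
    qed
    then have cU: "c \<in> Units R" using cw(1) notin_max_ideal_Units by blast
    define d where "d = inv c"
    have d: "d \<in> carrier R" "d \<otimes> c = \<one>" unfolding d_def using cU by auto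
    have wc: "w \<in> carrier R" and x0c: "x0 \<in> carrier R" using YW.Icarr cw x0 K.Icarr by auto
    \<comment> \<open>\<open>x0\<close> has a unit coefficient at \<open>y\<close>, so subtracting
      multiples of \<open>x0\<close> moves every element of \<open>K\<close> into \<open>?K\<close>,
      where the induction hypothesis applies.\<close>
    let ?K = "K \<inter> Idl (Y \<union> W)"
    have K1: "ideal ?K R" by (rule i_intersect[OF K.is_ideal YW.is_ideal])
    have "\<exists>Z. finite Z \<and> Z \<subseteq> ?K \<and> card Z \<le> card Y \<and> ?K \<subseteq> Idl (Z \<union> W) \<and>
      (card Z = card Y \<longrightarrow> Y \<subseteq> Idl (?K \<union> W))"
      by (rule insert.IH) (use insert.prems K1 in auto)
    then obtain Z where Z: "finite Z" "Z \<subseteq> ?K" "card Z \<le> card Y" "?K \<subseteq> Idl (Z \<union> W)"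
      "card Z = card Y \<Longrightarrow> Y \<subseteq> Idl (?K \<union> W)" by blast
    let ?Z = "insert x0 Z"
    have x0Z: "x0 \<notin> Z" using Z(2) x0(2) by blast
    have ZW: "?Z \<union> W \<subseteq> carrier R" and KW: "K \<union> W \<subseteq> carrier R"
      using Z(2) x0c Kc Wc by blast+
    interpret ZW: ideal "Idl (?Z \<union> W)" R by (rule genideal_ideal[OF ZW])
    interpret KW: ideal "Idl (K \<union> W)" R by (rule genideal_ideal[OF KW])
    have x0_ZW: "x0 \<in> Idl (?Z \<union> W)" using genideal_self[OF ZW] by blast
    have "K \<subseteq> Idl (?Z \<union> W)"
    proof
      fix x assume x: "x \<in> K"
      then obtain c' w' where h: "c' \<in> carrier R" "w' \<in> Idl (Y \<union> W)" "x = c' \<otimes> y \<oplus> w'" using dec by blast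
      have w'c: "w' \<in> carrier R" using YW.Icarr h by blast
      let ?u = "x \<ominus> (c' \<otimes> d) \<otimes> x0"
      have "?u = c' \<otimes> y \<oplus> w' \<ominus> c' \<otimes> (d \<otimes> c) \<otimes> y \<ominus> (c' \<otimes> d) \<otimes> w"
        unfolding h(3) cw(3) using h(1) w'c wc d(1) cw(1) y by algebra
      also have "\<dots> = w' \<ominus> (c' \<otimes> d) \<otimes> w"
        unfolding d(2) using h(1) w'c wc d(1) y by algebra
      also have "\<dots> \<in> Idl (Y \<union> W)"
        by (rule YW.minus_in[OF h(2) YW.I_l_closed[OF cw(2)]]) (use h d in auto)
      finally have "?u \<in> ?K"
        using K.minus_in[OF x K.I_l_closed[OF x0(1)]] h(1) d(1) by auto
      moreover have "Idl (Z \<union> W) \<subseteq> Idl (?Z \<union> W)"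
        using genideal_self[OF ZW] by (intro genideal_Un_ideal_mono[OF _ ZW]) blast
      ultimately have "?u \<in> Idl (?Z \<union> W)" using Z(4) by blast
      moreover have "(c' \<otimes> d) \<otimes> x0 \<in> Idl (?Z \<union> W)" using ZW.I_l_closed[OF x0_ZW] h(1) d(1) by auto
      ultimately have "?u \<oplus> (c' \<otimes> d) \<otimes> x0 \<in> Idl (?Z \<union> W)" by (rule ZW.add_in)
      moreover have "?u \<oplus> (c' \<otimes> d) \<otimes> x0 = x"
        using K.Icarr[OF x] x0c h(1) d(1) by algebra
      ultimately show "x \<in> Idl (?Z \<union> W)" by simp
    qed
    moreover have "insert y Y \<subseteq> Idl (K \<union> W)" if "card ?Z = card (insert y Y)"
    proof -
      have "card Z = card Y" using that insert.hyps Z(1) x0Z by simp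
      from Z(5)[OF this] have YK: "Y \<subseteq> Idl (K \<union> W)"
        using genideal_Un_ideal_mono[OF _ KW, of "?K \<union> W"] genideal_self[OF KW] by blast
      then have "Y \<union> W \<subseteq> Idl (K \<union> W)" using genideal_self[OF KW] by blast
      then have "w \<in> Idl (K \<union> W)" using genideal_Un_ideal_mono[OF _ KW] cw(2) by blast
      moreover have "x0 \<in> Idl (K \<union> W)" using genideal_self[OF KW] x0(1) by blast
      ultimately have "d \<otimes> (x0 \<ominus> w) \<in> Idl (K \<union> W)" using d(1) by (intro KW.I_l_closed KW.minus_in)
      also have "d \<otimes> (x0 \<ominus> w) = (d \<otimes> c) \<otimes> y" unfolding cw(3) using d(1) cw(1) y wc by algebra
      also have "\<dots> = y" using d(2) y by simp
      finally show ?thesis using YK by blast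
    qed
    moreover have "card ?Z \<le> card (insert y Y)" using insert.hyps Z(1,3) x0Z by simp
    ultimately show ?thesis using Z(1,2) x0(1) by (intro exI[of _ ?Z]) auto
  qed
qed

text \<open>Among the reductions inside \<open>J\<close>, one with the fewest generators is minimal.
  A reduction \<open>K\<close> inside it is spanned, modulo \<open>\<mm>\<close> times it, by at
  most as many elements of \<open>K\<close>; these already generate a reduction, so by minimality of
  the number none is missing, and Nakayama's lemma makes \<open>K\<close> everything.\<close>

lemma exists_min_reduction:
  assumes I: "ideal I R" and J: "reduction R I J"
  shows "\<exists>K\<in>min_reductions R I. K \<subseteq> J"
proof -
  have JI: "ideal J R" "J \<subseteq> I" using J unfolding reduction_iff by blast+
  define P where "P n \<longleftrightarrow> (\<exists>Z. finite Z \<and> Z \<subseteq> J \<and> card Z = n \<and> reduction R I (Idl Z))" for n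
  obtain X where X: "X \<subseteq> carrier R" "finite X" "J = Idl X" using finetely_gen[OF JI(1)] by blast
  have "P (card X)" unfolding P_def using X J genideal_self[OF X(1)] by blast
  then obtain n where n: "P n" "\<And>k. k < n \<Longrightarrow> \<not> P k" using exists_least_iff[of P] by blast
  then obtain Z where Z: "finite Z" "Z \<subseteq> J" "card Z = n" "reduction R I (Idl Z)" unfolding P_def by blast
  let ?m = "max_ideal R"
  have Zc: "Z \<subseteq> carrier R" using Z(2) ideal.Icarr[OF JI(1)] by blast
  have ZI: "ideal (Idl Z) R" "Idl Z \<subseteq> I" using Z(4) unfolding reduction_iff by blast+
  have W: "ideal (?m \<cdot> (Idl Z)) R" using ideal_prod_is_ideal[OF max.is_ideal ZI(1)] .
  have "K = Idl Z" if K: "reduction R I K" "K \<subseteq> Idl Z" for K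
  proof -
    have Ki: "ideal K R" using K unfolding reduction_iff by blast
    have ZW: "Z \<union> ?m \<cdot> (Idl Z) \<subseteq> carrier R" using Zc ideal.Icarr[OF W] by blast
    have KW: "K \<union> ?m \<cdot> (Idl Z) \<subseteq> carrier R" using ideal.Icarr[OF Ki] ideal.Icarr[OF W] by blast
    have "Idl Z \<subseteq> Idl (Z \<union> ?m \<cdot> (Idl Z))"
      using genideal_self[OF ZW] by (intro genideal_Un_ideal_mono[OF _ ZW]) blast
    then have KZ: "K \<subseteq> Idl (Z \<union> ?m \<cdot> (Idl Z))" using K(2) by blast
    have mult: "\<mu> \<otimes> y \<in> ?m \<cdot> (Idl Z)" if "\<mu> \<in> ?m" "y \<in> Z" for \<mu> y
      using that(1) subsetD[OF genideal_self[OF Zc] that(2)] by (rule ideal_prod.prod)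
    from ideal_echelon[OF Z(1) Zc W mult Ki KZ]
    obtain Z' where Z': "finite Z'" "Z' \<subseteq> K" "card Z' \<le> card Z" "K \<subseteq> Idl (Z' \<union> ?m \<cdot> (Idl Z))"
      "card Z' = card Z \<Longrightarrow> Z \<subseteq> Idl (K \<union> ?m \<cdot> (Idl Z))"
      by blast
    have Z'c: "Z' \<subseteq> carrier R" using Z'(2) ideal.Icarr[OF Ki] by blast
    have mI: "ideal (?m \<cdot> I) R" using ideal_prod_is_ideal[OF max.is_ideal I] .
    have U: "Idl Z' \<union> ?m \<cdot> I \<subseteq> carrier R"
      using ideal.Icarr[OF genideal_ideal[OF Z'c]] ideal.Icarr[OF mI] by blast
    \<comment> \<open>The echelon form is taken modulo \<open>\<mm>\<close> times
      \<open>Idl Z\<close>, whereas \<open>reduction_nakayama\<close> works modulo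
      \<open>\<mm> I\<close>; the first ideal is contained in the second.\<close>
    have "Z' \<union> ?m \<cdot> (Idl Z) \<subseteq> Idl (Idl Z' \<union> ?m \<cdot> I)"
      using genideal_self[OF U] genideal_self[OF Z'c] ideal_prod_mono[OF subset_refl ZI(2), of ?m] by blast
    then have "K \<subseteq> Idl (Idl Z' \<union> ?m \<cdot> I)" using Z'(4) genideal_Un_ideal_mono[OF _ U] by blast
    then have "reduction R I (Idl Z')"
      by (rule reduction_nakayama[OF I K(1) genideal_ideal[OF Z'c] genideal_minimal[OF Ki Z'(2)]])
    moreover have "K \<subseteq> J" using K(2) genideal_minimal[OF JI(1) Z(2)] by blast
    ultimately have "P (card Z')" unfolding P_def using Z'(1,2) by blast
    then have "card Z' = card Z" using n(2) Z(3) Z'(3) by (metis le_neq_implies_less)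
    then have "Idl Z \<subseteq> K"
      by (intro nakayama_local[OF Z(1) Zc Ki max.primeideal_axioms notin_max_ideal_Units] Z'(5))
    then show ?thesis using K(2) by blast
  qed
  then have "Idl Z \<in> min_reductions R I" unfolding min_reductions_def using Z(4) by blast
  moreover have "Idl Z \<subseteq> J" using genideal_minimal[OF JI(1) Z(2)] .
  ultimately show ?thesis by blast
qed

text \<open>The bound \<open>card X\<close> is the same for all \<open>J\<close>, so that generators
  of all minimal reductions can share one index range. An echelon basis of \<open>J\<close> modulo
  \<open>\<mm> I\<close>, chosen in \<open>J\<close>, generates a reduction inside \<open>J\<close>,
  which is \<open>J\<close> by minimality.\<close>

lemma min_reduction_gens:
  assumes X: "X \<subseteq> carrier R" "finite X" and J: "J \<in> min_reductions R (Idl X)"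
  shows "\<exists>Z. finite Z \<and> Z \<subseteq> carrier R \<and> card Z \<le> card X \<and> J = Idl Z"
proof -
  let ?m = "max_ideal R" and ?I = "Idl X"
  have I: "ideal ?I R" using genideal_ideal[OF X(1)] .
  have Jr: "reduction R ?I J" and min: "\<And>J'. reduction R ?I J' \<Longrightarrow> J' \<subseteq> J \<Longrightarrow> J' = J"
    using J unfolding min_reductions_def by blast+
  have JI: "ideal J R" "J \<subseteq> ?I" using Jr unfolding reduction_iff by blast+
  have W: "ideal (?m \<cdot> ?I) R" using ideal_prod_is_ideal[OF max.is_ideal I] .
  have XW: "X \<union> ?m \<cdot> ?I \<subseteq> carrier R" using X ideal.Icarr[OF W] by blast
  have "?I \<subseteq> Idl (X \<union> ?m \<cdot> ?I)"
    using genideal_self[OF XW] by (intro genideal_Un_ideal_mono[OF _ XW]) blast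
  then have JX: "J \<subseteq> Idl (X \<union> ?m \<cdot> ?I)" using JI(2) by blast
  have mult: "\<mu> \<otimes> y \<in> ?m \<cdot> ?I" if "\<mu> \<in> ?m" "y \<in> X" for \<mu> y
    using that(1) subsetD[OF genideal_self[OF X(1)] that(2)] by (rule ideal_prod.prod)
  from ideal_echelon[OF X(2,1) W mult JI(1) JX]
  obtain Z where Z: "finite Z" "Z \<subseteq> J" "card Z \<le> card X" "J \<subseteq> Idl (Z \<union> ?m \<cdot> ?I)"
    by blast
  have Zc: "Z \<subseteq> carrier R" using Z(2) ideal.Icarr[OF JI(1)] by blast
  have U: "Idl Z \<union> ?m \<cdot> ?I \<subseteq> carrier R"
    using ideal.Icarr[OF genideal_ideal[OF Zc]] ideal.Icarr[OF W] by blast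
  have "Z \<union> ?m \<cdot> ?I \<subseteq> Idl (Idl Z \<union> ?m \<cdot> ?I)"
    using genideal_self[OF U] genideal_self[OF Zc] by blast
  then have "J \<subseteq> Idl (Idl Z \<union> ?m \<cdot> ?I)" using Z(4) genideal_Un_ideal_mono[OF _ U] by blast
  then have "reduction R ?I (Idl Z)"
    by (rule reduction_nakayama[OF I Jr genideal_ideal[OF Zc] genideal_minimal[OF JI(1) Z(2)]])
  then have "Idl Z = J" using min genideal_minimal[OF JI(1) Z(2)] by blast
  then show ?thesis using Z Zc by blast
qed

lemma core_eq_Inter_min_reductions:
  assumes "ideal I R"
  shows "core R I = \<Inter>(min_reductions R I)"
proof
  show "core R I \<subseteq> \<Inter>(min_reductions R I)" unfolding core_def min_reductions_def by blast
  show "\<Inter>(min_reductions R I) \<subseteq> core R I"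
    unfolding core_def using exists_min_reduction[OF assms] by blast
qed

lemma min_reductions_nonempty: "ideal I R \<Longrightarrow> min_reductions R I \<noteq> {}"
  using exists_min_reduction[OF _ reduction_self] by blast

end

section \<open>Rings of \<open>R\<close>-valued functions, and subrings of them with the ascending
  chain condition\<close>

section \<open>Rings of functions\<close>

lemma (in cring) genideal_finite_eq:
  assumes "finite A" "\<And>i. i \<in> A \<Longrightarrow> f i \<in> carrier R" "u \<in> Idl (f ` A)"
  shows "\<exists>c. (\<forall>i\<in>A. c i \<in> carrier R) \<and> u = (\<Oplus>i\<in>A. c i \<otimes> f i)"
  using assms
proof (induction A arbitrary: u rule: finite_induct)
  case empty
  then have "u \<in> {\<zero>}" using genideal_minimal[OF zeroideal, of "{}"] by auto
  then show ?case by simp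
next
  case (insert j A)
  let ?X = "f ` A" and ?z = "f j"
  have z: "?z \<in> carrier R" and X: "?X \<subseteq> carrier R" using insert.prems by auto
  let ?T = "?X \<union> {\<nu> \<otimes> ?z | \<nu>. \<nu> \<in> carrier R}"
  have T: "?T \<subseteq> carrier R" using X z by auto
  have "\<one> \<otimes> ?z \<in> ?T" by blast
  then have "f ` insert j A \<subseteq> Idl ?T" using z genideal_self[OF T] by auto
  then have "u \<in> Idl ?T" using insert.prems(2) genideal_Un_ideal_mono[OF _ T] by blast
  from genideal_insert_multiples[OF oneideal X z this]
  obtain \<nu> w where u: "\<nu> \<in> carrier R" "w \<in> Idl ?X" "u = \<nu> \<otimes> ?z \<oplus> w" by blast
  then obtain c where c: "\<forall>i\<in>A. c i \<in> carrier R" "w = (\<Oplus>i\<in>A. c i \<otimes> f i)"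
    using insert.IH[of w] insert.prems(1) by blast
  have "(\<Oplus>i\<in>insert j A. (c(j := \<nu>)) i \<otimes> f i) = \<nu> \<otimes> ?z \<oplus> (\<Oplus>i\<in>A. (c(j := \<nu>)) i \<otimes> f i)"
    by (subst finsum_insert) (use insert.hyps c(1) u(1) insert.prems(1) in auto)
  also have "(\<Oplus>i\<in>A. (c(j := \<nu>)) i \<otimes> f i) = (\<Oplus>i\<in>A. c i \<otimes> f i)"
    by (rule finsum_cong') (use insert.hyps c(1) insert.prems(1) in auto)
  finally have "u = (\<Oplus>i\<in>insert j A. (c(j := \<nu>)) i \<otimes> f i)" using u(3) c(2) by simp
  then show ?case using c(1) u(1) by (intro exI[of _ "c(j := \<nu>)"]) auto
qed

lemma (in noetherian_ring) ideal_acc: "ideal_acc R"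
  unfolding ideal_acc_def
proof (intro allI impI)
  fix f :: "nat \<Rightarrow> 'a set" assume f: "\<forall>i. ideal (f i) R" and fS: "\<forall>i. f i \<subseteq> f (Suc i)"
  have mono: "f i \<subseteq> f j" if "i \<le> j" for i j
    using that by (induction j rule: dec_induct) (use fS in blast)+
  have "f i \<subseteq> f j \<or> f j \<subseteq> f i" for i j using mono[of i j] mono[of j i] by (meson nle_le)
  then have "subset.chain {I. ideal I R} (range f)"
    unfolding subset.chain_def using f by auto
  then have "\<Union>(range f) \<in> range f" by (rule ideal_chain_is_trivial[rotated]) auto
  then obtain k where k: "\<Union>(range f) = f k" by blast
  then have "f i = f k" if "i \<ge> k" for i using mono[OF that] by blast
  then show "\<exists>k. \<forall>i\<ge>k. f i = f k" by blast
qed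

text \<open>Restriction to \<open>\<Omega>\<close> makes all results extensional, so that ring
  identities are equalities of functions. The carrier is a parameter because the same operations
  serve the ring of all functions and its subrings.\<close>

definition fun_ring :: "('a, 'b) ring_scheme \<Rightarrow> 'c set \<Rightarrow> ('c \<Rightarrow> 'a) set \<Rightarrow> ('c \<Rightarrow> 'a) ring"
  where "fun_ring R \<Omega> B =
    \<lparr>carrier = B, mult = (\<lambda>f g. \<lambda>x\<in>\<Omega>. f x \<otimes>\<^bsub>R\<^esub> g x), one = (\<lambda>x\<in>\<Omega>. \<one>\<^bsub>R\<^esub>),
     zero = (\<lambda>x\<in>\<Omega>. \<zero>\<^bsub>R\<^esub>), add = (\<lambda>f g. \<lambda>x\<in>\<Omega>. f x \<oplus>\<^bsub>R\<^esub> g x)\<rparr>"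

lemma fun_ring_simps [simp]:
  "carrier (fun_ring R \<Omega> B) = B"
  "f \<otimes>\<^bsub>fun_ring R \<Omega> B\<^esub> g = (\<lambda>x\<in>\<Omega>. f x \<otimes>\<^bsub>R\<^esub> g x)"
  "f \<oplus>\<^bsub>fun_ring R \<Omega> B\<^esub> g = (\<lambda>x\<in>\<Omega>. f x \<oplus>\<^bsub>R\<^esub> g x)"
  "\<one>\<^bsub>fun_ring R \<Omega> B\<^esub> = (\<lambda>x\<in>\<Omega>. \<one>\<^bsub>R\<^esub>)"
  "\<zero>\<^bsub>fun_ring R \<Omega> B\<^esub> = (\<lambda>x\<in>\<Omega>. \<zero>\<^bsub>R\<^esub>)"
  by (simp_all add: fun_ring_def)

lemma fun_ring_update: "(fun_ring R \<Omega> B)\<lparr>carrier := C\<rparr> = fun_ring R \<Omega> C"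
  by (simp add: fun_ring_def)

abbreviation all_fun_ring :: "('a, 'b) ring_scheme \<Rightarrow> 'c set \<Rightarrow> ('c \<Rightarrow> 'a) ring"
  where "all_fun_ring R \<Omega> \<equiv> fun_ring R \<Omega> (\<Omega> \<rightarrow>\<^sub>E carrier R)"

lemma (in cring) all_fun_ring_cring: "cring (all_fun_ring R \<Omega>)"
proof (rule cringI)
  let ?E = "all_fun_ring R \<Omega>"
  have ext: "f = g" if "f \<in> extensional \<Omega>" "g \<in> extensional \<Omega>" "\<And>x. x \<in> \<Omega> \<Longrightarrow> f x = g x" for f g :: "'c \<Rightarrow> 'a"
    using that by (rule extensionalityI)
  have mem: "f x \<in> carrier R" if "f \<in> \<Omega> \<rightarrow>\<^sub>E carrier R" "x \<in> \<Omega>" for f x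
    using that by blast
  show "abelian_group ?E"
  proof (rule abelian_groupI)
    fix x assume x: "x \<in> carrier ?E"
    let ?y = "\<lambda>i\<in>\<Omega>. \<ominus> x i"
    have "?y \<in> carrier ?E" using x by auto
    moreover have "?y \<oplus>\<^bsub>?E\<^esub> x = \<zero>\<^bsub>?E\<^esub>"
      unfolding fun_ring_simps by (rule ext) (use x in \<open>auto simp: l_neg mem\<close>)
    ultimately show "\<exists>y\<in>carrier ?E. y \<oplus>\<^bsub>?E\<^esub> x = \<zero>\<^bsub>?E\<^esub>" by blast
  next
    fix x y z assume "x \<in> carrier ?E" "y \<in> carrier ?E" "z \<in> carrier ?E"
    then show "x \<oplus>\<^bsub>?E\<^esub> y \<oplus>\<^bsub>?E\<^esub> z = x \<oplus>\<^bsub>?E\<^esub> (y \<oplus>\<^bsub>?E\<^esub> z)"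
      unfolding fun_ring_simps by (intro ext) (auto simp: a_assoc mem)
  next
    fix x y assume "x \<in> carrier ?E" "y \<in> carrier ?E"
    then show "x \<oplus>\<^bsub>?E\<^esub> y = y \<oplus>\<^bsub>?E\<^esub> x"
      unfolding fun_ring_simps by (intro ext) (auto simp: a_comm mem)
  next
    fix x assume "x \<in> carrier ?E"
    then show "\<zero>\<^bsub>?E\<^esub> \<oplus>\<^bsub>?E\<^esub> x = x"
      unfolding fun_ring_simps by (intro ext) (auto simp: mem PiE_def)
  qed (auto simp: mem PiE_def)
  show "comm_monoid ?E"
  proof (rule comm_monoidI)
    fix x y z assume "x \<in> carrier ?E" "y \<in> carrier ?E" "z \<in> carrier ?E"
    then show "x \<otimes>\<^bsub>?E\<^esub> y \<otimes>\<^bsub>?E\<^esub> z = x \<otimes>\<^bsub>?E\<^esub> (y \<otimes>\<^bsub>?E\<^esub> z)"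
      unfolding fun_ring_simps by (intro ext) (auto simp: m_assoc mem)
  next
    fix x y assume "x \<in> carrier ?E" "y \<in> carrier ?E"
    then show "x \<otimes>\<^bsub>?E\<^esub> y = y \<otimes>\<^bsub>?E\<^esub> x"
      unfolding fun_ring_simps by (intro ext) (auto simp: m_comm mem)
  next
    fix x assume "x \<in> carrier ?E"
    then show "\<one>\<^bsub>?E\<^esub> \<otimes>\<^bsub>?E\<^esub> x = x"
      unfolding fun_ring_simps by (intro ext) (auto simp: mem PiE_def)
  qed (auto simp: mem PiE_def)
  fix x y z assume "x \<in> carrier ?E" "y \<in> carrier ?E" "z \<in> carrier ?E"
  then show "(x \<oplus>\<^bsub>?E\<^esub> y) \<otimes>\<^bsub>?E\<^esub> z = x \<otimes>\<^bsub>?E\<^esub> z \<oplus>\<^bsub>?E\<^esub> y \<otimes>\<^bsub>?E\<^esub> z"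
    unfolding fun_ring_simps by (intro ext) (auto simp: l_distr mem)
qed

text \<open>Three instances matter: the constants alone, a ring finitely generated over them, where
  the chain condition holds, and the ring of all functions, where values may be chosen independently
  at each point.\<close>

locale function_ring = cring R for R (structure) +
  fixes \<Omega> :: "'c set" and B :: "('c \<Rightarrow> 'a) set"
  assumes B: "subcring B (all_fun_ring R \<Omega>)"
    and const_B: "\<And>c. c \<in> carrier R \<Longrightarrow> (\<lambda>x\<in>\<Omega>. c) \<in> B"
begin

abbreviation const :: "'a \<Rightarrow> 'c \<Rightarrow> 'a"
  where "const c \<equiv> \<lambda>x\<in>\<Omega>. c"

abbreviation S :: "('c \<Rightarrow> 'a) ring"
  where "S \<equiv> fun_ring R \<Omega> B"

lemma B_PiE: "f \<in> B \<Longrightarrow> f \<in> \<Omega> \<rightarrow>\<^sub>E carrier R"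
  using subcringE(1)[OF B] by auto

lemma B_value: "f \<in> B \<Longrightarrow> x \<in> \<Omega> \<Longrightarrow> f x \<in> carrier R"
  using B_PiE by blast

lemma B_ext: "\<lbrakk>f \<in> B; g \<in> B; \<And>x. x \<in> \<Omega> \<Longrightarrow> f x = g x\<rbrakk> \<Longrightarrow> f = g"
  using B_PiE by (meson PiE_ext)

sublocale S: cring S
proof -
  interpret E: cring "all_fun_ring R \<Omega>" by (rule all_fun_ring_cring)
  show "cring S" using E.subcring_iff[OF subcringE(1)[OF B]] B by (simp add: fun_ring_update)
qed

lemma S_uminus: "f \<in> B \<Longrightarrow> x \<in> \<Omega> \<Longrightarrow> (\<ominus>\<^bsub>S\<^esub> f) x = \<ominus> f x"
proof -
  assume f: "f \<in> B" and x: "x \<in> \<Omega>"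
  have g: "\<ominus>\<^bsub>S\<^esub> f \<in> B" using S.a_inv_closed[of f] f by simp
  have "(\<ominus>\<^bsub>S\<^esub> f \<oplus>\<^bsub>S\<^esub> f) x = \<zero>\<^bsub>S\<^esub> x" using S.l_neg[of f] f by simp
  then have "(\<ominus>\<^bsub>S\<^esub> f) x \<oplus> f x = \<zero>" using x by simp
  then show ?thesis using B_value[OF f x] B_value[OF g x] minus_equality by metis
qed

lemma S_minus: "f \<in> B \<Longrightarrow> g \<in> B \<Longrightarrow> x \<in> \<Omega> \<Longrightarrow> (f \<ominus>\<^bsub>S\<^esub> g) x = f x \<ominus> g x"
  by (simp add: a_minus_def S_uminus)

lemma S_finsum:
  assumes "finite A" "\<And>i. i \<in> A \<Longrightarrow> F i \<in> B" "x \<in> \<Omega>"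
  shows "(finsum S F A) x = (\<Oplus>i\<in>A. F i x)"
  using assms
proof (induction A rule: finite_induct)
  case empty
  then show ?case by simp
next
  case (insert i A)
  have "finsum S F (insert i A) = F i \<oplus>\<^bsub>S\<^esub> finsum S F A"
    by (rule S.finsum_insert) (use insert in auto)
  moreover have "(\<Oplus>i\<in>insert i A. F i x) = F i x \<oplus> (\<Oplus>i\<in>A. F i x)"
    by (rule finsum_insert) (use insert B_value in auto)
  ultimately show ?case using insert by simp
qed

lemma const_mult: "const (a \<otimes> b) = const a \<otimes>\<^bsub>S\<^esub> const b"
  by (auto simp: fun_eq_iff restrict_def)

lemma const_add: "const (a \<oplus> b) = const a \<oplus>\<^bsub>S\<^esub> const b"
  by (auto simp: fun_eq_iff restrict_def)

lemma evaluation_preimage_ideal: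
  assumes "ideal N R" "x \<in> \<Omega>"
  shows "ideal {g \<in> B. g x \<in> N} S"
proof (rule S.cring_idealI)
  interpret N: ideal N R by fact
  show "\<zero>\<^bsub>S\<^esub> \<in> {g \<in> B. g x \<in> N}"
    using S.zero_closed additive_subgroup.zero_closed[OF N.additive_subgroup_axioms] assms(2) by simp
  fix f g assume f: "f \<in> {g \<in> B. g x \<in> N}" and g: "g \<in> {g \<in> B. g x \<in> N}"
  then have "f \<oplus>\<^bsub>S\<^esub> g \<in> B" using S.a_closed[of f g] by (simp only: fun_ring_simps(1) mem_Collect_eq)
  then show "f \<oplus>\<^bsub>S\<^esub> g \<in> {g \<in> B. g x \<in> N}" using f g N.add_in assms(2) by simp
next
  interpret N: ideal N R by fact
  fix f g assume f: "f \<in> carrier S" and g: "g \<in> {g \<in> B. g x \<in> N}"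
  then have "f \<otimes>\<^bsub>S\<^esub> g \<in> B" using S.m_closed[of f g] by (simp only: fun_ring_simps(1) mem_Collect_eq)
  then show "f \<otimes>\<^bsub>S\<^esub> g \<in> {g \<in> B. g x \<in> N}" using f g N.I_l_closed assms(2) B_value by simp
qed simp

lemma evaluation_preimage_prime:
  assumes "primeideal N R" "x \<in> \<Omega>"
  shows "primeideal {g \<in> B. g x \<in> N} S"
proof (rule primeidealI)
  interpret N: primeideal N R by fact
  show "ideal {g \<in> B. g x \<in> N} S" by (rule evaluation_preimage_ideal[OF N.is_ideal assms(2)])
  show "cring S" by (rule S.cring_axioms)
  have "const \<one> \<in> B" "const \<one> x \<notin> N" using const_B N.one_notin assms(2) by auto
  then have "const \<one> \<in> carrier S" "const \<one> \<notin> {g \<in> B. g x \<in> N}" by (simp only: fun_ring_simps, blast)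
  then show "carrier S \<noteq> {g \<in> B. g x \<in> N}" by metis
  fix f g assume "f \<in> carrier S" "g \<in> carrier S" "f \<otimes>\<^bsub>S\<^esub> g \<in> {g \<in> B. g x \<in> N}"
  then show "f \<in> {g \<in> B. g x \<in> N} \<or> g \<in> {g \<in> B. g x \<in> N}"
    using N.I_prime[of "f x" "g x"] B_value assms(2) by auto
qed

lemma const_preimage_ideal:
  assumes "ideal U S"
  shows "ideal {c \<in> carrier R. const c \<in> U} R"
proof (rule cring_idealI)
  interpret U: ideal U S by fact
  show "\<zero> \<in> {c \<in> carrier R. const c \<in> U}"
    using additive_subgroup.zero_closed[OF U.additive_subgroup_axioms] by simp
  fix a b assume "a \<in> {c \<in> carrier R. const c \<in> U}" "b \<in> {c \<in> carrier R. const c \<in> U}"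
  then show "a \<oplus> b \<in> {c \<in> carrier R. const c \<in> U}"
    using U.add_in[of "const a" "const b"] unfolding const_add[symmetric] by simp
next
  interpret U: ideal U S by fact
  fix a b assume a: "a \<in> carrier R" and b: "b \<in> {c \<in> carrier R. const c \<in> U}"
  then have "const a \<otimes>\<^bsub>S\<^esub> const b \<in> U" using const_B by (intro U.I_l_closed) auto
  then show "a \<otimes> b \<in> {c \<in> carrier R. const c \<in> U}" unfolding const_mult[symmetric] using a b by simp
qed simp

end

lemma (in cring) function_ringI_const: "\<Omega> \<noteq> {} \<Longrightarrow> function_ring R \<Omega> ((\<lambda>c. \<lambda>x\<in>\<Omega>. c) ` carrier R)"
proof -
  interpret E: cring "all_fun_ring R \<Omega>" by (rule all_fun_ring_cring)
  let ?A = "(\<lambda>c. \<lambda>x\<in>\<Omega>. c) ` carrier R"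
  have "subcring ?A (all_fun_ring R \<Omega>)"
  proof (rule E.subcringI', rule E.subringI)
    fix f assume "f \<in> ?A"
    then obtain c where c: "c \<in> carrier R" "f = (\<lambda>x\<in>\<Omega>. c)" by blast
    have "(\<lambda>x\<in>\<Omega>. \<ominus> c) \<oplus>\<^bsub>all_fun_ring R \<Omega>\<^esub> f = \<zero>\<^bsub>all_fun_ring R \<Omega>\<^esub>"
      using c l_neg by (auto simp: fun_eq_iff restrict_def)
    then have "\<ominus>\<^bsub>all_fun_ring R \<Omega>\<^esub> f = (\<lambda>x\<in>\<Omega>. \<ominus> c)"
      using c by (intro E.minus_equality) auto
    then show "\<ominus>\<^bsub>all_fun_ring R \<Omega>\<^esub> f \<in> ?A" using c by blast
    fix g assume "g \<in> ?A"
    then obtain d where d: "d \<in> carrier R" "g = (\<lambda>x\<in>\<Omega>. d)" by blast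
    have "f \<otimes>\<^bsub>all_fun_ring R \<Omega>\<^esub> g = (\<lambda>x\<in>\<Omega>. c \<otimes> d)" "f \<oplus>\<^bsub>all_fun_ring R \<Omega>\<^esub> g = (\<lambda>x\<in>\<Omega>. c \<oplus> d)"
      using c d by (auto simp: fun_eq_iff restrict_def)
    then show "f \<otimes>\<^bsub>all_fun_ring R \<Omega>\<^esub> g \<in> ?A" "f \<oplus>\<^bsub>all_fun_ring R \<Omega>\<^esub> g \<in> ?A"
      using c d by blast+
  qed (auto simp: fun_ring_def)
  then show ?thesis by (rule function_ring.intro[OF cring_axioms function_ring_axioms.intro]) blast
qed

lemma (in cring) function_ring_all: "function_ring R \<Omega> (\<Omega> \<rightarrow>\<^sub>E carrier R)"
proof -
  interpret E: cring "all_fun_ring R \<Omega>" by (rule all_fun_ring_cring)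
  have "subcring (\<Omega> \<rightarrow>\<^sub>E carrier R) (all_fun_ring R \<Omega>)" using E.carrier_is_subcring by simp
  then show ?thesis by (rule function_ring.intro[OF cring_axioms function_ring_axioms.intro]) auto
qed

text \<open>The constants inherit the chain condition from \<open>R\<close>, and adjoining the
  finitely many members of \<open>T\<close> preserves it by the basis theorem.\<close>

lemma (in noetherian_local_ring) exists_acc_function_ring:
  assumes "\<Omega> \<noteq> {}" "finite T" "T \<subseteq> \<Omega> \<rightarrow>\<^sub>E carrier R"
  obtains B where "function_ring R \<Omega> B" "T \<subseteq> B" "ideal_acc (fun_ring R \<Omega> B)"
proof -
  interpret E: cring "all_fun_ring R \<Omega>" by (rule all_fun_ring_cring)
  let ?c = "\<lambda>c. \<lambda>x\<in>\<Omega>. c"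
  let ?A = "?c ` carrier R"
  interpret A: function_ring R \<Omega> ?A by (rule function_ringI_const[OF assms(1)])
  have "ideal_acc A.S"
    unfolding ideal_acc_def
  proof (intro allI impI)
    fix f :: "nat \<Rightarrow> _ set" assume f: "\<forall>i. ideal (f i) A.S" and fS: "\<forall>i. f i \<subseteq> f (Suc i)"
    let ?g = "\<lambda>i. {c \<in> carrier R. A.const c \<in> f i}"
    have gI: "ideal (?g i) R" for i using f by (intro A.const_preimage_ideal) blast
    have gS: "?g i \<subseteq> ?g (Suc i)" for i using fS by blast
    obtain k where k: "\<And>i. i \<ge> k \<Longrightarrow> ?g i = ?g k"
      using ideal_accD[of R ?g, OF ideal_acc gI gS] by blast
    \<comment> \<open>An ideal of the ring of constants is determined by its contraction to
      \<open>R\<close>, so the chain stabilises when the contractions do.\<close>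
    have "f i = ?c ` ?g i" for i
    proof -
      have "ideal (f i) A.S" using f by blast
      from ideal.Icarr[OF this] have "f i \<subseteq> ?A" by auto
      then show ?thesis by blast
    qed
    then have fe: "f i = ?c ` ?g i" for i .
    have "f i = f k" if "i \<ge> k" for i
    proof -
      have "f i = ?c ` ?g i" by (rule fe)
      also have "\<dots> = ?c ` ?g k" by (rule arg_cong[OF k[OF that]])
      also have "\<dots> = f k" by (rule fe[symmetric])
      finally show ?thesis .
    qed
    then show "\<exists>k. \<forall>i\<ge>k. f i = f k" by blast
  qed
  then have acc: "ideal_acc ((all_fun_ring R \<Omega>)\<lparr>carrier := ?A\<rparr>)" by (simp add: fun_ring_update)
  have T: "T \<subseteq> carrier (all_fun_ring R \<Omega>)" using assms(3) by simp
  obtain B where B: "subcring B (all_fun_ring R \<Omega>)" "?A \<subseteq> B" "T \<subseteq> B"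
    "ideal_acc ((all_fun_ring R \<Omega>)\<lparr>carrier := B\<rparr>)"
    using E.subcring_acc_adjoin_finite[OF assms(2) T A.B acc] by blast
  have "function_ring R \<Omega> B"
    by (rule function_ring.intro[OF cring_axioms function_ring_axioms.intro[OF B(1)]]) (use B(2) in blast)
  then show thesis using that B(3,4) by (simp add: fun_ring_update)
qed

section \<open>A reduction exponent common to all minimal reductions\<close>

section \<open>A uniform reduction number\<close>

context noetherian_local_ring
begin

text \<open>With a common number \<open>n\<close> of generators, the \<open>j\<close>-th generator
  becomes a function of the minimal reduction, which is what puts all reductions into one function
  ring.\<close>

lemma min_reductions_gens:
  assumes I: "ideal I R"
  obtains n :: nat and \<gamma> where "\<And>J j. J \<in> min_reductions R I \<Longrightarrow> j < n \<Longrightarrow> \<gamma> J j \<in> carrier R"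
    "\<And>J. J \<in> min_reductions R I \<Longrightarrow> J = Idl (\<gamma> J ` {..<n})"
proof -
  obtain X where X: "X \<subseteq> carrier R" "finite X" "I = Idl X" using finetely_gen[OF I] by blast
  let ?n = "card X"
  have "\<exists>g. (\<forall>j<?n. g j \<in> carrier R) \<and> J = Idl (g ` {..<?n})" if J: "J \<in> min_reductions R I" for J
  proof -
    obtain Z where Z: "finite Z" "Z \<subseteq> carrier R" "card Z \<le> ?n" "J = Idl Z"
      using min_reduction_gens[OF X(1,2)] J X(3) by blast
    obtain f where f: "bij_betw f {0..<card Z} Z" using ex_bij_betw_nat_finite[OF Z(1)] by blast
    \<comment> \<open>Padding with \<open>\<zero>\<close> brings every generating family to the same
      length.\<close>
    define g where "g j = (if j < card Z then f j else \<zero>)" for j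
    have fZ: "f ` {0..<card Z} = Z" using f by (rule bij_betw_imp_surj_on)
    have Zg: "Z \<subseteq> g ` {..<?n}"
    proof
      fix z assume "z \<in> Z"
      then obtain j where j: "j < card Z" "z = f j" using fZ by force
      then have "z = g j" "j < ?n" using Z(3) unfolding g_def by auto
      then show "z \<in> g ` {..<?n}" by blast
    qed
    have gZ: "g j \<in> insert \<zero> Z" for j using fZ unfolding g_def by auto
    have gc: "g ` {..<?n} \<subseteq> carrier R" using gZ Z(2) zero_closed by (metis image_subsetI insertE subsetD)
    have "\<zero> \<in> Idl Z" using additive_subgroup.zero_closed[OF ideal.axioms(1)[OF genideal_ideal[OF Z(2)]]] .
    then have "g ` {..<?n} \<subseteq> Idl Z" using gZ genideal_self[OF Z(2)] by (metis image_subsetI insertE subsetD)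
    then have "Idl (g ` {..<?n}) \<subseteq> J" using genideal_Un_ideal_mono[OF _ Z(2)] Z(4) by blast
    moreover have "J \<subseteq> Idl (g ` {..<?n})"
      unfolding Z(4) using Zg genideal_self[OF gc] by (intro genideal_Un_ideal_mono[OF _ gc]) blast
    ultimately have "J = Idl (g ` {..<?n})" by blast
    moreover have "\<forall>j<?n. g j \<in> carrier R" using gc by blast
    ultimately show ?thesis by blast
  qed
  then obtain \<gamma> where "\<forall>J\<in>min_reductions R I. (\<forall>j<?n. \<gamma> J j \<in> carrier R) \<and> J = Idl (\<gamma> J ` {..<?n})"
    by metis
  then show thesis by (intro that[where n = ?n and \<gamma> = \<gamma>]) blast+
qed

lemma min_reductionD:
  assumes "J \<in> min_reductions R I"
  shows "ideal J R" "J \<subseteq> I" "\<exists>r. ideal_pow R I (Suc r) = J \<cdot> ideal_pow R I r"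
  using assms unfolding min_reductions_def reduction_iff by blast+

text \<open>The entries of the matrices expressing generators of the minimal reductions \<open>J\<close> in terms of
  generators of \<open>I\<close> generate a ring \<open>S\<close> of functions of \<open>J\<close> with the ascending chain condition. The
  transporters \<open>L s\<close> of the generic \<open>I\<^sup>s\<^sup>+\<^sup>1\<close> into the generic \<open>J I\<^sup>s\<close> stabilise, and by Nakayama's lemma
  \<open>L s\<close> has an element that is a unit at \<open>J\<close> as soon as \<open>I\<^sup>s\<^sup>+\<^sup>1 = J I\<^sup>s\<close>.\<close>

theorem uniform_reduction_number:
  assumes I: "ideal I R"
  shows "\<exists>r. \<forall>J\<in>min_reductions R I. ideal_pow R I (Suc r) = J \<cdot> ideal_pow R I r"
proof -
  define \<Omega> where "\<Omega> = min_reductions R I"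
  have \<Omega>: "\<Omega> \<noteq> {}" unfolding \<Omega>_def by (rule min_reductions_nonempty[OF I])
  obtain n :: nat and \<gamma> where \<gamma>c: "\<And>J j. J \<in> \<Omega> \<Longrightarrow> j < n \<Longrightarrow> \<gamma> J j \<in> carrier R"
    and \<gamma>J: "\<And>J. J \<in> \<Omega> \<Longrightarrow> J = Idl (\<gamma> J ` {..<n})"
    using min_reductions_gens[OF I] unfolding \<Omega>_def by metis
  obtain X where X: "X \<subseteq> carrier R" "finite X" "I = Idl X" using finetely_gen[OF I] by blast
  have "\<exists>c. (\<forall>x\<in>X. c x \<in> carrier R) \<and> \<gamma> J j = (\<Oplus>x\<in>X. c x \<otimes> x)" if "J \<in> \<Omega>" "j < n" for J j
  proof (rule genideal_finite_eq[OF X(2), of "\<lambda>x. x"])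
    show "x \<in> carrier R" if "x \<in> X" for x using X(1) that by blast
    have "\<gamma> J ` {..<n} \<subseteq> carrier R" using \<gamma>c[OF that(1)] by blast
    then have "\<gamma> J j \<in> Idl (\<gamma> J ` {..<n})" using genideal_self that(2) by blast
    then have "\<gamma> J j \<in> J" using \<gamma>J[OF that(1)] by simp
    then show "\<gamma> J j \<in> Idl ((\<lambda>x. x) ` X)" using min_reductionD(2) that(1) X(3) unfolding \<Omega>_def image_ident by blast
  qed
  then obtain C where Cc: "\<And>J j x. J \<in> \<Omega> \<Longrightarrow> j < n \<Longrightarrow> x \<in> X \<Longrightarrow> C J j x \<in> carrier R"
    and C: "\<And>J j. J \<in> \<Omega> \<Longrightarrow> j < n \<Longrightarrow> \<gamma> J j = (\<Oplus>x\<in>X. C J j x \<otimes> x)" by metis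
  \<comment> \<open>Each matrix entry, viewed as a function of \<open>J\<close>. There are at most
    \<open>n\<close> times \<open>card X\<close> of them, so they all fit into a function ring with
    the chain condition.\<close>
  define \<tau> where "\<tau> j x = (\<lambda>J\<in>\<Omega>. C J j x)" for j x
  have "finite ((\<lambda>(j, x). \<tau> j x) ` ({..<n} \<times> X))" using X(2) by blast
  moreover have "(\<lambda>(j, x). \<tau> j x) ` ({..<n} \<times> X) \<subseteq> \<Omega> \<rightarrow>\<^sub>E carrier R" using Cc unfolding \<tau>_def by auto
  ultimately obtain B where B: "function_ring R \<Omega> B" "(\<lambda>(j, x). \<tau> j x) ` ({..<n} \<times> X) \<subseteq> B"
    and acc: "ideal_acc (fun_ring R \<Omega> B)"
    using exists_acc_function_ring[OF \<Omega>] by blast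
  interpret F: function_ring R \<Omega> B by (rule B(1))
  let ?S = "fun_ring R \<Omega> B"
  note cB = F.const_B
  have \<tau>B: "\<tau> j x \<in> B" if "j < n" "x \<in> X" for j x using B(2) that by auto
  define \<Gamma> where "\<Gamma> j = (\<lambda>J\<in>\<Omega>. \<gamma> J j)" for j
  have terms: "\<tau> j x \<otimes>\<^bsub>?S\<^esub> F.const x \<in> B" if "j < n" "x \<in> X" for j x
    using F.S.m_closed[of "\<tau> j x" "F.const x"] \<tau>B[OF that] cB[of x] that X(1) by (simp only: fun_ring_simps(1) subset_iff)
  have \<Gamma>_eq: "\<Gamma> j = finsum ?S (\<lambda>x. \<tau> j x \<otimes>\<^bsub>?S\<^esub> F.const x) X" if j: "j < n" for j
  proof -
    have sB: "finsum ?S (\<lambda>x. \<tau> j x \<otimes>\<^bsub>?S\<^esub> F.const x) X \<in> B"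
      by (rule F.S.finsum_closed[unfolded fun_ring_simps(1)]) (use terms[OF j] in blast)
    show ?thesis
    proof (rule extensionalityI[of _ \<Omega>])
      show "finsum ?S (\<lambda>x. \<tau> j x \<otimes>\<^bsub>?S\<^esub> F.const x) X \<in> extensional \<Omega>"
        using F.B_PiE[OF sB] unfolding PiE_def by blast
      fix J assume J: "J \<in> \<Omega>"
      have "finsum ?S (\<lambda>x. \<tau> j x \<otimes>\<^bsub>?S\<^esub> F.const x) X J = (\<Oplus>x\<in>X. (\<tau> j x \<otimes>\<^bsub>?S\<^esub> F.const x) J)"
        by (rule F.S_finsum[OF X(2) terms[OF j] J])
      also have "\<dots> = (\<Oplus>x\<in>X. C J j x \<otimes> x)"
        by (rule finsum_cong') (use Cc[OF J j] X(1) J in \<open>auto simp: \<tau>_def\<close>)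
      finally show "\<Gamma> j J = finsum ?S (\<lambda>x. \<tau> j x \<otimes>\<^bsub>?S\<^esub> F.const x) X J"
        using C[OF J j] J by (simp add: \<Gamma>_def)
    qed (simp add: \<Gamma>_def)
  qed
  have \<Gamma>B: "\<Gamma> j \<in> B" if "j < n" for j
    unfolding \<Gamma>_eq[OF that]
    by (rule F.S.finsum_closed[unfolded fun_ring_simps(1)]) (use terms[OF that] in blast)
  let ?P = "ideal_pow R I"
  have P: "ideal (?P s) R" for s using ideal_pow_ideal[OF I] .
  have Pc: "y \<in> ?P s \<Longrightarrow> y \<in> carrier R" for y s using ideal.Icarr[OF P] .
  \<comment> \<open>\<open>N s\<close>, generated by these products, is the generic version of
    \<open>J I^s\<close>: its members take at each \<open>J\<close> a value in
    \<open>J I^s\<close>.\<close>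
  define G where "G s = {\<Gamma> j \<otimes>\<^bsub>?S\<^esub> F.const y | j y. j < n \<and> y \<in> ?P s}" for s
  have G: "G s \<subseteq> carrier ?S" for s
  proof
    fix g assume "g \<in> G s"
    then obtain j y where "g = \<Gamma> j \<otimes>\<^bsub>?S\<^esub> F.const y" "j < n" "y \<in> ?P s" unfolding G_def by blast
    then show "g \<in> carrier ?S" using F.S.m_closed[of "\<Gamma> j" "F.const y"] \<Gamma>B cB[OF Pc] by (simp only: fun_ring_simps(1))
  qed
  define N where "N s = Idl\<^bsub>?S\<^esub> (G s)" for s
  have N: "ideal (N s) ?S" for s unfolding N_def by (rule F.S.genideal_ideal[OF G])
  have cmult: "F.const a \<otimes>\<^bsub>?S\<^esub> u \<in> N (Suc s)" if a: "a \<in> I" and u: "u \<in> N s" for a u s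
  proof -
    have ac: "a \<in> carrier R" using ideal.Icarr[OF I a] .
    show ?thesis
    proof (rule F.S.colon_ideal_Idl[OF N _ G _ u[unfolded N_def]])
      show "F.const a \<in> carrier ?S" using cB[OF ac] by simp
      fix g assume "g \<in> G s"
      then obtain j y where g: "g = \<Gamma> j \<otimes>\<^bsub>?S\<^esub> F.const y" "j < n" "y \<in> ?P s" unfolding G_def by blast
      have c: "\<Gamma> j \<in> carrier ?S" "F.const y \<in> carrier ?S" "F.const a \<in> carrier ?S"
        using \<Gamma>B[OF g(2)] cB[OF Pc[OF g(3)]] cB[OF ac] by simp_all
      have "F.const a \<otimes>\<^bsub>?S\<^esub> g = \<Gamma> j \<otimes>\<^bsub>?S\<^esub> (F.const y \<otimes>\<^bsub>?S\<^esub> F.const a)"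
        unfolding g(1) using F.S.m_lcomm[OF c(3,1,2)] F.S.m_comm[OF c(2,3)] by (simp only:)
      also have "\<dots> = \<Gamma> j \<otimes>\<^bsub>?S\<^esub> F.const (y \<otimes> a)" by (simp only: F.const_mult)
      also have "\<dots> \<in> G (Suc s)"
        unfolding G_def ideal_pow_Suc using g(2) ideal_prod.prod[OF g(3) a, of R] by blast
      finally show "F.const a \<otimes>\<^bsub>?S\<^esub> g \<in> N (Suc s)"
        unfolding N_def using F.S.genideal_self[OF G] by blast
    qed
  qed
  define L where "L s = {h \<in> B. \<forall>w\<in>?P (Suc s). h \<otimes>\<^bsub>?S\<^esub> F.const w \<in> N s}" for s
  have L: "ideal (L s) ?S" for s
  proof (rule F.S.cring_idealI)
    interpret Ns: ideal "N s" ?S by (rule N)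
    show "L s \<subseteq> carrier ?S" unfolding L_def by auto
    have "\<zero>\<^bsub>?S\<^esub> \<otimes>\<^bsub>?S\<^esub> F.const w \<in> N s" if "w \<in> ?P (Suc s)" for w
      using F.S.l_null[of "F.const w"] cB[OF Pc[OF that]] additive_subgroup.zero_closed[OF Ns.additive_subgroup_axioms]
      by (simp only: fun_ring_simps(1))
    then show "\<zero>\<^bsub>?S\<^esub> \<in> L s" unfolding L_def using F.S.zero_closed by (simp only: fun_ring_simps(1) mem_Collect_eq) blast
    fix f g assume f: "f \<in> L s" and g: "g \<in> L s"
    have fB: "f \<in> carrier ?S" "g \<in> carrier ?S" using f g unfolding L_def by auto
    have "(f \<oplus>\<^bsub>?S\<^esub> g) \<otimes>\<^bsub>?S\<^esub> F.const w \<in> N s" if "w \<in> ?P (Suc s)" for w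
    proof -
      have "F.const w \<in> carrier ?S" using cB[OF Pc[OF that]] by simp
      from F.S.l_distr[OF fB this] show ?thesis
        using f g that Ns.add_in unfolding L_def by (simp only: mem_Collect_eq)
    qed
    then show "f \<oplus>\<^bsub>?S\<^esub> g \<in> L s" unfolding L_def using F.S.a_closed[OF fB] by (simp only: fun_ring_simps(1) mem_Collect_eq) blast
  next
    interpret Ns: ideal "N s" ?S by (rule N)
    fix f g assume f: "f \<in> carrier ?S" and g: "g \<in> L s"
    have gB: "g \<in> carrier ?S" using g unfolding L_def by auto
    have "(f \<otimes>\<^bsub>?S\<^esub> g) \<otimes>\<^bsub>?S\<^esub> F.const w \<in> N s" if "w \<in> ?P (Suc s)" for w
    proof -
      have "F.const w \<in> carrier ?S" using cB[OF Pc[OF that]] by simp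
      from F.S.m_assoc[OF f gB this] show ?thesis
        using g that Ns.I_l_closed[OF _ f] unfolding L_def by (simp only: mem_Collect_eq)
    qed
    then show "f \<otimes>\<^bsub>?S\<^esub> g \<in> L s" unfolding L_def using F.S.m_closed[OF f gB] by (simp only: fun_ring_simps(1) mem_Collect_eq) blast
  qed
  \<comment> \<open>Multiplying by \<open>I\<close> carries the transport property from one degree
    to the next, through \<open>cmult\<close>.\<close>
  have Lmono: "L s \<subseteq> L (Suc s)" for s
  proof
    fix h assume h: "h \<in> L s"
    then have hc: "h \<in> carrier ?S" unfolding L_def by simp
    interpret N': ideal "N (Suc s)" ?S by (rule N)
    have "ideal {c \<in> carrier R. F.const c \<in> {f \<in> carrier ?S. h \<otimes>\<^bsub>?S\<^esub> f \<in> N (Suc s)}} R"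
      by (rule F.const_preimage_ideal[OF F.S.colon_ideal[OF N hc]])
    moreover have "y \<otimes> a \<in> {c \<in> carrier R. F.const c \<in> {f \<in> carrier ?S. h \<otimes>\<^bsub>?S\<^esub> f \<in> N (Suc s)}}"
      if y: "y \<in> ?P (Suc s)" and a: "a \<in> I" for y a
    proof -
      have c: "y \<in> carrier R" "a \<in> carrier R" using Pc[OF y] ideal.Icarr[OF I a] by blast+
      have cc: "F.const y \<in> carrier ?S" "F.const a \<in> carrier ?S" using cB c by simp_all
      have "h \<otimes>\<^bsub>?S\<^esub> F.const (y \<otimes> a) = F.const a \<otimes>\<^bsub>?S\<^esub> (h \<otimes>\<^bsub>?S\<^esub> F.const y)"
        unfolding F.const_mult using F.S.m_assoc[OF hc cc] F.S.m_comm[OF F.S.m_closed[OF hc cc(1)] cc(2)] by (simp only:)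
      also have "\<dots> \<in> N (Suc s)" by (rule cmult[OF a]) (use h y L_def in blast)
      finally show ?thesis using c cB[of "y \<otimes> a"] by (simp only: mem_Collect_eq fun_ring_simps(1)) blast
    qed
    ultimately have "?P (Suc (Suc s)) \<subseteq> {c \<in> carrier R. F.const c \<in> {f \<in> carrier ?S. h \<otimes>\<^bsub>?S\<^esub> f \<in> N (Suc s)}}"
      unfolding ideal_pow_Suc[of I "Suc s"] by (subst ideal_prod_subset_iff) blast+
    then show "h \<in> L (Suc s)" unfolding L_def using hc by (simp only: mem_Collect_eq fun_ring_simps(1)) blast
  qed
  obtain r where r: "\<And>s. s \<ge> r \<Longrightarrow> L s = L r" using ideal_accD[of ?S L, OF acc L Lmono] by blast
  have "?P (Suc r) = J \<cdot> ?P r" if J: "J \<in> \<Omega>" for J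
  proof -
    have Ji: "ideal J R" and JI: "J \<subseteq> I" using min_reductionD[of J I] J unfolding \<Omega>_def by blast+
    obtain s0 where "?P (Suc s0) = J \<cdot> ?P s0" using min_reductionD(3)[of J I] J unfolding \<Omega>_def by blast
    from reduction_pow_mono[OF I Ji this, of "max s0 r"]
    obtain s where s: "?P (Suc s) = J \<cdot> ?P s" "s \<ge> r" by auto
    obtain Y where Y: "Y \<subseteq> carrier R" "finite Y" "?P (Suc s) = Idl Y" using finetely_gen[OF P] by blast
    \<comment> \<open>The prime at which Nakayama's lemma is applied. A function outside it is a
      unit at the one point \<open>J\<close>, which is all that is used of it.\<close>
    let ?Q = "{g \<in> B. g J \<in> max_ideal R}"
    have Q: "primeideal ?Q ?S" by (rule F.evaluation_preimage_prime[OF max.primeideal_axioms J])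
    let ?Y = "F.const ` Y"
    have Yc: "?Y \<subseteq> carrier ?S" using Y(1) cB by auto
    let ?Z = "N s \<union> {\<nu> \<otimes>\<^bsub>?S\<^esub> x | \<nu> x. \<nu> \<in> ?Q \<and> x \<in> ?Y}"
    have Z: "?Z \<subseteq> carrier ?S"
    proof
      fix z assume "z \<in> ?Z"
      then consider "z \<in> N s" | \<nu> x where "\<nu> \<in> ?Q" "x \<in> ?Y" "z = \<nu> \<otimes>\<^bsub>?S\<^esub> x" by blast
      then show "z \<in> carrier ?S"
      proof cases
        case 1 then show ?thesis by (rule ideal.Icarr[OF N])
      next
        case 2
        then have "\<nu> \<in> carrier ?S" "x \<in> carrier ?S" using Yc by auto
        then show ?thesis unfolding 2(3) by (rule F.S.m_closed)
      qed
    qed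
    interpret U: ideal "Idl\<^bsub>?S\<^esub> ?Z" ?S by (rule F.S.genideal_ideal[OF Z])
    have QP: "\<nu> \<otimes>\<^bsub>?S\<^esub> F.const w \<in> Idl\<^bsub>?S\<^esub> ?Z" if \<nu>: "\<nu> \<in> ?Q" and w: "w \<in> ?P (Suc s)" for \<nu> w
    proof -
      have \<nu>c: "\<nu> \<in> carrier ?S" using \<nu> by simp
      have "ideal {c \<in> carrier R. F.const c \<in> {f \<in> carrier ?S. \<nu> \<otimes>\<^bsub>?S\<^esub> f \<in> Idl\<^bsub>?S\<^esub> ?Z}} R"
        by (rule F.const_preimage_ideal[OF F.S.colon_ideal[OF U.is_ideal \<nu>c]])
      moreover have "Y \<subseteq> {c \<in> carrier R. F.const c \<in> {f \<in> carrier ?S. \<nu> \<otimes>\<^bsub>?S\<^esub> f \<in> Idl\<^bsub>?S\<^esub> ?Z}}"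
      proof
        fix y assume y: "y \<in> Y"
        have "\<nu> \<otimes>\<^bsub>?S\<^esub> F.const y \<in> ?Z" using \<nu> y by blast
        then show "y \<in> {c \<in> carrier R. F.const c \<in> {f \<in> carrier ?S. \<nu> \<otimes>\<^bsub>?S\<^esub> f \<in> Idl\<^bsub>?S\<^esub> ?Z}}"
          using F.S.genideal_self[OF Z] y Y(1) cB[of y] by (simp only: mem_Collect_eq fun_ring_simps(1)) blast
      qed
      ultimately have "Idl Y \<subseteq> {c \<in> carrier R. F.const c \<in> {f \<in> carrier ?S. \<nu> \<otimes>\<^bsub>?S\<^esub> f \<in> Idl\<^bsub>?S\<^esub> ?Z}}"
        by (rule genideal_minimal)
      then show ?thesis using w Y(3) by blast
    qed
    \<comment> \<open>The generic generator \<open>\<Gamma> j\<close> and the constant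
      \<open>\<gamma> J j\<close> agree at \<open>J\<close>. Their difference combines elements of
      \<open>X\<close> with the coefficients \<open>\<tau> j x\<close> minus their values at
      \<open>J\<close>, which vanish at \<open>J\<close> and so lie in \<open>?Q\<close>. Times
      \<open>b\<close>, the error is in \<open>?Q\<close> times the constants from
      \<open>I^(s+1)\<close>, exactly the part that Nakayama's lemma absorbs. Errors away from
      \<open>J\<close> are covered as well, since the identity \<open>key\<close> holds at every
      \<open>J'\<close>.\<close>
    have gen: "F.const (b \<otimes> \<gamma> J j) \<in> Idl\<^bsub>?S\<^esub> ?Z" if b: "b \<in> ?P s" and j: "j < n" for b j
    proof -
      have bc: "b \<in> carrier R" using Pc[OF b] .
      have cc: "F.const b \<in> carrier ?S" "\<Gamma> j \<in> carrier ?S" using cB[OF bc] \<Gamma>B[OF j] by simp_all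
      have "\<Gamma> j \<otimes>\<^bsub>?S\<^esub> F.const b \<in> N s"
        unfolding N_def using F.S.genideal_self[OF G] b j unfolding G_def by blast
      then have 1: "\<Gamma> j \<otimes>\<^bsub>?S\<^esub> F.const b \<in> Idl\<^bsub>?S\<^esub> ?Z" using F.S.genideal_self[OF Z] by blast
      let ?D = "\<lambda>x. (\<tau> j x \<ominus>\<^bsub>?S\<^esub> F.const (C J j x)) \<otimes>\<^bsub>?S\<^esub> F.const (b \<otimes> x)"
      have D: "?D x \<in> Idl\<^bsub>?S\<^esub> ?Z" if x: "x \<in> X" for x
      proof (rule QP)
        have c: "\<tau> j x \<in> B" "F.const (C J j x) \<in> B" using \<tau>B[OF j x] cB[OF Cc[OF J j x]] by blast+
        have "(\<tau> j x \<ominus>\<^bsub>?S\<^esub> F.const (C J j x)) J = \<zero>"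
          using F.S_minus[OF c J] J Cc[OF J j x] by (simp add: \<tau>_def)
        moreover have "\<tau> j x \<ominus>\<^bsub>?S\<^esub> F.const (C J j x) \<in> B"
          using F.S.minus_closed[of "\<tau> j x" "F.const (C J j x)"] c by (simp only: fun_ring_simps(1))
        ultimately show "\<tau> j x \<ominus>\<^bsub>?S\<^esub> F.const (C J j x) \<in> ?Q"
          using additive_subgroup.zero_closed[OF max.additive_subgroup_axioms] by simp
        have "x \<in> I" using X genideal_self[OF X(1)] x by blast
        then show "b \<otimes> x \<in> ?P (Suc s)" unfolding ideal_pow_Suc by (rule ideal_prod.prod[OF b])
      qed
      have "finsum ?S ?D X \<in> Idl\<^bsub>?S\<^esub> ?Z" by (rule U.finsum_in[OF D])
      have DB: "?D x \<in> B" if "x \<in> X" for x using U.Icarr[OF D[OF that]] by (simp only: fun_ring_simps(1))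
      have sB: "finsum ?S ?D X \<in> carrier ?S" by (rule F.S.finsum_closed) (use DB in auto)
      have key: "F.const (b \<otimes> \<gamma> J j) = \<Gamma> j \<otimes>\<^bsub>?S\<^esub> F.const b \<ominus>\<^bsub>?S\<^esub> finsum ?S ?D X"
      proof (rule F.B_ext)
        have g: "\<gamma> J j \<in> carrier R" using \<gamma>c[OF J j] .
        show "F.const (b \<otimes> \<gamma> J j) \<in> B" using cB bc g by simp
        have m: "\<Gamma> j \<otimes>\<^bsub>?S\<^esub> F.const b \<in> carrier ?S" by (rule F.S.m_closed[OF cc(2,1)])
        show "\<Gamma> j \<otimes>\<^bsub>?S\<^esub> F.const b \<ominus>\<^bsub>?S\<^esub> finsum ?S ?D X \<in> B"
          using F.S.minus_closed[OF m sB] by (simp only: fun_ring_simps(1))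
        fix J' assume J': "J' \<in> \<Omega>"
        have g': "\<gamma> J' j \<in> carrier R" using \<gamma>c[OF J' j] .
        have "finsum ?S ?D X J' = (\<Oplus>x\<in>X. ?D x J')" by (rule F.S_finsum[OF X(2) DB J'])
        also have "\<dots> = (\<Oplus>x\<in>X. (b \<otimes> C J' j x \<ominus> b \<otimes> C J j x) \<otimes> x)"
        proof (rule finsum_cong')
          show "(\<lambda>x. (b \<otimes> C J' j x \<ominus> b \<otimes> C J j x) \<otimes> x) \<in> X \<rightarrow> carrier R"
            using bc Cc[OF J' j] Cc[OF J j] X(1) by auto
          fix x assume x: "x \<in> X"
          have c: "\<tau> j x \<in> B" "F.const (C J j x) \<in> B" using \<tau>B[OF j x] cB[OF Cc[OF J j x]] by blast+
          have xc: "x \<in> carrier R" "C J' j x \<in> carrier R" "C J j x \<in> carrier R"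
            using x X(1) Cc[OF J' j x] Cc[OF J j x] by auto
          have "?D x J' = (C J' j x \<ominus> C J j x) \<otimes> (b \<otimes> x)"
            using F.S_minus[OF c J'] J' by (simp add: \<tau>_def)
          also have "\<dots> = (b \<otimes> C J' j x \<ominus> b \<otimes> C J j x) \<otimes> x"
          proof -
            have "(p \<ominus> q) \<otimes> (b \<otimes> x) = (b \<otimes> p \<ominus> b \<otimes> q) \<otimes> x" if "p \<in> carrier R" "q \<in> carrier R" for p q
              using that bc xc(1) by algebra
            then show ?thesis using xc(2,3) by blast
          qed
          finally show "?D x J' = (b \<otimes> C J' j x \<ominus> b \<otimes> C J j x) \<otimes> x" .
        qed simp
        also have "\<dots> = b \<otimes> (\<Oplus>x\<in>X. C J' j x \<otimes> x) \<ominus> b \<otimes> (\<Oplus>x\<in>X. C J j x \<otimes> x)"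
          by (rule finsum_elimination) (use X(1,2) bc Cc[OF J' j] Cc[OF J j] in auto)
        also have "\<dots> = b \<otimes> \<gamma> J' j \<ominus> b \<otimes> \<gamma> J j" using C[OF J j] C[OF J' j] by simp
        finally have sum: "finsum ?S ?D X J' = b \<otimes> \<gamma> J' j \<ominus> b \<otimes> \<gamma> J j" .
        have "(\<Gamma> j \<otimes>\<^bsub>?S\<^esub> F.const b \<ominus>\<^bsub>?S\<^esub> finsum ?S ?D X) J' = (\<Gamma> j \<otimes>\<^bsub>?S\<^esub> F.const b) J' \<ominus> finsum ?S ?D X J'"
          by (rule F.S_minus) (use m sB J' in \<open>simp_all only: fun_ring_simps(1)\<close>)
        also have "\<dots> = \<gamma> J' j \<otimes> b \<ominus> (b \<otimes> \<gamma> J' j \<ominus> b \<otimes> \<gamma> J j)"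
          unfolding sum using J' by (simp add: \<Gamma>_def)
        also have "\<dots> = b \<otimes> \<gamma> J j"
        proof -
          have "p \<otimes> b \<ominus> (b \<otimes> p \<ominus> b \<otimes> q) = b \<otimes> q" if "p \<in> carrier R" "q \<in> carrier R" for p q
            using that bc by algebra
          then show ?thesis using g g' by blast
        qed
        finally show "F.const (b \<otimes> \<gamma> J j) J' = (\<Gamma> j \<otimes>\<^bsub>?S\<^esub> F.const b \<ominus>\<^bsub>?S\<^esub> finsum ?S ?D X) J'" using J' by simp
      qed
      show ?thesis unfolding key by (rule U.minus_in) fact+
    qed
    have "g \<otimes> b \<in> {c \<in> carrier R. F.const c \<in> Idl\<^bsub>?S\<^esub> ?Z}" if g: "g \<in> J" and b: "b \<in> ?P s" for g b
    proof -
      have bc: "b \<in> carrier R" using Pc[OF b] .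
      have gc: "\<gamma> J ` {..<n} \<subseteq> carrier R" using \<gamma>c[OF J] by blast
      have T: "ideal {c \<in> carrier R. F.const c \<in> Idl\<^bsub>?S\<^esub> ?Z} R" by (rule F.const_preimage_ideal[OF U.is_ideal])
      have "b \<otimes> g \<in> {c \<in> carrier R. F.const c \<in> Idl\<^bsub>?S\<^esub> ?Z}"
      proof (rule colon_ideal_Idl[OF T bc gc])
        show "g \<in> Idl (\<gamma> J ` {..<n})" using g \<gamma>J[OF J] by simp
        fix y assume "y \<in> \<gamma> J ` {..<n}"
        then obtain j where j: "j < n" "y = \<gamma> J j" by blast
        show "b \<otimes> y \<in> {c \<in> carrier R. F.const c \<in> Idl\<^bsub>?S\<^esub> ?Z}"
          unfolding j(2) using gen[OF b j(1)] m_closed[OF bc \<gamma>c[OF J j(1)]] by (simp only: mem_Collect_eq)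
      qed
      then show ?thesis using m_comm[OF bc ideal.Icarr[OF Ji g]] by (simp only:)
    qed
    then have "?P (Suc s) \<subseteq> {c \<in> carrier R. F.const c \<in> Idl\<^bsub>?S\<^esub> ?Z}"
      unfolding s(1) using ideal_prod_subset_iff[OF F.const_preimage_ideal[OF U.is_ideal]] by blast
    then have YZ: "F.const y \<in> Idl\<^bsub>?S\<^esub> ?Z" if "y \<in> Y" for y using that Y(3) genideal_self[OF Y(1)] by blast
    have "\<exists>h\<in>carrier ?S - ?Q. \<forall>y\<in>?Y. h \<otimes>\<^bsub>?S\<^esub> y \<in> N s"
    proof (rule F.S.nakayama_prime[OF _ Yc N Q primeideal.one_notin[OF Q]])
      show "finite ?Y" using Y(2) by blast
      fix y assume "y \<in> ?Y"
      then obtain c where c: "c \<in> Y" "y = F.const c" by blast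
      have "\<one>\<^bsub>?S\<^esub> \<otimes>\<^bsub>?S\<^esub> F.const c = F.const c" by (rule F.S.l_one) (use Yc c in blast)
      then show "\<one>\<^bsub>?S\<^esub> \<otimes>\<^bsub>?S\<^esub> y \<in> Idl\<^bsub>?S\<^esub> ?Z" using YZ[OF c(1)] unfolding c(2) by (simp only:)
    qed
    then obtain h where h: "h \<in> carrier ?S" "h \<notin> ?Q" "\<And>y. y \<in> Y \<Longrightarrow> h \<otimes>\<^bsub>?S\<^esub> F.const y \<in> N s" by blast
    have hB: "h \<in> B" using h(1) by simp
    have "Idl Y \<subseteq> {c \<in> carrier R. F.const c \<in> {f \<in> carrier ?S. h \<otimes>\<^bsub>?S\<^esub> f \<in> N s}}"
    proof (rule genideal_minimal[OF F.const_preimage_ideal[OF F.S.colon_ideal[OF N h(1)]]])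
      show "Y \<subseteq> {c \<in> carrier R. F.const c \<in> {f \<in> carrier ?S. h \<otimes>\<^bsub>?S\<^esub> f \<in> N s}}"
        using h(3) Y(1) Yc by blast
    qed
    then have "h \<in> L s" unfolding L_def Y(3) using hB by blast
    \<comment> \<open>The exponent \<open>s\<close> depended on \<open>J\<close>; stabilisation of
      the transporters trades it for the fixed \<open>r\<close>.\<close>
    then have hL: "h \<in> L r" using r[OF s(2)] by simp
    have T: "ideal (J \<cdot> ?P r) R" by (rule ideal_prod_is_ideal[OF Ji P])
    have NT: "N r \<subseteq> {g \<in> B. g J \<in> J \<cdot> ?P r}"
      unfolding N_def
    proof (rule F.S.genideal_minimal[OF F.evaluation_preimage_ideal[OF T J]])
      show "G r \<subseteq> {g \<in> B. g J \<in> J \<cdot> ?P r}"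
      proof
        fix g assume g: "g \<in> G r"
        then obtain j y where j: "g = \<Gamma> j \<otimes>\<^bsub>?S\<^esub> F.const y" "j < n" "y \<in> ?P r" unfolding G_def by blast
        have gc: "\<gamma> J ` {..<n} \<subseteq> carrier R" using \<gamma>c[OF J] by blast
        have "\<gamma> J j \<in> J" using \<gamma>J[OF J] genideal_self[OF gc] j(2) by blast
        then have "g J \<in> J \<cdot> ?P r" using j J ideal_prod.prod[of "\<gamma> J j" J y "?P r" R] by (simp add: \<Gamma>_def)
        moreover have "g \<in> B" using subsetD[OF G g] by (simp only: fun_ring_simps(1))
        ultimately show "g \<in> {g \<in> B. g J \<in> J \<cdot> ?P r}" by blast
      qed
    qed
    have hU: "h J \<in> Units R" using h(2) hB F.B_value[OF hB J] notin_max_ideal_Units by blast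
    show ?thesis
    proof
      show "?P (Suc r) \<subseteq> J \<cdot> ?P r"
      proof
        fix w assume w: "w \<in> ?P (Suc r)"
        have "h \<otimes>\<^bsub>?S\<^esub> F.const w \<in> N r" using hL w unfolding L_def by blast
        then have "(h \<otimes>\<^bsub>?S\<^esub> F.const w) J \<in> J \<cdot> ?P r" using NT by blast
        then have hw: "h J \<otimes> w \<in> J \<cdot> ?P r" using J by simp
        have "inv (h J) \<otimes> (h J \<otimes> w) = (inv (h J) \<otimes> h J) \<otimes> w"
          using hU Pc[OF w] by (intro m_assoc[symmetric]) auto
        also have "\<dots> = w" using hU Pc[OF w] by simp
        finally show "w \<in> J \<cdot> ?P r" using ideal.I_l_closed[OF T hw Units_inv_closed[OF hU]] by simp
      qed
      show "J \<cdot> ?P r \<subseteq> ?P (Suc r)"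
        unfolding ideal_pow_Suc ideal_prod_commute[OF P I] by (rule ideal_prod_mono[OF JI subset_refl])
    qed
  qed
  then show ?thesis unfolding \<Omega>_def by blast
qed

end

section \<open>Arithmetic of fractions, the local ring at a prime, and localized ideals\<close>

section \<open>Localization at a prime\<close>

definition frac :: "('a, 'b) ring_scheme \<Rightarrow> 'a set \<Rightarrow> 'a \<Rightarrow> 'a \<Rightarrow> ('a \<times> 'a) set"
  where "frac R \<qq> a s = loc_rel R \<qq> `` {(a, s)}"

lemma (in cring) m_minus_distrib:
  assumes "x \<in> carrier R" "y \<in> carrier R" "z \<in> carrier R"
  shows "z \<otimes> (x \<ominus> y) = \<zero> \<longleftrightarrow> z \<otimes> x = z \<otimes> y"
proof -
  have "z \<otimes> (x \<ominus> y) = z \<otimes> x \<ominus> z \<otimes> y" using assms by algebra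
  then show ?thesis using assms r_right_minus_eq[of "z \<otimes> x" "z \<otimes> y"] by simp
qed

context primeideal
begin

abbreviation Den :: "'a set" where "Den \<equiv> carrier R - I"

lemma mem_loc_rel_iff:
  assumes "a \<in> carrier R" "s \<in> Den" "b \<in> carrier R" "t \<in> Den"
  shows "((a, s), (b, t)) \<in> loc_rel R I \<longleftrightarrow> (\<exists>u\<in>Den. u \<otimes> (a \<otimes> t) = u \<otimes> (b \<otimes> s))"
proof -
  have "u \<otimes> (a \<otimes> t \<ominus> b \<otimes> s) = \<zero> \<longleftrightarrow> u \<otimes> (a \<otimes> t) = u \<otimes> (b \<otimes> s)" if "u \<in> Den" for u
    using m_minus_distrib[of "a \<otimes> t" "b \<otimes> s" u] assms that by simp
  then show ?thesis unfolding loc_rel_def using assms by auto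
qed

lemma equiv_loc_rel: "equiv (carrier R \<times> Den) (loc_rel R I)"
proof (rule equivI)
  have "x \<otimes> y \<ominus> x \<otimes> y = \<zero>" if "x \<in> carrier R" "y \<in> carrier R" for x y using that by algebra
  then have rfl: "((a, s), (a, s)) \<in> loc_rel R I" if "a \<in> carrier R" "s \<in> Den" for a s
    using that one_notin by (subst mem_loc_rel_iff) auto
  show "loc_rel R I \<subseteq> (carrier R \<times> Den) \<times> carrier R \<times> Den" unfolding loc_rel_def by auto
  show "refl_on (carrier R \<times> Den) (loc_rel R I)"
    using rfl by (auto intro!: refl_onI)
  show "sym (loc_rel R I)"
  proof (rule symI)
    fix p r assume h: "(p, r) \<in> loc_rel R I"
    obtain a s b t where pr: "p = (a, s)" "r = (b, t)" by (meson surj_pair)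
    have c: "a \<in> carrier R" "s \<in> Den" "b \<in> carrier R" "t \<in> Den" using h unfolding pr loc_rel_def by auto
    obtain u where "u \<in> Den" "u \<otimes> (a \<otimes> t) = u \<otimes> (b \<otimes> s)"
      using h unfolding pr mem_loc_rel_iff[OF c] by blast
    then show "(r, p) \<in> loc_rel R I" unfolding pr mem_loc_rel_iff[OF c(3,4,1,2)] by metis
  qed
  show "trans (loc_rel R I)"
  proof (rule transI)
    fix p q r assume h: "(p, q) \<in> loc_rel R I" "(q, r) \<in> loc_rel R I"
    obtain a s b t d v where pr: "p = (a, s)" "q = (b, t)" "r = (d, v)" by (meson surj_pair)
    have c: "a \<in> carrier R" "s \<in> Den" "b \<in> carrier R" "t \<in> Den" "d \<in> carrier R" "v \<in> Den"
      using h unfolding pr loc_rel_def by auto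
    obtain u where u: "u \<in> Den" "u \<otimes> (a \<otimes> t) = u \<otimes> (b \<otimes> s)"
      using h(1) unfolding pr mem_loc_rel_iff[OF c(1-4)] by blast
    obtain w where w: "w \<in> Den" "w \<otimes> (b \<otimes> v) = w \<otimes> (d \<otimes> t)"
      using h(2) unfolding pr mem_loc_rel_iff[OF c(3-6)] by blast
    have cc: "a \<in> carrier R" "s \<in> carrier R" "b \<in> carrier R" "t \<in> carrier R" "d \<in> carrier R" "v \<in> carrier R"
      "u \<in> carrier R" "w \<in> carrier R" using c u w by auto
    have "(u \<otimes> w \<otimes> t) \<otimes> (a \<otimes> v) = (w \<otimes> v) \<otimes> (u \<otimes> (a \<otimes> t))" using cc by algebra
    also have "\<dots> = (u \<otimes> s) \<otimes> (w \<otimes> (b \<otimes> v))" unfolding u(2) using cc by algebra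
    also have "\<dots> = (u \<otimes> w \<otimes> t) \<otimes> (d \<otimes> s)" unfolding w(2) using cc by algebra
    finally have "(u \<otimes> w \<otimes> t) \<otimes> (a \<otimes> v) = (u \<otimes> w \<otimes> t) \<otimes> (d \<otimes> s)" .
    moreover have "u \<otimes> w \<otimes> t \<in> Den" using mult_notin u w c by blast
    ultimately show "(p, r) \<in> loc_rel R I" unfolding pr mem_loc_rel_iff[OF c(1,2,5,6)] by blast
  qed
qed

lemma frac_eq_iff:
  assumes "a \<in> carrier R" "s \<in> Den" "b \<in> carrier R" "t \<in> Den"
  shows "frac R I a s = frac R I b t \<longleftrightarrow> (\<exists>u\<in>Den. u \<otimes> (a \<otimes> t) = u \<otimes> (b \<otimes> s))"
  unfolding frac_def mem_loc_rel_iff[OF assms, symmetric]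
  using eq_equiv_class_iff[OF equiv_loc_rel] assms by blast

lemma frac_eqI:
  assumes "a \<in> carrier R" "s \<in> Den" "b \<in> carrier R" "t \<in> Den" "a \<otimes> t = b \<otimes> s"
  shows "frac R I a s = frac R I b t"
  unfolding frac_eq_iff[OF assms(1-4)] using assms(5) one_notin by metis

lemma mem_frac_iff:
  assumes "a \<in> carrier R" "s \<in> Den"
  shows "(b, t) \<in> frac R I a s \<longleftrightarrow> b \<in> carrier R \<and> t \<in> Den \<and> frac R I b t = frac R I a s"
proof
  assume "(b, t) \<in> frac R I a s"
  then have h: "((a, s), (b, t)) \<in> loc_rel R I" unfolding frac_def by blast
  then have "b \<in> carrier R" "t \<in> Den" unfolding loc_rel_def by auto
  then show "b \<in> carrier R \<and> t \<in> Den \<and> frac R I b t = frac R I a s"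
    using equiv_class_eq[OF equiv_loc_rel h] unfolding frac_def by simp
next
  assume h: "b \<in> carrier R \<and> t \<in> Den \<and> frac R I b t = frac R I a s"
  then have "(b, t) \<in> frac R I b t"
    unfolding frac_def using equiv_class_self[OF equiv_loc_rel, of "(b, t)"] by blast
  then show "(b, t) \<in> frac R I a s" using h by simp
qed

lemma loc_carrier: "carrier (loc R I) = {frac R I a s | a s. a \<in> carrier R \<and> s \<in> Den}"
  unfolding loc_def frac_def quotient_def by auto

lemma frac_closed: "\<lbrakk>a \<in> carrier R; s \<in> Den\<rbrakk> \<Longrightarrow> frac R I a s \<in> carrier (loc R I)"
  unfolding loc_carrier by blast

text \<open>The operations of \<open>loc\<close> are unions over all representatives; such a union
  collapses to one class because the summand is the same for every representative.\<close>

lemma UN_frac_const: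
  assumes "a \<in> carrier R" "s \<in> Den"
    and "\<And>b t. \<lbrakk>b \<in> carrier R; t \<in> Den; frac R I b t = frac R I a s\<rbrakk> \<Longrightarrow> F b t = c"
  shows "(\<Union>(b, t)\<in>frac R I a s. F b t) = c"
proof -
  have "(a, s) \<in> frac R I a s" using mem_frac_iff[OF assms(1,2)] assms(1,2) by blast
  moreover have "(case p of (b, t) \<Rightarrow> F b t) = c" if "p \<in> frac R I a s" for p
  proof -
    obtain b t where p: "p = (b, t)" by (rule prod.exhaust)
    have "b \<in> carrier R \<and> t \<in> Den \<and> frac R I b t = frac R I a s"
      using that mem_frac_iff[OF assms(1,2)] unfolding p by blast
    then have "F b t = c" by (intro assms(3)) blast+
    then show ?thesis unfolding p by simp
  qed
  ultimately show ?thesis by (metis (no_types, lifting) SUP_eq_const empty_iff)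
qed

lemma frac_mult_cong:
  assumes "a \<in> carrier R" "s \<in> Den" "b \<in> carrier R" "t \<in> Den"
    and "a' \<in> carrier R" "s' \<in> Den" "b' \<in> carrier R" "t' \<in> Den"
    and "frac R I a' s' = frac R I a s" "frac R I b' t' = frac R I b t"
  shows "frac R I (a' \<otimes> b') (s' \<otimes> t') = frac R I (a \<otimes> b) (s \<otimes> t)"
proof -
  obtain u where u: "u \<in> Den" "u \<otimes> (a' \<otimes> s) = u \<otimes> (a \<otimes> s')"
    using assms(9) unfolding frac_eq_iff[OF assms(5,6,1,2)] by blast
  obtain v where v: "v \<in> Den" "v \<otimes> (b' \<otimes> t) = v \<otimes> (b \<otimes> t')"
    using assms(10) unfolding frac_eq_iff[OF assms(7,8,3,4)] by blast
  have c: "u \<in> carrier R" "v \<in> carrier R" "s \<in> carrier R" "s' \<in> carrier R" "t \<in> carrier R" "t' \<in> carrier R"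
    using u v assms by auto
  note c = c assms(1,3,5,7)
  have "(u \<otimes> v) \<otimes> ((a' \<otimes> b') \<otimes> (s \<otimes> t)) = (u \<otimes> (a' \<otimes> s)) \<otimes> (v \<otimes> (b' \<otimes> t))" using c by algebra
  also have "\<dots> = (u \<otimes> v) \<otimes> ((a \<otimes> b) \<otimes> (s' \<otimes> t'))" unfolding u(2) v(2) using c by algebra
  finally have "(u \<otimes> v) \<otimes> ((a' \<otimes> b') \<otimes> (s \<otimes> t)) = (u \<otimes> v) \<otimes> ((a \<otimes> b) \<otimes> (s' \<otimes> t'))" .
  moreover have "u \<otimes> v \<in> Den" "s' \<otimes> t' \<in> Den" "s \<otimes> t \<in> Den" using mult_notin u v assms by blast+
  ultimately show ?thesis using assms by (subst frac_eq_iff) auto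
qed

lemma frac_add_cong:
  assumes "a \<in> carrier R" "s \<in> Den" "b \<in> carrier R" "t \<in> Den"
    and "a' \<in> carrier R" "s' \<in> Den" "b' \<in> carrier R" "t' \<in> Den"
    and "frac R I a' s' = frac R I a s" "frac R I b' t' = frac R I b t"
  shows "frac R I (a' \<otimes> t' \<oplus> b' \<otimes> s') (s' \<otimes> t') = frac R I (a \<otimes> t \<oplus> b \<otimes> s) (s \<otimes> t)"
proof -
  obtain u where u: "u \<in> Den" "u \<otimes> (a' \<otimes> s) = u \<otimes> (a \<otimes> s')"
    using assms(9) unfolding frac_eq_iff[OF assms(5,6,1,2)] by blast
  obtain v where v: "v \<in> Den" "v \<otimes> (b' \<otimes> t) = v \<otimes> (b \<otimes> t')"
    using assms(10) unfolding frac_eq_iff[OF assms(7,8,3,4)] by blast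
  have c: "u \<in> carrier R" "v \<in> carrier R" "s \<in> carrier R" "s' \<in> carrier R" "t \<in> carrier R" "t' \<in> carrier R"
    using u v assms by auto
  note c = c assms(1,3,5,7)
  have "(u \<otimes> v) \<otimes> ((a' \<otimes> t' \<oplus> b' \<otimes> s') \<otimes> (s \<otimes> t)) =
    (v \<otimes> t \<otimes> t') \<otimes> (u \<otimes> (a' \<otimes> s)) \<oplus> (u \<otimes> s \<otimes> s') \<otimes> (v \<otimes> (b' \<otimes> t))" using c by algebra
  also have "\<dots> = (u \<otimes> v) \<otimes> ((a \<otimes> t \<oplus> b \<otimes> s) \<otimes> (s' \<otimes> t'))" unfolding u(2) v(2) using c by algebra
  finally have "(u \<otimes> v) \<otimes> ((a' \<otimes> t' \<oplus> b' \<otimes> s') \<otimes> (s \<otimes> t)) = (u \<otimes> v) \<otimes> ((a \<otimes> t \<oplus> b \<otimes> s) \<otimes> (s' \<otimes> t'))" .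
  moreover have "u \<otimes> v \<in> Den" "s' \<otimes> t' \<in> Den" "s \<otimes> t \<in> Den" using mult_notin u v assms by blast+
  ultimately show ?thesis using assms by (subst frac_eq_iff) auto
qed

lemma frac_mult:
  assumes "a \<in> carrier R" "s \<in> Den" "b \<in> carrier R" "t \<in> Den"
  shows "frac R I a s \<otimes>\<^bsub>loc R I\<^esub> frac R I b t = frac R I (a \<otimes> b) (s \<otimes> t)"
proof -
  have "frac R I a s \<otimes>\<^bsub>loc R I\<^esub> frac R I b t =
    (\<Union>(a', s')\<in>frac R I a s. \<Union>(b', t')\<in>frac R I b t. frac R I (a' \<otimes> b') (s' \<otimes> t'))"
    by (simp add: loc_def frac_def)
  also have "\<dots> = frac R I (a \<otimes> b) (s \<otimes> t)"
    by (intro UN_frac_const frac_mult_cong assms)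
  finally show ?thesis .
qed

lemma frac_add:
  assumes "a \<in> carrier R" "s \<in> Den" "b \<in> carrier R" "t \<in> Den"
  shows "frac R I a s \<oplus>\<^bsub>loc R I\<^esub> frac R I b t = frac R I (a \<otimes> t \<oplus> b \<otimes> s) (s \<otimes> t)"
proof -
  have "frac R I a s \<oplus>\<^bsub>loc R I\<^esub> frac R I b t =
    (\<Union>(a', s')\<in>frac R I a s. \<Union>(b', t')\<in>frac R I b t. frac R I (a' \<otimes> t' \<oplus> b' \<otimes> s') (s' \<otimes> t'))"
    by (simp add: loc_def frac_def)
  also have "\<dots> = frac R I (a \<otimes> t \<oplus> b \<otimes> s) (s \<otimes> t)"
    by (intro UN_frac_const frac_add_cong assms)
  finally show ?thesis .
qed

lemma loc_one: "\<one>\<^bsub>loc R I\<^esub> = frac R I \<one> \<one>"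
  by (simp add: loc_def frac_def)

lemma loc_zero: "\<zero>\<^bsub>loc R I\<^esub> = frac R I \<zero> \<one>"
  by (simp add: loc_def frac_def)

lemma loc_carrierE:
  assumes "x \<in> carrier (loc R I)"
  obtains a s where "a \<in> carrier R" "s \<in> carrier R" "s \<in> Den" "x = frac R I a s"
  using assms unfolding loc_carrier by blast

lemma loc_cring: "cring (loc R I)"
proof (rule cringI)
  note D = mult_notin one_notin
  show "abelian_group (loc R I)"
  proof (rule abelian_groupI)
    fix x y assume "x \<in> carrier (loc R I)" "y \<in> carrier (loc R I)"
    then obtain a s b t where h: "a \<in> carrier R" "s \<in> carrier R" "s \<in> Den" "x = frac R I a s"
      "b \<in> carrier R" "t \<in> carrier R" "t \<in> Den" "y = frac R I b t" by (metis loc_carrierE)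
    show "x \<oplus>\<^bsub>loc R I\<^esub> y \<in> carrier (loc R I)"
      unfolding h(4,8) frac_add[OF h(1,3,5,7)] using h by (intro frac_closed D) auto
    show "x \<oplus>\<^bsub>loc R I\<^esub> y = y \<oplus>\<^bsub>loc R I\<^esub> x"
      unfolding h(4,8) frac_add[OF h(1,3,5,7)] frac_add[OF h(5,7,1,3)]
    proof (rule frac_eqI)
      show "(a \<otimes> t \<oplus> b \<otimes> s) \<otimes> (t \<otimes> s) = (b \<otimes> s \<oplus> a \<otimes> t) \<otimes> (s \<otimes> t)" using h(1,2,5,6) by algebra
    qed (use h in \<open>auto intro!: D(1)[of _ _, THEN DiffD1] dest: I_prime\<close>)
    fix z assume "z \<in> carrier (loc R I)"
    then obtain c v where k: "c \<in> carrier R" "v \<in> carrier R" "v \<in> Den" "z = frac R I c v" by (metis loc_carrierE)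
    have st: "s \<otimes> t \<in> Den" "t \<otimes> v \<in> Den" using D h k by blast+
    have n: "a \<otimes> t \<oplus> b \<otimes> s \<in> carrier R" "b \<otimes> v \<oplus> c \<otimes> t \<in> carrier R" using h k by auto
    show "x \<oplus>\<^bsub>loc R I\<^esub> y \<oplus>\<^bsub>loc R I\<^esub> z = x \<oplus>\<^bsub>loc R I\<^esub> (y \<oplus>\<^bsub>loc R I\<^esub> z)"
      unfolding h(4,8) k(4) frac_add[OF h(1,3,5,7)] frac_add[OF h(5,7) k(1,3)]
        frac_add[OF n(1) st(1) k(1,3)] frac_add[OF h(1,3) n(2) st(2)]
    proof (rule frac_eqI)
      show "((a \<otimes> t \<oplus> b \<otimes> s) \<otimes> v \<oplus> c \<otimes> (s \<otimes> t)) \<otimes> (s \<otimes> (t \<otimes> v)) =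
        (a \<otimes> (t \<otimes> v) \<oplus> (b \<otimes> v \<oplus> c \<otimes> t) \<otimes> s) \<otimes> (s \<otimes> t \<otimes> v)" using h(1,2,5,6) k(1,2) by algebra
      show "s \<otimes> t \<otimes> v \<in> Den" "s \<otimes> (t \<otimes> v) \<in> Den" using D(1) st h k by blast+
    qed (use h k n in auto)
  next
    show "\<zero>\<^bsub>loc R I\<^esub> \<in> carrier (loc R I)" unfolding loc_zero by (intro frac_closed D) auto
    fix x assume "x \<in> carrier (loc R I)"
    then obtain a s where h: "a \<in> carrier R" "s \<in> carrier R" "s \<in> Den" "x = frac R I a s" by (metis loc_carrierE)
    show "\<zero>\<^bsub>loc R I\<^esub> \<oplus>\<^bsub>loc R I\<^esub> x = x"
      unfolding h(4) loc_zero frac_add[OF zero_closed D(2) h(1,3)] using h by simp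
    have m: "\<ominus> a \<in> carrier R" using h by simp
    have "frac R I (\<ominus> a) s \<oplus>\<^bsub>loc R I\<^esub> x = \<zero>\<^bsub>loc R I\<^esub>"
      unfolding h(4) loc_zero frac_add[OF m h(3,1,3)]
    proof (rule frac_eqI)
      show "(\<ominus> a \<otimes> s \<oplus> a \<otimes> s) \<otimes> \<one> = \<zero> \<otimes> (s \<otimes> s)" using h(1,2) by algebra
      show "s \<otimes> s \<in> Den" using D(1) h by blast
    qed (use h D in auto)
    then show "\<exists>y\<in>carrier (loc R I). y \<oplus>\<^bsub>loc R I\<^esub> x = \<zero>\<^bsub>loc R I\<^esub>" using frac_closed[OF m h(3)] by blast
  qed
  show "comm_monoid (loc R I)"
  proof (rule comm_monoidI)
    fix x y assume "x \<in> carrier (loc R I)" "y \<in> carrier (loc R I)"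
    then obtain a s b t where h: "a \<in> carrier R" "s \<in> carrier R" "s \<in> Den" "x = frac R I a s"
      "b \<in> carrier R" "t \<in> carrier R" "t \<in> Den" "y = frac R I b t" by (metis loc_carrierE)
    show "x \<otimes>\<^bsub>loc R I\<^esub> y \<in> carrier (loc R I)"
      unfolding h(4,8) frac_mult[OF h(1,3,5,7)] using h by (intro frac_closed D) auto
    show "x \<otimes>\<^bsub>loc R I\<^esub> y = y \<otimes>\<^bsub>loc R I\<^esub> x"
      unfolding h(4,8) frac_mult[OF h(1,3,5,7)] frac_mult[OF h(5,7,1,3)]
      using m_comm h(1,2,5,6) by simp
    fix z assume "z \<in> carrier (loc R I)"
    then obtain c v where k: "c \<in> carrier R" "v \<in> carrier R" "v \<in> Den" "z = frac R I c v" by (metis loc_carrierE)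
    have st: "s \<otimes> t \<in> Den" "t \<otimes> v \<in> Den" using D h k by blast+
    have n: "a \<otimes> b \<in> carrier R" "b \<otimes> c \<in> carrier R" using h k by auto
    show "x \<otimes>\<^bsub>loc R I\<^esub> y \<otimes>\<^bsub>loc R I\<^esub> z = x \<otimes>\<^bsub>loc R I\<^esub> (y \<otimes>\<^bsub>loc R I\<^esub> z)"
      unfolding h(4,8) k(4) frac_mult[OF h(1,3,5,7)] frac_mult[OF h(5,7) k(1,3)]
        frac_mult[OF n(1) st(1) k(1,3)] frac_mult[OF h(1,3) n(2) st(2)]
      using m_assoc h(1,2,5,6) k(1,2) by simp
  next
    show "\<one>\<^bsub>loc R I\<^esub> \<in> carrier (loc R I)" unfolding loc_one by (intro frac_closed D) auto
    fix x assume "x \<in> carrier (loc R I)"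
    then obtain a s where h: "a \<in> carrier R" "s \<in> carrier R" "s \<in> Den" "x = frac R I a s" by (metis loc_carrierE)
    show "\<one>\<^bsub>loc R I\<^esub> \<otimes>\<^bsub>loc R I\<^esub> x = x"
      unfolding h(4) loc_one frac_mult[OF one_closed D(2) h(1,3)] using h by simp
  qed
  fix x y z assume "x \<in> carrier (loc R I)" "y \<in> carrier (loc R I)" "z \<in> carrier (loc R I)"
  then obtain a s b t c v where h: "a \<in> carrier R" "s \<in> carrier R" "s \<in> Den" "x = frac R I a s"
      "b \<in> carrier R" "t \<in> carrier R" "t \<in> Den" "y = frac R I b t"
      "c \<in> carrier R" "v \<in> carrier R" "v \<in> Den" "z = frac R I c v" by (metis loc_carrierE)
  have st: "s \<otimes> t \<in> Den" "t \<otimes> v \<in> Den" "s \<otimes> v \<in> Den" using D h by blast+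
  have n: "a \<otimes> t \<oplus> b \<otimes> s \<in> carrier R" "a \<otimes> c \<in> carrier R" "b \<otimes> c \<in> carrier R" using h by auto
  show "(x \<oplus>\<^bsub>loc R I\<^esub> y) \<otimes>\<^bsub>loc R I\<^esub> z = x \<otimes>\<^bsub>loc R I\<^esub> z \<oplus>\<^bsub>loc R I\<^esub> y \<otimes>\<^bsub>loc R I\<^esub> z"
    unfolding h(4,8,12) frac_add[OF h(1,3,5,7)] frac_mult[OF h(1,3,9,11)] frac_mult[OF h(5,7,9,11)]
      frac_mult[OF n(1) st(1) h(9,11)] frac_add[OF n(2) st(3) n(3) st(2)]
  proof (rule frac_eqI)
    show "(a \<otimes> t \<oplus> b \<otimes> s) \<otimes> c \<otimes> (s \<otimes> v \<otimes> (t \<otimes> v)) =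
      (a \<otimes> c \<otimes> (t \<otimes> v) \<oplus> b \<otimes> c \<otimes> (s \<otimes> v)) \<otimes> (s \<otimes> t \<otimes> v)" using h(1,2,5,6,9,10) by algebra
    show "s \<otimes> t \<otimes> v \<in> Den" "s \<otimes> v \<otimes> (t \<otimes> v) \<in> Den" using D(1) st h by blast+
  qed (use h n in auto)
qed

text \<open>Membership of a fraction does not depend on how it is written: it means that the
  numerator lies in the saturation of \<open>T\<close> with respect to the complement of the
  prime.\<close>

lemma mem_loc_ideal_iff:
  assumes T: "ideal T R" and a: "a \<in> carrier R" "s \<in> Den"
  shows "frac R I a s \<in> loc_ideal R I T \<longleftrightarrow> (\<exists>u\<in>Den. u \<otimes> a \<in> T)"
proof
  interpret T: ideal T R by fact
  assume "frac R I a s \<in> loc_ideal R I T"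
  then obtain b t where b: "b \<in> T" "t \<in> Den" "frac R I a s = frac R I b t"
    unfolding loc_ideal_def frac_def by blast
  have bc: "b \<in> carrier R" using T.Icarr b by blast
  then obtain u where u: "u \<in> Den" "u \<otimes> (a \<otimes> t) = u \<otimes> (b \<otimes> s)" using b frac_eq_iff[OF a bc b(2)] by blast
  have "(u \<otimes> t) \<otimes> a = u \<otimes> (a \<otimes> t)" using u b a m_assoc m_comm by auto
  also have "\<dots> = (u \<otimes> s) \<otimes> b" unfolding u(2) using u bc a m_assoc m_comm by auto
  also have "\<dots> \<in> T" using T.I_l_closed[OF b(1)] u a by auto
  finally show "\<exists>u\<in>Den. u \<otimes> a \<in> T" using mult_notin[OF u(1) b(2)] by blast
next
  assume "\<exists>u\<in>Den. u \<otimes> a \<in> T"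
  then obtain u where u: "u \<in> Den" "u \<otimes> a \<in> T" by blast
  have us: "u \<otimes> s \<in> Den" using mult_notin u a by blast
  have "frac R I a s = frac R I (u \<otimes> a) (u \<otimes> s)"
  proof (rule frac_eqI)
    have "u \<in> carrier R" "s \<in> carrier R" using u a by auto
    then show "a \<otimes> (u \<otimes> s) = u \<otimes> a \<otimes> s" using a(1) by algebra
  qed (use us u a in auto)
  then show "frac R I a s \<in> loc_ideal R I T"
    unfolding loc_ideal_def frac_def using u us by blast
qed

lemma loc_ideal_carrier: "ideal T R \<Longrightarrow> loc_ideal R I T \<subseteq> carrier (loc R I)"
proof -
  assume "ideal T R"
  from frac_closed[OF ideal.Icarr[OF this]] show ?thesis unfolding loc_ideal_def frac_def by blast
qed

lemma loc_ideal_ideal: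
  assumes T: "ideal T R"
  shows "ideal (loc_ideal R I T) (loc R I)"
proof -
  interpret L: cring "loc R I" by (rule loc_cring)
  interpret T: ideal T R by fact
  have fr: "loc_ideal R I T = {frac R I b t | b t. b \<in> T \<and> t \<in> Den}" unfolding loc_ideal_def frac_def ..
  show ?thesis
  proof (rule L.cring_idealI)
    show "loc_ideal R I T \<subseteq> carrier (loc R I)" unfolding fr using frac_closed T.Icarr by blast
    show "\<zero>\<^bsub>loc R I\<^esub> \<in> loc_ideal R I T"
      unfolding fr loc_zero using additive_subgroup.zero_closed[OF T.additive_subgroup_axioms] one_notin by blast
    fix x y assume "x \<in> loc_ideal R I T" "y \<in> loc_ideal R I T"
    then obtain a s b t where h: "a \<in> T" "s \<in> Den" "x = frac R I a s" "b \<in> T" "t \<in> Den" "y = frac R I b t"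
      unfolding fr by blast
    have c: "a \<in> carrier R" "b \<in> carrier R" using h T.Icarr by blast+
    have "a \<otimes> t \<oplus> b \<otimes> s \<in> T" using h by (intro T.add_in T.I_r_closed) auto
    moreover have "s \<otimes> t \<in> Den" using mult_notin h by blast
    ultimately show "x \<oplus>\<^bsub>loc R I\<^esub> y \<in> loc_ideal R I T"
      unfolding h(3,6) frac_add[OF c(1) h(2) c(2) h(5)] unfolding fr by blast
  next
    fix r x assume "r \<in> carrier (loc R I)" "x \<in> loc_ideal R I T"
    then obtain a s b t where h: "a \<in> carrier R" "s \<in> Den" "r = frac R I a s" "b \<in> T" "t \<in> Den" "x = frac R I b t"
      unfolding fr loc_carrier by blast
    have c: "b \<in> carrier R" using h T.Icarr by blast
    have "a \<otimes> b \<in> T" using h by (intro T.I_l_closed) auto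
    moreover have "s \<otimes> t \<in> Den" using mult_notin h by blast
    ultimately show "r \<otimes>\<^bsub>loc R I\<^esub> x \<in> loc_ideal R I T"
      unfolding h(3,6) frac_mult[OF h(1,2) c h(5)] unfolding fr by blast
  qed
qed

lemma mem_loc_ideal_self_iff: "\<lbrakk>a \<in> carrier R; s \<in> Den\<rbrakk> \<Longrightarrow> frac R I a s \<in> loc_ideal R I I \<longleftrightarrow> a \<in> I"
  using mem_loc_ideal_iff[OF is_ideal, of a s] I_prime one_notin by (metis DiffE l_one)

text \<open>A fraction whose numerator avoids the prime can be inverted, so no proper ideal contains
  it.\<close>

lemma loc_ideal_proper_subset:
  assumes "ideal N (loc R I)" "N \<noteq> carrier (loc R I)"
  shows "N \<subseteq> loc_ideal R I I"
proof
  interpret L: cring "loc R I" by (rule loc_cring)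
  fix x assume x: "x \<in> N"
  then obtain a s where h: "a \<in> carrier R" "s \<in> carrier R" "s \<in> Den" "x = frac R I a s"
    using ideal.Icarr[OF assms(1)] by (metis loc_carrierE)
  show "x \<in> loc_ideal R I I"
  proof (rule ccontr)
    assume "x \<notin> loc_ideal R I I"
    then have a: "a \<in> Den" using h mem_loc_ideal_self_iff by blast
    have "frac R I s a \<otimes>\<^bsub>loc R I\<^esub> frac R I a s = \<one>\<^bsub>loc R I\<^esub>"
      unfolding frac_mult[OF h(2) a h(1,3)] loc_one
      using h a mult_notin one_notin m_comm by (intro frac_eqI) auto
    then have "\<one>\<^bsub>loc R I\<^esub> \<in> N"
      using ideal.I_l_closed[OF assms(1) x frac_closed[OF h(2) a]] unfolding h(4) by simp
    then show False using ideal.one_imp_carrier[OF assms(1)] assms(2) by blast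
  qed
qed

lemma maximalideal_loc: "maximalideal (loc_ideal R I I) (loc R I)"
proof (rule maximalidealI[OF loc_ideal_ideal[OF is_ideal]])
  have "\<one>\<^bsub>loc R I\<^esub> \<notin> loc_ideal R I I"
    unfolding loc_one using mem_loc_ideal_self_iff one_notin by blast
  moreover have "\<one>\<^bsub>loc R I\<^esub> \<in> carrier (loc R I)" unfolding loc_one using frac_closed one_notin by blast
  ultimately show "carrier (loc R I) \<noteq> loc_ideal R I I" by blast
  fix J assume "ideal J (loc R I)" "loc_ideal R I I \<subseteq> J" "J \<subseteq> carrier (loc R I)"
  then show "J = loc_ideal R I I \<or> J = carrier (loc R I)" using loc_ideal_proper_subset by blast
qed

lemma max_ideal_loc: "max_ideal (loc R I) = loc_ideal R I I"
  unfolding max_ideal_def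
proof (rule the_equality)
  show "maximalideal (loc_ideal R I I) (loc R I)" by (rule maximalideal_loc)
  fix M assume M: "maximalideal M (loc R I)"
  interpret M: maximalideal M "loc R I" by fact
  have "M \<subseteq> loc_ideal R I I" using loc_ideal_proper_subset[OF M.is_ideal] M.I_notcarr by metis
  then have "loc_ideal R I I = M \<or> loc_ideal R I I = carrier (loc R I)"
    by (intro M.I_maximal loc_ideal_ideal is_ideal loc_ideal_carrier)
  then show "M = loc_ideal R I I" using maximalideal.I_notcarr[OF maximalideal_loc] by metis
qed

lemma frac_one_hom: "ring_hom_cring R (loc R I) (\<lambda>a. frac R I a \<one>)"
proof (rule RingHom.ring_hom_cringI[OF ring_hom_ringI[OF ring_axioms] cring_axioms loc_cring])
  show "ring (loc R I)" by (rule cring.axioms(1)[OF loc_cring])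
  show "frac R I a \<one> \<in> carrier (loc R I)" if "a \<in> carrier R" for a using that frac_closed one_notin by blast
  show "frac R I (a \<otimes> b) \<one> = frac R I a \<one> \<otimes>\<^bsub>loc R I\<^esub> frac R I b \<one>" if "a \<in> carrier R" "b \<in> carrier R" for a b
    using frac_mult[OF that(1) one_notin that(2) one_notin] by simp
  show "frac R I (a \<oplus> b) \<one> = frac R I a \<one> \<oplus>\<^bsub>loc R I\<^esub> frac R I b \<one>" if "a \<in> carrier R" "b \<in> carrier R" for a b
    using frac_add[OF that(1) one_notin that(2) one_notin] that by simp
  show "frac R I \<one> \<one> = \<one>\<^bsub>loc R I\<^esub>" by (rule loc_one[symmetric])
qed

end

context primeideal
begin

lemma loc_ideal_genideal:
  assumes X: "X \<subseteq> carrier R"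
  shows "loc_ideal R I (Idl X) = Idl\<^bsub>loc R I\<^esub> ((\<lambda>a. frac R I a \<one>) ` X)"
proof
  interpret L: cring "loc R I" by (rule loc_cring)
  let ?\<psi> = "\<lambda>a. frac R I a \<one>"
  interpret psi: ring_hom_cring R "loc R I" ?\<psi> by (rule frac_one_hom)
  have XL: "?\<psi> ` X \<subseteq> carrier (loc R I)" using X psi.hom_closed by blast
  let ?N = "Idl\<^bsub>loc R I\<^esub> (?\<psi> ` X)"
  interpret N: ideal ?N "loc R I" by (rule L.genideal_ideal[OF XL])
  interpret T: ideal "Idl X" R by (rule genideal_ideal[OF X])
  show "?N \<subseteq> loc_ideal R I (Idl X)"
  proof (rule L.genideal_minimal[OF loc_ideal_ideal[OF T.is_ideal]])
    show "?\<psi> ` X \<subseteq> loc_ideal R I (Idl X)"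
      using genideal_self[OF X] one_notin unfolding loc_ideal_def frac_def by blast
  qed
  have "ideal {a \<in> carrier R. ?\<psi> a \<in> ?N} R"
  proof (rule cring_idealI)
    show "\<zero> \<in> {a \<in> carrier R. ?\<psi> a \<in> ?N}"
      using psi.hom_zero additive_subgroup.zero_closed[OF N.additive_subgroup_axioms] by simp
    show "x \<oplus> y \<in> {a \<in> carrier R. ?\<psi> a \<in> ?N}"
      if "x \<in> {a \<in> carrier R. ?\<psi> a \<in> ?N}" "y \<in> {a \<in> carrier R. ?\<psi> a \<in> ?N}" for x y
      using that N.add_in[of "?\<psi> x" "?\<psi> y"] psi.hom_add[of x y] by simp
    show "r \<otimes> x \<in> {a \<in> carrier R. ?\<psi> a \<in> ?N}"
      if "r \<in> carrier R" "x \<in> {a \<in> carrier R. ?\<psi> a \<in> ?N}" for r x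
      using that N.I_l_closed[of "?\<psi> x" "?\<psi> r"] psi.hom_mult[of r x] psi.hom_closed[of r] by simp
  qed blast
  moreover have "X \<subseteq> {a \<in> carrier R. ?\<psi> a \<in> ?N}" using X L.genideal_self[OF XL] by blast
  ultimately have sub: "Idl X \<subseteq> {a \<in> carrier R. ?\<psi> a \<in> ?N}" by (rule genideal_minimal)
  show "loc_ideal R I (Idl X) \<subseteq> ?N"
  proof
    fix z assume "z \<in> loc_ideal R I (Idl X)"
    then obtain a s where z: "a \<in> Idl X" "s \<in> Den" "z = frac R I a s" unfolding loc_ideal_def frac_def by blast
    have ac: "a \<in> carrier R" using T.Icarr z by blast
    have "frac R I \<one> s \<otimes>\<^bsub>loc R I\<^esub> ?\<psi> a = z"
      unfolding z(3) using frac_mult[OF one_closed z(2) ac one_notin] z(2) ac by simp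
    moreover have "frac R I \<one> s \<otimes>\<^bsub>loc R I\<^esub> ?\<psi> a \<in> ?N"
      using sub z(1,2) by (intro N.I_l_closed frac_closed) auto
    ultimately show "z \<in> ?N" by simp
  qed
qed

lemma loc_ideal_mono: "S \<subseteq> T \<Longrightarrow> loc_ideal R I S \<subseteq> loc_ideal R I T"
  unfolding loc_ideal_def by blast

lemma common_denominator:
  assumes T: "ideal T R" and X: "finite X" "X \<subseteq> carrier R"
    and "\<And>x. x \<in> X \<Longrightarrow> \<exists>u\<in>Den. u \<otimes> x \<in> T"
  shows "\<exists>u\<in>Den. \<forall>x\<in>X. u \<otimes> x \<in> T"
  using X(1,2) assms(4)
proof (induction X rule: finite_induct)
  case empty
  then show ?case using one_notin by blast
next
  case (insert x X)
  interpret T: ideal T R by fact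
  obtain u where u: "u \<in> Den" "\<forall>x\<in>X. u \<otimes> x \<in> T" using insert by auto
  obtain v where v: "v \<in> Den" "v \<otimes> x \<in> T" using insert.prems(2)[of x] by auto
  have "(u \<otimes> v) \<otimes> y \<in> T" if y: "y \<in> insert x X" for y
  proof (cases "y = x")
    case True
    have "(u \<otimes> v) \<otimes> x = u \<otimes> (v \<otimes> x)" using u v insert.prems m_assoc by auto
    then show ?thesis using T.I_l_closed[OF v(2)] u(1) True by auto
  next
    case False
    have c: "y \<in> carrier R" "u \<in> carrier R" "v \<in> carrier R" using y u v insert.prems by auto
    then have "(u \<otimes> v) \<otimes> y = v \<otimes> (u \<otimes> y)" by algebra
    then show ?thesis using T.I_l_closed[of "u \<otimes> y" v] u(2) c False y by auto
  qed
  then show ?case using mult_notin[OF u(1) v(1)] by blast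
qed

text \<open>The members of a smallest generating set of the localized ideal differ by units from
  their numerators, which therefore generate too. As \<open>J\<close> is finitely generated, a
  single multiplier \<open>a\<close> brings all of it into the ideal of these numerators in
  \<open>R\<close>.\<close>

lemma localized_generators:
  assumes "noetherian_ring R" and J: "ideal J R"
  obtains m b a where "min_gens (loc R I) (loc_ideal R I J) = enat m"
    "\<And>k. k < m \<Longrightarrow> b k \<in> J" "loc_ideal R I J = Idl\<^bsub>loc R I\<^esub> ((\<lambda>k. frac R I (b k) \<one>) ` {..<m})"
    "a \<in> Den" "\<And>x. x \<in> J \<Longrightarrow> a \<otimes> x \<in> Idl (b ` {..<m})"
proof -
  interpret L: cring "loc R I" by (rule loc_cring)
  interpret J: ideal J R by fact
  obtain X where X: "X \<subseteq> carrier R" "finite X" "J = Idl X"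
    using noetherian_ring.finetely_gen[OF assms(1) J] by blast
  let ?\<psi> = "\<lambda>a. frac R I a \<one>"
  let ?A = "{enat (card S) | S. finite S \<and> S \<subseteq> carrier (loc R I) \<and> Idl\<^bsub>loc R I\<^esub> S = loc_ideal R I J}"
  have "?\<psi> ` X \<subseteq> carrier (loc R I)" using X(1) frac_closed one_notin by blast
  then have "enat (card (?\<psi> ` X)) \<in> ?A" using loc_ideal_genideal[OF X(1)] X(2,3) by blast
  \<comment> \<open>\<open>?A\<close> is nonempty, so the infimum defining \<open>min_gens\<close>
    is attained by a finite set.\<close>
  then have "Inf ?A \<in> ?A" by (metis (no_types, lifting) LeastI_ex Inf_enat_def empty_iff)
  then obtain S where S: "finite S" "S \<subseteq> carrier (loc R I)" "Idl\<^bsub>loc R I\<^esub> S = loc_ideal R I J"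
    "min_gens (loc R I) (loc_ideal R I J) = enat (card S)" unfolding min_gens_def by force
  define m where "m = card S"
  obtain z where z: "bij_betw z {0..<m} S" using ex_bij_betw_nat_finite[OF S(1)] unfolding m_def by blast
  have zS: "z ` {..<m} = S" using bij_betw_imp_surj_on[OF z] by (simp add: atLeast0LessThan)
  have SJ: "S \<subseteq> loc_ideal R I J" using S(3) L.genideal_self[OF S(2)] by simp
  have "\<exists>b s. b \<in> J \<and> s \<in> Den \<and> z k = frac R I b s" if "k < m" for k
  proof -
    have "z k \<in> loc_ideal R I J" using that zS SJ by blast
    then show ?thesis unfolding loc_ideal_def frac_def by blast
  qed
  then obtain b s where bs: "\<And>k. k < m \<Longrightarrow> b k \<in> J" "\<And>k. k < m \<Longrightarrow> s k \<in> Den" "\<And>k. k < m \<Longrightarrow> z k = frac R I (b k) (s k)"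
    by metis
  let ?T = "Idl (b ` {..<m})"
  have bJ: "b ` {..<m} \<subseteq> J" using bs(1) by blast
  have bc: "b ` {..<m} \<subseteq> carrier R" using bJ J.Icarr by blast
  interpret T: ideal ?T R by (rule genideal_ideal[OF bc])
  have TJ: "?T \<subseteq> J" by (rule genideal_minimal[OF J bJ])
  have "S \<subseteq> loc_ideal R I ?T"
  proof
    fix y assume "y \<in> S"
    then obtain k where "k < m" "y = z k" using zS by blast
    then show "y \<in> loc_ideal R I ?T"
      using bs(2,3) genideal_self[OF bc] unfolding loc_ideal_def frac_def by blast
  qed
  then have "loc_ideal R I J \<subseteq> loc_ideal R I ?T"
    unfolding S(3)[symmetric] by (rule L.genideal_minimal[OF loc_ideal_ideal[OF T.is_ideal]])
  then have eq: "loc_ideal R I J = loc_ideal R I ?T" using loc_ideal_mono[OF TJ] by blast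
  have "\<exists>u\<in>Den. u \<otimes> x \<in> ?T" if "x \<in> X" for x
  proof -
    have x: "x \<in> J" "x \<in> carrier R" using that X genideal_self[OF X(1)] by blast+
    then have "frac R I x \<one> \<in> loc_ideal R I J" using one_notin unfolding loc_ideal_def frac_def by blast
    then show ?thesis unfolding eq mem_loc_ideal_iff[OF T.is_ideal x(2) one_notin] .
  qed
  then obtain a where a: "a \<in> Den" "\<forall>x\<in>X. a \<otimes> x \<in> ?T"
    using common_denominator[OF T.is_ideal X(2,1)] by blast
  show thesis
  proof (rule that[of m b a])
    show "min_gens (loc R I) (loc_ideal R I J) = enat m" unfolding m_def by (rule S(4))
    show "loc_ideal R I J = Idl\<^bsub>loc R I\<^esub> ((\<lambda>k. frac R I (b k) \<one>) ` {..<m})"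
      unfolding eq loc_ideal_genideal[OF bc] by (simp only: image_image)
    show "a \<otimes> x \<in> ?T" if "x \<in> J" for x
      by (rule colon_ideal_Idl[OF T.is_ideal _ X(1)]) (use a that X(3) in auto)
  qed (use bs a in auto)
qed

end

section \<open>Linear algebra and dimension counting over a residue field, with scalars represented
  in \<open>R\<close>\<close>

section \<open>Algebras over a residue field\<close>

primrec monomial :: "('a, 'b) ring_scheme \<Rightarrow> (nat \<Rightarrow> 'a) \<Rightarrow> nat \<Rightarrow> (nat \<Rightarrow> nat) \<Rightarrow> 'a" where
  "monomial R x 0 \<alpha> = \<one>\<^bsub>R\<^esub>"
| "monomial R x (Suc m) \<alpha> = monomial R x m \<alpha> \<otimes>\<^bsub>R\<^esub> x m [^]\<^bsub>R\<^esub> \<alpha> m"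

text \<open>Extensional functions, so that two distinct exponents differ at some index below
  \<open>m\<close> and there are finitely many of each degree.\<close>

definition exponents :: "nat \<Rightarrow> nat \<Rightarrow> (nat \<Rightarrow> nat) set"
  where "exponents m d = {\<alpha> \<in> {..<m} \<rightarrow>\<^sub>E UNIV. (\<Sum>k<m. \<alpha> k) = d}"

lemma exponents_le: "\<alpha> \<in> exponents m d \<Longrightarrow> k < m \<Longrightarrow> \<alpha> k \<le> d"
  unfolding exponents_def by (auto intro: member_le_sum)

lemma finite_exponents: "finite (exponents m d)"
proof (rule finite_subset)
  show "exponents m d \<subseteq> {..<m} \<rightarrow>\<^sub>E {..d}"
  proof
    fix \<alpha> assume a: "\<alpha> \<in> exponents m d"
    then show "\<alpha> \<in> {..<m} \<rightarrow>\<^sub>E {..d}" using exponents_le[OF a] unfolding exponents_def PiE_def by auto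
  qed
qed (intro finite_PiE, auto)

lemma monomial_cong: "(\<And>k. k < m \<Longrightarrow> \<alpha> k = \<beta> k) \<Longrightarrow> monomial R x m \<alpha> = monomial R x m \<beta>"
  by (induction m) simp_all

context cring
begin

lemma monomial_closed: "(\<And>k. k < m \<Longrightarrow> x k \<in> carrier R) \<Longrightarrow> monomial R x m \<alpha> \<in> carrier R"
  by (induction m) simp_all

lemma monomial_mult:
  "(\<And>k. k < m \<Longrightarrow> x k \<in> carrier R) \<Longrightarrow>
    monomial R x m \<alpha> \<otimes> monomial R x m \<beta> = monomial R x m (\<lambda>k. \<alpha> k + \<beta> k)"
proof (induction m)
  case (Suc m)
  define p q a b where "p = monomial R x m \<alpha>" and "q = monomial R x m \<beta>"
    and "a = x m [^] \<alpha> m" and "b = x m [^] \<beta> m"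
  have c: "p \<in> carrier R" "q \<in> carrier R" "a \<in> carrier R" "b \<in> carrier R"
    unfolding p_def q_def a_def b_def using Suc.prems monomial_closed by auto
  have "x m [^] (\<alpha> m + \<beta> m) = a \<otimes> b" unfolding a_def b_def using Suc.prems by (simp add: nat_pow_mult)
  moreover have "monomial R x m (\<lambda>k. \<alpha> k + \<beta> k) = p \<otimes> q" using Suc unfolding p_def q_def by simp
  moreover have "(p \<otimes> a) \<otimes> (q \<otimes> b) = (p \<otimes> q) \<otimes> (a \<otimes> b)" using c by algebra
  ultimately show ?case unfolding monomial.simps p_def[symmetric] q_def[symmetric] a_def[symmetric] b_def[symmetric]
    by simp
qed simp

end

lemma (in maximalideal) inverse_mod:
  assumes "cring R" "c \<in> carrier R - I"
  shows "\<exists>d\<in>carrier R. \<exists>w\<in>I. \<one> = d \<otimes> c \<oplus> w"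
proof -
  interpret cring R by fact
  have Ic: "I \<subseteq> carrier R" using Icarr by blast
  let ?Z = "I \<union> {\<nu> \<otimes> c | \<nu>. \<nu> \<in> carrier R}"
  have Z: "?Z \<subseteq> carrier R" using Ic assms(2) by auto
  have "\<one> \<otimes> c \<in> ?Z" by blast
  then have cZ: "c \<in> Idl ?Z" using assms(2) genideal_self[OF Z] by auto
  have sub: "Idl ?Z \<subseteq> carrier R" using ideal.Icarr[OF genideal_ideal[OF Z]] by blast
  have "I \<subseteq> Idl ?Z" using genideal_self[OF Z] by blast
  then have "Idl ?Z = I \<or> Idl ?Z = carrier R" by (rule I_maximal[OF genideal_ideal[OF Z] _ sub])
  then have "\<one> \<in> Idl ?Z" using cZ assms(2) by auto
  from genideal_insert_multiples[OF oneideal Ic _ this] assms(2)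
  have "\<exists>\<nu>\<in>carrier R. \<exists>w\<in>Idl I. \<one> = \<nu> \<otimes> c \<oplus> w" by blast
  then show ?thesis using genideal_minimal[OF is_ideal subset_refl] by blast
qed

text \<open>An algebra over the residue field of \<open>M\<close> whose scalars are elements of
  \<open>R\<close>, acting through \<open>h\<close>; a nonzero scalar is one outside
  \<open>M\<close>. The quotient field is never formed, and coefficients of relations can be read
  off in \<open>R\<close>.\<close>

locale residue_algebra = ring_hom_cring R S h + max: maximalideal M R
  for R (structure) and S (structure) and h and M +
  assumes kills: "c \<in> M \<Longrightarrow> h c = \<zero>\<^bsub>S\<^esub>"
begin

inductive_set lin_span :: "'c set \<Rightarrow> 'c set" for X where
  zero: "\<zero>\<^bsub>S\<^esub> \<in> lin_span X"
| step: "\<lbrakk>c \<in> carrier R; x \<in> X; u \<in> lin_span X\<rbrakk> \<Longrightarrow> h c \<otimes>\<^bsub>S\<^esub> x \<oplus>\<^bsub>S\<^esub> u \<in> lin_span X"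

lemma inverse: "c \<in> carrier R - M \<Longrightarrow> \<exists>d\<in>carrier R. h d \<otimes>\<^bsub>S\<^esub> h c = \<one>\<^bsub>S\<^esub>"
proof -
  assume c: "c \<in> carrier R - M"
  obtain d w where d: "d \<in> carrier R" "w \<in> M" "\<one> = d \<otimes> c \<oplus> w"
    using max.inverse_mod[OF R.cring_axioms c] by blast
  have w: "w \<in> carrier R" using max.Icarr d by blast
  have "h (d \<otimes> c \<oplus> w) = h d \<otimes>\<^bsub>S\<^esub> h c" using d(1,2) w c kills by simp
  then have "h d \<otimes>\<^bsub>S\<^esub> h c = \<one>\<^bsub>S\<^esub>" unfolding d(3)[symmetric] by simp
  then show ?thesis using d(1) by blast
qed

context
  fixes X assumes X: "X \<subseteq> carrier S"
begin

lemma lin_span_closed: "u \<in> lin_span X \<Longrightarrow> u \<in> carrier S"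
  by (induction rule: lin_span.induct) (use X in auto)

lemma lin_span_add: "u \<in> lin_span X \<Longrightarrow> v \<in> lin_span X \<Longrightarrow> u \<oplus>\<^bsub>S\<^esub> v \<in> lin_span X"
proof (induction rule: lin_span.induct)
  case zero
  then show ?case using lin_span_closed by simp
next
  case (step c x u)
  have "h c \<otimes>\<^bsub>S\<^esub> x \<oplus>\<^bsub>S\<^esub> u \<oplus>\<^bsub>S\<^esub> v = h c \<otimes>\<^bsub>S\<^esub> x \<oplus>\<^bsub>S\<^esub> (u \<oplus>\<^bsub>S\<^esub> v)"
    using step X lin_span_closed by (intro S.a_assoc) auto
  then show ?case using lin_span.step[OF step(1,2)] step by simp
qed

lemma lin_span_scale: "u \<in> lin_span X \<Longrightarrow> a \<in> carrier R \<Longrightarrow> h a \<otimes>\<^bsub>S\<^esub> u \<in> lin_span X"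
proof (induction rule: lin_span.induct)
  case zero
  then show ?case using lin_span.zero by simp
next
  case (step c x u)
  have cc: "h a \<in> carrier S" "h c \<in> carrier S" "x \<in> carrier S" "u \<in> carrier S"
    using step X lin_span_closed by auto
  have "h a \<otimes>\<^bsub>S\<^esub> (h c \<otimes>\<^bsub>S\<^esub> x \<oplus>\<^bsub>S\<^esub> u) = (h a \<otimes>\<^bsub>S\<^esub> h c) \<otimes>\<^bsub>S\<^esub> x \<oplus>\<^bsub>S\<^esub> h a \<otimes>\<^bsub>S\<^esub> u"
    using cc by (simp add: S.r_distr S.m_assoc)
  also have "h a \<otimes>\<^bsub>S\<^esub> h c = h (a \<otimes> c)" using step by (simp add: hom_mult)
  finally show ?case using lin_span.step[of "a \<otimes> c" x X "h a \<otimes>\<^bsub>S\<^esub> u"] step by simp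
qed

lemma lin_span_uminus: "u \<in> lin_span X \<Longrightarrow> \<ominus>\<^bsub>S\<^esub> u \<in> lin_span X"
proof -
  assume u: "u \<in> lin_span X"
  have "h (\<ominus> \<one>) \<otimes>\<^bsub>S\<^esub> u = \<ominus>\<^bsub>S\<^esub> u"
    using lin_span_closed[OF u] S.l_minus[of "\<one>\<^bsub>S\<^esub>" u] by simp
  then show ?thesis using lin_span_scale[OF u, of "\<ominus> \<one>"] by simp
qed

lemma lin_span_base: "x \<in> X \<Longrightarrow> x \<in> lin_span X"
proof -
  assume x: "x \<in> X"
  then have "h \<one> \<otimes>\<^bsub>S\<^esub> x \<oplus>\<^bsub>S\<^esub> \<zero>\<^bsub>S\<^esub> = x" using X by auto
  then show ?thesis using lin_span.step[OF R.one_closed x lin_span.zero] by simp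
qed

lemma lin_span_finsum: "(\<And>i. i \<in> A \<Longrightarrow> f i \<in> lin_span X) \<Longrightarrow> finsum S f A \<in> lin_span X"
proof (induction A rule: infinite_finite_induct)
  case (insert i A)
  then have "finsum S f (insert i A) = f i \<oplus>\<^bsub>S\<^esub> finsum S f A"
    using lin_span_closed by (intro S.finsum_insert) auto
  then show ?case using insert lin_span_add by simp
qed (simp_all add: lin_span.zero)

end

lemma lin_span_trans:
  assumes "X \<subseteq> lin_span Y" "Y \<subseteq> carrier S" "u \<in> lin_span X"
  shows "u \<in> lin_span Y"
  using assms(3)
proof (induction rule: lin_span.induct)
  case zero
  then show ?case by (rule lin_span.zero)
next
  case (step c x u)
  then show ?case using assms(1) by (intro lin_span_add lin_span_scale assms(2)) auto
qed

lemma lin_span_mult: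
  assumes X: "X \<subseteq> carrier S" and Y: "Y \<subseteq> carrier S" and Z: "Z \<subseteq> carrier S"
    and XY: "\<And>x y. x \<in> X \<Longrightarrow> y \<in> Y \<Longrightarrow> x \<otimes>\<^bsub>S\<^esub> y \<in> lin_span Z"
    and u: "u \<in> lin_span X" and v: "v \<in> lin_span Y"
  shows "u \<otimes>\<^bsub>S\<^esub> v \<in> lin_span Z"
proof -
  have xv: "x \<otimes>\<^bsub>S\<^esub> v \<in> lin_span Z" if x: "x \<in> X" for x
    using v
  proof (induction rule: lin_span.induct)
    case zero
    then show ?case using x X lin_span.zero by auto
  next
    case (step c y w)
    have cc: "x \<in> carrier S" "h c \<in> carrier S" "y \<in> carrier S" "w \<in> carrier S"
      using step x X Y lin_span_closed[OF Y] by auto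
    have "x \<otimes>\<^bsub>S\<^esub> (h c \<otimes>\<^bsub>S\<^esub> y \<oplus>\<^bsub>S\<^esub> w) = h c \<otimes>\<^bsub>S\<^esub> (x \<otimes>\<^bsub>S\<^esub> y) \<oplus>\<^bsub>S\<^esub> x \<otimes>\<^bsub>S\<^esub> w"
      using cc by (simp add: S.r_distr S.m_lcomm)
    then show ?case using lin_span_add[OF Z lin_span_scale[OF Z XY[OF x step(2)] step(1)] step.IH] by simp
  qed
  show ?thesis
    using u
  proof (induction rule: lin_span.induct)
    case zero
    then show ?case using lin_span_closed[OF Y v] lin_span.zero by simp
  next
    case (step c x w)
    have cc: "x \<in> carrier S" "h c \<in> carrier S" "v \<in> carrier S" "w \<in> carrier S"
      using step X lin_span_closed[OF X] lin_span_closed[OF Y v] by auto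
    have "(h c \<otimes>\<^bsub>S\<^esub> x \<oplus>\<^bsub>S\<^esub> w) \<otimes>\<^bsub>S\<^esub> v = h c \<otimes>\<^bsub>S\<^esub> (x \<otimes>\<^bsub>S\<^esub> v) \<oplus>\<^bsub>S\<^esub> w \<otimes>\<^bsub>S\<^esub> v"
      using cc by (simp add: S.l_distr S.m_assoc)
    then show ?case using lin_span_add[OF Z lin_span_scale[OF Z xv[OF step(2)] step(1)] step.IH] by simp
  qed
qed

lemma lin_span_insert:
  assumes "insert x X \<subseteq> carrier S" "u \<in> lin_span (insert x X)"
  shows "\<exists>a\<in>carrier R. \<exists>v\<in>lin_span X. u = h a \<otimes>\<^bsub>S\<^esub> x \<oplus>\<^bsub>S\<^esub> v"
  using assms(2)
proof (induction rule: lin_span.induct)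
  case zero
  have "\<zero>\<^bsub>S\<^esub> = h \<zero> \<otimes>\<^bsub>S\<^esub> x \<oplus>\<^bsub>S\<^esub> \<zero>\<^bsub>S\<^esub>" using assms(1) by simp
  then show ?case using lin_span.zero by blast
next
  case (step c y u)
  then obtain a v where av: "a \<in> carrier R" "v \<in> lin_span X" "u = h a \<otimes>\<^bsub>S\<^esub> x \<oplus>\<^bsub>S\<^esub> v" by blast
  have X: "X \<subseteq> carrier S" and x: "x \<in> carrier S" using assms(1) by auto
  have vc: "v \<in> carrier S" using lin_span_closed[OF X av(2)] .
  show ?case
  proof (cases "y = x")
    case True
    have "h c \<otimes>\<^bsub>S\<^esub> x \<oplus>\<^bsub>S\<^esub> (h a \<otimes>\<^bsub>S\<^esub> x \<oplus>\<^bsub>S\<^esub> v) = h (c \<oplus> a) \<otimes>\<^bsub>S\<^esub> x \<oplus>\<^bsub>S\<^esub> v"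
      using step(1) av(1) vc x by (simp add: hom_add S.l_distr S.a_assoc)
    then show ?thesis using av step(1) True R.a_closed[OF step(1) av(1)] by blast
  next
    case False
    then have yX: "y \<in> X" using step(2) by blast
    have "h c \<otimes>\<^bsub>S\<^esub> y \<oplus>\<^bsub>S\<^esub> (h a \<otimes>\<^bsub>S\<^esub> x \<oplus>\<^bsub>S\<^esub> v) = h a \<otimes>\<^bsub>S\<^esub> x \<oplus>\<^bsub>S\<^esub> (h c \<otimes>\<^bsub>S\<^esub> y \<oplus>\<^bsub>S\<^esub> v)"
      using step(1) av(1) vc x yX X by (intro S.a_lcomm) auto
    then show ?thesis using av lin_span.step[OF step(1) yX av(2)] by metis
  qed
qed

text \<open>Elimination of one spanning vector \<open>x\<close>. If some coefficient at
  \<open>x\<close> is outside \<open>M\<close>, it serves as pivot and removes \<open>x\<close> from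
  all other vectors; otherwise \<open>x\<close> is already absent, since coefficients in
  \<open>M\<close> act as zero.\<close>

lemma linear_dependence:
  assumes "finite X" "X \<subseteq> carrier S" "finite B" "card X < card B" "\<And>b. b \<in> B \<Longrightarrow> v b \<in> lin_span X"
  shows "\<exists>c. (\<forall>b\<in>B. c b \<in> carrier R) \<and> (\<exists>b\<in>B. c b \<notin> M) \<and> (\<Oplus>\<^bsub>S\<^esub>b\<in>B. v b \<otimes>\<^bsub>S\<^esub> h (c b)) = \<zero>\<^bsub>S\<^esub>"
  using assms
proof (induction X arbitrary: B v rule: finite_induct)
  case empty
  have "v b = \<zero>\<^bsub>S\<^esub>" if "b \<in> B" for b
    using empty.prems(4)[OF that] by (auto elim: lin_span.cases)
  then have "(\<Oplus>\<^bsub>S\<^esub>b\<in>B. v b \<otimes>\<^bsub>S\<^esub> h \<one>) = (\<Oplus>\<^bsub>S\<^esub>b\<in>B. \<zero>\<^bsub>S\<^esub>)" by (intro S.finsum_cong') auto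
  then have "(\<Oplus>\<^bsub>S\<^esub>b\<in>B. v b \<otimes>\<^bsub>S\<^esub> h \<one>) = \<zero>\<^bsub>S\<^esub>" by simp
  moreover have "\<one> \<notin> M" using max.one_imp_carrier max.I_notcarr by blast
  moreover have "B \<noteq> {}" using empty.prems(3) by auto
  ultimately show ?case by (intro exI[of _ "\<lambda>_. \<one>"]) auto
next
  case (insert x X)
  have X: "X \<subseteq> carrier S" and x: "x \<in> carrier S" using insert.prems(1) by auto
  have "\<exists>a u. a \<in> carrier R \<and> u \<in> lin_span X \<and> v b = h a \<otimes>\<^bsub>S\<^esub> x \<oplus>\<^bsub>S\<^esub> u" if "b \<in> B" for b
    using lin_span_insert[OF insert.prems(1) insert.prems(4)[OF that]] by blast
  then obtain a u where au: "\<And>b. b \<in> B \<Longrightarrow> a b \<in> carrier R" "\<And>b. b \<in> B \<Longrightarrow> u b \<in> lin_span X"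
    "\<And>b. b \<in> B \<Longrightarrow> v b = h (a b) \<otimes>\<^bsub>S\<^esub> x \<oplus>\<^bsub>S\<^esub> u b" by metis
  have uc: "u b \<in> carrier S" if "b \<in> B" for b using lin_span_closed[OF X au(2)[OF that]] .
  have vc: "v b \<in> carrier S" if "b \<in> B" for b using lin_span_closed[OF insert.prems(1) insert.prems(4)[OF that]] .
  show ?case
  proof (cases "\<forall>b\<in>B. a b \<in> M")
    case True
    have "v b \<in> lin_span X" if "b \<in> B" for b
      using au(2,3)[OF that] kills True that x uc[OF that] by simp
    moreover have "card X < card B" using insert.prems(3) insert.hyps by simp
    ultimately show ?thesis using insert.IH[OF X insert.prems(2)] by blast
  next
    case False
    then obtain b0 where b0: "b0 \<in> B" "a b0 \<notin> M" by blast
    let ?B = "B - {b0}" and ?p = "a b0"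
    let ?w = "\<lambda>b. h ?p \<otimes>\<^bsub>S\<^esub> v b \<ominus>\<^bsub>S\<^esub> v b0 \<otimes>\<^bsub>S\<^esub> h (a b)"
    have p: "?p \<in> carrier R" using au b0 by blast
    have w: "?w b \<in> lin_span X" if b: "b \<in> ?B" for b
    proof -
      have bB: "b \<in> B" using b by blast
      have c: "h ?p \<in> carrier S" "h (a b) \<in> carrier S" "u b \<in> carrier S" "u b0 \<in> carrier S"
        using p au(1)[OF bB] uc bB b0 by auto
      have id: "P \<otimes>\<^bsub>S\<^esub> (A \<otimes>\<^bsub>S\<^esub> x \<oplus>\<^bsub>S\<^esub> U) \<ominus>\<^bsub>S\<^esub> (P \<otimes>\<^bsub>S\<^esub> x \<oplus>\<^bsub>S\<^esub> V) \<otimes>\<^bsub>S\<^esub> A = P \<otimes>\<^bsub>S\<^esub> U \<oplus>\<^bsub>S\<^esub> \<ominus>\<^bsub>S\<^esub> (A \<otimes>\<^bsub>S\<^esub> V)"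
        if "P \<in> carrier S" "A \<in> carrier S" "U \<in> carrier S" "V \<in> carrier S" for P A U V
        using that x by algebra
      have "?w b = h ?p \<otimes>\<^bsub>S\<^esub> u b \<oplus>\<^bsub>S\<^esub> \<ominus>\<^bsub>S\<^esub> (h (a b) \<otimes>\<^bsub>S\<^esub> u b0)"
        unfolding au(3)[OF bB] au(3)[OF b0(1)] by (rule id[OF c])
      then show ?thesis
        using lin_span_add[OF X lin_span_scale[OF X au(2)[OF bB] p]
            lin_span_uminus[OF X lin_span_scale[OF X au(2)[OF b0(1)] au(1)[OF bB]]]] by simp
    qed
    have "card X < card ?B" using insert.prems(2,3) insert.hyps b0 by simp
    moreover have "finite ?B" using insert.prems(2) by simp
    ultimately obtain c where c: "\<forall>b\<in>?B. c b \<in> carrier R" "\<exists>b\<in>?B. c b \<notin> M" "(\<Oplus>\<^bsub>S\<^esub>b\<in>?B. ?w b \<otimes>\<^bsub>S\<^esub> h (c b)) = \<zero>\<^bsub>S\<^esub>"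
      using insert.IH[of ?B ?w, OF X _ _ w] by blast
    \<comment> \<open>\<open>d\<close> is the back substitution carried out in \<open>R\<close>, and
      \<open>y\<close> is its image in \<open>S\<close>, where the elimination identity
      lives.\<close>
    define d where "d b = (if b = b0 then \<ominus> (\<Oplus>b\<in>?B. a b \<otimes> c b) else ?p \<otimes> c b)" for b
    define y where "y b = (if b = b0 then \<ominus>\<^bsub>S\<^esub> (\<Oplus>\<^bsub>S\<^esub>b\<in>?B. h (a b) \<otimes>\<^bsub>S\<^esub> h (c b)) else h ?p \<otimes>\<^bsub>S\<^esub> h (c b))" for b
    have sc: "(\<Oplus>b\<in>?B. a b \<otimes> c b) \<in> carrier R" using au(1) c(1) by (intro R.finsum_closed) auto
    have dc: "d b \<in> carrier R" if "b \<in> B" for b unfolding d_def using sc p c(1) that by auto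
    have hd: "h (d b) = y b" if "b \<in> B" for b
    proof (cases "b = b0")
      case True
      have "h (\<Oplus>b\<in>?B. a b \<otimes> c b) = (\<Oplus>\<^bsub>S\<^esub>b\<in>?B. (h \<circ> (\<lambda>b. a b \<otimes> c b)) b)"
        unfolding o_def by (rule hom_finsum[unfolded o_def]) (use au(1) c(1) in auto)
      also have "\<dots> = (\<Oplus>\<^bsub>S\<^esub>b\<in>?B. h (a b) \<otimes>\<^bsub>S\<^esub> h (c b))"
        using au(1) c(1) by (intro S.finsum_cong') auto
      finally show ?thesis using True sc unfolding d_def y_def by simp
    next
      case False
      then show ?thesis using that c(1) p unfolding d_def y_def by auto
    qed
    have "(\<Oplus>\<^bsub>S\<^esub>b\<in>B. v b \<otimes>\<^bsub>S\<^esub> h (d b)) = (\<Oplus>\<^bsub>S\<^esub>b\<in>B. v b \<otimes>\<^bsub>S\<^esub> y b)"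
    proof (rule S.finsum_cong')
      show "(\<lambda>b. v b \<otimes>\<^bsub>S\<^esub> y b) \<in> B \<rightarrow> carrier S" using vc hd[symmetric] dc by auto
      show "v b \<otimes>\<^bsub>S\<^esub> h (d b) = v b \<otimes>\<^bsub>S\<^esub> y b" if "b \<in> B" for b using hd[OF that] by simp
    qed simp
    also have "\<dots> = (\<Oplus>\<^bsub>S\<^esub>b\<in>?B. ?w b \<otimes>\<^bsub>S\<^esub> h (c b))"
      by (rule S.pivot_solution[where h = "\<lambda>b. h (a b)"])
        (use insert.prems(2) b0 vc au(1) c(1) y_def in auto)
    finally have "(\<Oplus>\<^bsub>S\<^esub>b\<in>B. v b \<otimes>\<^bsub>S\<^esub> h (d b)) = \<zero>\<^bsub>S\<^esub>" using c(3) by simp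
    moreover obtain b where b: "b \<in> ?B" "c b \<notin> M" using c(2) by blast
    have "d b \<notin> M"
    proof
      interpret pr: primeideal M R by (rule R.maximalideal_prime[OF max.maximalideal_axioms])
      assume "d b \<in> M"
      then have "?p \<otimes> c b \<in> M" using b unfolding d_def by auto
      then show False using pr.I_prime[OF p] c(1) b b0(2) by blast
    qed
    ultimately show ?thesis using dc b(1) by (intro exI[of _ d]) auto
  qed
qed

end

lemma digit_sum_less:
  fixes \<alpha> :: "nat \<Rightarrow> nat"
  assumes "\<And>k. k < m \<Longrightarrow> \<alpha> k < B"
  shows "(\<Sum>k<m. \<alpha> k * B ^ k) < B ^ m"
  using assms
proof (induction m)
  case (Suc m)
  have "(\<Sum>k<Suc m. \<alpha> k * B ^ k) < B ^ m + \<alpha> m * B ^ m" using Suc by simp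
  also have "\<dots> = (Suc (\<alpha> m)) * B ^ m" by simp
  also have "\<dots> \<le> B * B ^ m" using Suc.prems[of m] by (intro mult_le_mono1) simp
  finally show ?case by simp
qed simp

text \<open>Uniqueness of digits in base \<open>B\<close>; it makes the weight on exponents in the
  counting argument injective.\<close>

lemma digit_sum_inj:
  fixes \<alpha> \<beta> :: "nat \<Rightarrow> nat"
  assumes "\<And>k. k < m \<Longrightarrow> \<alpha> k < B" "\<And>k. k < m \<Longrightarrow> \<beta> k < B"
    and "(\<Sum>k<m. \<alpha> k * B ^ k) = (\<Sum>k<m. \<beta> k * B ^ k)" "k < m"
  shows "\<alpha> k = \<beta> k"
  using assms
proof (induction m)
  case (Suc m)
  let ?a = "\<Sum>k<m. \<alpha> k * B ^ k" and ?b = "\<Sum>k<m. \<beta> k * B ^ k"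
  have l: "?a < B ^ m" "?b < B ^ m" using Suc.prems(1,2) by (auto intro: digit_sum_less)
  have e: "?a + \<alpha> m * B ^ m = ?b + \<beta> m * B ^ m" using Suc.prems(3) by simp
  have "(a + c * b) div b = c" if "a < b" for a b c :: nat using that by simp
  then have "(?a + \<alpha> m * B ^ m) div B ^ m = \<alpha> m" "(?b + \<beta> m * B ^ m) div B ^ m = \<beta> m"
    using l by blast+
  then have top: "\<alpha> m = \<beta> m" using e by simp
  then have "?a = ?b" using e by simp
  note eq = this
  show ?case
  proof (cases "k = m")
    case False
    have "\<alpha> j < B" "\<beta> j < B" if "j < m" for j using Suc.prems(1)[of j] Suc.prems(2)[of j] that by auto
    from Suc.IH[OF this eq] show ?thesis using Suc.prems(4) False by simp
  qed (simp add: top)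
qed simp

text \<open>Bounding one coordinate by the fixed number \<open>d\<close> costs a whole dimension:
  the count grows like \<open>N ^ (m - 1)\<close> instead of \<open>N ^ m\<close>.\<close>

lemma card_PiE_coordinate_bound:
  fixes N d :: nat
  assumes "k < m"
  shows "card (({..<m} \<rightarrow>\<^sub>E {..N}) \<inter> {\<alpha>. \<alpha> k < d}) \<le> d * (N + 1) ^ (m - 1)"
proof -
  let ?F = "\<lambda>j. if j = k then {..<d} else {..N}"
  have "({..<m} \<rightarrow>\<^sub>E {..N}) \<inter> {\<alpha>. \<alpha> k < d} \<subseteq> PiE {..<m} ?F"
  proof
    fix \<alpha> assume a: "\<alpha> \<in> ({..<m} \<rightarrow>\<^sub>E {..N}) \<inter> {\<alpha>. \<alpha> k < d}"
    have "\<alpha> j \<in> ?F j" if "j \<in> {..<m}" for j using a PiE_mem[of \<alpha> "{..<m}" "\<lambda>_. {..N}" j] that by simp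
    then show "\<alpha> \<in> PiE {..<m} ?F" using a PiE_arb[of \<alpha> "{..<m}" "\<lambda>_. {..N}"] by (intro PiE_I) blast+
  qed
  then have "card (({..<m} \<rightarrow>\<^sub>E {..N}) \<inter> {\<alpha>. \<alpha> k < d}) \<le> card (PiE {..<m} ?F)"
    by (intro card_mono finite_PiE) auto
  also have "\<dots> = (\<Prod>j<m. card (?F j))" by (rule card_PiE) simp
  also have "\<dots> = card (?F k) * (\<Prod>j\<in>{..<m} - {k}. card (?F j))"
    using assms by (intro prod.remove) auto
  also have "(\<Prod>j\<in>{..<m} - {k}. card (?F j)) = (\<Prod>j\<in>{..<m} - {k}. N + 1)"
    by (intro prod.cong) auto
  also have "\<dots> = (N + 1) ^ (m - 1)" using assms by simp
  finally show ?thesis by simp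
qed

context residue_algebra
begin

text \<open>Scalars outside \<open>M\<close> become units of \<open>S\<close>, so no prime contains
  them.\<close>

lemma scalar_in_prime:
  assumes "primeideal Q S" "c \<in> carrier R" "h c \<in> Q"
  shows "c \<in> M"
proof (rule ccontr)
  interpret Q: primeideal Q S by fact
  assume "c \<notin> M"
  then obtain d where "d \<in> carrier R" "h d \<otimes>\<^bsub>S\<^esub> h c = \<one>\<^bsub>S\<^esub>" using inverse[of c] assms(2) by blast
  then have "\<one>\<^bsub>S\<^esub> \<in> Q" using Q.I_l_closed[OF assms(3), of "h d"] by simp
  then show False using Q.one_notin by blast
qed

text \<open>Elements \<open>y k\<close> picked from the steps of a chain of primes are algebraically independent: a
  relation is divided by the highest power of the last variable and then reduced modulo the next prime.\<close>

lemma prime_chain_independence: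
  assumes "\<And>k. k \<le> m \<Longrightarrow> primeideal (q k) S" "\<And>k. k < m \<Longrightarrow> q (Suc k) \<subseteq> q k"
    and "\<And>k. k < m \<Longrightarrow> y k \<in> q k - q (Suc k)" "finite B"
    and "\<And>\<beta> \<beta>'. \<lbrakk>\<beta> \<in> B; \<beta>' \<in> B; \<And>k. k < m \<Longrightarrow> \<beta> k = \<beta>' k\<rbrakk> \<Longrightarrow> \<beta> = \<beta>'"
    and "\<And>\<beta>. \<beta> \<in> B \<Longrightarrow> c \<beta> \<in> carrier R"
    and "(\<Oplus>\<^bsub>S\<^esub>\<beta>\<in>B. h (c \<beta>) \<otimes>\<^bsub>S\<^esub> monomial S y m \<beta>) \<in> q m" "\<beta> \<in> B"
  shows "c \<beta> \<in> M"
  using assms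
proof (induction m arbitrary: B \<beta>)
  case 0
  have "B = {\<beta>}" using "0.prems"(5,8) by blast
  moreover have "(\<Oplus>\<^bsub>S\<^esub>\<beta>\<in>{\<beta>}. h (c \<beta>) \<otimes>\<^bsub>S\<^esub> monomial S y 0 \<beta>) = h (c \<beta>)"
    using "0.prems"(6,8) by (subst S.finsum_insert) auto
  ultimately have "h (c \<beta>) \<in> q 0" using "0.prems"(7) by simp
  then show ?case using scalar_in_prime[OF "0.prems"(1)] "0.prems"(6,8) by blast
next
  case (Suc m)
  interpret Q': primeideal "q (Suc m)" S using Suc.prems(1) by blast
  interpret Q: primeideal "q m" S using Suc.prems(1) by simp
  let ?X = "monomial S y m"
  have ym: "y m \<in> q m" "y m \<notin> q (Suc m)" "y m \<in> carrier S" using Suc.prems(3)[of m] Q.Icarr by auto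
  have yc: "y k \<in> carrier S" if "k < Suc m" for k
    using Suc.prems(3)[OF that] ideal.Icarr[OF primeideal.axioms(1)[OF Suc.prems(1)[of k]]] that by auto
  have Xc: "?X \<gamma> \<in> carrier S" for \<gamma> using yc by (intro S.monomial_closed) simp
  show ?case
  proof (rule ccontr)
    assume "c \<beta> \<notin> M"
    define B1 where "B1 = {\<gamma> \<in> B. c \<gamma> \<notin> M}"
    have B1: "B1 \<subseteq> B" "finite B1" "\<beta> \<in> B1"
      unfolding B1_def using Suc.prems(4,8) \<open>c \<beta> \<notin> M\<close> by auto
    have hc: "h (c \<gamma>) \<in> carrier S" if "\<gamma> \<in> B" for \<gamma> using Suc.prems(6)[OF that] by simp
    \<comment> \<open>Terms with coefficient in \<open>M\<close> were dropped, so the minimum is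
      attained by a term \<open>\<delta>\<close> that survives. Cancelling this power is allowed
      because \<open>y m\<close> avoids the prime \<open>q (Suc m)\<close>.\<close>
    define e where "e = Min ((\<lambda>\<gamma>. \<gamma> m) ` B1)"
    have e_le: "e \<le> \<gamma> m" if "\<gamma> \<in> B1" for \<gamma> unfolding e_def using B1(2) that by auto
    have "e \<in> (\<lambda>\<gamma>. \<gamma> m) ` B1" unfolding e_def using B1(2,3) by (intro Min_in) auto
    then obtain \<delta> where \<delta>: "\<delta> \<in> B1" "\<delta> m = e" by auto
    define B2 where "B2 = {\<gamma> \<in> B1. \<gamma> m = e}"
    have B2: "B2 \<subseteq> B1" "finite B2" "\<delta> \<in> B2" unfolding B2_def using B1(2) \<delta> by auto
    let ?g = "\<lambda>\<gamma>. h (c \<gamma>) \<otimes>\<^bsub>S\<^esub> (?X \<gamma> \<otimes>\<^bsub>S\<^esub> y m [^]\<^bsub>S\<^esub> (\<gamma> m - e))"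
    have gc: "?g \<gamma> \<in> carrier S" if "\<gamma> \<in> B" for \<gamma> using hc[OF that] Xc ym(3) by simp
    have factor: "h (c \<gamma>) \<otimes>\<^bsub>S\<^esub> monomial S y (Suc m) \<gamma> = y m [^]\<^bsub>S\<^esub> e \<otimes>\<^bsub>S\<^esub> ?g \<gamma>" if "\<gamma> \<in> B1" for \<gamma>
    proof -
      define u v w z where "u = h (c \<gamma>)" and "v = ?X \<gamma>" and "w = y m [^]\<^bsub>S\<^esub> e" and "z = y m [^]\<^bsub>S\<^esub> (\<gamma> m - e)"
      have cc: "u \<in> carrier S" "v \<in> carrier S" "w \<in> carrier S" "z \<in> carrier S"
        unfolding u_def v_def w_def z_def using hc that B1(1) Xc ym(3) by auto
      have p: "y m [^]\<^bsub>S\<^esub> \<gamma> m = w \<otimes>\<^bsub>S\<^esub> z"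
        unfolding w_def z_def using e_le[OF that] ym(3) by (simp add: S.nat_pow_mult)
      have "u \<otimes>\<^bsub>S\<^esub> (v \<otimes>\<^bsub>S\<^esub> (w \<otimes>\<^bsub>S\<^esub> z)) = w \<otimes>\<^bsub>S\<^esub> (u \<otimes>\<^bsub>S\<^esub> (v \<otimes>\<^bsub>S\<^esub> z))" using cc by algebra
      then show ?thesis unfolding monomial.simps p u_def v_def w_def z_def .
    qed
    have "(\<Oplus>\<^bsub>S\<^esub>\<gamma>\<in>B. h (c \<gamma>) \<otimes>\<^bsub>S\<^esub> monomial S y (Suc m) \<gamma>) = (\<Oplus>\<^bsub>S\<^esub>\<gamma>\<in>B1. y m [^]\<^bsub>S\<^esub> e \<otimes>\<^bsub>S\<^esub> ?g \<gamma>)"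
    proof (rule S.add.finprod_mono_neutral_cong_right)
      show "h (c i) \<otimes>\<^bsub>S\<^esub> monomial S y (Suc m) i = \<zero>\<^bsub>S\<^esub>" if "i \<in> B - B1" for i
      proof -
        have "c i \<in> M" using that unfolding B1_def by blast
        then show ?thesis using kills Xc ym(3) by simp
      qed
      show "(\<lambda>\<gamma>. h (c \<gamma>) \<otimes>\<^bsub>S\<^esub> monomial S y (Suc m) \<gamma>) \<in> B \<rightarrow> carrier S" using hc Xc ym(3) by simp
    qed (use B1 factor Suc.prems(4) in auto)
    also have "\<dots> = y m [^]\<^bsub>S\<^esub> e \<otimes>\<^bsub>S\<^esub> (\<Oplus>\<^bsub>S\<^esub>\<gamma>\<in>B1. ?g \<gamma>)"
      using B1 gc ym(3) by (intro S.finsum_rdistr[symmetric]) auto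
    finally have prod: "y m [^]\<^bsub>S\<^esub> e \<otimes>\<^bsub>S\<^esub> (\<Oplus>\<^bsub>S\<^esub>\<gamma>\<in>B1. ?g \<gamma>) \<in> q (Suc m)" using Suc.prems(7) by simp
    have pow: "y m [^]\<^bsub>S\<^esub> e \<notin> q (Suc m)" using Q'.pow_notin[of "y m" e] ym by blast
    have g1: "(\<Oplus>\<^bsub>S\<^esub>\<gamma>\<in>B1. ?g \<gamma>) \<in> carrier S" using B1 gc by (intro S.finsum_closed) auto
    have "(\<Oplus>\<^bsub>S\<^esub>\<gamma>\<in>B1. ?g \<gamma>) \<in> q (Suc m)"
      using Q'.I_prime[OF S.nat_pow_closed[OF ym(3)] g1 prod] pow by blast
    then have in_q: "(\<Oplus>\<^bsub>S\<^esub>\<gamma>\<in>B1. ?g \<gamma>) \<in> q m" using subsetD[OF Suc.prems(2)[OF lessI]] by blast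
    have split: "(\<Oplus>\<^bsub>S\<^esub>\<gamma>\<in>B1. ?g \<gamma>) = (\<Oplus>\<^bsub>S\<^esub>\<gamma>\<in>B2. ?g \<gamma>) \<oplus>\<^bsub>S\<^esub> (\<Oplus>\<^bsub>S\<^esub>\<gamma>\<in>B1 - B2. ?g \<gamma>)"
    proof -
      have "B1 = B2 \<union> (B1 - B2)" using B2(1) by blast
      then have "(\<Oplus>\<^bsub>S\<^esub>\<gamma>\<in>B1. ?g \<gamma>) = (\<Oplus>\<^bsub>S\<^esub>\<gamma>\<in>B2 \<union> (B1 - B2). ?g \<gamma>)" by simp
      also have "\<dots> = (\<Oplus>\<^bsub>S\<^esub>\<gamma>\<in>B2. ?g \<gamma>) \<oplus>\<^bsub>S\<^esub> (\<Oplus>\<^bsub>S\<^esub>\<gamma>\<in>B1 - B2. ?g \<gamma>)"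
        using B1 B2 gc by (intro S.finsum_Un_disjoint) auto
      finally show ?thesis .
    qed
    have rest: "(\<Oplus>\<^bsub>S\<^esub>\<gamma>\<in>B1 - B2. ?g \<gamma>) \<in> q m"
    proof (rule Q.finsum_in)
      fix \<gamma> assume \<gamma>: "\<gamma> \<in> B1 - B2"
      then have "\<gamma> m \<noteq> e" "e \<le> \<gamma> m" using e_le unfolding B2_def by auto
      then obtain n where n: "\<gamma> m - e = Suc n" by (metis Suc_diff_Suc le_neq_implies_less)
      have "y m [^]\<^bsub>S\<^esub> (\<gamma> m - e) \<in> q m" unfolding n using Q.I_l_closed[OF ym(1), of "y m [^]\<^bsub>S\<^esub> n"] ym(3) by simp
      then have "?X \<gamma> \<otimes>\<^bsub>S\<^esub> y m [^]\<^bsub>S\<^esub> (\<gamma> m - e) \<in> q m" using Q.I_l_closed Xc by blast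
      then show "?g \<gamma> \<in> q m" using Q.I_l_closed hc \<gamma> B1(1) by blast
    qed
    have "(\<Oplus>\<^bsub>S\<^esub>\<gamma>\<in>B2. ?g \<gamma>) = (\<Oplus>\<^bsub>S\<^esub>\<gamma>\<in>B2. h (c \<gamma>) \<otimes>\<^bsub>S\<^esub> ?X \<gamma>)"
      using B1 B2 hc Xc unfolding B2_def by (intro S.finsum_cong') auto
    moreover have "(\<Oplus>\<^bsub>S\<^esub>\<gamma>\<in>B2. ?g \<gamma>) \<in> q m"
      by (rule Q.add_in_cancel[OF in_q[unfolded split] rest]) (use B1 B2 gc in \<open>auto intro!: S.finsum_closed\<close>)
    ultimately have "(\<Oplus>\<^bsub>S\<^esub>\<gamma>\<in>B2. h (c \<gamma>) \<otimes>\<^bsub>S\<^esub> ?X \<gamma>) \<in> q m" by simp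
    then have "c \<delta> \<in> M"
    proof (rule Suc.IH[rotated 6])
      fix \<gamma> \<gamma>' assume h: "\<gamma> \<in> B2" "\<gamma>' \<in> B2" "\<And>k. k < m \<Longrightarrow> \<gamma> k = \<gamma>' k"
      show "\<gamma> = \<gamma>'"
      proof (rule Suc.prems(5))
        fix k assume "k < Suc m"
        then show "\<gamma> k = \<gamma>' k" using h unfolding B2_def by (cases "k = m") auto
      qed (use h B1(1) B2(1) in auto)
    qed (use Suc.prems(1,2,3,6) B1(1) B2 in auto)
    then show False using \<delta>(1) unfolding B1_def by blast
  qed
qed

text \<open>A coefficient outside \<open>M\<close> would allow a monomial of degree \<open>d\<close>
  to be rewritten by others, so that the elements of degree at most \<open>N\<close> span a space of
  dimension of order \<open>N ^ (m - 1)\<close>. The chain of \<open>m + 1\<close> primes provides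
  \<open>m\<close> independent elements, whose monomials number about \<open>N ^ m\<close> in that
  same space.\<close>

theorem relation_coeffs_in_maximal:
  assumes m: "m \<ge> 1" and x: "\<And>k. k < m \<Longrightarrow> x k \<in> carrier S"
    and gen: "\<And>u. u \<in> carrier S \<Longrightarrow> \<exists>D. u \<in> lin_span (monomial S x m ` {\<alpha> \<in> {..<m} \<rightarrow>\<^sub>E UNIV. (\<Sum>k<m. \<alpha> k) \<le> D})"
    and p: "\<And>i. i \<le> m \<Longrightarrow> primeideal (p i) S" "\<And>i. i < m \<Longrightarrow> p i \<subset> p (Suc i)"
    and c: "\<And>\<alpha>. \<alpha> \<in> exponents m d \<Longrightarrow> c \<alpha> \<in> carrier R"
    and rel: "(\<Oplus>\<^bsub>S\<^esub>\<alpha>\<in>exponents m d. h (c \<alpha>) \<otimes>\<^bsub>S\<^esub> monomial S x m \<alpha>) = \<zero>\<^bsub>S\<^esub>"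
    and \<alpha>1: "\<alpha>1 \<in> exponents m d"
  shows "c \<alpha>1 \<in> M"
proof (rule ccontr)
  assume nM: "c \<alpha>1 \<notin> M"
  let ?X = "monomial S x m"
  let ?E = "{..<m} \<rightarrow>\<^sub>E (UNIV :: nat set)"
  define deg where "deg \<alpha> = (\<Sum>k<m. \<alpha> k)" for \<alpha> :: "nat \<Rightarrow> nat"
  \<comment> \<open>The exponent read as a number in base \<open>d + 1\<close>. The weight is
    additive and separates exponents of degree \<open>d\<close>, whose entries are at most
    \<open>d\<close>; it takes the place of a monomial order.\<close>
  define \<omega> where "\<omega> \<alpha> = (\<Sum>k<m. \<alpha> k * (d + 1) ^ k)" for \<alpha> :: "nat \<Rightarrow> nat"
  define pls where "pls \<alpha> \<beta> = (\<lambda>k\<in>{..<m}. \<alpha> k + \<beta> k)" for \<alpha> \<beta> :: "nat \<Rightarrow> nat"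
  have Xc: "?X \<alpha> \<in> carrier S" for \<alpha> by (rule S.monomial_closed) (rule x)
  have X_pls: "?X \<alpha> \<otimes>\<^bsub>S\<^esub> ?X \<beta> = ?X (pls \<alpha> \<beta>)" for \<alpha> \<beta>
  proof -
    have "?X \<alpha> \<otimes>\<^bsub>S\<^esub> ?X \<beta> = ?X (\<lambda>k. \<alpha> k + \<beta> k)" by (rule S.monomial_mult) (rule x)
    also have "\<dots> = ?X (pls \<alpha> \<beta>)" unfolding pls_def by (rule monomial_cong) simp
    finally show ?thesis .
  qed
  have deg_pls: "deg (pls \<alpha> \<beta>) = deg \<alpha> + deg \<beta>" for \<alpha> \<beta>
    unfolding deg_def pls_def by (simp add: sum.distrib)
  have \<omega>_pls: "\<omega> (pls \<alpha> \<beta>) = \<omega> \<alpha> + \<omega> \<beta>" for \<alpha> \<beta>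
    unfolding \<omega>_def pls_def by (simp add: sum.distrib algebra_simps)
  have pls_E: "pls \<alpha> \<beta> \<in> ?E" for \<alpha> \<beta> unfolding pls_def by simp
  have exp_E: "\<alpha> \<in> ?E" "deg \<alpha> = d" if "\<alpha> \<in> exponents m d" for \<alpha>
    using that unfolding exponents_def deg_def by auto
  have \<omega>_inj: "\<alpha> = \<beta>" if "\<alpha> \<in> exponents m d" "\<beta> \<in> exponents m d" "\<omega> \<alpha> = \<omega> \<beta>" for \<alpha> \<beta>
  proof (rule PiE_ext)
    show "\<alpha> \<in> ?E" "\<beta> \<in> ?E" using exp_E that by blast+
    fix k assume "k \<in> {..<m}"
    then show "\<alpha> k = \<beta> k"
      using that exponents_le[OF that(1)] exponents_le[OF that(2)] unfolding \<omega>_def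
      by (intro digit_sum_inj[of m \<alpha> "d + 1" \<beta>]) (auto simp: less_Suc_eq_le)
  qed
  define A where "A = {\<alpha> \<in> exponents m d. c \<alpha> \<notin> M}"
  have A: "finite A" "\<alpha>1 \<in> A" unfolding A_def using finite_exponents \<alpha>1 nM by auto
  have "Max (\<omega> ` A) \<in> \<omega> ` A" using A by (intro Max_in) auto
  then obtain \<alpha>0 where \<alpha>0: "\<alpha>0 \<in> A" "\<omega> \<alpha>0 = Max (\<omega> ` A)" by force
  have \<alpha>0e: "\<alpha>0 \<in> exponents m d" "c \<alpha>0 \<in> carrier R - M" using \<alpha>0(1) c unfolding A_def by auto
  have below: "\<omega> \<alpha> < \<omega> \<alpha>0" if "\<alpha> \<in> A" "\<alpha> \<noteq> \<alpha>0" for \<alpha>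
  proof -
    have "\<omega> \<alpha> \<le> \<omega> \<alpha>0" unfolding \<alpha>0(2) using that(1) A(1) by simp
    moreover have "\<omega> \<alpha> \<noteq> \<omega> \<alpha>0" using \<omega>_inj[of \<alpha> \<alpha>0] that \<alpha>0e unfolding A_def by auto
    ultimately show ?thesis by simp
  qed
  let ?L = "{\<alpha> \<in> ?E. deg \<alpha> = d \<and> \<omega> \<alpha> < \<omega> \<alpha>0}"
  have Lc: "?X ` Y \<subseteq> carrier S" for Y using Xc by blast
  \<comment> \<open>\<open>\<alpha>0\<close> is the heaviest exponent with a coefficient outside
    \<open>M\<close>. Inverting that coefficient expresses the leading monomial by lighter ones of
    equal degree.\<close>
  have lead: "?X \<alpha>0 \<in> lin_span (?X ` ?L)"
  proof -
    obtain e where e: "e \<in> carrier R" "h e \<otimes>\<^bsub>S\<^esub> h (c \<alpha>0) = \<one>\<^bsub>S\<^esub>" using inverse[OF \<alpha>0e(2)] by blast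
    let ?t = "\<lambda>\<alpha>. h (c \<alpha>) \<otimes>\<^bsub>S\<^esub> ?X \<alpha>"
    let ?D = "exponents m d - {\<alpha>0}"
    have tc: "?t \<alpha> \<in> carrier S" if "\<alpha> \<in> exponents m d" for \<alpha> using c[OF that] Xc by simp
    have tL: "?t \<alpha> \<in> lin_span (?X ` ?L)" if \<alpha>: "\<alpha> \<in> ?D" for \<alpha>
    proof (cases "c \<alpha> \<in> M")
      case True
      then show ?thesis using kills Xc lin_span.zero by simp
    next
      case False
      then have "\<alpha> \<in> A" using \<alpha> unfolding A_def by blast
      then have "\<alpha> \<in> ?L" using below \<alpha> exp_E by blast
      then show ?thesis using c \<alpha> by (intro lin_span_scale[OF Lc] lin_span_base[OF Lc]) auto
    qed
    have "(\<Oplus>\<^bsub>S\<^esub>\<alpha>\<in>insert \<alpha>0 ?D. ?t \<alpha>) = ?t \<alpha>0 \<oplus>\<^bsub>S\<^esub> (\<Oplus>\<^bsub>S\<^esub>\<alpha>\<in>?D. ?t \<alpha>)"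
      using tc \<alpha>0e(1) finite_exponents[of m d] by (intro S.finsum_insert) auto
    moreover have "insert \<alpha>0 ?D = exponents m d" using \<alpha>0e(1) by blast
    ultimately have sum: "?t \<alpha>0 \<oplus>\<^bsub>S\<^esub> (\<Oplus>\<^bsub>S\<^esub>\<alpha>\<in>?D. ?t \<alpha>) = \<zero>\<^bsub>S\<^esub>" using rel by simp
    have Dc: "(\<Oplus>\<^bsub>S\<^esub>\<alpha>\<in>?D. ?t \<alpha>) \<in> carrier S" using tc by (intro S.finsum_closed) auto
    have "?t \<alpha>0 = \<ominus>\<^bsub>S\<^esub> (\<Oplus>\<^bsub>S\<^esub>\<alpha>\<in>?D. ?t \<alpha>)"
      using S.minus_equality[OF sum Dc tc[OF \<alpha>0e(1)]] by simp
    moreover have "\<ominus>\<^bsub>S\<^esub> (\<Oplus>\<^bsub>S\<^esub>\<alpha>\<in>?D. ?t \<alpha>) \<in> lin_span (?X ` ?L)"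
      by (rule lin_span_uminus[OF Lc lin_span_finsum[OF Lc tL]])
    ultimately have "h e \<otimes>\<^bsub>S\<^esub> ?t \<alpha>0 \<in> lin_span (?X ` ?L)" using lin_span_scale[OF Lc _ e(1)] by simp
    moreover have "h e \<otimes>\<^bsub>S\<^esub> ?t \<alpha>0 = (h e \<otimes>\<^bsub>S\<^esub> h (c \<alpha>0)) \<otimes>\<^bsub>S\<^esub> ?X \<alpha>0"
      using e(1) \<alpha>0e(2) Xc by (intro S.m_assoc[symmetric]) auto
    ultimately show ?thesis using e(2) Xc by simp
  qed
  \<comment> \<open>Exponents of monomials not divisible by the leading one. They still span,
    because rewriting a multiple of the leading monomial lowers the weight and keeps the
    degree.\<close>
  define W where "W N = {\<alpha> \<in> ?E. deg \<alpha> \<le> N \<and> (\<exists>k<m. \<alpha> k < \<alpha>0 k)}" for N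
  have red: "?X \<alpha> \<in> lin_span (?X ` W N)" if "\<alpha> \<in> ?E" "deg \<alpha> \<le> N" for \<alpha> N
    using that
  proof (induction "\<omega> \<alpha>" arbitrary: \<alpha> rule: less_induct)
    case less
    show ?case
    proof (cases "\<exists>k<m. \<alpha> k < \<alpha>0 k")
      case True
      then have "\<alpha> \<in> W N" unfolding W_def using less.prems by blast
      then show ?thesis using lin_span_base[OF Lc] by blast
    next
      case False
      define \<delta> where "\<delta> = (\<lambda>k\<in>{..<m}. \<alpha> k - \<alpha>0 k)"
      have eq: "\<alpha> = pls \<delta> \<alpha>0"
      proof (rule PiE_ext[OF less.prems(1) pls_E])
        fix k assume k: "k \<in> {..<m}"
        then have "\<alpha>0 k \<le> \<alpha> k" using False by (meson lessThan_iff not_less)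
        then show "\<alpha> k = pls \<delta> \<alpha>0 k" using k unfolding pls_def \<delta>_def by simp
      qed
      have "?X \<delta> \<otimes>\<^bsub>S\<^esub> ?X \<alpha>0 \<in> lin_span (?X ` W N)"
      proof (rule lin_span_mult[OF Lc Lc Lc _ _ lead])
        show "?X \<delta> \<in> lin_span (?X ` {\<delta>})" using lin_span_base[OF Lc] by blast
        fix u v assume "u \<in> ?X ` {\<delta>}" "v \<in> ?X ` ?L"
        then obtain \<beta> where \<beta>: "u = ?X \<delta>" "v = ?X \<beta>" "deg \<beta> = d" "\<omega> \<beta> < \<omega> \<alpha>0" by auto
        have "?X (pls \<delta> \<beta>) \<in> lin_span (?X ` W N)"
        proof (rule less.hyps[OF _ pls_E])
          show "\<omega> (pls \<delta> \<beta>) < \<omega> \<alpha>" unfolding eq \<omega>_pls using \<beta>(4) by simp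
          have "deg (pls \<delta> \<beta>) = deg \<alpha>" unfolding eq deg_pls using \<beta>(3) exp_E(2)[OF \<alpha>0e(1)] by simp
          then show "deg (pls \<delta> \<beta>) \<le> N" using less.prems(2) by simp
        qed
        then show "u \<otimes>\<^bsub>S\<^esub> v \<in> lin_span (?X ` W N)" unfolding \<beta>(1,2) X_pls .
      qed
      then show ?thesis unfolding X_pls eq[symmetric] .
    qed
  qed
  have span_mono: "u \<in> lin_span (?X ` W N')" if u: "u \<in> lin_span (?X ` W N)" and NN: "N \<le> N'" for u N N'
  proof -
    have "W N \<subseteq> W N'"
    proof
      fix \<alpha> assume "\<alpha> \<in> W N"
      then show "\<alpha> \<in> W N'" unfolding W_def using le_trans[OF _ NN, of "deg \<alpha>"] by blast
    qed
    then have "?X ` W N \<subseteq> ?X ` W N'" by (rule image_mono)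
    moreover have "?X ` W N' \<subseteq> lin_span (?X ` W N')" by (rule subsetI) (rule lin_span_base[OF Lc])
    ultimately have "?X ` W N \<subseteq> lin_span (?X ` W N')" by (rule subset_trans)
    from lin_span_trans[OF this Lc u] show ?thesis .
  qed
  have span_gen: "\<exists>N. u \<in> lin_span (?X ` W N)" if u: "u \<in> carrier S" for u
  proof -
    obtain D where "u \<in> lin_span (?X ` {\<alpha> \<in> ?E. (\<Sum>k<m. \<alpha> k) \<le> D})" using gen[OF u] by blast
    moreover have "?X ` {\<alpha> \<in> ?E. (\<Sum>k<m. \<alpha> k) \<le> D} \<subseteq> lin_span (?X ` W D)"
      using red unfolding deg_def by blast
    ultimately have "u \<in> lin_span (?X ` W D)" using lin_span_trans[OF _ Lc, of _ "W D" u] by blast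
    then show ?thesis by blast
  qed
  have span_mult: "u \<otimes>\<^bsub>S\<^esub> v \<in> lin_span (?X ` W (N + N'))"
    if "u \<in> lin_span (?X ` W N)" "v \<in> lin_span (?X ` W N')" for u v N N'
  proof (rule lin_span_mult[OF Lc Lc Lc _ that])
    fix s t assume "s \<in> ?X ` W N" "t \<in> ?X ` W N'"
    then obtain \<alpha> \<beta> where "s = ?X \<alpha>" "t = ?X \<beta>" "deg \<alpha> \<le> N" "deg \<beta> \<le> N'" unfolding W_def by auto
    then show "s \<otimes>\<^bsub>S\<^esub> t \<in> lin_span (?X ` W (N + N'))"
      using red[OF pls_E, of \<alpha> \<beta> "N + N'"] by (simp add: X_pls deg_pls)
  qed
  \<comment> \<open>The chain is reversed, since \<open>prime_chain_independence\<close> starts from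
    the largest prime and works down.\<close>
  define q where "q k = p (m - k)" for k
  have q: "primeideal (q k) S" if "k \<le> m" for k unfolding q_def by (rule p(1)) simp
  have qs: "q (Suc k) \<subset> q k" if "k < m" for k
  proof -
    have "m - k = Suc (m - Suc k)" using that by simp
    then show ?thesis unfolding q_def using p(2)[of "m - Suc k"] that by simp
  qed
  then have "\<forall>k<m. \<exists>z. z \<in> q k - q (Suc k)" by blast
  then obtain y where y: "\<And>k. k < m \<Longrightarrow> y k \<in> q k - q (Suc k)" by metis
  have yc: "y k \<in> carrier S" if "k < m" for k
    using y[OF that] ideal.Icarr[OF primeideal.axioms(1)[OF q[of k]]] that by auto
  have "\<forall>k<m. \<exists>N. y k \<in> lin_span (?X ` W N)" using span_gen yc by blast
  then obtain Nf where Nf: "\<And>k. k < m \<Longrightarrow> y k \<in> lin_span (?X ` W (Nf k))" by metis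
  define D where "D = Max (Nf ` {..<m})"
  have yD: "y k \<in> lin_span (?X ` W D)" if "k < m" for k
    using span_mono[OF Nf[OF that]] that unfolding D_def by simp
  have one: "\<one>\<^bsub>S\<^esub> \<in> lin_span (?X ` W N)" for N
  proof -
    have "monomial S x j (\<lambda>k\<in>{..<m}. 0) = \<one>\<^bsub>S\<^esub>" if "j \<le> m" for j
      using that x by (induction j) auto
    then have "?X (\<lambda>k\<in>{..<m}. 0) = \<one>\<^bsub>S\<^esub>" by simp
    then show ?thesis using red[of "\<lambda>k\<in>{..<m}. 0" N] by (simp add: deg_def)
  qed
  have ypow: "y k [^]\<^bsub>S\<^esub> (e::nat) \<in> lin_span (?X ` W (D * e))" if "k < m" for k e
  proof (induction e)
    case 0
    then show ?case using one by simp
  next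
    case (Suc e)
    then show ?case using span_mult[OF Suc yD[OF that]] by (simp add: algebra_simps)
  qed
  have ymon: "monomial S y j \<beta> \<in> lin_span (?X ` W (\<Sum>k<j. D * \<beta> k))" if "j \<le> m" for j \<beta>
    using that
  proof (induction j)
    case 0
    then show ?case using one by simp
  next
    case (Suc j)
    then show ?case using span_mult[of "monomial S y j \<beta>" "\<Sum>k<j. D * \<beta> k" "y j [^]\<^bsub>S\<^esub> \<beta> j" "D * \<beta> j"] ypow[of j "\<beta> j"] by simp
  qed
  \<comment> \<open>Chosen for the estimate below. Monomials in \<open>y\<close> with exponents up
    to \<open>n\<close> have degree at most \<open>N = D m n\<close>, and
    \<open>N + 1 \<le> (m D + 1) (n + 1)\<close>; this bounds the spanning set by
    \<open>n (n + 1)^(m - 1)\<close>, fewer than the \<open>(n + 1)^m\<close> monomials.\<close>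
  define n where "n = m * d * (m * D + 1) ^ (m - 1)"
  define N where "N = D * m * n"
  define B where "B = {..<m} \<rightarrow>\<^sub>E {..n}"
  have yB: "monomial S y m \<beta> \<in> lin_span (?X ` W N)" if "\<beta> \<in> B" for \<beta>
  proof -
    have "(\<Sum>k<m. D * \<beta> k) \<le> (\<Sum>k<m. D * n)"
      using that unfolding B_def by (intro sum_mono mult_le_mono2) auto
    also have "\<dots> = N" unfolding N_def by simp
    finally show ?thesis using span_mono[OF ymon[of m \<beta>]] by simp
  qed
  have "W N \<subseteq> (\<Union>k<m. ({..<m} \<rightarrow>\<^sub>E {..N}) \<inter> {\<alpha>. \<alpha> k < d})"
  proof
    fix \<alpha> assume "\<alpha> \<in> W N"
    then obtain k where k: "\<alpha> \<in> ?E" "deg \<alpha> \<le> N" "k < m" "\<alpha> k < \<alpha>0 k" unfolding W_def by auto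
    have "\<alpha> j \<le> N" if "j < m" for j
      using k(2) member_le_sum[of j "{..<m}" \<alpha>] that unfolding deg_def by auto
    moreover have "\<alpha> k < d" using k(3,4) exponents_le[OF \<alpha>0e(1) k(3)] by simp
    ultimately show "\<alpha> \<in> (\<Union>k<m. ({..<m} \<rightarrow>\<^sub>E {..N}) \<inter> {\<alpha>. \<alpha> k < d})"
      using k(1,3) by (auto simp: PiE_iff)
  qed
  moreover have finU: "finite (\<Union>k<m. ({..<m} \<rightarrow>\<^sub>E {..N}) \<inter> {\<alpha>. \<alpha> k < d})"
    by (intro finite_UN_I finite_Int disjI1 finite_PiE) auto
  ultimately have WN: "finite (W N)" "card (W N) \<le> card (\<Union>k<m. ({..<m} \<rightarrow>\<^sub>E {..N}) \<inter> {\<alpha>. \<alpha> k < d})"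
    using finite_subset card_mono by blast+
  note WN(2)
  also have "card (\<Union>k<m. ({..<m} \<rightarrow>\<^sub>E {..N}) \<inter> {\<alpha>. \<alpha> k < d}) \<le> (\<Sum>k<m. card (({..<m} \<rightarrow>\<^sub>E {..N}) \<inter> {\<alpha>. \<alpha> k < d}))"
    by (rule card_UN_le) simp
  also have "\<dots> \<le> (\<Sum>k<m. d * (N + 1) ^ (m - 1))"
    by (intro sum_mono card_PiE_coordinate_bound) simp
  also have "\<dots> = m * d * (N + 1) ^ (m - 1)" by simp
  also have "\<dots> \<le> m * d * ((m * D + 1) * (n + 1)) ^ (m - 1)"
    unfolding N_def by (intro mult_le_mono2 power_mono) (simp_all add: algebra_simps)
  also have "\<dots> = (m * d * (m * D + 1) ^ (m - 1)) * (n + 1) ^ (m - 1)"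
    by (simp only: power_mult_distrib mult.assoc)
  also have "\<dots> = n * (n + 1) ^ (m - 1)" by (simp only: n_def[symmetric])
  also have "\<dots> < (n + 1) * (n + 1) ^ (m - 1)" by simp
  also have "\<dots> = (n + 1) ^ m" using m by (metis Suc_diff_1 less_le_trans power_Suc zero_less_one)
  also have "\<dots> = card B" unfolding B_def by (simp add: card_PiE)
  finally have card: "card (W N) < card B" .
  have "card (?X ` W N) < card B" using card card_image_le[OF WN(1), of ?X] by simp
  moreover have "finite B" unfolding B_def by (intro finite_PiE) auto
  ultimately obtain \<phi> where \<phi>: "\<forall>\<beta>\<in>B. \<phi> \<beta> \<in> carrier R" "\<exists>\<beta>\<in>B. \<phi> \<beta> \<notin> M"
    "(\<Oplus>\<^bsub>S\<^esub>\<beta>\<in>B. monomial S y m \<beta> \<otimes>\<^bsub>S\<^esub> h (\<phi> \<beta>)) = \<zero>\<^bsub>S\<^esub>"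
    using linear_dependence[of "?X ` W N" B "monomial S y m", OF finite_imageI[OF WN(1)] Lc _ _ yB] by blast
  interpret Qm: primeideal "q m" S by (rule q) simp
  have "(\<Oplus>\<^bsub>S\<^esub>\<beta>\<in>B. h (\<phi> \<beta>) \<otimes>\<^bsub>S\<^esub> monomial S y m \<beta>) = (\<Oplus>\<^bsub>S\<^esub>\<beta>\<in>B. monomial S y m \<beta> \<otimes>\<^bsub>S\<^esub> h (\<phi> \<beta>))"
    using \<phi>(1) S.monomial_closed[of m y] yc by (intro S.finsum_cong') (auto intro: S.m_comm)
  then have "(\<Oplus>\<^bsub>S\<^esub>\<beta>\<in>B. h (\<phi> \<beta>) \<otimes>\<^bsub>S\<^esub> monomial S y m \<beta>) \<in> q m"
    using \<phi>(3) additive_subgroup.zero_closed[OF Qm.additive_subgroup_axioms] by simp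
  then have "\<phi> \<beta> \<in> M" if "\<beta> \<in> B" for \<beta>
  proof (rule prime_chain_independence[where q = q and B = B and y = y and m = m and \<beta> = \<beta>, rotated 6])
    fix \<beta> \<beta>' assume "\<beta> \<in> B" "\<beta>' \<in> B" "\<And>k. k < m \<Longrightarrow> \<beta> k = \<beta>' k"
    then show "\<beta> = \<beta>'" unfolding B_def by (intro PiE_ext) auto
  qed (use q qs y \<phi>(1) that \<open>finite B\<close> in auto)
  then show False using \<phi>(2) by blast
qed

end

section \<open>The fiber ring degree by degree, and analytic independence\<close>

section \<open>The special fiber ring\<close>

locale fiber_cone = cring R + max: maximalideal M R + I: ideal I R for R (structure) and M I
begin

abbreviation P :: "nat \<Rightarrow> 'a set" where "P n \<equiv> ideal_pow R I n"

definition K :: "nat \<Rightarrow> 'a set" where "K n = M \<cdot> P n"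

text \<open>The homogeneous element of degree \<open>d\<close> represented by \<open>v\<close>, for
  \<open>v\<close> in \<open>P d\<close>; in degree \<open>0\<close> it is the structure map from
  \<open>R\<close>.\<close>

definition comp :: "nat \<Rightarrow> 'a \<Rightarrow> nat \<Rightarrow> 'a set"
  where "comp d v = (\<lambda>n. if n = d then K d +> v else K n)"

abbreviation F :: "(nat \<Rightarrow> 'a set) ring" where "F \<equiv> fiber_ring R M I"

lemma P: "ideal (P n) R" using ideal_pow_ideal[OF I.is_ideal] .

lemma P_carrier: "v \<in> P n \<Longrightarrow> v \<in> carrier R" using ideal.Icarr[OF P] .

lemma K: "ideal (K n) R" unfolding K_def by (rule ideal_prod_is_ideal[OF max.is_ideal P])

lemma P_zero: "\<zero> \<in> P n" using additive_subgroup.zero_closed[OF ideal.axioms(1)[OF P]] .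

lemma K_sub_P: "K n \<subseteq> P n" unfolding K_def using ideal_prod_inter[OF max.is_ideal P] by blast

lemma K_P: "k \<in> K i \<Longrightarrow> p \<in> P j \<Longrightarrow> k \<otimes> p \<in> K (i + j)"
proof -
  assume "k \<in> K i" "p \<in> P j"
  then have "k \<otimes> p \<in> (M \<cdot> P i) \<cdot> P j" unfolding K_def by (rule ideal_prod.prod)
  then show ?thesis
    unfolding K_def using ideal_prod_assoc[OF max.is_ideal P P] ideal_pow_add[OF I.is_ideal] by simp
qed

lemma P_mult: "v \<in> P i \<Longrightarrow> w \<in> P j \<Longrightarrow> v \<otimes> w \<in> P (i + j)"
  unfolding ideal_pow_add[OF I.is_ideal] by (rule ideal_prod.prod)

lemma coset_eqI: "\<lbrakk>a \<in> carrier R; b \<in> carrier R; a \<ominus> b \<in> K n\<rbrakk> \<Longrightarrow> K n +> a = K n +> b"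
  using quotient_eq_iff_same_a_r_cos[OF K] by blast

lemma coset_zero: "K n +> \<zero> = K n"
  using a_coset_add_zero[of "K n"] ideal.Icarr[OF K] by blast

lemma coset_mem: "a \<in> K n +> v \<Longrightarrow> \<exists>k\<in>K n. a = k \<oplus> v"
  unfolding a_r_coset_def' by blast

lemma coset_self: "v \<in> carrier R \<Longrightarrow> v \<in> K n +> v"
proof -
  assume "v \<in> carrier R"
  then have "v = \<zero> \<oplus> v" by simp
  moreover have "\<zero> \<in> K n" using additive_subgroup.zero_closed[OF ideal.axioms(1)[OF K]] .
  ultimately show ?thesis unfolding a_r_coset_def' by blast
qed

text \<open>Passing to other representatives of the two cosets changes the product by
  \<open>k b + l v\<close>, and both terms lie in \<open>\<mm> I^n\<close> because \<open>k\<close>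
  and \<open>l\<close> come from \<open>K i\<close> and \<open>K j\<close> while \<open>b\<close>
  and \<open>v\<close> lie in \<open>P j\<close> and \<open>P i\<close>.\<close>

lemma coset_mult:
  assumes v: "v \<in> P i" and w: "w \<in> P j" and n: "n = i + j"
  shows "rcoset_mult R (K n) (K i +> v) (K j +> w) = K n +> (v \<otimes> w)"
proof -
  have vc: "v \<in> carrier R" and wc: "w \<in> carrier R" using P_carrier v w by blast+
  have "K n +> (a \<otimes> b) = K n +> (v \<otimes> w)" if a: "a \<in> K i +> v" and b: "b \<in> K j +> w" for a b
  proof -
    interpret Kn: ideal "K n" R by (rule K)
    obtain k where k: "k \<in> K i" "a = k \<oplus> v" using coset_mem[OF a] by blast
    obtain l where l: "l \<in> K j" "b = l \<oplus> w" using coset_mem[OF b] by blast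
    have c: "k \<in> carrier R" "l \<in> carrier R" using ideal.Icarr[OF K] k l by blast+
    have bP: "b \<in> P j" unfolding l(2) using ideal.add_in[OF P] K_sub_P l w by blast
    have "k \<otimes> b \<in> K n" unfolding n by (rule K_P[OF k(1) bP])
    moreover have "l \<otimes> v \<in> K n" unfolding n using K_P[OF l(1) v] by (simp add: add.commute)
    ultimately have "k \<otimes> b \<oplus> l \<otimes> v \<in> K n" by (rule Kn.add_in)
    moreover have "a \<otimes> b \<ominus> v \<otimes> w = k \<otimes> b \<oplus> l \<otimes> v" unfolding k(2) l(2) using c vc wc by algebra
    ultimately show ?thesis using c vc wc k l by (intro coset_eqI) auto
  qed
  then have "(\<Union>a\<in>K i +> v. \<Union>b\<in>K j +> w. K n +> (a \<otimes> b)) = (\<Union>a\<in>K i +> v. \<Union>b\<in>K j +> w. K n +> (v \<otimes> w))"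
    by simp
  also have "\<dots> = K n +> (v \<otimes> w)" using coset_self[OF vc] coset_self[OF wc] by auto
  finally show ?thesis unfolding rcoset_mult_def .
qed

lemma F_carrier_iff: "f \<in> carrier F \<longleftrightarrow> (\<forall>n. \<exists>v\<in>P n. f n = K n +> v) \<and> finite {n. f n \<noteq> K n}"
  unfolding fiber_ring_def K_def quot_module_def by (auto simp: Let_def image_iff)

lemma F_zero: "\<zero>\<^bsub>F\<^esub> = K"
  unfolding fiber_ring_def K_def[abs_def] by (simp add: Let_def)

lemma F_add: "f \<oplus>\<^bsub>F\<^esub> g = (\<lambda>n. f n <+> g n)"
  unfolding fiber_ring_def by (simp add: Let_def)

lemma F_one: "\<one>\<^bsub>F\<^esub> = comp 0 \<one>"
  unfolding fiber_ring_def comp_def K_def[abs_def] by (auto simp: Let_def fun_eq_iff)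

lemma F_mult: "f \<otimes>\<^bsub>F\<^esub> g = (\<lambda>n. \<Oplus>\<^bsub>R Quot K n\<^esub>i\<in>{..n}. rcoset_mult R (K n) (f i) (g (n - i)))"
  unfolding fiber_ring_def K_def by (simp add: Let_def)

lemma comp_eq: "comp d v n = K n +> (if n = d then v else \<zero>)"
  unfolding comp_def using coset_zero by simp

lemma comp_closed: "v \<in> P d \<Longrightarrow> comp d v \<in> carrier F"
proof -
  assume v: "v \<in> P d"
  have "\<exists>w\<in>P n. comp d v n = K n +> w" for n using v P_zero by (auto simp: comp_eq)
  moreover have "{n. comp d v n \<noteq> K n} \<subseteq> {d}" unfolding comp_def by auto
  ultimately show ?thesis unfolding F_carrier_iff using finite_subset by blast
qed

lemma coset_add: "v \<in> carrier R \<Longrightarrow> w \<in> carrier R \<Longrightarrow> (K n +> v) <+> (K n +> w) = K n +> (v \<oplus> w)"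
  using ideal.a_rcos_sum[OF K] .

lemma comp_add: "v \<in> P d \<Longrightarrow> w \<in> P d \<Longrightarrow> comp d v \<oplus>\<^bsub>F\<^esub> comp d w = comp d (v \<oplus> w)"
  unfolding F_add comp_eq using P_carrier by (auto simp: fun_eq_iff coset_add)

lemma comp_zero: "comp d \<zero> = \<zero>\<^bsub>F\<^esub>"
  unfolding F_zero by (auto simp: fun_eq_iff comp_eq coset_zero)

lemma comp_in_K: "v \<in> K d \<Longrightarrow> comp d v = \<zero>\<^bsub>F\<^esub>"
proof -
  assume v: "v \<in> K d"
  have vc: "v \<in> carrier R" using ideal.Icarr[OF K v] .
  have "v \<ominus> \<zero> = v" using vc by algebra
  then have "K d +> v = K d +> \<zero>" using vc v by (intro coset_eqI) auto
  then show ?thesis unfolding F_zero comp_def using coset_zero by (auto simp: fun_eq_iff)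
qed

text \<open>In the convolution sum only the index \<open>i = d\<close> contributes, and only in
  degree \<open>d + e\<close>.\<close>

lemma comp_mult:
  assumes v: "v \<in> P d" and w: "w \<in> P e"
  shows "comp d v \<otimes>\<^bsub>F\<^esub> comp e w = comp (d + e) (v \<otimes> w)"
proof
  fix n
  have c: "v \<in> carrier R" "w \<in> carrier R" using P_carrier v w by blast+
  let ?t = "\<lambda>i. if i = d \<and> n - i = e then v \<otimes> w else \<zero>"
  interpret q: ring_hom_ring R "R Quot K n" "(+>) (K n)" by (rule ideal.rcos_ring_hom_ring[OF K])
  have "rcoset_mult R (K n) (comp d v i) (comp e w (n - i)) = K n +> ?t i" if "i \<le> n" for i
  proof -
    have "rcoset_mult R (K n) (comp d v i) (comp e w (n - i)) =
        K n +> ((if i = d then v else \<zero>) \<otimes> (if n - i = e then w else \<zero>))"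
      unfolding comp_eq using v w P_zero that by (intro coset_mult) auto
    also have "\<dots> = K n +> ?t i" using c by auto
    finally show ?thesis .
  qed
  then have "(comp d v \<otimes>\<^bsub>F\<^esub> comp e w) n = (\<Oplus>\<^bsub>R Quot K n\<^esub>i\<in>{..n}. K n +> ?t i)"
    unfolding F_mult by (intro q.S.finsum_cong') (use c q.hom_closed in auto)
  also have "\<dots> = K n +> (\<Oplus>i\<in>{..n}. ?t i)"
    using q.hom_finsum[of ?t "{..n}"] c by (simp add: o_def)
  also have "(\<Oplus>i\<in>{..n}. ?t i) = (if n = d + e then v \<otimes> w else \<zero>)"
  proof (cases "n = d + e")
    case True
    have "(\<Oplus>i\<in>{..n}. ?t i) = (\<Oplus>i\<in>{..n}. if d = i then v \<otimes> w else \<zero>)"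
      using c True by (intro finsum_cong') auto
    also have "\<dots> = v \<otimes> w"
      using add.finprod_singleton[of d "{..n}" "\<lambda>_. v \<otimes> w"] True c by simp
    finally show ?thesis using True by simp
  next
    case False
    have "(\<Oplus>i\<in>{..n}. ?t i) = (\<Oplus>i\<in>{..n}. \<zero>)" using False by (intro finsum_cong') auto
    then show ?thesis using False by simp
  qed
  also have "K n +> (if n = d + e then v \<otimes> w else \<zero>) = comp (d + e) (v \<otimes> w) n" by (simp add: comp_eq)
  finally show "(comp d v \<otimes>\<^bsub>F\<^esub> comp e w) n = comp (d + e) (v \<otimes> w) n" .
qed

text \<open>Finite support makes every element a finite sum of homogeneous ones.\<close>

lemma F_induct:
  assumes f: "f \<in> carrier F" and "Q \<zero>\<^bsub>F\<^esub>"
    and step: "\<And>d v u. \<lbrakk>v \<in> P d; Q u\<rbrakk> \<Longrightarrow> Q (comp d v \<oplus>\<^bsub>F\<^esub> u)"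
  shows "Q f"
proof -
  have "Q f" if "finite A" "{n. f n \<noteq> K n} \<subseteq> A" "\<forall>n. \<exists>v\<in>P n. f n = K n +> v" for A f
    using that
  proof (induction A arbitrary: f rule: finite_induct)
    case empty
    then have "f = K" by auto
    then show ?case using assms(2) F_zero by simp
  next
    case (insert d A)
    obtain v where v: "v \<in> P d" "f d = K d +> v" using insert.prems(2) by blast
    let ?u = "f(d := K d)"
    have "Q ?u"
    proof (rule insert.IH)
      show "{n. ?u n \<noteq> K n} \<subseteq> A" using insert.prems(1) by auto
      have "\<exists>v\<in>P d. K d = K d +> v" using P_zero coset_zero by metis
      then show "\<forall>n. \<exists>v\<in>P n. ?u n = K n +> v" using insert.prems(2) by simp
    qed
    moreover have "f = comp d v \<oplus>\<^bsub>F\<^esub> ?u"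
    proof
      fix n
      obtain w where w: "w \<in> P n" "f n = K n +> w" using insert.prems(2) by blast
      show "f n = (comp d v \<oplus>\<^bsub>F\<^esub> ?u) n"
      proof (cases "n = d")
        case True
        have "(K d +> v) <+> (K d +> \<zero>) = K d +> v" using coset_add P_carrier[OF v(1)] by simp
        then show ?thesis unfolding F_add comp_eq using v True coset_zero by simp
      next
        case False
        have "(K n +> \<zero>) <+> (K n +> w) = K n +> w" using coset_add P_carrier[OF w(1)] by simp
        then show ?thesis unfolding F_add comp_eq using w False by simp
      qed
    qed
    ultimately show ?case using step[OF v(1)] by metis
  qed
  then show ?thesis using f unfolding F_carrier_iff by blast
qed

end

text \<open>The ring axioms of the fiber ring are an assumption here. They come along with any prime
  ideal, since \<open>primeideal\<close> includes \<open>cring\<close>, and positive dimension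
  provides such a prime.\<close>

locale fiber_cone_cring = fiber_cone + F: cring "fiber_ring R M I"
begin

lemma comp_0_hom: "ring_hom_cring R F (comp 0)"
proof (rule RingHom.ring_hom_cringI[OF ring_hom_ringI[OF ring_axioms F.ring_axioms] cring_axioms F.cring_axioms])
  have P0: "P 0 = carrier R" by (rule ideal_pow_0)
  show "comp 0 c \<in> carrier F" if "c \<in> carrier R" for c using comp_closed[of c 0] that P0 by blast
  show "comp 0 (a \<otimes> b) = comp 0 a \<otimes>\<^bsub>F\<^esub> comp 0 b" if "a \<in> carrier R" "b \<in> carrier R" for a b
    using comp_mult[of a 0 b 0] that unfolding P0 by simp
  show "comp 0 (a \<oplus> b) = comp 0 a \<oplus>\<^bsub>F\<^esub> comp 0 b" if "a \<in> carrier R" "b \<in> carrier R" for a b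
    using comp_add[of a 0 b] that unfolding P0 by simp
  show "comp 0 \<one> = \<one>\<^bsub>F\<^esub>" by (rule F_one[symmetric])
qed

sublocale A: residue_algebra R F "comp 0" M
proof -
  interpret h: ring_hom_cring R F "comp 0" by (rule comp_0_hom)
  have "comp 0 c = \<zero>\<^bsub>F\<^esub>" if "c \<in> M" for c
  proof (rule comp_in_K)
    show "c \<in> K 0" unfolding K_def ideal_pow_0 using ideal_prod_one[OF max.is_ideal] that by simp
  qed
  then show "residue_algebra R F (comp 0) M"
    by (intro residue_algebra.intro residue_algebra_axioms.intro h.ring_hom_cring_axioms max.maximalideal_axioms)
qed

lemma comp_finsum:
  assumes "finite A" "\<And>i. i \<in> A \<Longrightarrow> v i \<in> P d"
  shows "(\<Oplus>\<^bsub>F\<^esub>i\<in>A. comp d (v i)) = comp d (\<Oplus>i\<in>A. v i)"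
  using assms
proof (induction A rule: finite_induct)
  case empty
  then show ?case using comp_zero by simp
next
  case (insert i A)
  have "(\<Oplus>\<^bsub>F\<^esub>i\<in>insert i A. comp d (v i)) = comp d (v i) \<oplus>\<^bsub>F\<^esub> (\<Oplus>\<^bsub>F\<^esub>i\<in>A. comp d (v i))"
    using insert comp_closed by (intro F.finsum_insert) auto
  also have "\<dots> = comp d (v i) \<oplus>\<^bsub>F\<^esub> comp d (\<Oplus>i\<in>A. v i)" using insert by simp
  also have "\<dots> = comp d (v i \<oplus> (\<Oplus>i\<in>A. v i))"
    using insert.prems ideal.finsum_in[OF P, of A v d] by (intro comp_add) auto
  also have "v i \<oplus> (\<Oplus>i\<in>A. v i) = (\<Oplus>i\<in>insert i A. v i)"
    using insert P_carrier by (intro finsum_insert[symmetric]) auto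
  finally show ?case .
qed

context
  fixes g :: "nat \<Rightarrow> 'a" and m :: nat
  assumes g: "\<And>k. k < m \<Longrightarrow> g k \<in> carrier R" and Ig: "I = Idl (g ` {..<m})"
begin

lemma g_P1: "k < m \<Longrightarrow> g k \<in> P 1"
proof -
  assume k: "k < m"
  have "g ` {..<m} \<subseteq> carrier R" using g by blast
  then have "g k \<in> I" unfolding Ig using genideal_self k by blast
  then show ?thesis using ideal_pow_one[OF I.is_ideal] by simp
qed

abbreviation x :: "nat \<Rightarrow> nat \<Rightarrow> 'a set" where "x k \<equiv> comp 1 (g k)"

lemma x_closed: "k < m \<Longrightarrow> x k \<in> carrier F" using comp_closed g_P1 by blast

lemma comp_power: "k < m \<Longrightarrow> g k [^] e \<in> P e \<and> x k [^]\<^bsub>F\<^esub> (e::nat) = comp e (g k [^] e)"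
proof (induction e)
  case 0
  then show ?case using F_one ideal_pow_0 by simp
next
  case (Suc e)
  have "g k [^] Suc e \<in> P (e + 1)" using P_mult[of "g k [^] e" e "g k" 1] Suc g_P1 by simp
  moreover have "x k [^]\<^bsub>F\<^esub> Suc e = comp (e + 1) (g k [^] Suc e)"
    using Suc comp_mult[of "g k [^] e" e "g k" 1] g_P1 by simp
  ultimately show ?case by simp
qed

lemma comp_monomial:
  "j \<le> m \<Longrightarrow> monomial R g j \<alpha> \<in> P (\<Sum>k<j. \<alpha> k) \<and> monomial F x j \<alpha> = comp (\<Sum>k<j. \<alpha> k) (monomial R g j \<alpha>)"
proof (induction j)
  case 0
  then show ?case using F_one ideal_pow_0 by simp
next
  case (Suc j)
  then show ?case
    using P_mult[of "monomial R g j \<alpha>" _ "g j [^] \<alpha> j" "\<alpha> j"] comp_mult[of "monomial R g j \<alpha>" _ "g j [^] \<alpha> j" "\<alpha> j"] comp_power[of j "\<alpha> j"]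
    by simp
qed

abbreviation low :: "nat \<Rightarrow> (nat \<Rightarrow> 'a set) set"
  where "low D \<equiv> monomial F x m ` {\<alpha> \<in> {..<m} \<rightarrow>\<^sub>E UNIV. (\<Sum>k<m. \<alpha> k) \<le> D}"

lemma low_closed: "low D \<subseteq> carrier F"
  using F.monomial_closed[of m x] x_closed by blast

lemma low_mono: "D \<le> D' \<Longrightarrow> u \<in> A.lin_span (low D) \<Longrightarrow> u \<in> A.lin_span (low D')"
proof -
  assume D: "D \<le> D'" and u: "u \<in> A.lin_span (low D)"
  have "{\<alpha> \<in> {..<m} \<rightarrow>\<^sub>E UNIV. (\<Sum>k<m. \<alpha> k) \<le> D} \<subseteq> {\<alpha> \<in> {..<m} \<rightarrow>\<^sub>E UNIV. (\<Sum>k<m. \<alpha> k) \<le> D'}"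
  proof
    fix \<alpha> assume "\<alpha> \<in> {\<alpha> \<in> {..<m} \<rightarrow>\<^sub>E UNIV. (\<Sum>k<m. \<alpha> k) \<le> D}"
    then show "\<alpha> \<in> {\<alpha> \<in> {..<m} \<rightarrow>\<^sub>E UNIV. (\<Sum>k<m. \<alpha> k) \<le> D'}" using le_trans[OF _ D] by blast
  qed
  then have "low D \<subseteq> low D'" by (rule image_mono)
  moreover have "low D' \<subseteq> A.lin_span (low D')" by (rule subsetI) (rule A.lin_span_base[OF low_closed])
  ultimately have "low D \<subseteq> A.lin_span (low D')" by (rule subset_trans)
  from A.lin_span_trans[OF this low_closed u] show ?thesis .
qed

lemma comp_1_span: "b \<in> I \<Longrightarrow> comp 1 b \<in> A.lin_span (x ` {..<m})"
proof -
  have xc: "x ` {..<m} \<subseteq> carrier F" using x_closed by blast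
  have P1: "P 1 = I" using ideal_pow_one[OF I.is_ideal] by simp
  have P0: "P 0 = carrier R" by (rule ideal_pow_0)
  let ?T = "{b \<in> I. comp 1 b \<in> A.lin_span (x ` {..<m})}"
  have "ideal ?T R"
  proof (rule cring_idealI)
    show "?T \<subseteq> carrier R" using I.Icarr by blast
    show "\<zero> \<in> ?T" using comp_zero A.lin_span.zero additive_subgroup.zero_closed[OF I.additive_subgroup_axioms] by simp
    fix a b assume ab: "a \<in> ?T" "b \<in> ?T"
    then have "comp 1 (a \<oplus> b) = comp 1 a \<oplus>\<^bsub>F\<^esub> comp 1 b" using comp_add[of a 1 b] unfolding P1 by simp
    then show "a \<oplus> b \<in> ?T" using ab I.add_in A.lin_span_add[OF xc] by simp
  next
    fix r a assume ra: "r \<in> carrier R" "a \<in> ?T"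
    then have "comp 1 (r \<otimes> a) = comp 0 r \<otimes>\<^bsub>F\<^esub> comp 1 a" using comp_mult[of r 0 a 1] unfolding P1 P0 by simp
    then show "r \<otimes> a \<in> ?T" using ra I.I_l_closed A.lin_span_scale[OF xc] by simp
  qed
  moreover have "g ` {..<m} \<subseteq> ?T" using g_P1 A.lin_span_base[OF xc] unfolding P1 by blast
  ultimately have "I \<subseteq> ?T" unfolding Ig using genideal_minimal[of ?T "g ` {..<m}"] Ig by simp
  then show "b \<in> I \<Longrightarrow> comp 1 b \<in> A.lin_span (x ` {..<m})" by blast
qed

text \<open>The fiber ring is generated in degree one: an element of \<open>P (Suc n)\<close> is a
  sum of products from \<open>P n\<close> and \<open>I\<close>, and multiplying a monomial by some
  \<open>x j\<close> raises one exponent.\<close>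

lemma comp_span: "v \<in> P n \<Longrightarrow> comp n v \<in> A.lin_span (low n)"
proof (induction n arbitrary: v)
  case 0
  have v: "v \<in> carrier R" using 0 ideal_pow_0 by simp
  have "monomial F x j (\<lambda>k\<in>{..<m}. 0) = \<one>\<^bsub>F\<^esub>" if "j \<le> m" for j
    using that x_closed by (induction j) auto
  then have one: "monomial F x m (\<lambda>k\<in>{..<m}. 0) = \<one>\<^bsub>F\<^esub>" by simp
  have "(\<lambda>k\<in>{..<m}. 0) \<in> {\<alpha> \<in> {..<m} \<rightarrow>\<^sub>E UNIV. (\<Sum>k<m. \<alpha> k) \<le> (0::nat)}" by simp
  then have "monomial F x m (\<lambda>k\<in>{..<m}. 0) \<in> low 0" by (rule imageI)
  then have "\<one>\<^bsub>F\<^esub> \<in> low 0" unfolding one .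
  then have "\<one>\<^bsub>F\<^esub> \<in> A.lin_span (low 0)" by (rule A.lin_span_base[OF low_closed])
  from A.lin_span_scale[OF low_closed this v] show ?case using A.hom_closed[OF v] by simp
next
  case (Suc n)
  have xc: "x ` {..<m} \<subseteq> carrier F" using x_closed by blast
  have P1: "P 1 = I" using ideal_pow_one[OF I.is_ideal] by simp
  have mult: "u \<otimes>\<^bsub>F\<^esub> y \<in> A.lin_span (low (Suc n))" if u: "u \<in> low n" and y: "y \<in> x ` {..<m}" for u y
  proof -
    obtain \<alpha> where \<alpha>: "(\<Sum>k<m. \<alpha> k) \<le> n" "u = monomial F x m \<alpha>" using u by blast
    obtain j where j: "j < m" "y = x j" using y by blast
    let ?e = "\<lambda>k. if k = j then 1 else 0 :: nat"
    have e: "monomial F x i ?e = (if j < i then x j else \<one>\<^bsub>F\<^esub>)" if "i \<le> m" for i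
      using that x_closed by (induction i) (auto simp: less_Suc_eq)
    let ?\<beta> = "\<lambda>k\<in>{..<m}. \<alpha> k + ?e k"
    have "u \<otimes>\<^bsub>F\<^esub> y = monomial F x m \<alpha> \<otimes>\<^bsub>F\<^esub> monomial F x m ?e" using e[of m] \<alpha> j by simp
    also have "\<dots> = monomial F x m (\<lambda>k. \<alpha> k + ?e k)" by (rule F.monomial_mult) (rule x_closed)
    also have "\<dots> = monomial F x m ?\<beta>" by (rule monomial_cong) simp
    finally have uy: "u \<otimes>\<^bsub>F\<^esub> y = monomial F x m ?\<beta>" .
    have "(\<Sum>k<m. ?\<beta> k) = (\<Sum>k<m. \<alpha> k) + (\<Sum>k<m. ?e k)" by (simp add: sum.distrib)
    also have "(\<Sum>k<m. ?e k) = 1" using j(1) by (simp add: sum.delta)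
    finally have "?\<beta> \<in> {\<alpha> \<in> {..<m} \<rightarrow>\<^sub>E UNIV. (\<Sum>k<m. \<alpha> k) \<le> Suc n}" using \<alpha>(1) by simp
    then have "monomial F x m ?\<beta> \<in> low (Suc n)" by (rule imageI)
    then show ?thesis unfolding uy by (rule A.lin_span_base[OF low_closed])
  qed
  have "v \<in> P n \<cdot> I" using Suc.prems ideal_pow_Suc by simp
  then have "v \<in> P (Suc n) \<and> comp (Suc n) v \<in> A.lin_span (low (Suc n))"
  proof (induction rule: ideal_prod.induct)
    case (prod a b)
    have b: "b \<in> P 1" using prod(2) unfolding P1 .
    have "comp n a \<otimes>\<^bsub>F\<^esub> comp 1 b \<in> A.lin_span (low (Suc n))"
      by (rule A.lin_span_mult[OF low_closed xc low_closed mult Suc.IH[OF prod(1)] comp_1_span[OF prod(2)]])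
    then have "comp (n + 1) (a \<otimes> b) \<in> A.lin_span (low (Suc n))" unfolding comp_mult[OF prod(1) b] .
    moreover have "a \<otimes> b \<in> P (n + 1)" by (rule P_mult[OF prod(1) b])
    ultimately show ?case unfolding Suc_eq_plus1 by blast
  next
    case (sum a b)
    then have ab: "a \<in> P (Suc n)" "b \<in> P (Suc n)" by blast+
    have "comp (Suc n) a \<oplus>\<^bsub>F\<^esub> comp (Suc n) b \<in> A.lin_span (low (Suc n))"
      by (rule A.lin_span_add[OF low_closed]) (use sum in blast)+
    then show ?case unfolding comp_add[OF ab] using ideal.add_in[OF P ab] by blast
  qed
  then show ?case by blast
qed

lemma F_span: "u \<in> carrier F \<Longrightarrow> \<exists>D. u \<in> A.lin_span (low D)"
proof (rule F_induct[where Q = "\<lambda>u. \<exists>D. u \<in> A.lin_span (low D)"])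
  show "\<exists>D. \<zero>\<^bsub>F\<^esub> \<in> A.lin_span (low D)" using A.lin_span.zero by blast
  fix d v u assume v: "v \<in> P d" and "\<exists>D. u \<in> A.lin_span (low D)"
  then obtain D where D: "u \<in> A.lin_span (low D)" by blast
  have "comp d v \<in> A.lin_span (low (max d D))" by (rule low_mono[OF _ comp_span[OF v]]) simp
  moreover have "u \<in> A.lin_span (low (max d D))" by (rule low_mono[OF _ D]) simp
  ultimately have "comp d v \<oplus>\<^bsub>F\<^esub> u \<in> A.lin_span (low (max d D))" by (rule A.lin_span_add[OF low_closed])
  then show "\<exists>D. comp d v \<oplus>\<^bsub>F\<^esub> u \<in> A.lin_span (low D)" by blast
qed

text \<open>A homogeneous relation in \<open>R\<close> becomes one in the fiber ring when each of
  its terms is placed in degree \<open>d\<close>.\<close>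

lemma relation_coeffs:
  assumes "m \<ge> 1"
    and p: "\<And>i. i \<le> m \<Longrightarrow> primeideal (p i) F" "\<And>i. i < m \<Longrightarrow> p i \<subset> p (Suc i)"
    and c: "\<And>\<alpha>. \<alpha> \<in> exponents m d \<Longrightarrow> c \<alpha> \<in> carrier R"
    and rel: "(\<Oplus>\<alpha>\<in>exponents m d. c \<alpha> \<otimes> monomial R g m \<alpha>) = \<zero>" and \<alpha>: "\<alpha> \<in> exponents m d"
  shows "c \<alpha> \<in> M"
proof (rule A.relation_coeffs_in_maximal[where m = m and x = "\<lambda>k. comp 1 (g k)" and p = p and d = d
      and c = c and ?\<alpha>1.0 = \<alpha>, OF assms(1) x_closed F_span p c _ \<alpha>])
  have t: "comp 0 (c \<beta>) \<otimes>\<^bsub>F\<^esub> monomial F x m \<beta> = comp d (c \<beta> \<otimes> monomial R g m \<beta>) \<and> c \<beta> \<otimes> monomial R g m \<beta> \<in> P d"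
    if \<beta>: "\<beta> \<in> exponents m d" for \<beta>
  proof -
    have "(\<Sum>k<m. \<beta> k) = d" using \<beta> unfolding exponents_def by simp
    then have "monomial R g m \<beta> \<in> P d" "monomial F x m \<beta> = comp d (monomial R g m \<beta>)"
      using comp_monomial[of m \<beta>] by auto
    moreover have "c \<beta> \<in> P 0" using c[OF \<beta>] ideal_pow_0 by simp
    ultimately show ?thesis using comp_mult[of "c \<beta>" 0 "monomial R g m \<beta>" d] P_mult[of "c \<beta>" 0 "monomial R g m \<beta>" d] by simp
  qed
  have "(\<Oplus>\<^bsub>F\<^esub>\<beta>\<in>exponents m d. comp 0 (c \<beta>) \<otimes>\<^bsub>F\<^esub> monomial F x m \<beta>) =
    (\<Oplus>\<^bsub>F\<^esub>\<beta>\<in>exponents m d. comp d (c \<beta> \<otimes> monomial R g m \<beta>))"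
    using t comp_closed by (intro F.finsum_cong') auto
  also have "\<dots> = comp d (\<Oplus>\<beta>\<in>exponents m d. c \<beta> \<otimes> monomial R g m \<beta>)"
    using t by (intro comp_finsum finite_exponents) blast
  also have "\<dots> = \<zero>\<^bsub>F\<^esub>" unfolding rel by (rule comp_zero)
  finally show "(\<Oplus>\<^bsub>F\<^esub>\<beta>\<in>exponents m d. comp 0 (c \<beta>) \<otimes>\<^bsub>F\<^esub> monomial F x m \<beta>) = \<zero>\<^bsub>F\<^esub>" .
qed

end

end

text \<open>A finite supremum in \<open>enat\<close> of a nonempty set is attained. Positivity of
  \<open>m\<close> rules out the empty set of chains, whose supremum is \<open>0\<close> as
  well.\<close>

lemma krull_dim_chain:
  assumes "krull_dim R = enat m" "m \<ge> 1"
  obtains p where "\<And>i. i \<le> m \<Longrightarrow> primeideal (p i) R" "\<And>i. i < m \<Longrightarrow> p i \<subset> p (Suc i)"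
proof -
  define A where "A = {enat n | n \<pp>. (\<forall>i\<le>n. \<pp> i \<in> Spec R) \<and> (\<forall>i<n. \<pp> i \<subset> \<pp> (Suc i))}"
  have S: "Sup A = enat m" using assms(1) unfolding krull_dim_def A_def .
  have ne: "A \<noteq> {}"
  proof
    assume "A = {}"
    then have "Sup A = 0" by (simp add: Sup_enat_def)
    then show False using S assms(2) by (simp add: zero_enat_def)
  qed
  have fin: "finite A"
  proof (rule ccontr)
    assume "infinite A"
    then have "Sup A = \<infinity>" using ne by (simp add: Sup_enat_def)
    then show False using S by simp
  qed
  have "Sup A = Max A" using ne fin by (simp add: Sup_enat_def)
  then have "enat m \<in> A" using Max_in[OF fin ne] S by simp
  then obtain n p where np: "enat m = enat n" "\<forall>i\<le>n. p i \<in> Spec R" "\<forall>i<n. p i \<subset> p (Suc i)"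
    unfolding A_def by blast
  have "n = m" using np(1) by simp
  then show thesis using np(2,3) by (intro that[of p]) (simp_all add: Spec_def)
qed

text \<open>Analytic independence: when the number of generators equals the dimension of the fiber
  ring, that ring is a polynomial ring over the residue field, expressed here through the
  coefficients of homogeneous relations.\<close>

theorem (in cring) fiber_ring_relation:
  assumes M: "maximalideal M R" and g: "\<And>k. k < m \<Longrightarrow> g k \<in> carrier R"
    and dim: "krull_dim (fiber_ring R M (Idl (g ` {..<m}))) = enat m"
    and c: "\<And>\<alpha>. \<alpha> \<in> exponents m d \<Longrightarrow> c \<alpha> \<in> carrier R"
    and rel: "(\<Oplus>\<alpha>\<in>exponents m d. c \<alpha> \<otimes> monomial R g m \<alpha>) = \<zero>" and \<alpha>: "\<alpha> \<in> exponents m d"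
  shows "c \<alpha> \<in> M"
proof (cases "m = 0")
  case True
  \<comment> \<open>Dimension \<open>0\<close> guarantees no prime; but the empty exponent is the
    only one, so the relation says directly that its coefficient is \<open>\<zero>\<close>.\<close>
  have "exponents m d = {\<alpha>}" using \<alpha> True unfolding exponents_def by auto
  then have "(\<Oplus>\<beta>\<in>{\<alpha>}. c \<beta> \<otimes> monomial R g m \<beta>) = \<zero>" using rel by simp
  moreover have "(\<Oplus>\<beta>\<in>{\<alpha>}. c \<beta> \<otimes> monomial R g m \<beta>) = c \<alpha>"
    using c[OF \<alpha>] True by (subst finsum_insert) auto
  ultimately have "c \<alpha> = \<zero>" by simp
  then show ?thesis using additive_subgroup.zero_closed[OF ideal.axioms(1)[OF maximalideal.axioms(1)[OF M]]] by simp
next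
  case False
  let ?I = "Idl (g ` {..<m})"
  have gc: "g ` {..<m} \<subseteq> carrier R" using g by blast
  obtain p where p: "\<And>i. i \<le> m \<Longrightarrow> primeideal (p i) (fiber_ring R M ?I)" "\<And>i. i < m \<Longrightarrow> p i \<subset> p (Suc i)"
    using krull_dim_chain[OF dim] False by auto
  interpret fiber_cone R M ?I
    by (intro fiber_cone.intro cring_axioms M genideal_ideal[OF gc])
  \<comment> \<open>The first prime of the chain supplies the ring axioms.\<close>
  interpret fiber_cone_cring R M ?I
    by (intro fiber_cone_cring.intro fiber_cone_axioms primeideal.axioms(2)[OF p(1)[of 0]]) simp
  show ?thesis
    by (rule relation_coeffs[where g = g and m = m and p = p and d = d and c = c and \<alpha> = \<alpha>,
          OF g refl _ p c rel \<alpha>]) (use False in auto)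
qed

section \<open>Analytic independence at a prime, expressed in \<open>R\<close>\<close>

section \<open>Relations among generators at a prime\<close>

lemma (in ring_hom_cring) hom_monomial:
  "(\<And>k. k < m \<Longrightarrow> x k \<in> carrier R) \<Longrightarrow> h (monomial R x m \<alpha>) = monomial S (\<lambda>k. h (x k)) m \<alpha>"
proof (induction m)
  case (Suc m)
  have "monomial R x m \<alpha> \<in> carrier R" using Suc.prems by (intro R.monomial_closed) simp
  then show ?case using Suc by (simp add: hom_nat_pow)
qed simp

text \<open>Collects what the local hypothesis provides in terms of \<open>R\<close> alone:
  numerators \<open>f\<close> as generators, a multiplier \<open>a\<close> in place of denominators,
  and coefficients in the prime in place of the maximal ideal. Later arguments use only
  this.\<close>

lemma (in primeideal) localization_data:
  assumes "noetherian_ring R" and J: "ideal J R"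
    and eq: "min_gens (loc R I) (loc_ideal R I J) = analytic_spread (loc R I) (loc_ideal R I J)"
  obtains m f a where "\<And>k. k < m \<Longrightarrow> f k \<in> J" "a \<in> Den" "\<And>x. x \<in> J \<Longrightarrow> a \<otimes> x \<in> Idl (f ` {..<m})"
    "\<And>d c \<alpha>. \<lbrakk>\<And>\<alpha>. \<alpha> \<in> exponents m d \<Longrightarrow> c \<alpha> \<in> carrier R;
      (\<Oplus>\<alpha>\<in>exponents m d. c \<alpha> \<otimes> monomial R f m \<alpha>) = \<zero>; \<alpha> \<in> exponents m d\<rbrakk> \<Longrightarrow> c \<alpha> \<in> I"
proof -
  obtain m b a where h: "min_gens (loc R I) (loc_ideal R I J) = enat m"
    "\<And>k. k < m \<Longrightarrow> b k \<in> J" "loc_ideal R I J = Idl\<^bsub>loc R I\<^esub> ((\<lambda>k. frac R I (b k) \<one>) ` {..<m})"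
    "a \<in> Den" "\<And>x. x \<in> J \<Longrightarrow> a \<otimes> x \<in> Idl (b ` {..<m})"
    using localized_generators[OF assms(1) J] by blast
  interpret L: cring "loc R I" by (rule loc_cring)
  let ?\<psi> = "\<lambda>a. frac R I a \<one>"
  interpret psi: ring_hom_cring R "loc R I" ?\<psi> by (rule frac_one_hom)
  have bc: "b k \<in> carrier R" if "k < m" for k using ideal.Icarr[OF J h(2)[OF that]] .
  have dim: "krull_dim (fiber_ring (loc R I) (loc_ideal R I I) (Idl\<^bsub>loc R I\<^esub> ((\<lambda>k. ?\<psi> (b k)) ` {..<m}))) = enat m"
  proof -
    have "krull_dim (fiber_ring (loc R I) (loc_ideal R I I) (loc_ideal R I J)) = enat m"
      using eq h(1) unfolding analytic_spread_def max_ideal_loc by simp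
    then show ?thesis unfolding h(3) .
  qed
  show thesis
  proof (rule that[of m b a])
    fix d c \<alpha>
    assume c: "\<And>\<alpha>. \<alpha> \<in> exponents m d \<Longrightarrow> c \<alpha> \<in> carrier R"
      and rel: "(\<Oplus>\<alpha>\<in>exponents m d. c \<alpha> \<otimes> monomial R b m \<alpha>) = \<zero>" and \<alpha>: "\<alpha> \<in> exponents m d"
    have Xc: "monomial R b m \<beta> \<in> carrier R" for \<beta> by (rule monomial_closed) (rule bc)
    have hX: "?\<psi> (monomial R b m \<beta>) = monomial (loc R I) (\<lambda>k. ?\<psi> (b k)) m \<beta>" for \<beta>
      by (rule psi.hom_monomial) (rule bc)
    have tc: "c \<beta> \<otimes> monomial R b m \<beta> \<in> carrier R" if "\<beta> \<in> exponents m d" for \<beta>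
      using c[OF that] Xc by simp
    have "\<zero>\<^bsub>loc R I\<^esub> = ?\<psi> (\<Oplus>\<beta>\<in>exponents m d. c \<beta> \<otimes> monomial R b m \<beta>)" unfolding rel by simp
    also have "\<dots> = (\<Oplus>\<^bsub>loc R I\<^esub>\<beta>\<in>exponents m d. ?\<psi> (c \<beta> \<otimes> monomial R b m \<beta>))"
      using psi.hom_finsum[of "\<lambda>\<beta>. c \<beta> \<otimes> monomial R b m \<beta>" "exponents m d"] tc by (simp add: o_def Pi_iff)
    also have "\<dots> = (\<Oplus>\<^bsub>loc R I\<^esub>\<beta>\<in>exponents m d. ?\<psi> (c \<beta>) \<otimes>\<^bsub>loc R I\<^esub> monomial (loc R I) (\<lambda>k. ?\<psi> (b k)) m \<beta>)"
    proof (rule L.finsum_cong')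
      show "(\<lambda>\<beta>. ?\<psi> (c \<beta>) \<otimes>\<^bsub>loc R I\<^esub> monomial (loc R I) (\<lambda>k. ?\<psi> (b k)) m \<beta>) \<in> exponents m d \<rightarrow> carrier (loc R I)"
        unfolding hX[symmetric] using c Xc by (auto intro!: L.m_closed psi.hom_closed)
      show "?\<psi> (c \<beta> \<otimes> monomial R b m \<beta>) = ?\<psi> (c \<beta>) \<otimes>\<^bsub>loc R I\<^esub> monomial (loc R I) (\<lambda>k. ?\<psi> (b k)) m \<beta>"
        if "\<beta> \<in> exponents m d" for \<beta>
        unfolding hX[symmetric] by (rule psi.hom_mult[OF c[OF that] Xc])
    qed simp
    finally have rel': "(\<Oplus>\<^bsub>loc R I\<^esub>\<beta>\<in>exponents m d. ?\<psi> (c \<beta>) \<otimes>\<^bsub>loc R I\<^esub> monomial (loc R I) (\<lambda>k. ?\<psi> (b k)) m \<beta>) = \<zero>\<^bsub>loc R I\<^esub>"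
      by (rule sym)
    have "?\<psi> (c \<alpha>) \<in> loc_ideal R I I"
      by (rule L.fiber_ring_relation[OF maximalideal_loc _ dim _ rel' \<alpha>]) (use bc c psi.hom_closed in blast)+
    then show "c \<alpha> \<in> I" using mem_loc_ideal_self_iff[OF c[OF \<alpha>] one_notin] by blast
  qed (use h(2,4,5) in blast)+
qed

section \<open>Homogeneous forms, and substitution of one tuple for another\<close>

context cring
begin

abbreviation form :: "(nat \<Rightarrow> 'a) \<Rightarrow> nat \<Rightarrow> nat \<Rightarrow> ((nat \<Rightarrow> nat) \<Rightarrow> 'a) \<Rightarrow> 'a"
  where "form x m d c \<equiv> (\<Oplus>\<alpha>\<in>exponents m d. c \<alpha> \<otimes> monomial R x m \<alpha>)"

lemma monomial_Pi_closed: "x \<in> {..<m} \<rightarrow> carrier R \<Longrightarrow> monomial R x m \<alpha> \<in> carrier R"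
  by (rule monomial_closed) blast

lemma form_term_closed:
  "\<lbrakk>x \<in> {..<m} \<rightarrow> carrier R; c \<in> exponents m d \<rightarrow> carrier R; \<alpha> \<in> exponents m d\<rbrakk>
    \<Longrightarrow> c \<alpha> \<otimes> monomial R x m \<alpha> \<in> carrier R"
  using monomial_Pi_closed[of x m \<alpha>] by blast

lemma form_closed:
  "\<lbrakk>x \<in> {..<m} \<rightarrow> carrier R; c \<in> exponents m d \<rightarrow> carrier R\<rbrakk> \<Longrightarrow> form x m d c \<in> carrier R"
  using form_term_closed[of x m c d] by (intro finsum_closed) blast

lemma form_add:
  assumes "x \<in> {..<m} \<rightarrow> carrier R" "c \<in> exponents m d \<rightarrow> carrier R" "c' \<in> exponents m d \<rightarrow> carrier R"
  shows "form x m d (\<lambda>\<alpha>. c \<alpha> \<oplus> c' \<alpha>) = form x m d c \<oplus> form x m d c'"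
proof -
  have "form x m d (\<lambda>\<alpha>. c \<alpha> \<oplus> c' \<alpha>) =
    (\<Oplus>\<alpha>\<in>exponents m d. c \<alpha> \<otimes> monomial R x m \<alpha> \<oplus> c' \<alpha> \<otimes> monomial R x m \<alpha>)"
  proof (rule finsum_cong')
    show "(\<lambda>\<alpha>. c \<alpha> \<otimes> monomial R x m \<alpha> \<oplus> c' \<alpha> \<otimes> monomial R x m \<alpha>) \<in> exponents m d \<rightarrow> carrier R"
      using form_term_closed[OF assms(1,2)] form_term_closed[OF assms(1,3)] by blast
    show "(c \<alpha> \<oplus> c' \<alpha>) \<otimes> monomial R x m \<alpha> = c \<alpha> \<otimes> monomial R x m \<alpha> \<oplus> c' \<alpha> \<otimes> monomial R x m \<alpha>"
      if "\<alpha> \<in> exponents m d" for \<alpha>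
      using that assms(2,3) monomial_Pi_closed[OF assms(1), of \<alpha>] by (intro l_distr) auto
  qed simp
  also have "\<dots> = form x m d c \<oplus> form x m d c'"
    using form_term_closed[OF assms(1,2)] form_term_closed[OF assms(1,3)] by (intro finsum_addf) blast+
  finally show ?thesis .
qed

lemma form_scale:
  assumes "x \<in> {..<m} \<rightarrow> carrier R" "c \<in> exponents m d \<rightarrow> carrier R" "s \<in> carrier R"
  shows "form x m d (\<lambda>\<alpha>. s \<otimes> c \<alpha>) = s \<otimes> form x m d c"
proof -
  have "s \<otimes> form x m d c = (\<Oplus>\<alpha>\<in>exponents m d. s \<otimes> (c \<alpha> \<otimes> monomial R x m \<alpha>))"
    using form_term_closed[OF assms(1,2)] by (intro finsum_rdistr finite_exponents assms(3)) blast
  also have "\<dots> = form x m d (\<lambda>\<alpha>. s \<otimes> c \<alpha>)"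
  proof (rule finsum_cong')
    show "(\<lambda>\<alpha>. s \<otimes> c \<alpha> \<otimes> monomial R x m \<alpha>) \<in> exponents m d \<rightarrow> carrier R"
      using assms(2,3) monomial_Pi_closed[OF assms(1)] by blast
    show "s \<otimes> (c \<alpha> \<otimes> monomial R x m \<alpha>) = s \<otimes> c \<alpha> \<otimes> monomial R x m \<alpha>" if "\<alpha> \<in> exponents m d" for \<alpha>
      using that assms(2,3) monomial_Pi_closed[OF assms(1), of \<alpha>] by (intro m_assoc[symmetric]) auto
  qed simp
  finally show ?thesis by (rule sym)
qed

text \<open>\<open>c'\<close> is a reindexing of \<open>c\<close> that does not depend on
  \<open>x\<close>. This order of quantifiers lets the same coefficients serve both tuples in
  \<open>rep\<close>.\<close>

lemma form_shift:
  assumes c: "c \<in> exponents m d \<rightarrow> carrier R" and j: "j < m"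
  shows "\<exists>c'. c' \<in> exponents m (Suc d) \<rightarrow> carrier R \<and>
    (\<forall>x. x \<in> {..<m} \<rightarrow> carrier R \<longrightarrow> form x m (Suc d) c' = form x m d c \<otimes> x j)"
proof -
  let ?e = "\<lambda>k. if k = j then 1 else 0 :: nat"
  define T where "T \<alpha> = (\<lambda>k\<in>{..<m}. \<alpha> k + ?e k)" for \<alpha> :: "nat \<Rightarrow> nat"
  let ?E = "exponents m d"
  have TE: "T ` ?E \<subseteq> exponents m (Suc d)"
  proof
    fix \<beta> assume "\<beta> \<in> T ` ?E"
    then obtain \<alpha> where \<alpha>: "\<beta> = T \<alpha>" "\<alpha> \<in> ?E" by blast
    have "(\<Sum>k<m. T \<alpha> k) = (\<Sum>k<m. \<alpha> k) + (\<Sum>k<m. ?e k)" unfolding T_def by (simp add: sum.distrib)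
    also have "(\<Sum>k<m. ?e k) = 1" using j by (simp add: sum.delta)
    finally show "\<beta> \<in> exponents m (Suc d)" using \<alpha> unfolding exponents_def by (simp add: T_def)
  qed
  have inj: "inj_on T ?E"
  proof (rule inj_onI)
    fix \<alpha> \<beta> assume h: "\<alpha> \<in> ?E" "\<beta> \<in> ?E" "T \<alpha> = T \<beta>"
    show "\<alpha> = \<beta>"
    proof (rule PiE_ext)
      show "\<alpha> \<in> {..<m} \<rightarrow>\<^sub>E UNIV" "\<beta> \<in> {..<m} \<rightarrow>\<^sub>E UNIV" using h(1,2) unfolding exponents_def by blast+
      fix k assume "k \<in> {..<m}"
      then show "\<alpha> k = \<beta> k" using fun_cong[OF h(3), of k] unfolding T_def by simp
    qed
  qed
  define c' where "c' \<beta> = (if \<beta> \<in> T ` ?E then c (inv_into ?E T \<beta>) else \<zero>)" for \<beta>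
  have c'T: "c' (T \<alpha>) = c \<alpha>" if "\<alpha> \<in> ?E" for \<alpha>
    unfolding c'_def using that inj by (simp add: inv_into_f_f)
  have c'c: "c' \<in> exponents m (Suc d) \<rightarrow> carrier R"
  proof
    fix \<beta> show "c' \<beta> \<in> carrier R"
    proof (cases "\<beta> \<in> T ` ?E")
      case True
      then obtain \<alpha> where "\<alpha> \<in> ?E" "\<beta> = T \<alpha>" by blast
      then show ?thesis using c'T c by auto
    qed (simp add: c'_def)
  qed
  have "form x m (Suc d) c' = form x m d c \<otimes> x j" if x: "x \<in> {..<m} \<rightarrow> carrier R" for x
  proof -
    have Xc: "monomial R x m \<alpha> \<in> carrier R" for \<alpha> using x by (rule monomial_Pi_closed)
    have e: "monomial R x i ?e = (if j < i then x j else \<one>)" if "i \<le> m" for i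
      using that x by (induction i) (auto simp: less_Suc_eq Pi_iff)
    have XT: "monomial R x m (T \<alpha>) = monomial R x m \<alpha> \<otimes> x j" for \<alpha>
    proof -
      have "monomial R x m \<alpha> \<otimes> x j = monomial R x m \<alpha> \<otimes> monomial R x m ?e" using e[of m] j by simp
      also have "\<dots> = monomial R x m (\<lambda>k. \<alpha> k + ?e k)" using x by (intro monomial_mult) blast
      also have "\<dots> = monomial R x m (T \<alpha>)" unfolding T_def by (rule monomial_cong) simp
      finally show ?thesis by (rule sym)
    qed
    have xj: "x j \<in> carrier R" using x j by blast
    have "form x m (Suc d) c' = (\<Oplus>\<beta>\<in>T ` ?E. c' \<beta> \<otimes> monomial R x m \<beta>)"
    proof (rule add.finprod_mono_neutral_cong_right[OF finite_exponents TE])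
      show "c' i \<otimes> monomial R x m i = \<zero>" if "i \<in> exponents m (Suc d) - T ` ?E" for i
        using that Xc unfolding c'_def by simp
      show "(\<lambda>\<beta>. c' \<beta> \<otimes> monomial R x m \<beta>) \<in> exponents m (Suc d) \<rightarrow> carrier R" using c'c Xc by blast
    qed simp
    also have "\<dots> = (\<Oplus>\<alpha>\<in>?E. c' (T \<alpha>) \<otimes> monomial R x m (T \<alpha>))"
      by (rule add.finprod_reindex[OF _ inj]) (use c'c TE Xc in blast)
    also have "\<dots> = (\<Oplus>\<alpha>\<in>?E. (c \<alpha> \<otimes> monomial R x m \<alpha>) \<otimes> x j)"
    proof (rule finsum_cong')
      show "(\<lambda>\<alpha>. c \<alpha> \<otimes> monomial R x m \<alpha> \<otimes> x j) \<in> ?E \<rightarrow> carrier R" using c Xc xj by blast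
      show "c' (T \<alpha>) \<otimes> monomial R x m (T \<alpha>) = c \<alpha> \<otimes> monomial R x m \<alpha> \<otimes> x j" if "\<alpha> \<in> ?E" for \<alpha>
        unfolding c'T[OF that] XT using that c Xc xj by (intro m_assoc[symmetric]) auto
    qed simp
    also have "\<dots> = form x m d c \<otimes> x j"
      by (rule finsum_ldistr[symmetric, OF finite_exponents xj]) (use c Xc in blast)
    finally show ?thesis .
  qed
  with c'c show ?thesis by blast
qed

text \<open>Stands for the substitution of \<open>y\<close> for \<open>x\<close> in a form. It is a
  relation because the value at \<open>x\<close> need not determine the form; the ambiguity,
  consisting of forms that vanish at \<open>x\<close>, is resolved only where the substitution is
  applied.\<close>

definition rep :: "(nat \<Rightarrow> 'a) \<Rightarrow> (nat \<Rightarrow> 'a) \<Rightarrow> nat \<Rightarrow> nat \<Rightarrow> 'a \<Rightarrow> 'a \<Rightarrow> bool"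
  where "rep x y m d v w \<longleftrightarrow>
    (\<exists>c \<in> exponents m d \<rightarrow> carrier R. v = form x m d c \<and> w = form y m d c)"

context
  fixes x y :: "nat \<Rightarrow> 'a" and m :: nat
  assumes x: "x \<in> {..<m} \<rightarrow> carrier R" and y: "y \<in> {..<m} \<rightarrow> carrier R"
begin

lemma rep_closed: "rep x y m d v w \<Longrightarrow> v \<in> carrier R \<and> w \<in> carrier R"
  unfolding rep_def using form_closed[OF x] form_closed[OF y] by blast

lemma rep_add:
  assumes "rep x y m d v w" "rep x y m d v' w'"
  shows "rep x y m d (v \<oplus> v') (w \<oplus> w')"
proof -
  obtain c where c: "c \<in> exponents m d \<rightarrow> carrier R" "v = form x m d c" "w = form y m d c"
    using assms(1) unfolding rep_def by blast
  obtain c' where c': "c' \<in> exponents m d \<rightarrow> carrier R" "v' = form x m d c'" "w' = form y m d c'"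
    using assms(2) unfolding rep_def by blast
  have 1: "(\<lambda>\<alpha>. c \<alpha> \<oplus> c' \<alpha>) \<in> exponents m d \<rightarrow> carrier R" using c(1) c'(1) by blast
  have 2: "v \<oplus> v' = form x m d (\<lambda>\<alpha>. c \<alpha> \<oplus> c' \<alpha>)"
    unfolding c(2) c'(2) by (rule form_add[symmetric, OF x c(1) c'(1)])
  have 3: "w \<oplus> w' = form y m d (\<lambda>\<alpha>. c \<alpha> \<oplus> c' \<alpha>)"
    unfolding c(3) c'(3) by (rule form_add[symmetric, OF y c(1) c'(1)])
  show ?thesis unfolding rep_def by (rule bexI[OF _ 1]) (rule conjI[OF 2 3])
qed

lemma rep_scale:
  assumes "rep x y m d v w" "s \<in> carrier R"
  shows "rep x y m d (s \<otimes> v) (s \<otimes> w)"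
proof -
  obtain c where c: "c \<in> exponents m d \<rightarrow> carrier R" "v = form x m d c" "w = form y m d c"
    using assms(1) unfolding rep_def by blast
  have 1: "(\<lambda>\<alpha>. s \<otimes> c \<alpha>) \<in> exponents m d \<rightarrow> carrier R" using c(1) assms(2) by blast
  have 2: "s \<otimes> v = form x m d (\<lambda>\<alpha>. s \<otimes> c \<alpha>)"
    unfolding c(2) by (rule form_scale[symmetric, OF x c(1) assms(2)])
  have 3: "s \<otimes> w = form y m d (\<lambda>\<alpha>. s \<otimes> c \<alpha>)"
    unfolding c(3) by (rule form_scale[symmetric, OF y c(1) assms(2)])
  show ?thesis unfolding rep_def by (rule bexI[OF _ 1]) (rule conjI[OF 2 3])
qed

lemma rep_shift:
  assumes "rep x y m d v w" "j < m"
  shows "rep x y m (Suc d) (v \<otimes> x j) (w \<otimes> y j)"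
proof -
  obtain c where c: "c \<in> exponents m d \<rightarrow> carrier R" "v = form x m d c" "w = form y m d c"
    using assms(1) unfolding rep_def by blast
  obtain c' where c': "c' \<in> exponents m (Suc d) \<rightarrow> carrier R"
    "\<And>x. x \<in> {..<m} \<rightarrow> carrier R \<Longrightarrow> form x m (Suc d) c' = form x m d c \<otimes> x j"
    using form_shift[OF c(1) assms(2)] by blast
  have "v \<otimes> x j = form x m (Suc d) c'" unfolding c(2) by (rule c'(2)[OF x, symmetric])
  moreover have "w \<otimes> y j = form y m (Suc d) c'" unfolding c(3) by (rule c'(2)[OF y, symmetric])
  ultimately show ?thesis unfolding rep_def using c'(1) by blast
qed

lemma rep_const: "s \<in> carrier R \<Longrightarrow> rep x y m 0 s s"
proof -
  assume s: "s \<in> carrier R"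
  let ?z = "\<lambda>k\<in>{..<m}. 0 :: nat"
  have E: "exponents m 0 = {?z}"
  proof
    show "exponents m 0 \<subseteq> {?z}"
    proof
      fix \<alpha> assume \<alpha>: "\<alpha> \<in> exponents m 0"
      have "\<alpha> = ?z"
      proof (rule PiE_ext)
        show "\<alpha> \<in> {..<m} \<rightarrow>\<^sub>E UNIV" using \<alpha> unfolding exponents_def by blast
        show "?z \<in> {..<m} \<rightarrow>\<^sub>E UNIV" by simp
        show "\<alpha> k = ?z k" if "k \<in> {..<m}" for k using exponents_le[OF \<alpha>, of k] that by simp
      qed
      then show "\<alpha> \<in> {?z}" by blast
    qed
    show "{?z} \<subseteq> exponents m 0" unfolding exponents_def by simp
  qed
  have one: "monomial R u i ?z = \<one>" if "i \<le> m" "u \<in> {..<m} \<rightarrow> carrier R" for u i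
    using that by (induction i) (auto simp: Pi_iff)
  have "form u m 0 (\<lambda>_. s) = s" if "u \<in> {..<m} \<rightarrow> carrier R" for u
    unfolding E using one[OF order_refl that] s by (subst finsum_insert) auto
  from this[OF x] this[OF y] have "s = form x m 0 (\<lambda>_. s)" "s = form y m 0 (\<lambda>_. s)" by simp_all
  then show ?thesis unfolding rep_def using s by (intro bexI[of _ "\<lambda>_. s"]) auto
qed

lemma rep_zero: "rep x y m d \<zero> \<zero>"
proof -
  have "form u m d (\<lambda>_. \<zero>) = \<zero>" if "u \<in> {..<m} \<rightarrow> carrier R" for u
  proof -
    have "form u m d (\<lambda>_. \<zero>) = (\<Oplus>\<alpha>\<in>exponents m d. \<zero>)"
      using monomial_Pi_closed[OF that] by (intro finsum_cong') auto
    then show ?thesis by simp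
  qed
  from this[OF x] this[OF y] have "\<zero> = form x m d (\<lambda>_. \<zero>)" "\<zero> = form y m d (\<lambda>_. \<zero>)" by simp_all
  then show ?thesis unfolding rep_def by (intro bexI[of _ "\<lambda>_. \<zero>"]) auto
qed

lemma rep_finsum:
  assumes "finite A" "\<And>i. i \<in> A \<Longrightarrow> rep x y m d (v i) (w i)"
  shows "rep x y m d (\<Oplus>i\<in>A. v i) (\<Oplus>i\<in>A. w i)"
  using assms
proof (induction A rule: finite_induct)
  case empty
  then show ?case using rep_zero by simp
next
  case (insert i A)
  have c: "v k \<in> carrier R" "w k \<in> carrier R" if "k \<in> insert i A" for k
    using rep_closed[OF insert.prems[OF that]] by blast+
  have "(\<Oplus>k\<in>insert i A. v k) = v i \<oplus> (\<Oplus>k\<in>A. v k)" "(\<Oplus>k\<in>insert i A. w k) = w i \<oplus> (\<Oplus>k\<in>A. w k)"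
    using insert.hyps c by (auto intro!: finsum_insert)
  then show ?case using rep_add[OF insert.prems[of i] insert.IH] insert.prems by simp
qed

lemma rep_linear:
  assumes "rep x y m d v w" "\<And>k. k < m \<Longrightarrow> s k \<in> carrier R"
  shows "rep x y m (Suc d) ((\<Oplus>k\<in>{..<m}. s k \<otimes> x k) \<otimes> v) ((\<Oplus>k\<in>{..<m}. s k \<otimes> y k) \<otimes> w)"
proof -
  have vw: "v \<in> carrier R" "w \<in> carrier R" using rep_closed[OF assms(1)] by blast+
  have dist: "(\<Oplus>k\<in>{..<m}. s k \<otimes> z k) \<otimes> u = (\<Oplus>k\<in>{..<m}. s k \<otimes> (u \<otimes> z k))"
    if z: "z \<in> {..<m} \<rightarrow> carrier R" and u: "u \<in> carrier R" for z u
  proof -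
    have "(\<Oplus>k\<in>{..<m}. s k \<otimes> z k) \<otimes> u = (\<Oplus>k\<in>{..<m}. (s k \<otimes> z k) \<otimes> u)"
      using z u assms(2) by (intro finsum_ldistr) (auto simp: Pi_iff)
    also have "\<dots> = (\<Oplus>k\<in>{..<m}. s k \<otimes> (u \<otimes> z k))"
    proof (rule finsum_cong')
      show "(\<lambda>k. s k \<otimes> (u \<otimes> z k)) \<in> {..<m} \<rightarrow> carrier R" using z u assms(2) by (auto simp: Pi_iff)
      show "(s k \<otimes> z k) \<otimes> u = s k \<otimes> (u \<otimes> z k)" if "k \<in> {..<m}" for k
        using funcset_mem[OF z that] u assms(2)[of k] that m_comm[of "z k" u] by (simp add: m_assoc)
    qed simp
    finally show ?thesis .
  qed
  show ?thesis
    unfolding dist[OF x vw(1)] dist[OF y vw(2)]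
    by (rule rep_finsum) (use rep_scale[OF rep_shift[OF assms(1)]] assms(2) in auto)
qed

lemma rep_power: "k < m \<Longrightarrow> rep x y m d (x k [^] d) (y k [^] d)"
proof (induction d)
  case 0
  then show ?case using rep_const[of \<one>] by simp
next
  case (Suc d)
  then show ?case using rep_shift[OF Suc.IH] by simp
qed

end

text \<open>Each factor from \<open>I\<close> needs one factor \<open>a\<close> to become a linear
  form in \<open>f\<close>. Using \<open>rep\<close> with equal tuples makes its closure properties
  available.\<close>

lemma ideal_pow_form:
  assumes f: "f \<in> {..<m} \<rightarrow> carrier R" and I: "ideal I R" and a: "a \<in> carrier R"
    and aI: "\<And>x. x \<in> I \<Longrightarrow> a \<otimes> x \<in> Idl (f ` {..<m})" and z: "z \<in> ideal_pow R I d"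
  shows "rep f f m d (a [^] d \<otimes> z) (a [^] d \<otimes> z)"
  using z
proof (induction d arbitrary: z)
  case 0
  then show ?case using rep_const[OF f f, of z] ideal_pow_0 by simp
next
  case (Suc d)
  have "z \<in> ideal_pow R I d \<cdot> I" using Suc.prems by (simp only: ideal_pow_Suc)
  then show ?case
  proof (induction rule: ideal_prod.induct)
    case (prod p b)
    have pc: "p \<in> carrier R" and bc: "b \<in> carrier R"
      using ideal_pow_carrier[OF I prod(1)] ideal.Icarr[OF I prod(2)] by blast+
    obtain s where s: "\<forall>k\<in>{..<m}. s k \<in> carrier R" "a \<otimes> b = (\<Oplus>k\<in>{..<m}. s k \<otimes> f k)"
      using genideal_finite_eq[of "{..<m}" f, OF finite_lessThan funcset_mem[OF f] aI[OF prod(2)]] by blast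
    have "rep f f m (Suc d) ((\<Oplus>k\<in>{..<m}. s k \<otimes> f k) \<otimes> (a [^] d \<otimes> p)) ((\<Oplus>k\<in>{..<m}. s k \<otimes> f k) \<otimes> (a [^] d \<otimes> p))"
      by (rule rep_linear[OF f f Suc.IH[OF prod(1)]]) (use s(1) in auto)
    moreover have "(a \<otimes> b) \<otimes> (a [^] d \<otimes> p) = a [^] Suc d \<otimes> (p \<otimes> b)"
    proof -
      have "(a \<otimes> b) \<otimes> (A \<otimes> p) = (A \<otimes> a) \<otimes> (p \<otimes> b)" if "A \<in> carrier R" for A
        using that a bc pc by algebra
      then show ?thesis using a by simp
    qed
    ultimately show ?case unfolding s(2)[symmetric] by (simp only:)
  next
    case (sum u v)
    have "u \<in> ideal_pow R I (Suc d)" "v \<in> ideal_pow R I (Suc d)" using sum(1,2) by (simp_all only: ideal_pow_Suc)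
    then have "u \<in> carrier R" "v \<in> carrier R" using ideal_pow_carrier[OF I] by blast+
    then have "a [^] Suc d \<otimes> (u \<oplus> v) = a [^] Suc d \<otimes> u \<oplus> a [^] Suc d \<otimes> v"
      using a by (intro r_distr) auto
    then show ?case using rep_add[OF f f sum.IH] by (simp only:)
  qed
qed

lemma ideal_prod_gens:
  assumes A: "finite A" "\<And>j. j \<in> A \<Longrightarrow> \<gamma> j \<in> carrier R" and T: "ideal T R" and u: "u \<in> (Idl (\<gamma> ` A)) \<cdot> T"
  shows "\<exists>z. (\<forall>j\<in>A. z j \<in> T) \<and> u = (\<Oplus>j\<in>A. \<gamma> j \<otimes> z j)"
  using u
proof (induction rule: ideal_prod.induct)
  case (prod i p)
  have pc: "p \<in> carrier R" using ideal.Icarr[OF T prod(2)] .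
  obtain c where c: "\<forall>j\<in>A. c j \<in> carrier R" "i = (\<Oplus>j\<in>A. c j \<otimes> \<gamma> j)"
    using genideal_finite_eq[OF A prod(1)] by blast
  have "i \<otimes> p = (\<Oplus>j\<in>A. (c j \<otimes> \<gamma> j) \<otimes> p)"
    unfolding c(2) using A c(1) pc by (intro finsum_ldistr) auto
  also have "\<dots> = (\<Oplus>j\<in>A. \<gamma> j \<otimes> (c j \<otimes> p))"
  proof (rule finsum_cong')
    show "(\<lambda>j. \<gamma> j \<otimes> (c j \<otimes> p)) \<in> A \<rightarrow> carrier R" using A c(1) pc by auto
    fix j assume j: "j \<in> A"
    have "c j \<in> carrier R" "\<gamma> j \<in> carrier R" using j A c(1) by blast+
    then show "(c j \<otimes> \<gamma> j) \<otimes> p = \<gamma> j \<otimes> (c j \<otimes> p)" using pc m_comm[of "c j" "\<gamma> j"] by (simp add: m_assoc)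
  qed simp
  finally have "i \<otimes> p = (\<Oplus>j\<in>A. \<gamma> j \<otimes> (c j \<otimes> p))" .
  moreover have "\<forall>j\<in>A. c j \<otimes> p \<in> T" using ideal.I_l_closed[OF T prod(2)] c(1) by blast
  ultimately show ?case by (intro exI[of _ "\<lambda>j. c j \<otimes> p"]) blast
next
  case (sum u v)
  obtain z where z: "\<forall>j\<in>A. z j \<in> T" "u = (\<Oplus>j\<in>A. \<gamma> j \<otimes> z j)" using sum.IH(1) by blast
  obtain z' where z': "\<forall>j\<in>A. z' j \<in> T" "v = (\<Oplus>j\<in>A. \<gamma> j \<otimes> z' j)" using sum.IH(2) by blast
  have zc: "z j \<in> carrier R" "z' j \<in> carrier R" if "j \<in> A" for j using that z(1) z'(1) ideal.Icarr[OF T] by blast+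
  have "u \<oplus> v = (\<Oplus>j\<in>A. \<gamma> j \<otimes> z j \<oplus> \<gamma> j \<otimes> z' j)"
    unfolding z(2) z'(2) using A zc by (intro finsum_addf[symmetric]) auto
  also have "\<dots> = (\<Oplus>j\<in>A. \<gamma> j \<otimes> (z j \<oplus> z' j))"
    using A zc by (intro finsum_cong') (auto simp: r_distr)
  finally have "u \<oplus> v = (\<Oplus>j\<in>A. \<gamma> j \<otimes> (z j \<oplus> z' j))" .
  moreover have "\<forall>j\<in>A. z j \<oplus> z' j \<in> T" using z(1) z'(1) ideal.add_in[OF T] by blast
  ultimately show ?case by (intro exI[of _ "\<lambda>j. z j \<oplus> z' j"]) blast
qed

end

section \<open>Elimination over the ring of all functions on the set of minimal reductions\<close>

section \<open>A uniform power annihilating all quotients by minimal reductions\<close>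

text \<open>The primes not containing \<open>u\<close> form an open neighbourhood of
  \<open>q\<close> that misses \<open>P\<close>.\<close>

lemma (in cring) notin_zariski_closure:
  assumes u: "u \<in> carrier R" and q: "q \<in> Spec R" "u \<notin> q" and P: "\<And>p. p \<in> P \<Longrightarrow> u \<in> p"
  shows "q \<notin> zariski R closure_of P"
proof
  let ?T = "Spec R - {p \<in> Spec R. PIdl u \<subseteq> p}"
  have "?T \<in> {Spec R - {p \<in> Spec R. \<aa> \<subseteq> p} | \<aa>. ideal \<aa> R}" using cgenideal_ideal[OF u] by blast
  then have op: "openin (zariski R) ?T" unfolding zariski_def by (rule topology_generated_by_Basis)
  have "\<not> PIdl u \<subseteq> q" using q(2) subsetD[OF _ cgenideal_self[OF u], of q] by metis
  then have qT: "q \<in> ?T" using q(1) by simp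
  assume "q \<in> zariski R closure_of P"
  then have "\<forall>T. q \<in> T \<and> openin (zariski R) T \<longrightarrow> (\<exists>p. p \<in> P \<and> p \<in> T)" unfolding in_closure_of by (rule conjunct2)
  then obtain p where p: "p \<in> P" "p \<in> ?T" using qT op by meson
  then have "ideal p R" unfolding Spec_def using primeideal.axioms(1) by blast
  from cgenideal_minimal[OF this P[OF p(1)]] show False using p(2) by blast
qed

text \<open>A product of elements outside \<open>I\<close>, one taken from each member of the finite
  set \<open>P\<close>, stays outside \<open>I\<close> by primality.\<close>

lemma (in primeideal) exists_in_all_notin:
  assumes "finite P" "\<And>p. p \<in> P \<Longrightarrow> ideal p R" "\<And>p. p \<in> P \<Longrightarrow> \<not> p \<subseteq> I"
  shows "\<exists>u\<in>carrier R - I. \<forall>p\<in>P. u \<in> p"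
  using assms
proof (induction P rule: finite_induct)
  case empty
  then show ?case using one_notin by blast
next
  case (insert p P)
  obtain u where u: "u \<in> carrier R - I" "\<forall>p\<in>P. u \<in> p" using insert by auto
  obtain v where v: "v \<in> p" "v \<notin> I" using insert.prems(2)[of p] by auto
  interpret p: ideal p R using insert.prems(1) by blast
  have vc: "v \<in> carrier R" using p.Icarr v by blast
  have "u \<otimes> v \<in> p" using p.I_l_closed[OF v(1)] u(1) by blast
  moreover have "u \<otimes> v \<in> p'" if "p' \<in> P" for p'
    using ideal.I_r_closed[OF insert.prems(1)[of p'], of u v] that u(2) vc by blast
  moreover have "u \<otimes> v \<in> carrier R - I" using mult_notin u(1) v vc by blast
  ultimately show ?case by blast
qed

context function_ring
begin

lemma const_pow: "c \<in> carrier R \<Longrightarrow> const c [^]\<^bsub>S\<^esub> (n::nat) = const (c [^] n)"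
  by (induction n) (auto simp: fun_eq_iff restrict_def)

lemma S_monomial_value:
  "\<lbrakk>\<And>k. k < m \<Longrightarrow> f k \<in> carrier R; t \<in> \<Omega>\<rbrakk> \<Longrightarrow> monomial S (\<lambda>k. const (f k)) m \<alpha> t = monomial R f m \<alpha>"
  by (induction m) (auto simp: const_pow)

lemma pointwise_ideal:
  assumes "\<And>t. t \<in> \<Omega> \<Longrightarrow> ideal (N t) R"
  shows "ideal {g \<in> B. \<forall>t\<in>\<Omega>. g t \<in> N t} S"
proof -
  have "{g \<in> B. \<forall>t\<in>\<Omega>. g t \<in> N t} = B \<inter> (\<Inter>t\<in>\<Omega>. {g \<in> B. g t \<in> N t})" by blast
  moreover have "ideal (B \<inter> (\<Inter>t\<in>\<Omega>. {g \<in> B. g t \<in> N t})) S"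
  proof (cases "\<Omega> = {}")
    case True
    then show ?thesis using S.oneideal by simp
  next
    case False
    have "ideal (\<Inter>t\<in>\<Omega>. {g \<in> B. g t \<in> N t}) S"
      by (rule S.i_Intersect) (use False assms evaluation_preimage_ideal in auto)
    then show ?thesis using S.i_intersect[OF S.oneideal] by simp
  qed
  ultimately show ?thesis by simp
qed

end

context noetherian_local_ring
begin

text \<open>A minimal reduction \<open>J\<close> varies over a set \<open>\<Omega>\<close>, and the whole family is treated at once inside the ring
  \<open>S\<close> of all functions on \<open>\<Omega>\<close>. If no power of \<open>u\<close> multiplied \<open>I\<close> into every \<open>J\<close>, a prime \<open>Q\<close>
  of \<open>S\<close> would contain the conductor but not \<open>u\<close>; its contraction \<open>q\<close> to \<open>R\<close> is a prime at which the fiber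
  ring of \<open>I\<close> is a polynomial ring, and this forces the generic reduction to be all of \<open>I\<close> at \<open>Q\<close>.\<close>

lemma uniform_power:
  assumes I: "ideal I R" and u: "u \<in> carrier R"
    and loc: "\<And>q. \<lbrakk>primeideal q R; u \<notin> q\<rbrakk> \<Longrightarrow>
      min_gens (loc R q) (loc_ideal R q I) = analytic_spread (loc R q) (loc_ideal R q I)"
  shows "\<exists>N::nat. \<forall>J\<in>min_reductions R I. \<forall>y\<in>I. u [^] N \<otimes> y \<in> J"
proof (rule ccontr)
  assume contra: "\<not> ?thesis"
  define \<Omega> where "\<Omega> = min_reductions R I"
  define B where "B = \<Omega> \<rightarrow>\<^sub>E carrier R"
  interpret F: function_ring R \<Omega> B unfolding B_def by (rule function_ring_all)
  let ?S = "fun_ring R \<Omega> B"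
  have Ji: "ideal J R" "J \<subseteq> I" if "J \<in> \<Omega>" for J using min_reductionD[of J I] that unfolding \<Omega>_def by blast+
  have BI: "(\<lambda>J\<in>\<Omega>. g J) \<in> B" if "\<And>J. J \<in> \<Omega> \<Longrightarrow> g J \<in> carrier R" for g
    using that unfolding B_def by simp
  \<comment> \<open>The conductor of \<open>I\<close> into the generic reduction. A power of the
    constant \<open>u\<close> in it would be a uniform exponent, so \<open>contra\<close> keeps all
    powers out.\<close>
  define KK where "KK = {g \<in> B. \<forall>J\<in>\<Omega>. g J \<in> {x \<in> carrier R. \<forall>y\<in>I. x \<otimes> y \<in> J}}"
  have col: "ideal {x \<in> carrier R. \<forall>y\<in>I. x \<otimes> y \<in> J} R" if "J \<in> \<Omega>" for J
  proof (rule cring_idealI)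
    interpret J: ideal J R using Ji that by blast
    show "\<zero> \<in> {x \<in> carrier R. \<forall>y\<in>I. x \<otimes> y \<in> J}"
      using ideal.Icarr[OF I] additive_subgroup.zero_closed[OF J.additive_subgroup_axioms] by auto
    fix a b assume a: "a \<in> {x \<in> carrier R. \<forall>y\<in>I. x \<otimes> y \<in> J}" and b: "b \<in> {x \<in> carrier R. \<forall>y\<in>I. x \<otimes> y \<in> J}"
    have "(a \<oplus> b) \<otimes> y \<in> J" if y: "y \<in> I" for y
      using l_distr[of a b y] a b y ideal.Icarr[OF I y] J.add_in[of "a \<otimes> y" "b \<otimes> y"] by simp
    then show "a \<oplus> b \<in> {x \<in> carrier R. \<forall>y\<in>I. x \<otimes> y \<in> J}" using a b by simp
  next
    interpret J: ideal J R using Ji that by blast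
    fix r a assume r: "r \<in> carrier R" and a: "a \<in> {x \<in> carrier R. \<forall>y\<in>I. x \<otimes> y \<in> J}"
    have "(r \<otimes> a) \<otimes> y \<in> J" if y: "y \<in> I" for y
      using m_assoc[of r a y] r a y ideal.Icarr[OF I y] J.I_l_closed[of "a \<otimes> y" r] by simp
    then show "r \<otimes> a \<in> {x \<in> carrier R. \<forall>y\<in>I. x \<otimes> y \<in> J}" using r a by simp
  qed blast
  have KK: "ideal KK ?S" unfolding KK_def by (rule F.pointwise_ideal[OF col])
  have KKI: "g \<in> KK" if "g \<in> B" "\<And>J y. J \<in> \<Omega> \<Longrightarrow> y \<in> I \<Longrightarrow> g J \<otimes> y \<in> J" for g
    unfolding KK_def using that F.B_value by blast
  have uS: "F.const u \<in> carrier ?S" using F.const_B[OF u] by simp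
  have "F.const u [^]\<^bsub>?S\<^esub> n \<notin> KK" for n :: nat
  proof
    assume "F.const u [^]\<^bsub>?S\<^esub> n \<in> KK"
    then have "F.const (u [^] n) \<in> KK" unfolding F.const_pow[OF u] .
    then have "\<forall>J\<in>\<Omega>. \<forall>y\<in>I. u [^] n \<otimes> y \<in> J" unfolding KK_def by simp
    then show False using contra unfolding \<Omega>_def by blast
  qed
  then obtain Q where Q: "primeideal Q ?S" "KK \<subseteq> Q" "F.const u \<notin> Q"
    using F.S.exists_prime_avoiding_powers[OF KK uS] by blast
  interpret Q: primeideal Q ?S by (rule Q(1))
  define q where "q = {c \<in> carrier R. F.const c \<in> Q}"
  have q: "primeideal q R"
  proof (rule primeidealI)
    show "ideal q R" unfolding q_def by (rule F.const_preimage_ideal[OF Q.is_ideal])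
    show "cring R" by (rule cring_axioms)
    have "\<one> \<notin> q" using Q.one_notin unfolding q_def by simp
    then show "carrier R \<noteq> q" using one_closed by blast
    fix a b assume ab: "a \<in> carrier R" "b \<in> carrier R" "a \<otimes> b \<in> q"
    have "F.const a \<otimes>\<^bsub>?S\<^esub> F.const b \<in> Q" using ab(3) unfolding q_def F.const_mult[symmetric] by blast
    moreover have "F.const a \<in> carrier ?S" "F.const b \<in> carrier ?S" using F.const_B ab by simp_all
    ultimately show "a \<in> q \<or> b \<in> q" using Q.I_prime ab(1,2) unfolding q_def by blast
  qed
  interpret q: primeideal q R by (rule q)
  have "u \<notin> q" using Q(3) unfolding q_def by blast
  obtain m f a where fI: "\<And>k. k < m \<Longrightarrow> f k \<in> I" and a: "a \<in> q.Den"
    and aI: "\<And>x. x \<in> I \<Longrightarrow> a \<otimes> x \<in> Idl (f ` {..<m})"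
    and ind: "\<And>d c \<alpha>. \<lbrakk>\<And>\<alpha>. \<alpha> \<in> exponents m d \<Longrightarrow> c \<alpha> \<in> carrier R;
      (\<Oplus>\<alpha>\<in>exponents m d. c \<alpha> \<otimes> monomial R f m \<alpha>) = \<zero>; \<alpha> \<in> exponents m d\<rbrakk> \<Longrightarrow> c \<alpha> \<in> q"
    using q.localization_data[OF noetherian_ring_axioms I loc[OF q \<open>u \<notin> q\<close>]] by blast
  have fc: "f k \<in> carrier R" if "k < m" for k using ideal.Icarr[OF I fI[OF that]] .
  have fPi: "f \<in> {..<m} \<rightarrow> carrier R" using fc by blast
  have ac: "a \<in> carrier R" and aq: "F.const a \<notin> Q" using a unfolding q_def by blast+
  obtain n :: nat and \<gamma> where \<gamma>c: "\<And>J j. J \<in> \<Omega> \<Longrightarrow> j < n \<Longrightarrow> \<gamma> J j \<in> carrier R"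
    and \<gamma>J: "\<And>J. J \<in> \<Omega> \<Longrightarrow> J = Idl (\<gamma> J ` {..<n})"
    using min_reductions_gens[OF I] unfolding \<Omega>_def by metis
  have \<gamma>in: "\<gamma> J j \<in> J" if "J \<in> \<Omega>" "j < n" for J j
  proof -
    have "\<gamma> J ` {..<n} \<subseteq> carrier R" using \<gamma>c[OF that(1)] by blast
    then have "\<gamma> J j \<in> Idl (\<gamma> J ` {..<n})" using genideal_self that(2) by blast
    then show ?thesis using \<gamma>J[OF that(1)] by simp
  qed
  have "\<exists>c. (\<forall>k\<in>{..<m}. c k \<in> carrier R) \<and> a \<otimes> \<gamma> J j = (\<Oplus>k\<in>{..<m}. c k \<otimes> f k)" if "J \<in> \<Omega>" "j < n" for J j
    using that \<gamma>in Ji(2) by (intro genideal_finite_eq aI) (use fc in auto)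
  then obtain G where Gc: "\<And>J j k. J \<in> \<Omega> \<Longrightarrow> j < n \<Longrightarrow> k < m \<Longrightarrow> G J j k \<in> carrier R"
    and G: "\<And>J j. J \<in> \<Omega> \<Longrightarrow> j < n \<Longrightarrow> a \<otimes> \<gamma> J j = (\<Oplus>k\<in>{..<m}. G J j k \<otimes> f k)" by (metis lessThan_iff)
  \<comment> \<open>Rows of the generic matrix: after multiplication by \<open>a\<close>, the
    generators of each \<open>J\<close> are linear in the fixed elements \<open>f\<close>, with
    coefficients depending on \<open>J\<close>.\<close>
  define g where "g j k = (\<lambda>J\<in>\<Omega>. G J j k)" for j k
  have gB: "g j k \<in> carrier ?S" if "j < n" "k < m" for j k unfolding g_def using BI Gc that by simp
  let ?f = "\<lambda>k. F.const (f k)"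
  have fS: "?f k \<in> carrier ?S" if "k < m" for k using F.const_B[OF fc[OF that]] by simp
  have fSPi: "?f \<in> {..<m} \<rightarrow> carrier ?S" using fS by blast
  let ?row = "\<lambda>j. \<Oplus>\<^bsub>?S\<^esub>k\<in>{..<m}. g j k \<otimes>\<^bsub>?S\<^esub> ?f k"
  have rowS: "?row j \<in> carrier ?S" if "j < n" for j
    by (rule F.S.finsum_closed) (use F.S.m_closed[OF gB[OF that] fS] in blast)
  have row: "?row j J = a \<otimes> \<gamma> J j" if "j < n" "J \<in> \<Omega>" for j J
  proof -
    have gf: "g j k \<otimes>\<^bsub>?S\<^esub> ?f k \<in> B" if k: "k \<in> {..<m}" for k
      using F.S.m_closed[OF gB[OF \<open>j < n\<close>] fS, of k k] k by (simp only: fun_ring_simps(1) lessThan_iff)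
    have "?row j J = (\<Oplus>k\<in>{..<m}. (g j k \<otimes>\<^bsub>?S\<^esub> ?f k) J)" by (rule F.S_finsum[OF finite_lessThan gf that(2)])
    also have "\<dots> = (\<Oplus>k\<in>{..<m}. G J j k \<otimes> f k)"
      using that Gc[OF that(2,1)] fc by (intro finsum_cong') (auto simp: g_def)
    finally show ?thesis using G[OF that(2,1)] by simp
  qed
  define N where "N = {h \<in> B. \<forall>J\<in>\<Omega>. h J \<in> J}"
  have N: "ideal N ?S" unfolding N_def by (rule F.pointwise_ideal[OF Ji(1)])
  have rowN: "?row j \<in> N" if "j < n" for j
  proof -
    have "?row j \<in> B" using rowS[OF that] by (simp only: fun_ring_simps(1))
    moreover have "?row j J \<in> J" if J: "J \<in> \<Omega>" for J
      unfolding row[OF \<open>j < n\<close> J] by (rule ideal.I_l_closed[OF Ji(1)[OF J] \<gamma>in[OF J \<open>j < n\<close>] ac])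
    ultimately show ?thesis unfolding N_def by blast
  qed
  \<comment> \<open>Full rank is impossible: \<open>e\<close> would carry all \<open>f\<close> into
    the generic reduction, hence \<open>e\<close> times \<open>a\<close> would carry all of
    \<open>I\<close> there. This product would lie in \<open>KK\<close> and so in \<open>Q\<close>,
    although neither factor does.\<close>
  have full: False if e: "e \<in> carrier ?S - Q" "\<forall>k\<in>{..<m}. e \<otimes>\<^bsub>?S\<^esub> ?f k \<in> N" for e
  proof -
    have eB: "e \<in> B" using e(1) by simp
    have "e \<otimes>\<^bsub>?S\<^esub> F.const a \<in> KK"
    proof (rule KKI)
      show "e \<otimes>\<^bsub>?S\<^esub> F.const a \<in> B"
        using F.S.m_closed[of e "F.const a"] eB F.const_B[OF ac] by (simp only: fun_ring_simps(1))
      fix J y assume J: "J \<in> \<Omega>" and y: "y \<in> I"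
      have eJ: "e J \<in> carrier R" using F.B_value[OF eB J] .
      have "e J \<otimes> (a \<otimes> y) \<in> J"
      proof (rule colon_ideal_Idl[OF Ji(1)[OF J] eJ _ _ aI[OF y]])
        show "f ` {..<m} \<subseteq> carrier R" using fc by blast
        fix z assume "z \<in> f ` {..<m}"
        then obtain k where k: "k < m" "z = f k" by blast
        have "(e \<otimes>\<^bsub>?S\<^esub> ?f k) J \<in> J" using e(2) k(1) J unfolding N_def by blast
        then show "e J \<otimes> z \<in> J" using k(2) J by simp
      qed
      then show "(e \<otimes>\<^bsub>?S\<^esub> F.const a) J \<otimes> y \<in> J"
        using J eJ ac ideal.Icarr[OF I y] by (simp add: m_assoc)
    qed
    then have "e \<otimes>\<^bsub>?S\<^esub> F.const a \<in> Q" using Q(2) by blast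
    moreover have "F.const a \<in> carrier ?S" using F.const_B[OF ac] by simp
    ultimately show False using Q.I_prime[of e "F.const a"] e(1) aq by blast
  qed
  have "(\<exists>x. (\<forall>b\<in>{..<m}. x b \<in> carrier ?S) \<and> (\<exists>b\<in>{..<m}. x b \<notin> Q) \<and>
      (\<forall>w\<in>{..<n}. (\<Oplus>\<^bsub>?S\<^esub>b\<in>{..<m}. g w b \<otimes>\<^bsub>?S\<^esub> x b) \<in> Q)) \<or>
    (\<exists>e\<in>carrier ?S - Q. \<forall>b\<in>{..<m}. e \<otimes>\<^bsub>?S\<^esub> ?f b \<in> N)"
    by (rule Q.kernel_vector_or_full_rank[OF finite_lessThan finite_lessThan _ _ N])
      (use gB fS rowN in blast)+
  then obtain \<phi> where \<phi>: "\<forall>k\<in>{..<m}. \<phi> k \<in> carrier ?S" "\<exists>k\<in>{..<m}. \<phi> k \<notin> Q"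
    "\<forall>j\<in>{..<n}. (\<Oplus>\<^bsub>?S\<^esub>k\<in>{..<m}. g j k \<otimes>\<^bsub>?S\<^esub> \<phi> k) \<in> Q" using full by blast
  have \<phi>Pi: "\<phi> \<in> {..<m} \<rightarrow> carrier ?S" using \<phi>(1) by blast
  obtain k0 where k0: "k0 < m" "\<phi> k0 \<notin> Q" using \<phi>(2) by blast
  obtain r where r: "\<And>J. J \<in> \<Omega> \<Longrightarrow> ideal_pow R I (Suc r) = J \<cdot> ideal_pow R I r"
    using uniform_reduction_number[OF I] unfolding \<Omega>_def by blast
  \<comment> \<open>Values in \<open>q\<close> are written with a fixed finite set of generators of
    \<open>q\<close>. The coefficients may vary arbitrarily with \<open>J\<close>, and here it
    matters that the ring contains all functions.\<close>
  have qQ: "h \<in> Q" if hB: "h \<in> B" and hq: "\<And>J. J \<in> \<Omega> \<Longrightarrow> h J \<in> q" for h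
  proof -
    obtain Z where Z: "Z \<subseteq> carrier R" "finite Z" "q = Idl Z" using finetely_gen[OF q.is_ideal] by blast
    have "\<exists>c. (\<forall>z\<in>Z. c z \<in> carrier R) \<and> h J = (\<Oplus>z\<in>Z. c z \<otimes> z)" if "J \<in> \<Omega>" for J
      using genideal_finite_eq[of Z "\<lambda>z. z" "h J"] Z hq[OF that] by auto
    then obtain c where cc: "\<And>J z. J \<in> \<Omega> \<Longrightarrow> z \<in> Z \<Longrightarrow> c J z \<in> carrier R"
      and c: "\<And>J. J \<in> \<Omega> \<Longrightarrow> h J = (\<Oplus>z\<in>Z. c J z \<otimes> z)" by metis
    let ?t = "\<lambda>z. (\<lambda>J\<in>\<Omega>. c J z) \<otimes>\<^bsub>?S\<^esub> F.const z"
    have tQ: "?t z \<in> Q" if "z \<in> Z" for z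
    proof (rule Q.I_l_closed)
      have "z \<in> q" using that Z(1,3) genideal_self by blast
      then show "F.const z \<in> Q" unfolding q_def by blast
      show "(\<lambda>J\<in>\<Omega>. c J z) \<in> carrier ?S" using BI cc that by simp
    qed
    have tB: "?t z \<in> B" if "z \<in> Z" for z using Q.Icarr[OF tQ[OF that]] by (simp only: fun_ring_simps(1))
    have sQ: "finsum ?S ?t Z \<in> Q" by (rule Q.finsum_in[OF tQ])
    have "h = finsum ?S ?t Z"
    proof (rule F.B_ext[OF hB])
      show "finsum ?S ?t Z \<in> B" using Q.Icarr[OF sQ] by (simp only: fun_ring_simps(1))
      fix J assume J: "J \<in> \<Omega>"
      have "finsum ?S ?t Z J = (\<Oplus>z\<in>Z. ?t z J)" by (rule F.S_finsum[OF Z(2) tB J])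
      also have "\<dots> = (\<Oplus>z\<in>Z. c J z \<otimes> z)"
        using J cc[OF J] Z(1) by (intro finsum_cong') auto
      finally show "h J = finsum ?S ?t Z J" using c[OF J] by simp
    qed
    then show ?thesis using sQ by simp
  qed
  have formR: "F.S.form ?f m d c J = form f m d (\<lambda>\<alpha>. c \<alpha> J)"
    if c: "c \<in> exponents m d \<rightarrow> carrier ?S" and J: "J \<in> \<Omega>" for c d J
  proof -
    have tB: "c \<alpha> \<otimes>\<^bsub>?S\<^esub> monomial ?S ?f m \<alpha> \<in> B" if "\<alpha> \<in> exponents m d" for \<alpha>
      using F.S.form_term_closed[OF fSPi c that] by (simp only: fun_ring_simps(1))
    have "F.S.form ?f m d c J = (\<Oplus>\<alpha>\<in>exponents m d. (c \<alpha> \<otimes>\<^bsub>?S\<^esub> monomial ?S ?f m \<alpha>) J)"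
      by (rule F.S_finsum[OF finite_exponents tB J])
    also have "\<dots> = form f m d (\<lambda>\<alpha>. c \<alpha> J)"
    proof (rule finsum_cong')
      have cJ: "c \<alpha> J \<in> carrier R" if "\<alpha> \<in> exponents m d" for \<alpha>
        using F.B_value[OF _ J, of "c \<alpha>"] funcset_mem[OF c that] by simp
      show "(\<lambda>\<alpha>. c \<alpha> J \<otimes> monomial R f m \<alpha>) \<in> exponents m d \<rightarrow> carrier R"
        using cJ monomial_Pi_closed[OF fPi] by blast
      show "(c \<alpha> \<otimes>\<^bsub>?S\<^esub> monomial ?S ?f m \<alpha>) J = c \<alpha> J \<otimes> monomial R f m \<alpha>" for \<alpha>
        using J F.S_monomial_value[of m f J \<alpha>, OF fc J] by simp
    qed simp
    finally show ?thesis .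
  qed
  \<comment> \<open>Substituting \<open>\<phi>\<close> for \<open>f\<close> is well defined modulo
    \<open>Q\<close>: a form vanishing at the constants \<open>f\<close> vanishes at each
    \<open>J\<close>, so analytic independence puts its coefficients into \<open>q\<close>
    pointwise, and \<open>qQ\<close> puts them into \<open>Q\<close>.\<close>
  have vanish: "w \<in> Q" if "F.S.rep ?f \<phi> m d \<zero>\<^bsub>?S\<^esub> w" for d w
  proof -
    obtain c where c: "c \<in> exponents m d \<rightarrow> carrier ?S" "\<zero>\<^bsub>?S\<^esub> = F.S.form ?f m d c" "w = F.S.form \<phi> m d c"
      using \<open>F.S.rep ?f \<phi> m d \<zero>\<^bsub>?S\<^esub> w\<close> unfolding F.S.rep_def by blast
    have cB: "c \<alpha> \<in> B" if "\<alpha> \<in> exponents m d" for \<alpha> using funcset_mem[OF c(1) that] by simp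
    have "c \<alpha> \<in> Q" if \<alpha>: "\<alpha> \<in> exponents m d" for \<alpha>
    proof (rule qQ[OF cB[OF \<alpha>]])
      fix J assume J: "J \<in> \<Omega>"
      have "form f m d (\<lambda>\<alpha>. c \<alpha> J) = \<zero>" unfolding formR[OF c(1) J, symmetric] c(2)[symmetric] using J by simp
      then show "c \<alpha> J \<in> q" using ind[of d "\<lambda>\<alpha>. c \<alpha> J" \<alpha>] F.B_value[OF cB J] \<alpha> by blast
    qed
    then show ?thesis
      unfolding c(3) using Q.I_r_closed F.S.monomial_Pi_closed[OF \<phi>Pi] by (intro Q.finsum_in) blast
  qed
  \<comment> \<open>For every \<open>J\<close> this element lies in \<open>J I^r\<close>, with one
    and the same \<open>r\<close>. The expansions for different \<open>J\<close> therefore have a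
    common degree and combine into a single form with function coefficients.\<close>
  define y where "y = f k0 [^] Suc r"
  have yc: "y \<in> carrier R" unfolding y_def using fc[OF k0(1)] by simp
  have "f k0 [^] d \<in> ideal_pow R I d" for d :: nat
  proof (induction d)
    case 0
    then show ?case using ideal_pow_0 by simp
  next
    case (Suc d)
    have "f k0 [^] d \<otimes> f k0 \<in> ideal_pow R I d \<cdot> I" by (rule ideal_prod.prod[OF Suc fI[OF k0(1)]])
    then show ?case by (simp only: ideal_pow_Suc nat_pow_Suc)
  qed
  then have yI: "y \<in> ideal_pow R I (Suc r)" unfolding y_def .
  have "\<exists>z. (\<forall>j\<in>{..<n}. z j \<in> ideal_pow R I r) \<and> y = (\<Oplus>j\<in>{..<n}. \<gamma> J j \<otimes> z j)" if J: "J \<in> \<Omega>" for J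
  proof (rule ideal_prod_gens[OF finite_lessThan _ ideal_pow_ideal[OF I]])
    show "\<gamma> J j \<in> carrier R" if "j \<in> {..<n}" for j using \<gamma>c J that by simp
    show "y \<in> (Idl (\<gamma> J ` {..<n})) \<cdot> ideal_pow R I r" using yI unfolding r[OF J] \<gamma>J[OF J, symmetric] .
  qed
  then obtain z where zI: "\<And>J j. J \<in> \<Omega> \<Longrightarrow> j < n \<Longrightarrow> z J j \<in> ideal_pow R I r"
    and yz: "\<And>J. J \<in> \<Omega> \<Longrightarrow> y = (\<Oplus>j\<in>{..<n}. \<gamma> J j \<otimes> z J j)" by (metis lessThan_iff)
  have zc: "z J j \<in> carrier R" if "J \<in> \<Omega>" "j < n" for J j using ideal_pow_carrier[OF I zI[OF that]] .
  have ex: "\<exists>c. c \<in> exponents m r \<rightarrow> carrier R \<and> a [^] r \<otimes> z J j = form f m r c" if "J \<in> \<Omega>" "j < n" for J j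
    using ideal_pow_form[OF fPi I ac aI zI[OF that]] unfolding rep_def by blast
  define c where "c J j = (SOME c. c \<in> exponents m r \<rightarrow> carrier R \<and> a [^] r \<otimes> z J j = form f m r c)" for J j
  have cc: "c J j \<in> exponents m r \<rightarrow> carrier R" and c: "a [^] r \<otimes> z J j = form f m r (c J j)"
    if "J \<in> \<Omega>" "j < n" for J j
    using someI_ex[OF ex[OF that]] unfolding c_def[symmetric] by blast+
  define C where "C j \<alpha> = (\<lambda>J\<in>\<Omega>. c J j \<alpha>)" for j \<alpha>
  have CS: "C j \<in> exponents m r \<rightarrow> carrier ?S" if "j < n" for j
  proof
    fix \<alpha> assume "\<alpha> \<in> exponents m r"
    then show "C j \<alpha> \<in> carrier ?S" unfolding C_def using BI funcset_mem[OF cc] that by simp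
  qed
  let ?v = "\<lambda>j. F.S.form ?f m r (C j)" and ?w = "\<lambda>j. F.S.form \<phi> m r (C j)"
  let ?g\<phi> = "\<lambda>j. \<Oplus>\<^bsub>?S\<^esub>k\<in>{..<m}. g j k \<otimes>\<^bsub>?S\<^esub> \<phi> k"
  have vS: "?v j \<in> carrier ?S" and wS: "?w j \<in> carrier ?S" if "j < n" for j
    using F.S.form_closed[OF fSPi CS[OF that]] F.S.form_closed[OF \<phi>Pi CS[OF that]] by blast+
  have vJ: "?v j J = a [^] r \<otimes> z J j" if "j < n" "J \<in> \<Omega>" for j J
  proof -
    have "?v j J = form f m r (\<lambda>\<alpha>. C j \<alpha> J)" by (rule formR[OF CS[OF that(1)] that(2)])
    also have "\<dots> = form f m r (c J j)"
    proof (rule finsum_cong')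
      show "(\<lambda>\<alpha>. c J j \<alpha> \<otimes> monomial R f m \<alpha>) \<in> exponents m r \<rightarrow> carrier R"
        using form_term_closed[OF fPi cc[OF that(2,1)]] by blast
    qed (use that in \<open>simp_all add: C_def\<close>)
    finally show ?thesis using c[OF that(2,1)] by simp
  qed
  \<comment> \<open>The first expression sums the products of \<open>a \<gamma>_j\<close> and
    \<open>a^r z_j\<close>. After the substitution each summand has the factor
    \<open>?g\<phi> j\<close>, which lies in \<open>Q\<close> because \<open>\<phi>\<close> is a
    kernel vector.\<close>
  have rep1: "F.S.rep ?f \<phi> m (Suc r) (\<Oplus>\<^bsub>?S\<^esub>j\<in>{..<n}. ?row j \<otimes>\<^bsub>?S\<^esub> ?v j) (\<Oplus>\<^bsub>?S\<^esub>j\<in>{..<n}. ?g\<phi> j \<otimes>\<^bsub>?S\<^esub> ?w j)"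
  proof (rule F.S.rep_finsum[OF fSPi \<phi>Pi finite_lessThan])
    fix j assume "j \<in> {..<n}"
    then have j: "j < n" by simp
    have "F.S.rep ?f \<phi> m r (?v j) (?w j)" unfolding F.S.rep_def using CS[OF j] by blast
    then show "F.S.rep ?f \<phi> m (Suc r) (?row j \<otimes>\<^bsub>?S\<^esub> ?v j) (?g\<phi> j \<otimes>\<^bsub>?S\<^esub> ?w j)"
      by (rule F.S.rep_linear[OF fSPi \<phi>Pi]) (rule gB[OF j])
  qed
  have w1: "(\<Oplus>\<^bsub>?S\<^esub>j\<in>{..<n}. ?g\<phi> j \<otimes>\<^bsub>?S\<^esub> ?w j) \<in> Q"
  proof (rule Q.finsum_in)
    fix j assume j: "j \<in> {..<n}"
    then have "?g\<phi> j \<in> Q" using \<phi>(3) by blast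
    moreover have "?w j \<in> carrier ?S" using wS j by blast
    ultimately show "?g\<phi> j \<otimes>\<^bsub>?S\<^esub> ?w j \<in> Q" by (rule Q.I_r_closed)
  qed
  let ?A = "F.const (a [^] Suc r)"
  have AS: "?A \<in> carrier ?S" using F.const_B ac by simp
  \<comment> \<open>The second expression for the same element, as a multiple of a pure power of
    \<open>f k0\<close>. Its substituted value is a product of powers of \<open>a\<close> and of
    \<open>\<phi> k0\<close>, both outside \<open>Q\<close>.\<close>
  have rep2: "F.S.rep ?f \<phi> m (Suc r) (?A \<otimes>\<^bsub>?S\<^esub> ?f k0 [^]\<^bsub>?S\<^esub> Suc r) (?A \<otimes>\<^bsub>?S\<^esub> \<phi> k0 [^]\<^bsub>?S\<^esub> Suc r)"
    by (rule F.S.rep_scale[OF fSPi \<phi>Pi F.S.rep_power[OF fSPi \<phi>Pi k0(1)] AS])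
  have tS: "?row j \<otimes>\<^bsub>?S\<^esub> ?v j \<in> B" if "j \<in> {..<n}" for j
    using F.S.m_closed[OF rowS vS, of j j] that by (simp only: fun_ring_simps(1) lessThan_iff)
  have veq: "(\<Oplus>\<^bsub>?S\<^esub>j\<in>{..<n}. ?row j \<otimes>\<^bsub>?S\<^esub> ?v j) = ?A \<otimes>\<^bsub>?S\<^esub> ?f k0 [^]\<^bsub>?S\<^esub> Suc r"
  proof (rule F.B_ext)
    show "(\<Oplus>\<^bsub>?S\<^esub>j\<in>{..<n}. ?row j \<otimes>\<^bsub>?S\<^esub> ?v j) \<in> B"
      using F.S.rep_closed[OF fSPi \<phi>Pi rep1] by (simp only: fun_ring_simps(1))
    show "?A \<otimes>\<^bsub>?S\<^esub> ?f k0 [^]\<^bsub>?S\<^esub> Suc r \<in> B"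
      using F.S.rep_closed[OF fSPi \<phi>Pi rep2] by (simp only: fun_ring_simps(1))
    fix J assume J: "J \<in> \<Omega>"
    have "(\<Oplus>\<^bsub>?S\<^esub>j\<in>{..<n}. ?row j \<otimes>\<^bsub>?S\<^esub> ?v j) J = (\<Oplus>j\<in>{..<n}. (?row j \<otimes>\<^bsub>?S\<^esub> ?v j) J)"
      by (rule F.S_finsum[OF finite_lessThan tS J])
    also have "\<dots> = (\<Oplus>j\<in>{..<n}. a [^] Suc r \<otimes> (\<gamma> J j \<otimes> z J j))"
    proof (rule finsum_cong')
      show "(\<lambda>j. a [^] Suc r \<otimes> (\<gamma> J j \<otimes> z J j)) \<in> {..<n} \<rightarrow> carrier R" using ac \<gamma>c[OF J] zc[OF J] by auto
      fix j assume "j \<in> {..<n}"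
      then have j: "j < n" by simp
      have id: "(a \<otimes> p) \<otimes> (e \<otimes> s) = (e \<otimes> a) \<otimes> (p \<otimes> s)" if "p \<in> carrier R" "e \<in> carrier R" "s \<in> carrier R" for p e s
        using that ac by algebra
      have "(?row j \<otimes>\<^bsub>?S\<^esub> ?v j) J = ?row j J \<otimes> ?v j J" using J by simp
      also have "\<dots> = (a \<otimes> \<gamma> J j) \<otimes> (a [^] r \<otimes> z J j)" by (simp only: row[OF j J] vJ[OF j J])
      also have "\<dots> = (a [^] r \<otimes> a) \<otimes> (\<gamma> J j \<otimes> z J j)"
        by (rule id[OF \<gamma>c[OF J j] nat_pow_closed[OF ac] zc[OF J j]])
      finally show "(?row j \<otimes>\<^bsub>?S\<^esub> ?v j) J = a [^] Suc r \<otimes> (\<gamma> J j \<otimes> z J j)" by simp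
    qed simp
    also have "\<dots> = a [^] Suc r \<otimes> (\<Oplus>j\<in>{..<n}. \<gamma> J j \<otimes> z J j)"
      using ac \<gamma>c[OF J] zc[OF J] by (intro finsum_rdistr[symmetric]) auto
    also have "\<dots> = a [^] Suc r \<otimes> y" by (simp only: yz[OF J, symmetric])
    also have "\<dots> = (?A \<otimes>\<^bsub>?S\<^esub> ?f k0 [^]\<^bsub>?S\<^esub> Suc r) J"
      unfolding F.const_pow[OF fc[OF k0(1)]] y_def using J by simp
    finally show "(\<Oplus>\<^bsub>?S\<^esub>j\<in>{..<n}. ?row j \<otimes>\<^bsub>?S\<^esub> ?v j) J = (?A \<otimes>\<^bsub>?S\<^esub> ?f k0 [^]\<^bsub>?S\<^esub> Suc r) J" .
  qed
  let ?V = "?A \<otimes>\<^bsub>?S\<^esub> ?f k0 [^]\<^bsub>?S\<^esub> Suc r" and ?W = "\<Oplus>\<^bsub>?S\<^esub>j\<in>{..<n}. ?g\<phi> j \<otimes>\<^bsub>?S\<^esub> ?w j"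
  let ?U = "?A \<otimes>\<^bsub>?S\<^esub> \<phi> k0 [^]\<^bsub>?S\<^esub> Suc r"
  have m1: "\<ominus>\<^bsub>?S\<^esub> \<one>\<^bsub>?S\<^esub> \<in> carrier ?S" by (rule F.S.a_inv_closed[OF F.S.one_closed])
  have cl: "?V \<in> carrier ?S" "?U \<in> carrier ?S" "?W \<in> carrier ?S"
    using F.S.rep_closed[OF fSPi \<phi>Pi rep2] F.S.rep_closed[OF fSPi \<phi>Pi rep1] by blast+
  have neg: "\<ominus>\<^bsub>?S\<^esub> \<one>\<^bsub>?S\<^esub> \<otimes>\<^bsub>?S\<^esub> t = \<ominus>\<^bsub>?S\<^esub> t" if "t \<in> carrier ?S" for t
    using F.S.l_minus[OF F.S.one_closed that] F.S.l_one[OF that] by (simp only:)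
  \<comment> \<open>The difference of the two expressions represents \<open>\<zero>\<close>, so by
    \<open>vanish\<close> the substituted values agree modulo \<open>Q\<close>, a
    contradiction.\<close>
  have "F.S.rep ?f \<phi> m (Suc r) (?V \<oplus>\<^bsub>?S\<^esub> \<ominus>\<^bsub>?S\<^esub> ?V) (?U \<oplus>\<^bsub>?S\<^esub> \<ominus>\<^bsub>?S\<^esub> ?W)"
    using F.S.rep_add[OF fSPi \<phi>Pi rep2 F.S.rep_scale[OF fSPi \<phi>Pi rep1[unfolded veq] m1]]
    unfolding neg[OF cl(1)] neg[OF cl(3)] .
  then have "F.S.rep ?f \<phi> m (Suc r) \<zero>\<^bsub>?S\<^esub> (?U \<oplus>\<^bsub>?S\<^esub> \<ominus>\<^bsub>?S\<^esub> ?W)" by (simp only: F.S.r_neg[OF cl(1)])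
  then have "?U \<oplus>\<^bsub>?S\<^esub> \<ominus>\<^bsub>?S\<^esub> ?W \<in> Q" by (rule vanish)
  then have UQ: "?U \<in> Q"
    using Q.add_in_cancel[of ?U "\<ominus>\<^bsub>?S\<^esub> ?W"] cl(2) additive_subgroup.a_inv_closed[OF Q.additive_subgroup_axioms w1] by blast
  have \<phi>0: "\<phi> k0 \<in> carrier ?S" using \<phi>(1) k0(1) by blast
  have "?A \<notin> Q"
  proof
    assume "?A \<in> Q"
    then have "a [^] Suc r \<in> q" unfolding q_def using ac by simp
    then show False using q.pow_in_D[OF ac] a by blast
  qed
  then have "\<phi> k0 [^]\<^bsub>?S\<^esub> Suc r \<in> Q" using Q.I_prime[OF AS F.S.nat_pow_closed[OF \<phi>0] UQ] by blast
  then show False using Q.pow_in_D[OF \<phi>0] k0(2) by blast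
qed

end

section \<open>Associated primes, prime filtrations, and the core as a finite intersection\<close>

section \<open>Associated primes and the core\<close>

context cring
begin

lemma colon_element_ideal:
  assumes "ideal N R" "x \<in> carrier R"
  shows "ideal {r \<in> carrier R. r \<otimes> x \<in> N} R"
proof -
  have "{r \<in> carrier R. r \<otimes> x \<in> N} = {r \<in> carrier R. x \<otimes> r \<in> N}" using m_comm[of _ x] assms(2) by auto
  then show ?thesis using colon_ideal[OF assms] by simp
qed

lemma quot_module_smult:
  assumes J: "ideal J R" and r: "r \<in> carrier R" and x: "x \<in> carrier R"
  shows "r \<odot>\<^bsub>quot_module R I J\<^esub> (J +> x) = J +> (r \<otimes> x)"
proof -
  interpret J: ideal J R by fact
  have "J +> (r \<otimes> z) = J +> (r \<otimes> x)" if z: "z \<in> J +> x" for z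
  proof -
    obtain k where k: "k \<in> J" "z = k \<oplus> x" using z unfolding a_r_coset_def' by blast
    have kc: "k \<in> carrier R" using J.Icarr[OF k(1)] .
    have "r \<otimes> z \<ominus> r \<otimes> x = r \<otimes> k" unfolding k(2) using kc r x by algebra
    also have "\<dots> \<in> J" by (rule J.I_l_closed[OF k(1) r])
    finally have "r \<otimes> z \<ominus> r \<otimes> x \<in> J" .
    moreover have "r \<otimes> z \<in> carrier R" "r \<otimes> x \<in> carrier R" using k(2) kc r x by auto
    ultimately show ?thesis using quotient_eq_iff_same_a_r_cos[OF J] by blast
  qed
  then have "(\<Union>z\<in>J +> x. J +> (r \<otimes> z)) = (\<Union>z\<in>J +> x. J +> (r \<otimes> x))" by simp
  moreover have "x = \<zero> \<oplus> x" using x by simp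
  then have "x \<in> J +> x"
    unfolding a_r_coset_def' using additive_subgroup.zero_closed[OF J.additive_subgroup_axioms] by blast
  ultimately show ?thesis unfolding quot_module_def by auto
qed

lemma coset_eq_ideal_iff:
  assumes J: "ideal J R" and x: "x \<in> carrier R"
  shows "J +> x = J \<longleftrightarrow> x \<in> J"
proof -
  interpret J: ideal J R by fact
  have "J \<subseteq> carrier R" using J.Icarr by blast
  then have z: "J +> \<zero> = J" by (rule a_coset_add_zero)
  have "x \<ominus> \<zero> = x" using x by algebra
  then show ?thesis using quotient_eq_iff_same_a_r_cos[OF J x zero_closed] z by simp
qed

text \<open>Annihilators of classes in \<open>I/J\<close> become colon ideals \<open>J : x\<close>
  with \<open>x\<close> in \<open>I\<close>, the form in which associated primes are produced
  below.\<close>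

lemma Ass_quot_module_iff:
  assumes J: "ideal J R" and I: "ideal I R"
  shows "p \<in> Ass R (quot_module R I J) \<longleftrightarrow>
    primeideal p R \<and> (\<exists>x\<in>I. p = {r \<in> carrier R. r \<otimes> x \<in> J})"
proof -
  have carr: "carrier (quot_module R I J) = (\<lambda>a. J +> a) ` I" and zero: "\<zero>\<^bsub>quot_module R I J\<^esub> = J"
    unfolding quot_module_def by simp_all
  have "{r \<in> carrier R. r \<odot>\<^bsub>quot_module R I J\<^esub> (J +> x) = \<zero>\<^bsub>quot_module R I J\<^esub>} = {r \<in> carrier R. r \<otimes> x \<in> J}"
    if "x \<in> I" for x
  proof -
    have x: "x \<in> carrier R" using ideal.Icarr[OF I that] .
    have "(r \<odot>\<^bsub>quot_module R I J\<^esub> (J +> x) = \<zero>\<^bsub>quot_module R I J\<^esub>) \<longleftrightarrow> r \<otimes> x \<in> J" if "r \<in> carrier R" for r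
      unfolding quot_module_smult[OF J that x] zero using coset_eq_ideal_iff[OF J] that x by simp
    then show ?thesis by blast
  qed
  then show ?thesis unfolding Ass_def Spec_def carr by auto
qed

end

text \<open>A maximal colon \<open>U : y\<close> above \<open>U : x\<close> is prime: if
  \<open>b y\<close> is outside \<open>U\<close>, then its colon contains \<open>U : y\<close> and
  is therefore equal to it, so \<open>a b y\<close> in \<open>U\<close> implies \<open>a y\<close>
  in \<open>U\<close>.\<close>

lemma (in noetherian_local_ring) exists_associated_prime:
  assumes U: "ideal U R" and T: "ideal T R" and x: "x \<in> T" "x \<notin> U"
  shows "\<exists>y\<in>T. y \<notin> U \<and> primeideal {r \<in> carrier R. r \<otimes> y \<in> U} R \<and>
    {r \<in> carrier R. r \<otimes> x \<in> U} \<subseteq> {r \<in> carrier R. r \<otimes> y \<in> U}"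
proof -
  interpret U: ideal U R by fact
  interpret T: ideal T R by fact
  let ?c = "\<lambda>y. {r \<in> carrier R. r \<otimes> y \<in> U}"
  define F where "F = {?c y | y. y \<in> T \<and> y \<notin> U \<and> ?c x \<subseteq> ?c y}"
  have Fi: "ideal X R" if "X \<in> F" for X
    using that colon_element_ideal[OF U.is_ideal T.Icarr] unfolding F_def by blast
  have "\<exists>M\<in>F. \<forall>X\<in>F. M \<subseteq> X \<longrightarrow> X = M"
  proof (rule subset_Zorn_nonempty)
    show "F \<noteq> {}" unfolding F_def using x by blast
    fix C assume C: "C \<noteq> {}" "subset.chain F C"
    then have CF: "C \<subseteq> F" and tot: "\<forall>X\<in>C. \<forall>Y\<in>C. X \<subseteq> Y \<or> Y \<subseteq> X" by (auto simp: subset_chain_def)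
    have "F \<subseteq> {I. ideal I R}" using Fi by (intro subsetI CollectI)
    then have "C \<subseteq> {I. ideal I R}" using CF by (rule subset_trans[rotated])
    then have "subset.chain {I. ideal I R} C" using tot by (simp add: subset_chain_def)
    then have "\<Union>C \<in> C" by (rule ideal_chain_is_trivial[OF C(1)])
    then show "\<Union>C \<in> F" using CF by (rule subsetD[rotated])
  qed
  then obtain M where M: "M \<in> F" "\<And>X. X \<in> F \<Longrightarrow> M \<subseteq> X \<Longrightarrow> X = M" by blast
  then obtain y where y: "y \<in> T" "y \<notin> U" "?c x \<subseteq> ?c y" "M = ?c y" unfolding F_def by blast
  have yc: "y \<in> carrier R" using T.Icarr[OF y(1)] .
  have "primeideal (?c y) R"
  proof (rule primeidealI)
    show "ideal (?c y) R" by (rule colon_element_ideal[OF U.is_ideal yc])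
    show "cring R" by (rule cring_axioms)
    have "\<one> \<notin> ?c y" using y(2) yc by simp
    then show "carrier R \<noteq> ?c y" using one_closed by metis
    fix a b assume ab: "a \<in> carrier R" "b \<in> carrier R" "a \<otimes> b \<in> ?c y"
    show "a \<in> ?c y \<or> b \<in> ?c y"
    proof (cases "b \<otimes> y \<in> U")
      case True
      then show ?thesis using ab(2) by blast
    next
      case False
      have sub: "?c y \<subseteq> ?c (b \<otimes> y)"
      proof
        fix r assume r: "r \<in> ?c y"
        then have "r \<otimes> (b \<otimes> y) = b \<otimes> (r \<otimes> y)" using ab(2) yc by (intro m_lcomm) auto
        then show "r \<in> ?c (b \<otimes> y)" using r U.I_l_closed[of "r \<otimes> y" b] ab(2) by simp
      qed
      have "?c (b \<otimes> y) \<in> F"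
        unfolding F_def using False T.I_l_closed[OF y(1) ab(2)] y(3) sub by blast
      then have "?c (b \<otimes> y) = ?c y" using M(2) sub unfolding y(4) by blast
      moreover have "a \<in> ?c (b \<otimes> y)" using ab yc m_assoc[of a b y] by simp
      ultimately show ?thesis by blast
    qed
  qed
  then show ?thesis using y(1-3) by blast
qed

context noetherian_local_ring
begin

text \<open>The class of \<open>x\<close> in \<open>I/N\<close> generates a copy of
  \<open>R/p\<close>, where \<open>p\<close> is the prime \<open>N : x\<close>.\<close>

definition prime_step :: "'a set \<Rightarrow> 'a set \<Rightarrow> 'a \<Rightarrow> bool"
  where "prime_step I N x \<longleftrightarrow> x \<in> I \<and> x \<notin> N \<and> primeideal {r \<in> carrier R. r \<otimes> x \<in> N} R"

text \<open>Adjoining one prime step after another enlarges the ideal strictly until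
  \<open>I\<close> is reached, which the chain condition forces. The sequence is defined for all
  indices and stays at \<open>I\<close>; \<open>L\<close> is the first index where it
  arrives.\<close>

lemma prime_filtration:
  assumes E: "ideal E R" "E \<subseteq> I" and I: "ideal I R"
  obtains N L x where "N 0 = E" "N L = I" "\<And>j. ideal (N j) R" "\<And>j. N j \<subseteq> N (Suc j)"
    "\<And>j. j < L \<Longrightarrow> prime_step I (N j) (x j)" "\<And>j. j < L \<Longrightarrow> N (Suc j) = Idl (N j \<union> {\<nu> \<otimes> x j | \<nu>. \<nu> \<in> carrier R})"
proof -
  define pick where "pick N = (SOME x. prime_step I N x)" for N
  have pick: "prime_step I N (pick N)" if N: "ideal N R" "N \<subseteq> I" "N \<noteq> I" for N
  proof -
    obtain z where "z \<in> I" "z \<notin> N" using N by blast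
    from exists_associated_prime[OF N(1) I this] have "\<exists>y. prime_step I N y" unfolding prime_step_def by blast
    then show ?thesis unfolding pick_def by (rule someI_ex)
  qed
  define nx where "nx N = (if N = I then I else Idl (N \<union> {\<nu> \<otimes> pick N | \<nu>. \<nu> \<in> carrier R}))" for N
  define N where "N j = (nx ^^ j) E" for j
  have N0: "N 0 = E" and NS: "N (Suc j) = nx (N j)" for j unfolding N_def by simp_all
  have step: "ideal (nx M) R \<and> nx M \<subseteq> I \<and> M \<subseteq> nx M \<and> (nx M = M \<longrightarrow> M = I)" if M: "ideal M R" "M \<subseteq> I" for M
  proof (cases "M = I")
    case True
    then show ?thesis unfolding nx_def using I by simp
  next
    case False
    have p: "pick M \<in> I" "pick M \<notin> M" using pick[OF M False] unfolding prime_step_def by blast+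
    have pc: "pick M \<in> carrier R" using ideal.Icarr[OF I p(1)] .
    let ?Z = "M \<union> {\<nu> \<otimes> pick M | \<nu>. \<nu> \<in> carrier R}"
    have ZI: "?Z \<subseteq> I" using M(2) ideal.I_l_closed[OF I p(1)] by blast
    have Z: "?Z \<subseteq> carrier R" using ZI ideal.Icarr[OF I] by blast
    have nx: "nx M = Idl ?Z" unfolding nx_def using False by simp
    have "\<one> \<otimes> pick M \<in> ?Z" by blast
    then have "pick M \<in> nx M" unfolding nx using genideal_self[OF Z] pc by auto
    moreover have "ideal (nx M) R" unfolding nx by (rule genideal_ideal[OF Z])
    moreover have "nx M \<subseteq> I" unfolding nx by (rule genideal_minimal[OF I ZI])
    moreover have "M \<subseteq> nx M" unfolding nx using genideal_self[OF Z] by blast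
    ultimately show ?thesis using p(2) by metis
  qed
  have Ni: "ideal (N j) R \<and> N j \<subseteq> I" for j
  proof (induction j)
    case (Suc j)
    then show ?case unfolding NS using step[of "N j"] by blast
  qed (use E N0 in simp)
  have mono: "N j \<subseteq> N (Suc j)" for j unfolding NS using step[of "N j"] Ni[of j] by blast
  obtain k where k: "\<And>i. i \<ge> k \<Longrightarrow> N i = N k"
    using ideal_accD[of R N, OF ideal_acc _ mono] Ni by blast
  have "nx (N k) = N k" using k[of "Suc k"] NS[of k] by simp
  then have ex: "\<exists>k. N k = I" using step[of "N k"] Ni[of k] by blast
  define L where "L = (LEAST k. N k = I)"
  have L: "N L = I" unfolding L_def using ex by (rule LeastI_ex)
  have below: "N j \<noteq> I" if "j < L" for j using not_less_Least[of j "\<lambda>k. N k = I"] that unfolding L_def by blast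
  show thesis
  proof (rule that[of N L "\<lambda>j. pick (N j)"])
    fix j assume "j < L"
    then have ne: "N j \<noteq> I" by (rule below)
    show "prime_step I (N j) (pick (N j))" using pick[OF _ _ ne] Ni[of j] by blast
    show "N (Suc j) = Idl (N j \<union> {\<nu> \<otimes> pick (N j) | \<nu>. \<nu> \<in> carrier R})"
      unfolding NS nx_def using ne by simp
  qed (use N0 L Ni mono in blast)+
qed

text \<open>If \<open>z\<close> in \<open>U' - U\<close> occurs first at step \<open>j\<close> of the filtration, the prime of that step is contained in \<open>U : z\<close>,
  hence equal to a member \<open>p\<close> of the antichain \<open>P\<close>. Then \<open>U\<close> also has an element \<open>y\<close> occurring first at
  step \<open>j\<close>, and eliminating \<open>x j\<close> between \<open>z\<close> and \<open>y\<close> puts an element outside \<open>p\<close> into \<open>U : z\<close>.\<close>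

lemma ideal_determined_by_jumps:
  assumes I: "ideal I R" and N: "\<And>j. ideal (N j) R" "N 0 \<subseteq> U" "N L = I" "\<And>j. N j \<subseteq> N (Suc j)"
    and st: "\<And>j. j < L \<Longrightarrow> prime_step I (N j) (x j)"
      "\<And>j. j < L \<Longrightarrow> N (Suc j) = Idl (N j \<union> {\<nu> \<otimes> x j | \<nu>. \<nu> \<in> carrier R})"
    and above: "\<And>j. j < L \<Longrightarrow> \<exists>p\<in>P. p \<subseteq> {r \<in> carrier R. r \<otimes> x j \<in> N j}"
    and anti: "\<And>p p'. p \<in> P \<Longrightarrow> p' \<in> P \<Longrightarrow> p' \<subseteq> p \<Longrightarrow> p' = p"
    and U: "ideal U R" and U': "ideal U' R" "U' \<subseteq> I"
    and sat: "\<And>z. z \<in> I \<Longrightarrow> z \<notin> U \<Longrightarrow> \<exists>p\<in>P. {r \<in> carrier R. r \<otimes> z \<in> U} \<subseteq> p"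
    and jumps: "\<And>j y. \<lbrakk>j < L; {r \<in> carrier R. r \<otimes> x j \<in> N j} \<in> P; y \<in> U'; y \<in> N (Suc j); y \<notin> N j\<rbrakk>
      \<Longrightarrow> \<exists>y\<in>U. y \<in> N (Suc j) \<and> y \<notin> N j"
    and UU': "U \<subseteq> U'"
  shows "U' \<subseteq> U"
proof -
  interpret U: ideal U R by fact
  interpret U': ideal U' R by fact
  have "z \<in> U" if "j \<le> L" "z \<in> U'" "z \<in> N j" for j z
    using that
  proof (induction j arbitrary: z)
    case 0
    then show ?case using N(2) by blast
  next
    case (Suc j)
    interpret Nj: ideal "N j" R by (rule N(1))
    let ?Q = "{r \<in> carrier R. r \<otimes> x j \<in> N j}"
    have j: "j < L" using Suc.prems(1) by simp
    have IH: "\<And>z. z \<in> U' \<Longrightarrow> z \<in> N j \<Longrightarrow> z \<in> U" using Suc.IH j by simp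
    have xj: "x j \<in> I" and Q: "primeideal ?Q R" using st(1)[OF j] unfolding prime_step_def by blast+
    interpret Q: primeideal ?Q R by (rule Q)
    have xc: "x j \<in> carrier R" using ideal.Icarr[OF I xj] .
    have zc: "z \<in> carrier R" using U'.Icarr[OF Suc.prems(2)] .
    have dec: "\<exists>c\<in>carrier R. \<exists>w\<in>N j. y = c \<otimes> x j \<oplus> w" if "y \<in> N (Suc j)" for y
    proof -
      have Nc: "N j \<subseteq> carrier R" using Nj.Icarr by blast
      have "\<exists>c\<in>carrier R. \<exists>w\<in>Idl (N j). y = c \<otimes> x j \<oplus> w"
        by (rule genideal_insert_multiples[OF oneideal Nc xc]) (use that st(2)[OF j] in blast)
      then show ?thesis using genideal_minimal[OF Nj.is_ideal subset_refl] by blast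
    qed
    show ?case
    proof (cases "z \<in> N j")
      case True
      then show ?thesis using IH Suc.prems(2) by blast
    next
      case zN: False
      show ?thesis
      proof (rule ccontr)
        assume zU: "z \<notin> U"
        have "z \<in> I" using U'(2) Suc.prems(2) by blast
        then obtain p where p: "p \<in> P" "{r \<in> carrier R. r \<otimes> z \<in> U} \<subseteq> p" using sat zU by blast
        obtain c w where z: "c \<in> carrier R" "w \<in> N j" "z = c \<otimes> x j \<oplus> w" using dec[OF Suc.prems(3)] by blast
        have wc: "w \<in> carrier R" using Nj.Icarr z(2) by blast
        \<comment> \<open>An element of \<open>?Q\<close> times \<open>z\<close> falls into
          \<open>N j\<close>, where the induction hypothesis already identifies \<open>U'\<close>
          with \<open>U\<close>.\<close>
        have "?Q \<subseteq> {r \<in> carrier R. r \<otimes> z \<in> U}"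
        proof
          fix s assume s: "s \<in> ?Q"
          then have sc: "s \<in> carrier R" and sx: "s \<otimes> x j \<in> N j" by blast+
          have "s \<otimes> z = c \<otimes> (s \<otimes> x j) \<oplus> s \<otimes> w" unfolding z(3) using sc z(1) wc xc by algebra
          also have "\<dots> \<in> N j" by (rule Nj.add_in[OF Nj.I_l_closed[OF sx z(1)] Nj.I_l_closed[OF z(2) sc]])
          finally have "s \<otimes> z \<in> N j" .
          moreover have "s \<otimes> z \<in> U'" by (rule U'.I_l_closed[OF Suc.prems(2) sc])
          ultimately show "s \<in> {r \<in> carrier R. r \<otimes> z \<in> U}" using IH sc by blast
        qed
        then have Qp: "?Q \<subseteq> p" using p(2) by (rule subset_trans)
        obtain p' where p': "p' \<in> P" "p' \<subseteq> ?Q" using above[OF j] by (elim bexE)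
        have p'p: "p' \<subseteq> p" using p'(2) Qp by (rule subset_trans)
        have pp: "p' = p" using p(1) p'(1) p'p by (rule anti)
        have "p \<subseteq> ?Q" by (rule p'(2)[unfolded pp])
        with Qp have eq: "?Q = p" by (rule subset_antisym)
        have QP: "?Q \<in> P" unfolding eq by (rule p(1))
        then obtain y where y: "y \<in> U" "y \<in> N (Suc j)" "y \<notin> N j"
          using jumps[OF j QP Suc.prems(2,3) zN] by (elim bexE conjE)
        obtain b v where b: "b \<in> carrier R" "v \<in> N j" "y = b \<otimes> x j \<oplus> v" using dec[OF y(2)] by blast
        have vc: "v \<in> carrier R" using Nj.Icarr b(2) by blast
        have yc: "y \<in> carrier R" using U.Icarr[OF y(1)] .
        have "b \<notin> ?Q"
        proof
          assume "b \<in> ?Q"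
          then have "b \<otimes> x j \<in> N j" by blast
          then show False using y(3) Nj.add_in[OF _ b(2)] b(3) by blast
        qed
        have "b \<otimes> z \<ominus> c \<otimes> y = b \<otimes> w \<ominus> c \<otimes> v" unfolding z(3) b(3) using b(1) z(1) wc vc xc by algebra
        also have "\<dots> \<in> N j" by (rule Nj.minus_in[OF Nj.I_l_closed[OF z(2) b(1)] Nj.I_l_closed[OF b(2) z(1)]])
        finally have 1: "b \<otimes> z \<ominus> c \<otimes> y \<in> N j" .
        have cy: "c \<otimes> y \<in> U" by (rule U.I_l_closed[OF y(1) z(1)])
        have "b \<otimes> z \<ominus> c \<otimes> y \<in> U'"
          by (rule U'.minus_in[OF U'.I_l_closed[OF Suc.prems(2) b(1)]]) (use cy UU' in blast)
        then have "b \<otimes> z \<ominus> c \<otimes> y \<in> U" using IH 1 by blast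
        then have "(b \<otimes> z \<ominus> c \<otimes> y) \<oplus> c \<otimes> y \<in> U" using cy by (rule U.add_in)
        moreover have "(b \<otimes> z \<ominus> c \<otimes> y) \<oplus> c \<otimes> y = b \<otimes> z"
          using m_closed[OF b(1) zc] m_closed[OF z(1) yc] by (simp only: a_minus_def a_assoc a_inv_closed l_neg r_zero)
        ultimately have "b \<otimes> z \<in> U" by (simp only:)
        then have "b \<in> p" using p(2) b(1) by blast
        then show False using \<open>b \<notin> ?Q\<close> unfolding eq by (rule notE[rotated])
      qed
    qed
  qed
  from this[OF order_refl] show ?thesis using U'(2) N(3) by blast
qed

text \<open>Intersecting further can only remove jumps. At a finite intersection with the least
  number of them, a further \<open>J\<close> removes none, and
  \<open>ideal_determined_by_jumps\<close> then shows that intersecting with \<open>J\<close>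
  changes nothing.\<close>

lemma core_finite_intersection:
  assumes I: "ideal I R"
    and above: "\<And>Q. \<lbrakk>primeideal Q R; {x \<in> carrier R. \<forall>y\<in>I. x \<otimes> y \<in> core R I} \<subseteq> Q\<rbrakk> \<Longrightarrow> \<exists>p\<in>reduction_primes R I. p \<subseteq> Q"
    and anti: "\<And>p p'. p \<in> reduction_primes R I \<Longrightarrow> p' \<in> reduction_primes R I \<Longrightarrow> p' \<subseteq> p \<Longrightarrow> p' = p"
  shows "\<exists>\<S>. finite \<S> \<and> \<S> \<noteq> {} \<and> \<S> \<subseteq> min_reductions R I \<and> core R I = \<Inter>\<S>"
proof -
  let ?M = "min_reductions R I" and ?P = "reduction_primes R I" and ?E = "core R I"
  have Ji: "ideal J R" "J \<subseteq> I" if "J \<in> ?M" for J using min_reductionD[OF that] by blast+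
  have E: "?E = \<Inter>?M" by (rule core_eq_Inter_min_reductions[OF I])
  have inter: "ideal (\<Inter>\<S>) R" if "\<S> \<subseteq> ?M" "\<S> \<noteq> {}" for \<S>
    by (rule i_Intersect) (use that Ji(1) in blast)+
  obtain J0 where J0: "J0 \<in> ?M" using min_reductions_nonempty[OF I] by blast
  have Ei: "ideal ?E R" unfolding E using inter[OF subset_refl] J0 by blast
  have EI: "?E \<subseteq> I" unfolding E by (rule subset_trans[OF Inter_lower[OF J0] Ji(2)[OF J0]])
  obtain N L x where N: "N 0 = ?E" "N L = I" "\<And>j. ideal (N j) R" "\<And>j. N j \<subseteq> N (Suc j)"
    "\<And>j. j < L \<Longrightarrow> prime_step I (N j) (x j)"
    "\<And>j. j < L \<Longrightarrow> N (Suc j) = Idl (N j \<union> {\<nu> \<otimes> x j | \<nu>. \<nu> \<in> carrier R})"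
  proof (rule prime_filtration[OF Ei EI I])
    fix N L x
    assume "N 0 = ?E" "N L = I" "\<And>j. ideal (N j) R" "\<And>j. N j \<subseteq> N (Suc j)"
      "\<And>j. j < L \<Longrightarrow> prime_step I (N j) (x j)"
      "\<And>j. j < L \<Longrightarrow> N (Suc j) = Idl (N j \<union> {\<nu> \<otimes> x j | \<nu>. \<nu> \<in> carrier R})"
    then show thesis by (rule that)
  qed
  have EN: "?E \<subseteq> N j" for j
  proof (induction j)
    case (Suc j)
    then show ?case using N(4)[of j] by (rule subset_trans)
  qed (use N(1) in simp)
  let ?Q = "\<lambda>j. {r \<in> carrier R. r \<otimes> x j \<in> N j}"
  have Qabove: "\<exists>p\<in>?P. p \<subseteq> ?Q j" if j: "j < L" for j
  proof (rule above)
    show "primeideal (?Q j) R" using N(5)[OF j] by (simp add: prime_step_def)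
    have "x j \<in> I" using N(5)[OF j] by (simp add: prime_step_def)
    show "{a \<in> carrier R. \<forall>y\<in>I. a \<otimes> y \<in> ?E} \<subseteq> ?Q j"
    proof
      fix a assume "a \<in> {a \<in> carrier R. \<forall>y\<in>I. a \<otimes> y \<in> ?E}"
      then have "a \<in> carrier R" "a \<otimes> x j \<in> ?E" using \<open>x j \<in> I\<close> by simp_all
      then show "a \<in> ?Q j" using subsetD[OF EN[of j]] by simp
    qed
  qed
  have satJ: "\<exists>p\<in>?P. {r \<in> carrier R. r \<otimes> z \<in> J} \<subseteq> p" if J: "J \<in> ?M" and z: "z \<in> I" "z \<notin> J" for J z
  proof -
    obtain y where y: "y \<in> I" "primeideal {r \<in> carrier R. r \<otimes> y \<in> J} R"
      "{r \<in> carrier R. r \<otimes> z \<in> J} \<subseteq> {r \<in> carrier R. r \<otimes> y \<in> J}"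
      using exists_associated_prime[OF Ji(1)[OF J] I z] by (elim bexE conjE)
    have "{r \<in> carrier R. r \<otimes> y \<in> J} \<in> Ass R (quot_module R I J)"
      unfolding Ass_quot_module_iff[OF Ji(1)[OF J] I] using y(1,2) by (intro conjI bexI[of _ y] refl)
    then have "{r \<in> carrier R. r \<otimes> y \<in> J} \<in> ?P" unfolding reduction_primes_def using J by (intro UN_I)
    with y(3) show ?thesis by (rule bexI)
  qed
  \<comment> \<open>The steps with prime in \<open>?P\<close> at which \<open>U\<close> acquires a
    new element. Counting them replaces a length, since \<open>I\<close> modulo the core may have
    infinite length.\<close>
  define A where "A U = {j. j < L \<and> ?Q j \<in> ?P \<and> (\<exists>y\<in>U. y \<in> N (Suc j) \<and> y \<notin> N j)}" for U
  have Afin: "finite (A U)" for U unfolding A_def by simp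
  define C where "C n \<longleftrightarrow> (\<exists>\<S>. finite \<S> \<and> \<S> \<noteq> {} \<and> \<S> \<subseteq> ?M \<and> card (A (\<Inter>\<S>)) = n)" for n
  have "C (card (A (\<Inter>{J0})))" unfolding C_def using J0 by (intro exI[of _ "{J0}"]) simp
  then have "\<exists>n. C n" by (rule exI)
  then obtain n where n: "C n" "\<forall>k<n. \<not> C k" unfolding exists_least_iff[of C] by (elim exE conjE)
  from n(1) obtain \<S> where \<S>: "finite \<S>" "\<S> \<noteq> {}" "\<S> \<subseteq> ?M" "card (A (\<Inter>\<S>)) = n"
    unfolding C_def by (elim exE conjE)
  have "\<Inter>\<S> \<subseteq> J" if J: "J \<in> ?M" for J
  proof -
    let ?U = "\<Inter>(insert J \<S>)" and ?U' = "\<Inter>\<S>"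
    have ins: "insert J \<S> \<subseteq> ?M" using J \<S>(3) by blast
    have UU': "?U \<subseteq> ?U'" by (rule Inter_anti_mono[OF subset_insertI])
    have sub: "A ?U \<subseteq> A ?U'" unfolding A_def using UU' by (intro Collect_mono impI) (elim conjE bexE, intro conjI bexI; auto)
    have "finite (insert J \<S>)" using \<S>(1) by simp
    then have "C (card (A ?U))" unfolding C_def using ins by (intro exI[of _ "insert J \<S>"]) simp
    then have "\<not> card (A ?U) < n" using n(2) by blast
    then have eq: "A ?U = A ?U'" using sub \<S>(4) card_seteq[OF Afin sub] by simp
    have "?U' \<subseteq> ?U"
    proof (rule ideal_determined_by_jumps[where N = N and x = x and L = L and P = ?P, OF I N(3) _ N(2) N(4) N(5) N(6) Qabove anti])
      show "N 0 \<subseteq> ?U" unfolding N(1) E by (rule Inter_anti_mono[OF ins])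
      show "ideal ?U R" by (rule inter[OF ins]) simp
      show "ideal ?U' R" by (rule inter[OF \<S>(3,2)])
      obtain J1 where J1: "J1 \<in> \<S>" using \<S>(2) by blast
      show "?U' \<subseteq> I" by (rule subset_trans[OF Inter_lower[OF J1] Ji(2)[OF subsetD[OF \<S>(3) J1]]])
      show "?U \<subseteq> ?U'" by (rule UU')
      show "\<exists>p\<in>?P. {r \<in> carrier R. r \<otimes> z \<in> ?U} \<subseteq> p" if "z \<in> I" "z \<notin> ?U" for z
      proof -
        obtain J' where J': "J' \<in> insert J \<S>" "z \<notin> J'" using \<open>z \<notin> ?U\<close> by blast
        \<comment> \<open>The colon of an intersection is contained in the colon of any member that
          misses \<open>z\<close>, so an associated prime found for that one reduction
          suffices.\<close>
        have sub': "{r \<in> carrier R. r \<otimes> z \<in> ?U} \<subseteq> {r \<in> carrier R. r \<otimes> z \<in> J'}"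
          using J'(1) by (intro Collect_mono impI conjI; elim conjE InterE) auto
        obtain p where p: "p \<in> ?P" "{r \<in> carrier R. r \<otimes> z \<in> J'} \<subseteq> p"
          using satJ[OF subsetD[OF ins J'(1)] \<open>z \<in> I\<close> J'(2)] by (elim bexE)
        show ?thesis using subset_trans[OF sub' p(2)] p(1) by (rule bexI)
      qed
      show "\<exists>y\<in>?U. y \<in> N (Suc j) \<and> y \<notin> N j"
        if "j < L" "?Q j \<in> ?P" "y \<in> ?U'" "y \<in> N (Suc j)" "y \<notin> N j" for j y
      proof -
        have "j \<in> A ?U'" unfolding A_def using that by (intro CollectI conjI bexI[of _ y])
        then have "j \<in> A ?U" unfolding eq .
        then show ?thesis unfolding A_def by (elim CollectE conjE)
      qed
    qed
    then show ?thesis by (rule subset_trans[OF _ Inter_lower]) simp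
  qed
  then have "\<Inter>\<S> \<subseteq> ?E" unfolding E by (rule Inter_greatest)
  moreover have "?E \<subseteq> \<Inter>\<S>" unfolding E by (rule Inter_anti_mono[OF \<S>(3)])
  ultimately have "?E = \<Inter>\<S>" by (intro subset_antisym)
  with \<S>(1-3) show ?thesis by (intro exI[of _ \<S>] conjI)
qed

end

theorem theorem3p1:
  fixes R :: "('a, 'b) ring_scheme" and I :: "'a set"
  assumes "noetherian_ring R" and "local_ring R"
    and "infinite (carrier (R Quot max_ideal R))"
    and "ideal I R"
    and "finite (reduction_primes R I)"
    and "\<And>\<pp> \<pp>'. \<pp> \<in> reduction_primes R I \<Longrightarrow> \<pp>' \<in> reduction_primes R I \<Longrightarrow> \<pp>' \<subseteq> \<pp> \<Longrightarrow> \<pp>' = \<pp>"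
    and "\<And>\<qq>. \<qq> \<in> Spec R - (zariski R closure_of reduction_primes R I) \<Longrightarrow>
      min_gens (loc R \<qq>) (loc_ideal R \<qq> I) = analytic_spread (loc R \<qq>) (loc_ideal R \<qq> I)"
  shows "core_number R I < \<infinity>"
proof -
  interpret local_ring R by fact
  interpret noetherian_ring R by fact
  interpret noetherian_local_ring R
    by (intro noetherian_local_ring.intro cring_axioms noetherian_ring_axioms local_ring_axioms)
  let ?P = "reduction_primes R I"
  have Pid: "ideal p R" if "p \<in> ?P" for p
    using that primeideal.axioms(1) unfolding reduction_primes_def Ass_def Spec_def by blast
  have "\<exists>p\<in>?P. p \<subseteq> Q" if Q: "primeideal Q R" and QE: "{x \<in> carrier R. \<forall>y\<in>I. x \<otimes>\<^bsub>R\<^esub> y \<in> core R I} \<subseteq> Q" for Q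
  proof (rule ccontr)
    interpret Q: primeideal Q R by (rule Q)
    assume no: "\<not> ?thesis"
    \<comment> \<open>\<open>?P\<close> is finite and no member of it lies in \<open>Q\<close>.
      Every prime without \<open>u\<close> is then outside the closure of \<open>?P\<close>, where
      the hypothesis on generators and analytic spread applies.\<close>
    obtain u where u: "u \<in> carrier R - Q" "\<forall>p\<in>?P. u \<in> p"
      using Q.exists_in_all_notin[OF assms(5) Pid] no by blast
    have uc: "u \<in> carrier R" using u(1) by blast
    have "min_gens (loc R q) (loc_ideal R q I) = analytic_spread (loc R q) (loc_ideal R q I)"
      if q: "primeideal q R" "u \<notin> q" for q
    proof -
      have "q \<in> Spec R" unfolding Spec_def using q(1) by blast
      moreover have "q \<notin> zariski R closure_of ?P"
        by (rule notin_zariski_closure[OF uc \<open>q \<in> Spec R\<close> q(2)]) (use u(2) in blast)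
      ultimately show ?thesis using assms(7) by blast
    qed
    from uniform_power[OF assms(4) uc this]
    obtain n :: nat where n: "\<forall>J\<in>min_reductions R I. \<forall>y\<in>I. u [^]\<^bsub>R\<^esub> n \<otimes>\<^bsub>R\<^esub> y \<in> J" by blast
    then have "u [^]\<^bsub>R\<^esub> n \<in> {x \<in> carrier R. \<forall>y\<in>I. x \<otimes>\<^bsub>R\<^esub> y \<in> core R I}"
      unfolding core_eq_Inter_min_reductions[OF assms(4)] using uc by simp
    then have "u [^]\<^bsub>R\<^esub> n \<in> Q" using QE by blast
    then show False using Q.pow_in_D[OF uc] u(1) by blast
  qed
  from core_finite_intersection[OF assms(4) this assms(6)]
  obtain \<S> where \<S>: "finite \<S>" "\<S> \<noteq> {}" "\<S> \<subseteq> min_reductions R I" "core R I = \<Inter>\<S>" by blast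
  \<comment> \<open>The family is enumerated from \<open>1\<close>; it is nonempty, as
    \<open>core_number\<close> asks for \<open>t \<ge> 1\<close>.\<close>
  let ?t = "card \<S>"
  have "card {1..?t} = card \<S>" by simp
  then obtain J where J: "bij_betw J {1..?t} \<S>" using finite_same_card_bij[OF finite_atLeastAtMost \<S>(1)] by blast
  have JS: "J ` {1..?t} = \<S>" by (rule bij_betw_imp_surj_on[OF J])
  have "?t \<ge> 1" using \<S>(1,2) by (simp add: Suc_le_eq card_gt_0_iff)
  moreover have "\<forall>i\<in>{1..?t}. J i \<in> min_reductions R I" using JS \<S>(3) by blast
  moreover have "core R I = (\<Inter>i\<in>{1..?t}. J i)" using JS \<S>(4) by simp
  ultimately have "core_number R I \<le> enat ?t" unfolding core_number_def by (intro Inf_lower) blast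
  then show ?thesis by (rule le_less_trans) simp
qed

end
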